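(* Let $n$ be a positive integer and let $D=\{x_1,\dots,x_n\}\subset\mathbb{C}\mathbb{P}^1$ be a set of $n$ ordered distinct points. For any $S\subset\{1,\dots,n\}$ such that $1\in S$ and $2\le|S|\le n-2$, the components $\mathcal{Z}_S\subset\mathcal{H}_0^n$ and $Z_S\subset X_0^n$ of the fixed-point sets of the involutions $(E,\Phi)\mapsto(E^*,\Phi^t)$ on $\mathcal{H}_0^n$ and $[p,q]\mapsto[q^t,p^t]$ on $X_0^n$, respectively, are diffeomorphic to the moduli space $M_0^{|S|,|S^c|}$ of closed null polygons in Minkowski $3$-space.
   Context: **Null hyperpolygons.** Use coordinates $(p,q)$ on $T^*\mathbb{C}^{2n}$, where $p=(p_1,\dots,p_n)$ with row vectors $p_i\in(\mathbb{C}^2)^*$ and $q=(q_1,\dots,q_n)$ with column vectors $q_i\in\mathbb{C}^2$. The group $K=(SU(2)\times U(1)^n)/(\mathbb{Z}/2\mathbb{Z})$ ($\mathbb{Z}/2\mathbb{Z}$ acting by multiplication of each factor by $-1$) acts by $(p,q)\cdot[A;e_1,\dots,e_n]=((e_i^{-1}p_iA)_i,(A^{-1}q_ie_i)_i)$. Write $(\ )_0$ for the traceless part of a matrix. Let $\mathcal{P}_0^n$ be the set of $(p,q)$ with $p_iq_i=0$, $|q_i|=|p_i|$, $|p_i|^2+|q_i|^2\ne0$ for all $i$, $\sum_i(q_ip_i)_0=0$ and $\sum_i(q_iq_i^*-p_i^*p_i)_0=0$. Then $X_0^n=\mathcal{P}_0^n/K$, a smooth manifold ($K$ acts freely). A subset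 $S\subset\{1,\dots,n\}$ is straight at $(p,q)$ if $q_i$ is proportional to $q_j$ for all $i,j\in S$. $Z_S$ is the set of $[p,q]\in X_0^n$ such that $S$ and $S^c$ (complement in $\{1,\dots,n\}$) are both straight at $(p,q)$. In $[q^t,p^t]$ the row vectors are $q_i^t$ and the column vectors are $p_i^t$. **Quasi-parabolic Higgs bundles.** A rank-$2$ quasi-parabolic bundle over $\Sigma=\mathbb{C}\mathbb{P}^1$ at $D$ is a rank-$2$ holomorphic vector bundle $E$ with complete flags $E_x=E_{x,1}\supsetneq E_{x,2}\supsetneq\{0\}$, $\dim E_{x,2}=1$, for each $x\in D$. A quasi-parabolic Higgs bundle is a pair $(E,\Phi)$ where $\Phi$ is a meromorphic $End(E)$-valued one-form with at most simple poles along $D$ whose residues satisfy $(\mathrm{Res}_x\Phi)(E_{x,1})\subset E_{x,2}$ and $(\mathrm{Res}_x\Phi)(E_{x,2})=0$ for $x\in D$. It is an $SL(2,\mathbb{C})$-Higgs bundle if $\det E$ is trivial and $\Phi$ is traceless. For a line subbundle $L\subset E$ put $S_L=\{x\in D:L_x\cap E_{x,2}\neq\{0\}\}$. The pair $(E,\Phi)$ is stable if $\mathrm{Res}_x\Phi\ne0$ for all $x\in D$ and $\frac12\deg E+\frac12|D|>\deg L+\frac12|S_L|$ for every line subbundle $L$ preserved by $\Phi$. $\mathcal{H}_0^n$ is the set of isomorphism classes (bundle isomorphisms preserving flags and intertwining Higgs fields) of stable rank-$2$ quasi-parabolic $SL(2,\mathbb{C})$-Higgs bundles over $\mathbb{C}\mathbb{P}^1$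 at $D$ with $E$ holomorphically trivial. Manifold structure on $\mathcal{H}_0^n$: for $E=\mathbb{C}\mathbb{P}^1\times\mathbb{C}^2$ the data are lines $X_i=E_{x_i,2}\in\mathbb{C}\mathbb{P}^1$ and residues $N_i=\mathrm{Res}_{x_i}\Phi$ with $\sum_iN_i=0$. Given a disjoint decomposition $\{1,\dots,n\}=A\cup B$, $j\in A$, $k\in B$, consider classes that have a representative with $X_i=[1:w_i]$ for $i\in A$, $X_i=[z_i:1]$ for $i\in B$, $w_j=0$, $z_k=0$, and $N_i=\lambda_i\begin{pmatrix}-w_i&1\\-w_i^2&w_i\end{pmatrix}$ for $i\in A$, $N_i=\lambda_i\begin{pmatrix}-z_i&z_i^2\\-1&z_i\end{pmatrix}$ for $i\in B$, $\lambda_i\in\mathbb{C}^*$, $\lambda_j=1$. Such a representative is unique, and the parameters are subject only to $\sum_iN_i=0$; this condition is used to eliminate $\lambda_k$ and the two parameters attached to one further index $i_0$, the remaining $w_i,z_i,\lambda_i$ being local holomorphic coordinates. These coordinates, for all $(A,B,j,k)$, define the complex manifold structure. In the involution, $E^*$ carries the dual flags $E_x^*\supset E_{x,2}^0\supset\{0\}$, $E_{x,2}^0=\{f\in E_x^*:f(E_{x,2})=0\}$. $\mathcal{Z}_S$ is the set of $(E,\Phi)\in\mathcal{H}_0^n$ such that $E=L_0\oplus L_1$ with $L_0,L_1$ trivial line bundles, $E_{x_i,2}=(L_0)_{x_i}$ for $i\in S$ and $E_{x_i,2}=(L_1)_{x_i}$ for $i\in S^c$, and $\Phi=\begin{pmatrix}0&\alpha\\\beta&0\end{pmatrix}$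 in this decomposition, with $\beta$ having zero residue at $x_i$ for $i\in S$ and $\alpha$ having zero residue at $x_i$ for $i\in S^c$. **Null polygons.** Minkowski $3$-space $\mathbb{R}^{2,1}$ is $\mathbb{R}^3$ with $v\circ w=-v_1w_1-v_2w_2+v_3w_3$. The future and past light cones are $C^\pm=\{(x,y,t):t=\pm\sqrt{x^2+y^2}\}\setminus\{0\}$; they are coadjoint orbits of $SU(1,1)$ under $\mathfrak{su}(1,1)^*\cong\mathbb{R}^{2,1}$, where $\begin{pmatrix}\alpha&\beta\\\bar\beta&\bar\alpha\end{pmatrix}\in SU(1,1)$, $|\alpha|^2-|\beta|^2=1$, acts on $\mathbb{R}^{2,1}$ by the matrix $$\begin{pmatrix}\mathrm{Re}(\alpha^2-\beta^2)&-\mathrm{Im}(\alpha^2+\beta^2)&-2\,\mathrm{Im}(\alpha\beta)\\\mathrm{Im}(\alpha^2-\beta^2)&\mathrm{Re}(\alpha^2+\beta^2)&2\,\mathrm{Re}(\alpha\beta)\\2\,\mathrm{Im}(\alpha\bar\beta)&2\,\mathrm{Re}(\alpha\bar\beta)&|\alpha|^2+|\beta|^2\end{pmatrix}.$$ For positive integers $k_1+k_2=n$, let $\mathcal{O}_i=C^-$ for $1\le i\le k_1$ and $\mathcal{O}_i=C^+$ for $k_1<i\le n$, and let $\mu:\mathcal{O}_1\times\cdots\times\mathcal{O}_n\to\mathbb{R}^3$, $\mu(u_1,\dots,u_n)=u_1+\cdots+u_n$. Let $\mu^{-1}(0)_{\rm reg}$ be the set of points of $\mu^{-1}(0)$ that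 are regular points of $\mu$ (equivalently, the $u_i$ do not all lie on one line). Then $M_0^{k_1,k_2}=\mu^{-1}(0)_{\rm reg}/SU(1,1)$ for the diagonal action, with its quotient smooth structure. *)

theory Defs
  imports "HOL-Complex_Analysis.Complex_Analysis"
begin

no_notation fps_nth (infixl "$" 75)

section \<open>Smooth spaces\<close>

text \<open>
  A smooth structure is recorded as a topology together with the smooth real functions
  on its open sets (the sheaf of smooth functions). A map of manifolds is a diffeomorphism iff
  it is a homeomorphism identifying the two sheaves. Quotient structures and submanifold structures
  are given by the usual universal descriptions, without charts whose dimension would have
  to be a type. The field \<open>smooth\<close> is only meaningful on open sets.
\<close>

record 'a smooth_space =
  topo :: "'a topology"
  smooth :: "'a set \<Rightarrow> ('a \<Rightarrow> real) \<Rightarrow> bool"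

primrec Ck_on :: "nat \<Rightarrow> 'e::euclidean_space set \<Rightarrow> ('e \<Rightarrow> real) \<Rightarrow> bool" where
  "Ck_on 0 U f \<longleftrightarrow> continuous_on U f"
| "Ck_on (Suc k) U f \<longleftrightarrow>
     (\<forall>x\<in>U. f differentiable (at x)) \<and> (\<forall>v. Ck_on k U (\<lambda>x. frechet_derivative f (at x) v))"

definition euclidean_smooth :: "'e::euclidean_space smooth_space" where
  "euclidean_smooth = \<lparr>topo = euclidean, smooth = (\<lambda>U f. open U \<and> (\<forall>k. Ck_on k U f))\<rparr>"

text \<open>The structure induced on a subset: functions that extend locally to smooth functions of the
  ambient space. On an embedded submanifold this is the submanifold structure.\<close>

definition sub_space :: "'a smooth_space \<Rightarrow> 'a set \<Rightarrow> 'a smooth_space" where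
  "sub_space X S =
     \<lparr>topo = subtopology (topo X) S,
      smooth = (\<lambda>U f. openin (subtopology (topo X) S) U \<and>
        (\<forall>x\<in>U. \<exists>V g. openin (topo X) V \<and> x \<in> V \<and> smooth X V g \<and> (\<forall>y\<in>U \<inter> V. f y = g y)))\<rparr>"

text \<open>The structure on \<open>\<pi> ` X\<close> pushed forward along \<open>\<pi>\<close>: a function is smooth iff its
  pullback is. For the projection of a free proper group action this is the quotient structure.\<close>

definition quotient_space :: "'a smooth_space \<Rightarrow> ('a \<Rightarrow> 'b) \<Rightarrow> 'b smooth_space" where
  "quotient_space X \<pi> =
     \<lparr>topo = topology (\<lambda>V. V \<subseteq> \<pi> ` topspace (topo X) \<and>
        openin (topo X) {x \<in> topspace (topo X). \<pi> x \<in> V}),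
      smooth = (\<lambda>V f. smooth X {x \<in> topspace (topo X). \<pi> x \<in> V} (f \<circ> \<pi>))\<rparr>"

text \<open>A chart \<open>(U, \<kappa>, W)\<close> is a coordinate map \<open>\<kappa>\<close>, injective on its domain \<open>U\<close>, whose image is an
  open subset of the linear subspace \<open>W\<close> of a Euclidean space. The inverse of
  the chart is \<open>inv_into U \<kappa>\<close>.\<close>

definition chart_preimage :: "'a set \<Rightarrow> ('a \<Rightarrow> 'e) \<Rightarrow> 'a set \<Rightarrow> 'e set" where
  "chart_preimage U \<kappa> V = {y \<in> \<kappa> ` U. inv_into U \<kappa> y \<in> V}"

definition atlas_space ::
    "'a set \<Rightarrow> ('a set \<times> ('a \<Rightarrow> 'e::euclidean_space) \<times> 'e set) set \<Rightarrow> 'a smooth_space" where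
  "atlas_space M \<A> =
     \<lparr>topo = topology (\<lambda>V. V \<subseteq> M \<and>
        (\<forall>(U, \<kappa>, W)\<in>\<A>. openin (top_of_set W) (chart_preimage U \<kappa> V))),
      smooth = (\<lambda>V f. \<forall>(U, \<kappa>, W)\<in>\<A>.
        smooth (sub_space euclidean_smooth W) (chart_preimage U \<kappa> V) (f \<circ> inv_into U \<kappa>))\<rparr>"

definition diffeomorphism :: "'a smooth_space \<Rightarrow> 'b smooth_space \<Rightarrow> ('a \<Rightarrow> 'b) \<Rightarrow> bool" where
  "diffeomorphism X Y F \<longleftrightarrow> homeomorphic_map (topo X) (topo Y) F \<and>
     (\<forall>V f. openin (topo Y) V \<longrightarrow>
        (smooth Y V f \<longleftrightarrow> smooth X {x \<in> topspace (topo X). F x \<in> V} (f \<circ> F)))"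

definition diffeomorphic :: "'a smooth_space \<Rightarrow> 'b smooth_space \<Rightarrow> bool" where
  "diffeomorphic X Y \<longleftrightarrow> (\<exists>F. diffeomorphism X Y F)"

lemma openin_quotient_space:
  "openin (topo (quotient_space X \<pi>)) V \<longleftrightarrow>
     V \<subseteq> \<pi> ` topspace (topo X) \<and> openin (topo X) {x \<in> topspace (topo X). \<pi> x \<in> V}"
proof -
  let ?T = "topspace (topo X)"
  let ?P = "\<lambda>V. V \<subseteq> \<pi> ` ?T \<and> openin (topo X) {x \<in> ?T. \<pi> x \<in> V}"
  have "?P (S \<inter> T)" if "?P S" "?P T" for S T
  proof -
    have "{x \<in> ?T. \<pi> x \<in> S \<inter> T} = {x \<in> ?T. \<pi> x \<in> S} \<inter> {x \<in> ?T. \<pi> x \<in> T}"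
      by blast
    moreover have "openin (topo X) ({x \<in> ?T. \<pi> x \<in> S} \<inter> {x \<in> ?T. \<pi> x \<in> T})"
      using that by (intro openin_Int) blast+
    ultimately show ?thesis using that by (metis le_infI1)
  qed
  moreover have "?P (\<Union>\<K>)" if K: "\<forall>K\<in>\<K>. ?P K" for \<K>
  proof -
    have "{x \<in> ?T. \<pi> x \<in> \<Union>\<K>} = \<Union> ((\<lambda>K. {x \<in> ?T. \<pi> x \<in> K}) ` \<K>)" by blast
    moreover have "openin (topo X) (\<Union> ((\<lambda>K. {x \<in> ?T. \<pi> x \<in> K}) ` \<K>))"
      using K by (intro openin_Union) blast
    moreover have "\<Union>\<K> \<subseteq> \<pi> ` ?T" using K by blast
    ultimately show ?thesis by simp
  qed
  ultimately have "istopology ?P" unfolding istopology_def by blast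
  then show ?thesis
    by (simp add: quotient_space_def topology_inverse')
qed

lemma openin_atlas_space:
  "openin (topo (atlas_space M \<A>)) V \<longleftrightarrow>
     V \<subseteq> M \<and> (\<forall>(U, \<kappa>, W)\<in>\<A>. openin (top_of_set W) (chart_preimage U \<kappa> V))"
proof -
  let ?Q = "\<lambda>V (U, \<kappa>, W). openin (top_of_set W) (chart_preimage U \<kappa> V)"
  have 1: "?Q (S \<inter> T) c" if "?Q S c" "?Q T c" for S T c
  proof -
    obtain U \<kappa> W where c: "c = (U, \<kappa>, W)" by (cases c)
    have "chart_preimage U \<kappa> (S \<inter> T) = chart_preimage U \<kappa> S \<inter> chart_preimage U \<kappa> T"
      unfolding chart_preimage_def by blast
    then show ?thesis using that unfolding c by (simp add: openin_Int)
  qed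
  have 2: "?Q (\<Union>\<K>) c" if "\<And>K. K \<in> \<K> \<Longrightarrow> ?Q K c" for \<K> c
  proof -
    obtain U \<kappa> W where c: "c = (U, \<kappa>, W)" by (cases c)
    have "chart_preimage U \<kappa> (\<Union>\<K>) = \<Union> (chart_preimage U \<kappa> ` \<K>)"
      unfolding chart_preimage_def by blast
    moreover have "openin (top_of_set W) (\<Union> (chart_preimage U \<kappa> ` \<K>))"
      using that unfolding c prod.case by (intro openin_Union) blast
    ultimately show ?thesis unfolding c by simp
  qed
  let ?P = "\<lambda>V. V \<subseteq> M \<and> (\<forall>c\<in>\<A>. ?Q V c)"
  have "?P (S \<inter> T)" if "?P S" "?P T" for S T
  proof (intro conjI ballI)
    show "S \<inter> T \<subseteq> M" using that by blast
    show "?Q (S \<inter> T) c" if "c \<in> \<A>" for c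
      using \<open>?P S\<close> \<open>?P T\<close> that by (intro 1) simp_all
  qed
  moreover have "?P (\<Union>\<K>)" if "\<forall>K\<in>\<K>. ?P K" for \<K>
  proof (intro conjI ballI)
    show "\<Union>\<K> \<subseteq> M" using that by blast
    show "?Q (\<Union>\<K>) c" if "c \<in> \<A>" for c
      using \<open>\<forall>K\<in>\<K>. ?P K\<close> that by (intro 2) simp
  qed
  ultimately have "istopology ?P" unfolding istopology_def by simp
  then show ?thesis
    by (simp add: atlas_space_def topology_inverse')
qed


section \<open>Null hyperpolygons\<close>

text \<open>The index set \<open>{1,\<dots>,n}\<close> is a finite linearly ordered type \<open>'n\<close>. The rows
  \<open>p\<^sub>i\<close> and the columns \<open>q\<^sub>i\<close> are both stored as vectors of type \<open>complex^2\<close>.\<close>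

type_synonym 'n hyperpolygon = "((complex^2)^'n) \<times> ((complex^2)^'n)"

definition traceless :: "complex^2^2 \<Rightarrow> complex^2^2" where
  "traceless M = M - mat (trace M / 2)"

definition adjoint_mat :: "complex^2^2 \<Rightarrow> complex^2^2" where
  "adjoint_mat A = (\<chi> a b. cnj (A $ b $ a))"

definition SU2 :: "(complex^2^2) set" where
  "SU2 = {A. A ** adjoint_mat A = mat 1 \<and> det A = 1}"

definition null_hyperpolygon_level :: "'n::finite hyperpolygon set" where
  "null_hyperpolygon_level = {(p, q).
     (\<forall>i. (\<Sum>a\<in>UNIV. p $ i $ a * q $ i $ a) = 0) \<and>
     (\<forall>i. norm (q $ i) = norm (p $ i)) \<and>
     (\<forall>i. (norm (p $ i))\<^sup>2 + (norm (q $ i))\<^sup>2 \<noteq> 0) \<and>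
     (\<Sum>i\<in>UNIV. traceless (\<chi> a b. q $ i $ a * p $ i $ b)) = 0 \<and>
     (\<Sum>i\<in>UNIV. traceless ((\<chi> a b. q $ i $ a * cnj (q $ i $ b))
                          - (\<chi> a b. cnj (p $ i $ a) * p $ i $ b))) = 0}"

definition hyperpolygon_act ::
    "'n::finite hyperpolygon \<Rightarrow> complex^2^2 \<Rightarrow> complex^'n \<Rightarrow> 'n hyperpolygon" where
  "hyperpolygon_act = (\<lambda>(p, q) A e.
     (\<chi> i. inverse (e $ i) *s (p $ i v* A), \<chi> i. e $ i *s (matrix_inv A *v q $ i)))"

text \<open>\<open>SU(2) \<times> U(1)\<^sup>n\<close> and its quotient \<open>K\<close> by \<open>\<plusminus>1\<close> (which acts trivially) have the same orbits.\<close>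

definition hyperpolygon_orbit :: "'n::finite hyperpolygon \<Rightarrow> 'n hyperpolygon set" where
  "hyperpolygon_orbit x =
     {hyperpolygon_act x A e | A e. A \<in> SU2 \<and> (\<forall>i. cmod (e $ i) = 1)}"

definition null_hyperpolygons :: "'n::finite hyperpolygon set set" where
  "null_hyperpolygons = hyperpolygon_orbit ` null_hyperpolygon_level"

definition null_hyperpolygon_space :: "'n::finite hyperpolygon set smooth_space" where
  "null_hyperpolygon_space =
     quotient_space (sub_space euclidean_smooth null_hyperpolygon_level) hyperpolygon_orbit"

text \<open>The involution \<open>[p,q] \<mapsto> [q\<^sup>t,p\<^sup>t]\<close>; the swap maps orbits to orbits.\<close>

definition hyperpolygon_involution :: "'n::finite hyperpolygon set \<Rightarrow> 'n hyperpolygon set" where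
  "hyperpolygon_involution c = (\<lambda>(p, q). (q, p)) ` c"

definition straight :: "'n set \<Rightarrow> 'n::finite hyperpolygon \<Rightarrow> bool" where
  "straight S x \<longleftrightarrow> (\<forall>i\<in>S. \<forall>j\<in>S. \<exists>c. snd x $ i = c *s snd x $ j)"

definition hyperpolygon_component :: "'n::finite set \<Rightarrow> 'n hyperpolygon set set" where
  "hyperpolygon_component S =
     hyperpolygon_orbit ` {x \<in> null_hyperpolygon_level. straight S x \<and> straight (- S) x}"


section \<open>Quasi-parabolic Higgs bundles on the Riemann sphere\<close>

datatype cp1 = Pt complex | Pt_inf

text \<open>The holomorphic coordinate centred at a point: \<open>z - a\<close> at \<open>a\<close>, and \<open>1/z\<close> at infinity.\<close>

primrec local_coord :: "cp1 \<Rightarrow> complex \<Rightarrow> cp1" where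
  "local_coord (Pt a) w = Pt (a + w)"
| "local_coord Pt_inf w = (if w = 0 then Pt_inf else Pt (1 / w))"

definition holomorphic_cp1 :: "(cp1 \<Rightarrow> complex) \<Rightarrow> bool" where
  "holomorphic_cp1 f \<longleftrightarrow> (\<forall>y. (\<lambda>w. f (local_coord y w)) analytic_on {0})"

subsection \<open>Line subbundles of the product bundle with fibre \<open>complex^2\<close>\<close>

definition is_line :: "(complex^2) set \<Rightarrow> bool" where
  "is_line L \<longleftrightarrow> vec.subspace L \<and> vec.dim L = 1"

text \<open>\<open>s\<close> is the germ at 0 of a holomorphic, nowhere vanishing vector-valued function.\<close>

definition frame_germ :: "(complex \<Rightarrow> complex^2) \<Rightarrow> bool" where
  "frame_germ s \<longleftrightarrow> (\<forall>a. (\<lambda>w. s w $ a) analytic_on {0}) \<and> s 0 \<noteq> 0"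

definition line_subbundle :: "(cp1 \<Rightarrow> (complex^2) set) \<Rightarrow> bool" where
  "line_subbundle L \<longleftrightarrow> (\<forall>y. is_line (L y)) \<and>
     (\<forall>y. \<exists>s. frame_germ s \<and> (\<forall>\<^sub>F w in nhds 0. L (local_coord y w) = vec.span {s w}))"

text \<open>The degree of a line bundle is the number of zeros minus poles of a nonzero
  meromorphic section \<open>\<sigma>\<close>: near every point \<open>y\<close>, \<open>\<sigma>\<close> is the \<open>ord y\<close>-th power
  of the local coordinate times a nowhere vanishing section \<open>s\<close> of \<open>L\<close>.\<close>

definition has_degree :: "(cp1 \<Rightarrow> (complex^2) set) \<Rightarrow> int \<Rightarrow> bool" where
  "has_degree L d \<longleftrightarrow> (\<exists>\<sigma> ord.
     (\<forall>y. \<exists>s. frame_germ s \<and>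
        (\<forall>\<^sub>F w in at 0. s w \<in> L (local_coord y w) \<and>
                        \<sigma> (local_coord y w) = w powi (ord y) *s s w)) \<and>
     finite {y. ord y \<noteq> 0} \<and> d = (\<Sum>y | ord y \<noteq> 0. ord y))"

definition trivial_line_subbundle :: "(cp1 \<Rightarrow> (complex^2) set) \<Rightarrow> bool" where
  "trivial_line_subbundle L \<longleftrightarrow> line_subbundle L \<and>
     (\<exists>s. (\<forall>a. holomorphic_cp1 (\<lambda>y. s y $ a)) \<and> (\<forall>y. s y \<noteq> 0 \<and> s y \<in> L y))"

subsection \<open>Higgs bundles\<close>

text \<open>
  Since \<open>E\<close> is holomorphically trivial, it is represented as the product bundle with fibre
  \<open>complex^2\<close>, of degree 0. A Higgs bundle is then a pair \<open>(X, \<phi>)\<close>: \<open>X i\<close> is the line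
  \<open>E\<^sub>x\<^sub>,\<^sub>2\<close> of the flag at \<open>x i\<close>, and \<open>\<Phi> = \<phi>(z) dz\<close> on the affine part. The values of \<open>\<phi>\<close> at
  points of \<open>D\<close> carry no meaning. In the coordinate \<open>w = 1/z\<close>
  at infinity, \<open>dz = - dw / w\<^sup>2\<close>.
\<close>

type_synonym 'n higgs = "('n \<Rightarrow> (complex^2) set) \<times> (complex \<Rightarrow> complex^2^2)"

primrec form_at :: "(complex \<Rightarrow> complex^2^2) \<Rightarrow> cp1 \<Rightarrow> complex \<Rightarrow> complex^2^2" where
  "form_at \<phi> (Pt c) w = \<phi> (c + w)"
| "form_at \<phi> Pt_inf w = (\<chi> a b. - \<phi> (1 / w) $ a $ b / w\<^sup>2)"

text \<open>The quotient \<open>h w / w\<close> below has at most a simple pole, and is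
  holomorphic at 0 if \<open>h 0 = 0\<close>.\<close>

definition simple_pole_form :: "cp1 set \<Rightarrow> (complex \<Rightarrow> complex^2^2) \<Rightarrow> bool" where
  "simple_pole_form D \<phi> \<longleftrightarrow>
     (\<forall>a b. (\<lambda>z. \<phi> z $ a $ b) holomorphic_on {z. Pt z \<notin> D}) \<and>
     (\<forall>y a b. \<exists>h. h analytic_on {0} \<and> (y \<notin> D \<longrightarrow> h 0 = 0) \<and>
        (\<forall>\<^sub>F w in at 0. form_at \<phi> y w $ a $ b = h w / w))"

definition Res :: "(complex \<Rightarrow> complex^2^2) \<Rightarrow> cp1 \<Rightarrow> complex^2^2" where
  "Res \<phi> y = (\<chi> a b. residue (\<lambda>w. form_at \<phi> y w $ a $ b) 0)"

definition higgs_bundles :: "('n::finite \<Rightarrow> cp1) \<Rightarrow> 'n higgs set" where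
  "higgs_bundles x = {(X, \<phi>).
     (\<forall>i. is_line (X i)) \<and>
     simple_pole_form (range x) \<phi> \<and>
     (\<forall>z. Pt z \<notin> range x \<longrightarrow> trace (\<phi> z) = 0) \<and>
     (\<forall>i. (\<forall>v. Res \<phi> (x i) *v v \<in> X i) \<and> (\<forall>v\<in>X i. Res \<phi> (x i) *v v = 0))}"

definition preserved_by ::
    "('n::finite \<Rightarrow> cp1) \<Rightarrow> (complex \<Rightarrow> complex^2^2) \<Rightarrow> (cp1 \<Rightarrow> (complex^2) set) \<Rightarrow> bool" where
  "preserved_by x \<phi> L \<longleftrightarrow> (\<forall>z. Pt z \<notin> range x \<longrightarrow> (\<forall>v\<in>L (Pt z). \<phi> z *v v \<in> L (Pt z)))"

text \<open>The term \<open>0\<close> on the left of the stability inequality is \<open>deg E\<close>.\<close>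

definition stable_higgs :: "('n::finite \<Rightarrow> cp1) \<Rightarrow> 'n higgs \<Rightarrow> bool" where
  "stable_higgs x = (\<lambda>(X, \<phi>).
     (\<forall>i. Res \<phi> (x i) \<noteq> 0) \<and>
     (\<forall>L d. line_subbundle L \<and> has_degree L d \<and> preserved_by x \<phi> L \<longrightarrow>
        1/2 * 0 + 1/2 * real CARD('n)
          > real_of_int d + 1/2 * real (card {i. L (x i) \<inter> X i \<noteq> {0}})))"

text \<open>Isomorphisms are holomorphic maps from the sphere to \<open>GL(2)\<close>.
  Both sides of the intertwining relation being meromorphic, it suffices to require it on the
  affine part outside of \<open>D\<close>.\<close>

definition higgs_iso :: "('n::finite \<Rightarrow> cp1) \<Rightarrow> ('n higgs \<times> 'n higgs) set" where
  "higgs_iso x = {((X, \<phi>), (Y, \<psi>)).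
     (X, \<phi>) \<in> higgs_bundles x \<and> (Y, \<psi>) \<in> higgs_bundles x \<and>
     (\<exists>g :: cp1 \<Rightarrow> complex^2^2.
        (\<forall>a b. holomorphic_cp1 (\<lambda>y. g y $ a $ b)) \<and> (\<forall>y. invertible (g y)) \<and>
        (\<forall>i. (\<lambda>v. g (x i) *v v) ` X i = Y i) \<and>
        (\<forall>z. Pt z \<notin> range x \<longrightarrow> g (Pt z) ** \<phi> z = \<psi> z ** g (Pt z)))}"

definition higgs_moduli :: "('n::finite \<Rightarrow> cp1) \<Rightarrow> 'n higgs set set" where
  "higgs_moduli x = {h \<in> higgs_bundles x. stable_higgs x h} // higgs_iso x"

subsection \<open>The manifold structure\<close>

text \<open>Normal forms for the decomposition into \<open>A\<close> and its complement. The vector \<open>t\<close> collects the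
  \<open>w\<^sub>i\<close> (\<open>i \<in> A\<close>) and the \<open>z\<^sub>i\<close> (\<open>i \<notin> A\<close>).\<close>

definition normal_line :: "'n set \<Rightarrow> complex^'n \<Rightarrow> 'n::finite \<Rightarrow> (complex^2) set" where
  "normal_line A t i = vec.span {if i \<in> A then vector [1, t $ i] else vector [t $ i, 1]}"

definition normal_residue ::
    "'n set \<Rightarrow> (complex^'n) \<times> (complex^'n) \<Rightarrow> 'n::finite \<Rightarrow> complex^2^2" where
  "normal_residue A = (\<lambda>(t, l) i.
     if i \<in> A
     then vector [vector [- l $ i * t $ i, l $ i], vector [- l $ i * (t $ i)\<^sup>2, l $ i * t $ i]]
     else vector [vector [- l $ i * t $ i, l $ i * (t $ i)\<^sup>2], vector [- l $ i, l $ i * t $ i]])"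

definition normal_parameters ::
    "'n set \<Rightarrow> 'n \<Rightarrow> 'n \<Rightarrow> ((complex^'n) \<times> (complex^'n::finite)) set" where
  "normal_parameters A j k = {(t, l).
     t $ j = 0 \<and> t $ k = 0 \<and> (\<forall>i. l $ i \<noteq> 0) \<and> l $ j = 1 \<and>
     (\<Sum>i\<in>UNIV. normal_residue A (t, l) i) = 0}"

definition represents ::
    "('n::finite \<Rightarrow> cp1) \<Rightarrow> 'n set \<Rightarrow> (complex^'n) \<times> (complex^'n) \<Rightarrow> 'n higgs set \<Rightarrow> bool" where
  "represents x A m c \<longleftrightarrow> (\<exists>(X, \<phi>)\<in>c.
     \<forall>i. X i = normal_line A (fst m) i \<and> Res \<phi> (x i) = normal_residue A m i)"

text \<open>
  The equation \<open>\<Sum>N\<^sub>i = 0\<close> determines \<open>l $ k\<close> and, given the remaining parameters, the values of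
  \<open>\<lambda> t, \<lambda>\<close> (if \<open>i0 \<in> A\<close>) or of \<open>\<lambda> t, \<lambda> t\<^sup>2\<close> (if \<open>i0 \<notin> A\<close>), where \<open>(t, \<lambda>)\<close> are the two parameters
  attached to \<open>i0\<close>. In the first case these can always be solved for \<open>(t, \<lambda>)\<close>,
  in the second case exactly where \<open>t \<noteq> 0\<close>. Every stable class lies in such a chart domain.
\<close>

definition higgs_chart_domain ::
    "('n::finite \<Rightarrow> cp1) \<Rightarrow> 'n set \<Rightarrow> 'n \<Rightarrow> 'n \<Rightarrow> 'n \<Rightarrow> 'n higgs set set" where
  "higgs_chart_domain x A j k i0 = {c \<in> higgs_moduli x.
     \<exists>m\<in>normal_parameters A j k. represents x A m c \<and> (i0 \<in> A \<or> fst m $ i0 \<noteq> 0)}"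

text \<open>The eliminated parameters and the constants are replaced by 0.\<close>

definition higgs_chart ::
    "('n::finite \<Rightarrow> cp1) \<Rightarrow> 'n set \<Rightarrow> 'n \<Rightarrow> 'n \<Rightarrow> 'n \<Rightarrow> 'n higgs set
       \<Rightarrow> (complex^'n) \<times> (complex^'n)" where
  "higgs_chart x A j k i0 c =
     (let m = (THE m. m \<in> normal_parameters A j k \<and> represents x A m c)
      in (\<chi> i. if i \<in> {j, k, i0} then 0 else fst m $ i,
          \<chi> i. if i \<in> {j, k, i0} then 0 else snd m $ i))"

definition higgs_atlas :: "('n::finite \<Rightarrow> cp1) \<Rightarrow>
    ('n higgs set set \<times> ('n higgs set \<Rightarrow> (complex^'n) \<times> (complex^'n))
       \<times> ((complex^'n) \<times> (complex^'n)) set) set" where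
  "higgs_atlas x =
     {(higgs_chart_domain x A j k i0, higgs_chart x A j k i0,
       {(t, l). \<forall>i\<in>{j, k, i0}. t $ i = 0 \<and> l $ i = 0}) | A j k i0.
      j \<in> A \<and> k \<notin> A \<and> i0 \<noteq> j \<and> i0 \<noteq> k}"

definition higgs_space :: "('n::finite \<Rightarrow> cp1) \<Rightarrow> 'n higgs set smooth_space" where
  "higgs_space x = atlas_space (higgs_moduli x) (higgs_atlas x)"

subsection \<open>The involution\<close>

text \<open>The dual of the product bundle is the product bundle with fibre the dual of \<open>complex^2\<close>,
  which is written in the dual basis.\<close>

definition annihilator :: "(complex^2) set \<Rightarrow> (complex^2) set" where
  "annihilator V = {f. \<forall>v\<in>V. (\<Sum>a\<in>UNIV. f $ a * v $ a) = 0}"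

definition dual_higgs :: "'n higgs \<Rightarrow> 'n higgs" where
  "dual_higgs = (\<lambda>(X, \<phi>). (\<lambda>i. annihilator (X i), \<lambda>z. transpose (\<phi> z)))"

definition higgs_involution :: "('n::finite \<Rightarrow> cp1) \<Rightarrow> 'n higgs set \<Rightarrow> 'n higgs set" where
  "higgs_involution x c = higgs_iso x `` (dual_higgs ` c)"

text \<open>In the block form of \<open>\<Phi>\<close> with respect to \<open>L\<^sub>0 \<oplus> L\<^sub>1\<close>, the entry \<open>\<beta>\<close> is the restriction of \<open>\<Phi>\<close>
  to \<open>L\<^sub>0\<close>, and \<open>\<alpha>\<close> is its restriction to \<open>L\<^sub>1\<close>.\<close>

definition higgs_component :: "('n::finite \<Rightarrow> cp1) \<Rightarrow> 'n set \<Rightarrow> 'n higgs set set" where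
  "higgs_component x S = {c \<in> higgs_moduli x. \<exists>(X, \<phi>)\<in>c. \<exists>L0 L1.
     trivial_line_subbundle L0 \<and> trivial_line_subbundle L1 \<and> (\<forall>y. L0 y \<inter> L1 y = {0}) \<and>
     (\<forall>i\<in>S. X i = L0 (x i)) \<and> (\<forall>i\<in>- S. X i = L1 (x i)) \<and>
     (\<forall>z. Pt z \<notin> range x \<longrightarrow>
        (\<forall>v\<in>L0 (Pt z). \<phi> z *v v \<in> L1 (Pt z)) \<and> (\<forall>v\<in>L1 (Pt z). \<phi> z *v v \<in> L0 (Pt z))) \<and>
     (\<forall>i\<in>S. \<forall>v\<in>L0 (x i). Res \<phi> (x i) *v v = 0) \<and>
     (\<forall>i\<in>- S. \<forall>v\<in>L1 (x i). Res \<phi> (x i) *v v = 0)}"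


section \<open>Null polygons in Minkowski space\<close>

definition future_cone :: "(real^3) set" where
  "future_cone = {u. u $ 3 = sqrt ((u $ 1)\<^sup>2 + (u $ 2)\<^sup>2)} - {0}"

definition past_cone :: "(real^3) set" where
  "past_cone = {u. u $ 3 = - sqrt ((u $ 1)\<^sup>2 + (u $ 2)\<^sup>2)} - {0}"

text \<open>\<open>card {..i}\<close> is the position of \<open>i\<close> in the linear order of the index type.\<close>

definition cone_factor :: "nat \<Rightarrow> 'n::{finite,linorder} \<Rightarrow> (real^3) set" where
  "cone_factor k1 i = (if card {..i} \<le> k1 then past_cone else future_cone)"

text \<open>The tangent space at \<open>u\<close> of an embedded submanifold \<open>M\<close>, as the set of velocities of curves.\<close>

definition tangent :: "(real^3) set \<Rightarrow> real^3 \<Rightarrow> (real^3) set" where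
  "tangent M u = {v. \<exists>\<gamma> :: real \<Rightarrow> real^3.
     \<gamma> 0 = u \<and> (\<forall>\<^sub>F t in at 0. \<gamma> t \<in> M) \<and> (\<gamma> has_vector_derivative v) (at 0)}"

text \<open>The regular part of \<open>\<mu>\<^sup>-\<^sup>1(0)\<close>. The last conjunct says that the differential
  \<open>(v\<^sub>1,\<dots>,v\<^sub>n) \<mapsto> v\<^sub>1 + \<dots> + v\<^sub>n\<close> of \<open>\<mu>\<close> at \<open>u\<close> is onto.
  There are \<open>k1\<close> past and \<open>k2 = CARD('n) - k1\<close> future vectors.\<close>

definition null_polygon_level :: "nat \<Rightarrow> ((real^3)^'n::{finite,linorder}) set" where
  "null_polygon_level k1 = {u.
     (\<forall>i. u $ i \<in> cone_factor k1 i) \<and> (\<Sum>i\<in>UNIV. u $ i) = 0 \<and>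
     (\<forall>y. \<exists>v. (\<forall>i. v i \<in> tangent (cone_factor k1 i) (u $ i)) \<and> (\<Sum>i\<in>UNIV. v i) = y)}"

definition SU11_matrix :: "complex \<Rightarrow> complex \<Rightarrow> real^3^3" where
  "SU11_matrix \<alpha> \<beta> = vector
     [vector [Re (\<alpha>\<^sup>2 - \<beta>\<^sup>2), - Im (\<alpha>\<^sup>2 + \<beta>\<^sup>2), - 2 * Im (\<alpha> * \<beta>)],
      vector [Im (\<alpha>\<^sup>2 - \<beta>\<^sup>2), Re (\<alpha>\<^sup>2 + \<beta>\<^sup>2), 2 * Re (\<alpha> * \<beta>)],
      vector [2 * Im (\<alpha> * cnj \<beta>), 2 * Re (\<alpha> * cnj \<beta>), (cmod \<alpha>)\<^sup>2 + (cmod \<beta>)\<^sup>2]]"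

definition SU11_orbit :: "(real^3)^'n::finite \<Rightarrow> ((real^3)^'n) set" where
  "SU11_orbit u = {\<chi> i. SU11_matrix \<alpha> \<beta> *v u $ i | \<alpha> \<beta>. (cmod \<alpha>)\<^sup>2 - (cmod \<beta>)\<^sup>2 = 1}"

definition null_polygon_space :: "nat \<Rightarrow> ((real^3)^'n::{finite,linorder}) set smooth_space" where
  "null_polygon_space k1 =
     quotient_space (sub_space euclidean_smooth (null_polygon_level k1)) SU11_orbit"

end

theory Submission
  imports Defs
begin

text \<open>All three moduli spaces are quotients of one elementary space.  A \<^emph>\<open>configuration\<close> for \<open>S\<close> is a vector
  \<open>l\<close> of nonzero complex numbers whose entries sum to zero over \<open>S\<close> and over its complement; a scalar \<open>c \<noteq> 0\<close> acts
  by multiplying the entries with index in \<open>S\<close> by \<open>c\<close> and dividing the others by \<open>c\<close>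
  (\<open>config\<close>, \<open>config_rel\<close>).

  \<^item> \<^emph>\<open>Higgs bundles.\<close>  A line subbundle of nonnegative degree of the trivial bundle over the sphere is constant
    (\<open>nonneg_degree_constant\<close>), and a Higgs field with simple poles is determined by its residues
    (\<open>simple_pole_partial_fractions\<close>).  Stable bundles are therefore tuples of nonzero nilpotent matrices with sum zero
    that do not all have the same kernel, up to simultaneous conjugation (\<open>stable_iff\<close>, \<open>higgs_moduli_eq\<close>).
    In \<open>\<Z>\<^sub>S\<close> the residues indexed by \<open>S\<close> share one kernel and the others share another one.  In a basis taken from
    these two lines the residues are multiples \<open>l\<^sub>i\<close> of the two elementary off-diagonal matrices, and the
    diagonal matrices that are left act on \<open>l\<close> by scaling (\<open>model_residues_form\<close>).

  \<^item> \<^emph>\<open>Hyperpolygons.\<close>  In a unitary frame containing the common line of the \<open>q\<^sub>i\<close>, \<open>i \<in> S\<close>, the real moment map equation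
    forces the other line to be the second axis and the two halves of \<open>l\<close> to have the same total length.  Only scalings of
    modulus one are left, but each orbit of the positive scalings meets the balanced configurations in one
    point, so the quotient is the same (\<open>hyperpolygon_standard_form\<close>, \<open>balance_unit_rel\<close>).

  \<^item> \<^emph>\<open>Null polygons.\<close>  At a regular point the total momentum of the past vectors is timelike, because
    equality in the triangle inequality would make all vectors parallel (\<open>polygons_timelike\<close>).  A boost takes it to
    its rest frame, in which the spatial parts of the past vectors and the conjugates of those of the future vectors form a balanced
    configuration, unique up to rotation (\<open>boosted_polygon\<close>, \<open>config_of_orbit\<close>).

  To obtain a diffeomorphism it suffices to have smooth maps in both directions between the component and the configurations
  that are inverse to each other up to scaling (\<open>diffeomorphic_null_polygon_spaceI\<close>).  From configurations to the component this is the explicit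
  normal form; in the other direction the traces \<open>tr (N\<^sub>i N\<^sub>k)\<close>, with \<open>N\<^sub>i = q\<^sub>i p\<^sub>i\<close> for hyperpolygons, are smooth functions on
  the moduli space, and they recover \<open>l\<close> up to scaling because \<open>tr (N\<^sub>i N\<^sub>k) = l\<^sub>i l\<^sub>k\<close> for \<open>i \<in> S\<close>, \<open>k \<notin> S\<close> (\<open>trace_config_model\<close>).

  The same traces identify the components of the fixed-point set: \<open>tr (N\<^sub>i N\<^sub>k)\<close> vanishes iff \<open>N\<^sub>i\<close> and \<open>N\<^sub>k\<close> have the
  same kernel.  The space attached to \<open>S\<close> is given by the closed condition that the lines within \<open>S\<close> agree and those outside \<open>S\<close> agree.
  At a fixed point, moreover, all lines are isotropic for one nonzero quadratic form in two variables, so that at most two of them are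
  distinct, and the open condition that each line of \<open>S\<close> differs from each line outside \<open>S\<close> is equivalent.
  Hence the space is closed and open in the fixed-point set (\<open>trace_component\<close>), and it is connected as an
  image of the connected space of configurations (\<open>connected_config\<close>).\<close>

section \<open>Calculus of smooth maps between Euclidean spaces\<close>

text \<open>The vector-valued analogue of \<^const>\<open>Ck_on\<close>, in which sums, products and composites can be
  differentiated without passing to components.\<close>

primrec Ck :: "nat \<Rightarrow> 'e::euclidean_space set \<Rightarrow> ('e \<Rightarrow> 'f::real_normed_vector) \<Rightarrow> bool" where
  "Ck 0 U f \<longleftrightarrow> continuous_on U f"
| "Ck (Suc k) U f \<longleftrightarrow>
     (\<forall>x\<in>U. f differentiable (at x)) \<and> (\<forall>v. Ck k U (\<lambda>x. frechet_derivative f (at x) v))"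

definition smooth_on :: "'e::euclidean_space set \<Rightarrow> ('e \<Rightarrow> 'f::real_normed_vector) \<Rightarrow> bool" where
  "smooth_on U f \<longleftrightarrow> open U \<and> (\<forall>k. Ck k U f)"

lemma Ck_on_iff_Ck: "Ck_on k U f \<longleftrightarrow> Ck k U f"
  by (induction k arbitrary: f) auto

lemma smooth_euclidean_iff: "smooth euclidean_smooth U f \<longleftrightarrow> smooth_on U f"
  by (simp add: euclidean_smooth_def smooth_on_def Ck_on_iff_Ck)

lemma topo_euclidean_smooth [simp]: "topo euclidean_smooth = euclidean"
  by (simp add: euclidean_smooth_def)

lemma frechet_derivative_eqI: "(f has_derivative f') (at x) \<Longrightarrow> frechet_derivative f (at x) = f'"
  using frechet_derivative_at by metis

lemma Ck_continuous: "Ck k U f \<Longrightarrow> continuous_on U f"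
proof (cases k)
  case (Suc l)
  assume "Ck k U f"
  then have "f differentiable (at x)" if "x \<in> U" for x using Suc that by simp
  then show ?thesis
    by (intro continuous_at_imp_continuous_on ballI differentiable_imp_continuous_within)
qed simp

lemma Ck_SucD: "Ck (Suc k) U f \<Longrightarrow> Ck k U f"
proof (induction k arbitrary: f)
  case 0
  then show ?case using Ck_continuous by (metis Ck.simps(1))
next
  case (Suc k)
  have "\<forall>x\<in>U. f differentiable (at x)" "\<forall>v. Ck (Suc k) U (\<lambda>x. frechet_derivative f (at x) v)"
    using Suc.prems Ck.simps(2)[of "Suc k" U f] by blast+
  then show ?case using Suc.IH Ck.simps(2)[of k U f] by blast
qed

lemma Ck_subset: "Ck k U f \<Longrightarrow> V \<subseteq> U \<Longrightarrow> Ck k V f"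
  by (induction k arbitrary: f) (auto intro: continuous_on_subset)

text \<open>Openness enters because derivatives see a full neighbourhood of each point.\<close>

lemma Ck_cong:
  assumes "open U" "\<And>x. x \<in> U \<Longrightarrow> f x = g x" "Ck k U f"
  shows "Ck k U g"
  using assms(2,3)
proof (induction k arbitrary: f g)
  case 0
  then show ?case by (metis Ck.simps(1) continuous_on_cong)
next
  case (Suc k)
  have d: "(g has_derivative frechet_derivative f (at x)) (at x)" if "x \<in> U" for x
  proof (rule has_derivative_transform_within_open[OF _ assms(1) that])
    show "(f has_derivative frechet_derivative f (at x)) (at x)"
      using Suc.prems(2) that frechet_derivative_works by auto
  qed (use Suc.prems(1) in auto)
  have "Ck k U (\<lambda>x. frechet_derivative g (at x) v)" for v
  proof (rule Suc.IH)
    show "frechet_derivative f (at x) v = frechet_derivative g (at x) v" if "x \<in> U" for x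
      using frechet_derivative_eqI[OF d[OF that]] by simp
    show "Ck k U (\<lambda>x. frechet_derivative f (at x) v)" using Suc.prems(2) by simp
  qed
  then show ?case using d by (auto simp: differentiable_def)
qed

text \<open>To pass from order \<open>k\<close> to order \<open>k + 1\<close> it suffices to exhibit the derivative.\<close>

lemma Ck_SucI:
  assumes "open U" "\<And>x. x \<in> U \<Longrightarrow> (f has_derivative f' x) (at x)" "\<And>v. Ck k U (\<lambda>x. f' x v)"
  shows "Ck (Suc k) U f"
proof -
  have "Ck k U (\<lambda>x. frechet_derivative f (at x) v)" for v
  proof (rule Ck_cong[OF assms(1) _ assms(3)[of v]])
    show "f' x v = frechet_derivative f (at x) v" if "x \<in> U" for x
      using frechet_derivative_eqI[OF assms(2)[OF that]] by simp
  qed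
  then show ?thesis using assms(2) by (auto simp: differentiable_def)
qed

text \<open>The converse of the preceding lemma with the derivative as an arbitrary witness; the pair lets each closure
  property be proved by exhibiting one formula.\<close>

lemma Ck_SucE:
  assumes "Ck (Suc k) U f"
  shows "\<exists>f'. (\<forall>x\<in>U. (f has_derivative f' x) (at x)) \<and> (\<forall>v. Ck k U (\<lambda>x. f' x v))"
  using assms by (intro exI[of _ "\<lambda>x. frechet_derivative f (at x)"]) (simp add: frechet_derivative_works)

lemma Ck_const: "open U \<Longrightarrow> Ck k U (\<lambda>x. c)"
proof (induction k arbitrary: c)
  case (Suc k)
  then show ?case by (intro Ck_SucI[where f' = "\<lambda>x v. 0"]) auto
qed simp

lemma Ck_add: "open U \<Longrightarrow> Ck k U f \<Longrightarrow> Ck k U g \<Longrightarrow> Ck k U (\<lambda>x. f x + g x)"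
proof (induction k arbitrary: f g)
  case (Suc k)
  obtain f' where f: "\<And>x. x \<in> U \<Longrightarrow> (f has_derivative f' x) (at x)" "\<And>v. Ck k U (\<lambda>x. f' x v)"
    using Ck_SucE[OF Suc.prems(2)] by blast
  obtain g' where g: "\<And>x. x \<in> U \<Longrightarrow> (g has_derivative g' x) (at x)" "\<And>v. Ck k U (\<lambda>x. g' x v)"
    using Ck_SucE[OF Suc.prems(3)] by blast
  show ?case
    using Suc.prems(1) f g
    by (intro Ck_SucI[where f' = "\<lambda>x v. f' x v + g' x v"] has_derivative_add Suc.IH) auto
qed (auto intro: continuous_on_add)

lemma Ck_sum:
  "open U \<Longrightarrow> (\<And>i. i \<in> I \<Longrightarrow> Ck k U (f i)) \<Longrightarrow> Ck k U (\<lambda>x. \<Sum>i\<in>I. f i x)"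
  by (induction I rule: infinite_finite_induct) (auto intro: Ck_const Ck_add)

lemma Ck_linear:
  assumes "bounded_linear L" "open U"
  shows "Ck k U f \<Longrightarrow> Ck k U (\<lambda>x. L (f x))"
proof (induction k arbitrary: f)
  case 0
  then show ?case using assms(1) by (simp add: bounded_linear.continuous_on)
next
  case (Suc k)
  obtain f' where
      f: "\<And>x. x \<in> U \<Longrightarrow> (f has_derivative f' x) (at x)" "\<And>v. Ck k U (\<lambda>x. f' x v)"
    using Ck_SucE[OF Suc.prems] by blast
  show ?case
    by (rule Ck_SucI[OF assms(2) bounded_linear.has_derivative[OF assms(1) f(1)] Suc.IH[OF f(2)]])
qed

lemma Ck_bilinear:
  assumes "bounded_bilinear B" "open U"
  shows "Ck k U f \<Longrightarrow> Ck k U g \<Longrightarrow> Ck k U (\<lambda>x. B (f x) (g x))"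
proof (induction k arbitrary: f g)
  case 0
  then show ?case using assms(1) by (simp add: bounded_bilinear.continuous_on)
next
  case (Suc k)
  obtain f' where f: "\<And>x. x \<in> U \<Longrightarrow> (f has_derivative f' x) (at x)" "\<And>v. Ck k U (\<lambda>x. f' x v)"
    using Ck_SucE[OF Suc.prems(1)] by blast
  obtain g' where g: "\<And>x. x \<in> U \<Longrightarrow> (g has_derivative g' x) (at x)" "\<And>v. Ck k U (\<lambda>x. g' x v)"
    using Ck_SucE[OF Suc.prems(2)] by blast
  have fg: "Ck k U f" "Ck k U g" using Suc.prems Ck_SucD by blast+
  then show ?case
    using assms f g
    by (intro Ck_SucI[where f' = "\<lambda>x v. B (f x) (g' x v) + B (f' x v) (g x)"] Ck_add Suc.IH
        bounded_bilinear.FDERIV) auto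
qed

lemma Ck_compose:
  fixes f :: "'a::euclidean_space \<Rightarrow> 'b::euclidean_space" and g :: "'b \<Rightarrow> 'c::real_normed_vector"
  assumes "open U" "open V" "f ` U \<subseteq> V"
  shows "Ck k U f \<Longrightarrow> Ck k V g \<Longrightarrow> Ck k U (\<lambda>x. g (f x))"
proof (induction k arbitrary: g)
  case 0
  then show ?case using assms(3) continuous_on_compose2 by auto
next
  case (Suc k)
  obtain f' where f': "\<And>x. x \<in> U \<Longrightarrow> (f has_derivative f' x) (at x)" "\<And>v. Ck k U (\<lambda>x. f' x v)"
    using Ck_SucE[OF Suc.prems(1)] by blast
  obtain g' where g': "\<And>x. x \<in> V \<Longrightarrow> (g has_derivative g' x) (at x)" "\<And>v. Ck k V (\<lambda>x. g' x v)"
    using Ck_SucE[OF Suc.prems(2)] by blast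
  have f: "Ck k U f" using Suc.prems Ck_SucD by blast
  \<comment> \<open>expanding the inner derivative in the basis leaves only functions of the form \<open>h \<circ> f\<close>\<close>
  have e: "(\<Sum>b\<in>Basis. (f' x v \<bullet> b) *\<^sub>R g' (f x) b) = g' (f x) (f' x v)" if "x \<in> U" for x v
  proof -
    have lin: "linear (g' (f x))"
      using g'(1) that assms(3) has_derivative_linear by blast
    have "g' (f x) (\<Sum>b\<in>Basis. (f' x v \<bullet> b) *\<^sub>R b) = (\<Sum>b\<in>Basis. (f' x v \<bullet> b) *\<^sub>R g' (f x) b)"
      by (simp add: linear_sum[OF lin] linear_scale[OF lin])
    then show ?thesis by (simp add: euclidean_representation)
  qed
  have "((\<lambda>x. g (f x)) has_derivative
          (\<lambda>v. \<Sum>b\<in>Basis. (f' x v \<bullet> b) *\<^sub>R g' (f x) b)) (at x)" if "x \<in> U" for x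
    using has_derivative_compose[OF f'(1)[OF that] g'(1)] assms(3) that
    by (subst e[OF that]) auto
  moreover have "Ck k U (\<lambda>x. \<Sum>b\<in>Basis. (f' x v \<bullet> b) *\<^sub>R g' (f x) b)" for v
    using f'(2) g'(2) assms(1) f Suc.IH
    by (intro Ck_sum Ck_bilinear[OF bounded_bilinear_scaleR] Ck_linear[OF bounded_linear_inner_left])
      auto
  ultimately show ?case by (intro Ck_SucI assms(1))
qed

lemma Ck_inverse:
  fixes f :: "'a::euclidean_space \<Rightarrow> 'b::real_normed_field"
  assumes "open U" "\<And>x. x \<in> U \<Longrightarrow> f x \<noteq> 0"
  shows "Ck k U f \<Longrightarrow> Ck k U (\<lambda>x. inverse (f x))"
proof (induction k)
  case 0
  then show ?case using assms by (auto intro: continuous_on_inverse)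
next
  case (Suc k)
  obtain f' where
      *: "\<And>x. x \<in> U \<Longrightarrow> (f has_derivative f' x) (at x)" "\<And>v. Ck k U (\<lambda>x. f' x v)"
    using Ck_SucE[OF Suc.prems] by blast
  have i: "Ck k U (\<lambda>x. inverse (f x))" using Suc Ck_SucD by blast
  have "((\<lambda>x. inverse (f x)) has_derivative
          (\<lambda>v. - (inverse (f x) * f' x v * inverse (f x)))) (at x)" if "x \<in> U" for x
    using Deriv.has_derivative_inverse[OF assms(2) *(1)] that by auto
  moreover have "Ck k U (\<lambda>x. - (inverse (f x) * f' x v * inverse (f x)))" for v
    using assms(1) i *(2)
    by (intro Ck_linear[OF bounded_linear_minus[OF bounded_linear_ident]]
        Ck_bilinear[OF bounded_bilinear_mult])
  ultimately show ?case by (intro Ck_SucI assms(1))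
qed

lemma Ck_sqrt:
  assumes "open U" "\<And>x. x \<in> U \<Longrightarrow> 0 < f x"
  shows "Ck k U f \<Longrightarrow> Ck k U (\<lambda>x. sqrt (f x))"
proof (induction k)
  case 0
  then show ?case by (auto intro: continuous_on_real_sqrt)
next
  case (Suc k)
  obtain f' where
      *: "\<And>x. x \<in> U \<Longrightarrow> (f has_derivative f' x) (at x)" "\<And>v. Ck k U (\<lambda>x. f' x v)"
    using Ck_SucE[OF Suc.prems] by blast
  have i: "Ck k U (\<lambda>x. sqrt (f x))" using Suc Ck_SucD by blast
  have "((\<lambda>x. sqrt (f x)) has_derivative (\<lambda>v. (inverse (sqrt (f x)) * f' x v) * (1 / 2))) (at x)"
    if "x \<in> U" for x
  proof -
    have "((\<lambda>x. sqrt (f x)) has_derivative (\<lambda>v. f' x v * (inverse (sqrt (f x)) / 2))) (at x)"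
      by (rule has_derivative_real_sqrt[OF assms(2)[OF that] *(1)[OF that]])
    then show ?thesis by (simp add: mult_ac)
  qed
  moreover have "Ck k U (\<lambda>x. (inverse (sqrt (f x)) * f' x v) * (1 / 2))" for v
  proof (intro Ck_bilinear[OF bounded_bilinear_mult] Ck_const Ck_inverse assms(1) i *(2))
    show "sqrt (f x) \<noteq> 0" if "x \<in> U" for x using assms(2)[OF that] by simp
  qed
  ultimately show ?case by (intro Ck_SucI assms(1))
qed

named_theorems smooth_intros

lemma smooth_on_open: "smooth_on U f \<Longrightarrow> open U"
  by (simp add: smooth_on_def)

lemma smooth_on_continuous: "smooth_on U f \<Longrightarrow> continuous_on U f"
  unfolding smooth_on_def by (rule Ck_continuous[of 0]) simp

lemma smooth_on_subset: "smooth_on U f \<Longrightarrow> open V \<Longrightarrow> V \<subseteq> U \<Longrightarrow> smooth_on V f"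
  unfolding smooth_on_def by (auto intro: Ck_subset)

lemma smooth_on_compose:
  fixes f :: "'a::euclidean_space \<Rightarrow> 'b::euclidean_space"
  assumes "smooth_on U f" "smooth_on V g" "f ` U \<subseteq> V"
  shows "smooth_on U (\<lambda>x. g (f x))"
  unfolding smooth_on_def
proof (intro conjI allI)
  show "open U" using assms(1) by (simp add: smooth_on_def)
  show "Ck k U (\<lambda>x. g (f x))" for k
    by (rule Ck_compose[of U V]) (use assms in \<open>simp_all add: smooth_on_def\<close>)
qed

lemma smooth_on_const [smooth_intros]: "open U \<Longrightarrow> smooth_on U (\<lambda>x. c)"
  by (simp add: smooth_on_def Ck_const)

lemma smooth_on_linear: "bounded_linear L \<Longrightarrow> smooth_on U f \<Longrightarrow> smooth_on U (\<lambda>x. L (f x))"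
  by (simp add: smooth_on_def Ck_linear)

lemma smooth_on_bilinear:
  "bounded_bilinear B \<Longrightarrow> smooth_on U f \<Longrightarrow> smooth_on U g \<Longrightarrow> smooth_on U (\<lambda>x. B (f x) (g x))"
  by (simp add: smooth_on_def Ck_bilinear)

lemma smooth_on_id [smooth_intros]: "open U \<Longrightarrow> smooth_on U (\<lambda>x. x)"
proof -
  assume U: "open U"
  have "Ck k U (\<lambda>x. x)" for k
  proof (cases k)
    case (Suc l)
    show ?thesis
      unfolding Suc by (rule Ck_SucI[where f' = "\<lambda>x v. v"]) (auto intro: U Ck_const)
  qed auto
  with U show ?thesis by (simp add: smooth_on_def)
qed

lemma smooth_on_add [smooth_intros]:
  "smooth_on U f \<Longrightarrow> smooth_on U g \<Longrightarrow> smooth_on U (\<lambda>x. f x + g x)"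
  by (simp add: smooth_on_def Ck_add)

lemma smooth_on_sum [smooth_intros]:
  "open U \<Longrightarrow> (\<And>i. i \<in> I \<Longrightarrow> smooth_on U (f i)) \<Longrightarrow> smooth_on U (\<lambda>x. \<Sum>i\<in>I. f i x)"
  by (simp add: smooth_on_def Ck_sum)

lemma smooth_on_minus [smooth_intros]: "smooth_on U f \<Longrightarrow> smooth_on U (\<lambda>x. - f x)"
  by (rule smooth_on_linear[OF bounded_linear_minus[OF bounded_linear_ident]])

lemma smooth_on_diff [smooth_intros]:
  "smooth_on U f \<Longrightarrow> smooth_on U g \<Longrightarrow> smooth_on U (\<lambda>x. f x - g x)"
  using smooth_on_add[OF _ smooth_on_minus, of U f g] by simp

lemma smooth_on_mult [smooth_intros]:
  fixes f g :: "'a::euclidean_space \<Rightarrow> 'b::real_normed_algebra"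
  shows "smooth_on U f \<Longrightarrow> smooth_on U g \<Longrightarrow> smooth_on U (\<lambda>x. f x * g x)"
  by (rule smooth_on_bilinear[OF bounded_bilinear_mult])

lemma smooth_on_power [smooth_intros]:
  fixes f :: "'a::euclidean_space \<Rightarrow> 'b::real_normed_algebra_1"
  shows "smooth_on U f \<Longrightarrow> smooth_on U (\<lambda>x. f x ^ n)"
  by (induction n) (auto intro!: smooth_intros dest: smooth_on_open)

lemma smooth_on_divide [smooth_intros]:
  fixes f g :: "'a::euclidean_space \<Rightarrow> 'b::real_normed_field"
  assumes "smooth_on U f" "smooth_on U g" "\<And>x. x \<in> U \<Longrightarrow> g x \<noteq> 0"
  shows "smooth_on U (\<lambda>x. f x / g x)"
proof -
  have "smooth_on U (\<lambda>x. inverse (g x))"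
    using assms(2,3) by (simp add: smooth_on_def Ck_inverse)
  then show ?thesis using assms(1) by (simp add: divide_inverse smooth_on_mult)
qed

lemma smooth_on_sqrt [smooth_intros]:
  "smooth_on U f \<Longrightarrow> (\<And>x. x \<in> U \<Longrightarrow> 0 < f x) \<Longrightarrow> smooth_on U (\<lambda>x. sqrt (f x))"
  by (simp add: smooth_on_def Ck_sqrt)

lemmas smooth_on_complex_parts [smooth_intros] =
  smooth_on_linear[OF bounded_linear_Re] smooth_on_linear[OF bounded_linear_Im]
  smooth_on_linear[OF bounded_linear_cnj] smooth_on_linear[OF bounded_linear_of_real]

lemmas smooth_on_components [smooth_intros] =
  smooth_on_linear[OF bounded_linear_fst] smooth_on_linear[OF bounded_linear_snd]
  smooth_on_linear[OF bounded_linear_vec_nth]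

lemma smooth_on_cmod [smooth_intros]:
  assumes "smooth_on U f" "\<And>x. x \<in> U \<Longrightarrow> f x \<noteq> 0"
  shows "smooth_on U (\<lambda>x. cmod (f x))"
  unfolding cmod_def
  using assms
  by (intro smooth_intros) (auto simp: sum_power2_gt_zero_iff complex_eq_iff)

lemma smooth_on_Complex [smooth_intros]:
  assumes "smooth_on U f" "smooth_on U g"
  shows "smooth_on U (\<lambda>x. Complex (f x) (g x))"
proof -
  have "smooth_on U (\<lambda>x. of_real (f x) + \<i> * of_real (g x))"
    using assms by (intro smooth_intros) (auto dest: smooth_on_open)
  then show ?thesis by (simp add: Complex_eq)
qed

lemma smooth_on_Pair [smooth_intros]:
  assumes "smooth_on U f" "smooth_on U g"
  shows "smooth_on U (\<lambda>x. (f x, g x))"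
proof -
  have "smooth_on U (\<lambda>x. (f x, 0) + (0, g x))"
    using assms by (intro smooth_on_add smooth_on_linear[of "\<lambda>y. (y, 0)"]
        smooth_on_linear[of "\<lambda>y. (0, y)"] bounded_linear_Pair bounded_linear_zero
        bounded_linear_ident)
  then show ?thesis by simp
qed

lemma smooth_on_vec_lambda [smooth_intros]:
  fixes f :: "'i::finite \<Rightarrow> 'a::euclidean_space \<Rightarrow> 'b::euclidean_space"
  assumes "open U" "\<And>i. smooth_on U (f i)"
  shows "smooth_on U (\<lambda>x. \<chi> i. f i x)"
proof -
  have "bounded_linear (axis i :: 'b \<Rightarrow> 'b ^ 'i)" for i
    by (rule linear_conv_bounded_linear[THEN iffD1])
      (auto simp: linear_iff axis_def vec_eq_iff)
  then have "smooth_on U (\<lambda>x. \<Sum>i\<in>UNIV. axis i (f i x))"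
    using assms by (intro smooth_on_sum smooth_on_linear[of "axis _"])
  moreover have "(\<Sum>i\<in>UNIV. axis i (f i x)) = (\<chi> i. f i x)" for x
    by (simp add: vec_eq_iff axis_def if_distrib cong: if_cong)
  ultimately show ?thesis by simp
qed

lemma smooth_on_if [smooth_intros]:
  "(P \<Longrightarrow> smooth_on U f) \<Longrightarrow> (\<not> P \<Longrightarrow> smooth_on U g) \<Longrightarrow> smooth_on U (\<lambda>x. if P then f x else g x)"
  by (cases P) auto

section \<open>Smooth maps and diffeomorphisms onto quotients\<close>

definition smooth_map :: "'a smooth_space \<Rightarrow> 'b smooth_space \<Rightarrow> ('a \<Rightarrow> 'b) \<Rightarrow> bool" where
  "smooth_map X Y F \<longleftrightarrow> continuous_map (topo X) (topo Y) F \<and>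
     (\<forall>V g. openin (topo Y) V \<and> smooth Y V g \<longrightarrow>
        smooth X {x \<in> topspace (topo X). F x \<in> V} (g \<circ> F))"

lemma smooth_mapD:
  assumes "smooth_map X Y F"
  shows "openin (topo Y) V \<Longrightarrow> smooth Y V g \<Longrightarrow>
      smooth X {x \<in> topspace (topo X). F x \<in> V} (g \<circ> F)"
    and "openin (topo Y) V \<Longrightarrow> openin (topo X) {x \<in> topspace (topo X). F x \<in> V}"
    and "continuous_map (topo X) (topo Y) F"
  using assms by (simp_all add: smooth_map_def continuous_map_def)

lemma openin_top_of_setE:
  assumes "openin (top_of_set A) U"
  obtains G where "open G" "U = A \<inter> G"
  using assms unfolding openin_open by (elim exE conjE)

lemma openin_subtopologyE:
  assumes "openin (subtopology T A) U"
  obtains G where "openin T G" "U = G \<inter> A"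
  using assms unfolding openin_subtopology by (elim exE conjE)

text \<open>Smooth structures here carry an arbitrary family of smooth functions; restriction to smaller open sets
  is what makes functions on a subspace, which are given only locally, fit together.\<close>

definition smooth_restricts :: "'a smooth_space \<Rightarrow> bool" where
  "smooth_restricts X \<longleftrightarrow>
     (\<forall>U V f. smooth X U f \<and> openin (topo X) V \<and> V \<subseteq> U \<longrightarrow> smooth X V f)"

lemma topo_sub_space [simp]: "topo (sub_space X S) = subtopology (topo X) S"
  by (simp add: sub_space_def)

lemma smooth_sub_space_iff:
  "smooth (sub_space X S) U f \<longleftrightarrow> openin (subtopology (topo X) S) U \<and>
     (\<forall>x\<in>U. \<exists>V g. openin (topo X) V \<and> x \<in> V \<and> smooth X V g \<and> (\<forall>y\<in>U \<inter> V. f y = g y))"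
  by (simp add: sub_space_def)

lemma topspace_sub_euclidean [simp]: "topspace (topo (sub_space euclidean_smooth A)) = A"
  by simp

lemma smooth_sub_euclidean_iff:
  "smooth (sub_space euclidean_smooth A) U f \<longleftrightarrow> openin (top_of_set A) U \<and>
     (\<forall>x\<in>U. \<exists>V g. x \<in> V \<and> smooth_on V g \<and> (\<forall>y\<in>U \<inter> V. f y = g y))"
proof -
  have "(openin euclidean V \<and> x \<in> V \<and> smooth euclidean_smooth V g \<and> R) \<longleftrightarrow>
      (x \<in> V \<and> smooth_on V g \<and> R)" for V :: "'a set" and x g R
    using smooth_on_open by (auto simp: smooth_euclidean_iff)
  then show ?thesis by (simp add: sub_space_def)
qed

lemma topspace_quotient_space [simp]:
  "topspace (topo (quotient_space X \<pi>)) = \<pi> ` topspace (topo X)"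
proof
  show "topspace (topo (quotient_space X \<pi>)) \<subseteq> \<pi> ` topspace (topo X)"
    using openin_quotient_space[of X \<pi> "topspace (topo (quotient_space X \<pi>))"] by auto
  have "openin (topo (quotient_space X \<pi>)) (\<pi> ` topspace (topo X))"
  proof -
    have "{x \<in> topspace (topo X). \<pi> x \<in> \<pi> ` topspace (topo X)} = topspace (topo X)" by auto
    then show ?thesis by (simp add: openin_quotient_space)
  qed
  then show "\<pi> ` topspace (topo X) \<subseteq> topspace (topo (quotient_space X \<pi>))"
    by (rule openin_subset)
qed

lemma smooth_quotient_iff:
  "smooth (quotient_space X \<pi>) V f \<longleftrightarrow> smooth X {x \<in> topspace (topo X). \<pi> x \<in> V} (f \<circ> \<pi>)"
  by (simp add: quotient_space_def)

lemma smooth_restricts_sub_euclidean: "smooth_restricts (sub_space euclidean_smooth A)"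
  unfolding smooth_restricts_def smooth_sub_euclidean_iff topo_sub_space topo_euclidean_smooth
proof (intro allI impI, elim conjE, intro conjI ballI)
  fix U V :: "'a set" and f x
  assume *: "\<forall>x\<in>U. \<exists>V g. x \<in> V \<and> smooth_on V g \<and> (\<forall>y\<in>U \<inter> V. f y = g y)" "V \<subseteq> U" "x \<in> V"
  then obtain W g where "x \<in> W" "smooth_on W g" "\<forall>y\<in>U \<inter> W. f y = g y" by blast
  with *(2) show "\<exists>W g. x \<in> W \<and> smooth_on W g \<and> (\<forall>y\<in>V \<inter> W. f y = g y)"
    by (intro exI[of _ W] exI[of _ g]) auto
qed

lemma smooth_restricts_quotient:
  assumes "smooth_restricts X"
  shows "smooth_restricts (quotient_space X \<pi>)"
  unfolding smooth_restricts_def smooth_quotient_iff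
proof (intro allI impI, elim conjE)
  fix U V and f :: "'b \<Rightarrow> real"
  assume *: "smooth X {x \<in> topspace (topo X). \<pi> x \<in> U} (f \<circ> \<pi>)"
    "openin (topo (quotient_space X \<pi>)) V" "V \<subseteq> U"
  have "openin (topo X) {x \<in> topspace (topo X). \<pi> x \<in> V}"
    using *(2) by (simp add: openin_quotient_space)
  moreover have "{x \<in> topspace (topo X). \<pi> x \<in> V} \<subseteq> {x \<in> topspace (topo X). \<pi> x \<in> U}"
    using *(3) by blast
  ultimately show "smooth X {x \<in> topspace (topo X). \<pi> x \<in> V} (f \<circ> \<pi>)"
    using assms *(1) unfolding smooth_restricts_def by blast
qed

lemma smooth_map_compose:
  assumes F: "smooth_map X Y F" and G: "smooth_map Y Z G"
  shows "smooth_map X Z (G \<circ> F)"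
proof -
  note cont = smooth_mapD(3)[OF F] smooth_mapD(3)[OF G]
  have "smooth X {x \<in> topspace (topo X). (G \<circ> F) x \<in> V} (g \<circ> (G \<circ> F))"
    if 2: "openin (topo Z) V" "smooth Z V g" for V g
  proof -
    let ?V = "{y \<in> topspace (topo Y). G y \<in> V}"
    have "smooth X {x \<in> topspace (topo X). F x \<in> ?V} ((g \<circ> G) \<circ> F)"
      by (intro smooth_mapD(1)[OF F] smooth_mapD(1,2)[OF G] 2)
    moreover have "{x \<in> topspace (topo X). F x \<in> ?V} = {x \<in> topspace (topo X). (G \<circ> F) x \<in> V}"
      using continuous_map_funspace[OF cont(1)] by auto
    ultimately show ?thesis by (simp add: o_assoc)
  qed
  with continuous_map_compose[OF cont] show ?thesis by (simp add: smooth_map_def)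
qed

lemma smooth_map_sub_euclidean:
  assumes s: "smooth_on O1 s" and A: "A \<subseteq> O1" "s ` A \<subseteq> B"
  shows "smooth_map (sub_space euclidean_smooth A) (sub_space euclidean_smooth B) s"
proof -
  note cs = smooth_on_continuous[OF s]
  have "continuous_on A s" using cs A(1) continuous_on_subset by blast
  with A(2) have cm: "continuous_map (top_of_set A) (top_of_set B) s"
    by (simp add: continuous_map_in_subtopology image_subset_iff)
  have "smooth (sub_space euclidean_smooth A) {x \<in> A. s x \<in> V} (g \<circ> s)"
    if 2: "openin (top_of_set B) V" "smooth (sub_space euclidean_smooth B) V g" for V g
  proof -
    have "openin (top_of_set A) {x \<in> A. s x \<in> V}"
      using cm 2(1) by (simp add: continuous_map_def)
    moreover have "\<exists>W h. x \<in> W \<and> smooth_on W h \<and> (\<forall>y\<in>{x \<in> A. s x \<in> V} \<inter> W. (g \<circ> s) y = h y)"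
      if x: "x \<in> A" "s x \<in> V" for x
    proof -
      obtain W h where W: "s x \<in> W" "smooth_on W h" "\<forall>y\<in>V \<inter> W. g y = h y"
        using 2 x by (auto simp: smooth_sub_euclidean_iff)
      let ?W = "O1 \<inter> s -` W"
      have "open ?W"
        using cs smooth_on_open[OF s] smooth_on_open[OF W(2)] by (simp add: continuous_open_preimage)
      then have "smooth_on ?W s" using s smooth_on_subset by blast
      then have "smooth_on ?W (\<lambda>x. h (s x))" using W(2) smooth_on_compose by blast
      with W x A(1) show ?thesis by (intro exI[of _ ?W] exI[of _ "\<lambda>x. h (s x)"]) auto
    qed
    ultimately show ?thesis by (simp add: smooth_sub_euclidean_iff)
  qed
  with cm show ?thesis by (simp add: smooth_map_def)
qed

lemma smooth_map_compose_smooth_on: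
  assumes F: "smooth_map X euclidean_smooth F" "F ` topspace (topo X) \<subseteq> O1" and s: "smooth_on O1 s"
  shows "smooth_map X euclidean_smooth (s \<circ> F)"
  unfolding smooth_map_def
proof (intro conjI allI impI, goal_cases)
  case 1
  have 1: "continuous_map (topo X) (top_of_set O1) F"
    using F by (simp add: smooth_map_def continuous_map_in_subtopology image_subset_iff)
  have 2: "continuous_map (top_of_set O1) euclidean s"
    using smooth_on_continuous[OF s] by simp
  show ?case using continuous_map_compose[OF 1 2] by simp
next
  case (2 V g)
  then have g: "smooth_on V g" "open V" by (auto simp: smooth_euclidean_iff)
  let ?W = "O1 \<inter> s -` V"
  have W: "open ?W"
    using smooth_on_continuous[OF s] smooth_on_open[OF s] g by (simp add: continuous_open_preimage)
  then have "smooth_on ?W s" using s smooth_on_subset by blast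
  then have "smooth_on ?W (\<lambda>x. g (s x))" using g smooth_on_compose by blast
  then have "smooth X {x \<in> topspace (topo X). F x \<in> ?W} ((\<lambda>x. g (s x)) \<circ> F)"
    using W by (intro smooth_mapD(1)[OF F(1)]) (simp_all add: smooth_euclidean_iff)
  moreover have "{x \<in> topspace (topo X). F x \<in> ?W} = {x \<in> topspace (topo X). (s \<circ> F) x \<in> V}"
    using F(2) by auto
  moreover have "(\<lambda>x. g (s x)) \<circ> F = g \<circ> (s \<circ> F)" by (simp add: fun_eq_iff)
  ultimately show ?case by simp
qed

text \<open>An invariant function of representatives descends to a quotient; \<open>Z\<close> need only be
  contained in the part of the quotient where the invariant function is defined.\<close>

lemma smooth_map_quotient_invariant:
  fixes P :: "'e::euclidean_space set" and s :: "'e \<Rightarrow> 'f::euclidean_space"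
  assumes s: "smooth_on O1 s"
    and inv: "\<And>x y. x \<in> P \<Longrightarrow> y \<in> P \<Longrightarrow> \<pi> x = \<pi> y \<Longrightarrow> x \<in> O1 \<Longrightarrow> y \<in> O1 \<and> s x = s y"
    and Z: "Z \<subseteq> \<pi> ` (P \<inter> O1)"
    and \<sigma>: "\<And>x. x \<in> P \<inter> O1 \<Longrightarrow> \<sigma> (\<pi> x) = s x"
  shows "smooth_map (sub_space (quotient_space (sub_space euclidean_smooth P) \<pi>) Z)
           euclidean_smooth \<sigma>"
proof -
  let ?X = "quotient_space (sub_space euclidean_smooth P) \<pi>"
  let ?W = "\<lambda>G. \<pi> ` (P \<inter> O1 \<inter> s -` G)"
  have pre: "{x \<in> P. \<pi> x \<in> ?W G} = P \<inter> (O1 \<inter> s -` G)" for G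
  proof (intro equalityI subsetI)
    fix x assume "x \<in> {x \<in> P. \<pi> x \<in> ?W G}"
    then obtain y where "x \<in> P" "y \<in> P" "\<pi> y = \<pi> x" "y \<in> O1" "s y \<in> G" by auto
    then show "x \<in> P \<inter> (O1 \<inter> s -` G)" using inv[of y x] by simp
  qed auto
  have op: "openin (topo ?X) (?W G)" if "open G" for G
  proof -
    have "open (O1 \<inter> s -` G)"
      using smooth_on_continuous[OF s] smooth_on_open[OF s] that
      by (simp add: continuous_open_preimage)
    then have "openin (top_of_set P) (P \<inter> (O1 \<inter> s -` G))" by blast
    then show ?thesis using pre[of G] by (auto simp: openin_quotient_space)
  qed
  have pt: "topspace (subtopology (topo ?X) Z) = Z" using Z by auto
  have ZW: "{x \<in> Z. \<sigma> x \<in> G} = Z \<inter> ?W G" for G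
  proof (intro equalityI subsetI)
    fix c assume "c \<in> {x \<in> Z. \<sigma> x \<in> G}"
    then obtain x where "c \<in> Z" "c = \<pi> x" "x \<in> P \<inter> O1" "\<sigma> c \<in> G" using Z by auto
    then show "c \<in> Z \<inter> ?W G" using \<sigma>[of x] by auto
  next
    fix c assume "c \<in> Z \<inter> ?W G"
    then obtain x where "c \<in> Z" "c = \<pi> x" "x \<in> P \<inter> O1" "s x \<in> G" by auto
    then show "c \<in> {x \<in> Z. \<sigma> x \<in> G}" using \<sigma>[of x] by simp
  qed
  have opZ: "openin (subtopology (topo ?X) Z) {x \<in> Z. \<sigma> x \<in> G}" if "open G" for G
    unfolding ZW using op[OF that] by (simp add: openin_subtopology_Int2)
  show ?thesis
    unfolding smooth_map_def topo_sub_space[of ?X] pt topo_euclidean_smooth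
  proof (intro conjI allI impI, goal_cases)
    case 1
    then show ?case unfolding continuous_map_def pt using opZ by auto
  next
    case (2 V g)
    then have g: "smooth_on V g" "open V" by (auto simp: smooth_euclidean_iff)
    have "smooth ?X (?W V) (g \<circ> \<sigma>)"
    proof -
      have W: "open (O1 \<inter> s -` V)"
        using smooth_on_continuous[OF s] smooth_on_open[OF s] g
        by (simp add: continuous_open_preimage)
      then have "smooth_on (O1 \<inter> s -` V) s" using s smooth_on_subset by blast
      then have "smooth_on (O1 \<inter> s -` V) (\<lambda>x. g (s x))" using g smooth_on_compose by blast
      then show ?thesis
        unfolding smooth_quotient_iff smooth_sub_euclidean_iff topspace_sub_euclidean pre
        using W \<sigma> by (auto intro!: exI[of _ "O1 \<inter> s -` V"] exI[of _ "\<lambda>x. g (s x)"])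
    qed
    with op[OF g(2)] opZ[OF g(2)] show ?case
      unfolding smooth_sub_space_iff ZW by (auto intro!: exI[of _ "?W V"] exI[of _ "g \<circ> \<sigma>"])
  qed
qed

lemma smooth_map_quotient_projection:
  "smooth_map X (quotient_space X \<pi>) \<pi>"
  by (auto simp: smooth_map_def continuous_map_def openin_quotient_space smooth_quotient_iff)

text \<open>The inverse of the induced bijection need not be computed: \<open>\<sigma>\<close> and \<open>\<theta>\<close> are
  smooth and mutually inverse up to \<open>\<rho>\<close>-equivalence, so each of them transports
  open sets and smooth functions in one direction.\<close>

lemma diffeomorphic_quotientI:
  fixes Q :: "'e::euclidean_space set"
  assumes X: "smooth_restricts X" and Z: "Z \<subseteq> topspace (topo X)"
    and \<sigma>: "smooth_map (sub_space X Z) euclidean_smooth \<sigma>" and \<sigma>Q: "\<sigma> ` Z \<subseteq> Q"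
    and \<theta>: "smooth_map (sub_space euclidean_smooth Q) X \<theta>" and \<theta>Z: "\<theta> ` Q \<subseteq> Z"
    and \<rho>: "\<And>u. u \<in> Q \<Longrightarrow> \<rho> (\<sigma> (\<theta> u)) = \<rho> u"
    and inj: "\<And>c. c \<in> Z \<Longrightarrow> \<theta> (\<sigma> c) = c"
    and inv: "\<And>u v. u \<in> Q \<Longrightarrow> v \<in> Q \<Longrightarrow> \<rho> u = \<rho> v \<Longrightarrow> \<theta> u = \<theta> v"
  shows "diffeomorphic (sub_space X Z) (quotient_space (sub_space euclidean_smooth Q) \<rho>)"
proof -
  let ?Y = "quotient_space (sub_space euclidean_smooth Q) \<rho>"
  let ?Z = "subtopology (topo X) Z"
  let ?F = "\<lambda>c. \<rho> (\<sigma> c)"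
  have tZ: "topspace ?Z = Z" using Z by auto
  have tY: "topspace (topo ?Y) = \<rho> ` Q" by simp
  have \<sigma>_in: "\<sigma> c \<in> Q" if "c \<in> Z" for c using that \<sigma>Q by blast
  have \<theta>_in: "\<theta> u \<in> Z" if "u \<in> Q" for u using that \<theta>Z by blast
  have F_open: "openin ?Z {c \<in> Z. ?F c \<in> V}" if V: "openin (topo ?Y) V" for V
  proof -
    have "openin (top_of_set Q) {u \<in> Q. \<rho> u \<in> V}"
      using V by (simp add: openin_quotient_space)
    then obtain G where G: "open G" "{u \<in> Q. \<rho> u \<in> V} = Q \<inter> G"
      by (rule openin_top_of_setE)
    have "openin ?Z {c \<in> topspace ?Z. \<sigma> c \<in> G}"
      using smooth_mapD(2)[OF \<sigma>, of G] G(1) by simp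
    moreover have "{c \<in> topspace ?Z. \<sigma> c \<in> G} = {c \<in> Z. ?F c \<in> V}"
      unfolding tZ using G(2) \<sigma>_in by blast
    ultimately show ?thesis by simp
  qed
  have \<theta>_cont: "openin (top_of_set Q) {u \<in> Q. \<theta> u \<in> W}" if "openin (topo X) W" for W
    using smooth_mapD(2)[OF \<theta> that] by simp
  have homeo: "homeomorphic_map ?Z (topo ?Y) ?F"
  proof (rule bijective_open_imp_homeomorphic_map)
    show "continuous_map ?Z (topo ?Y) ?F"
      unfolding continuous_map_def tZ tY using F_open \<sigma>_in by blast
    show "open_map ?Z (topo ?Y) ?F"
      unfolding open_map_def
    proof (intro allI impI)
      fix U assume "openin ?Z U"
      then obtain W where W: "openin (topo X) W" "U = W \<inter> Z" by (rule openin_subtopologyE)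
      have "{u \<in> Q. \<rho> u \<in> ?F ` U} = {u \<in> Q. \<theta> u \<in> W}"
      proof (intro Collect_cong conj_cong refl)
        fix u assume u: "u \<in> Q"
        show "\<rho> u \<in> ?F ` U \<longleftrightarrow> \<theta> u \<in> W"
        proof
          assume "\<rho> u \<in> ?F ` U"
          then obtain c where c: "c \<in> U" "\<rho> u = \<rho> (\<sigma> c)" by blast
          then have "\<theta> u = c" using W(2) inv[OF u \<sigma>_in] inj by auto
          with c W show "\<theta> u \<in> W" by blast
        next
          assume "\<theta> u \<in> W"
          then have "\<theta> u \<in> U" using W(2) \<theta>_in[OF u] by blast
          then show "\<rho> u \<in> ?F ` U" using \<rho>[OF u] by (metis image_eqI)
        qed
      qed
      moreover have "?F ` U \<subseteq> \<rho> ` Q" using W(2) \<sigma>_in by blast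
      ultimately show "openin (topo ?Y) (?F ` U)"
        using \<theta>_cont[OF W(1)] by (simp add: openin_quotient_space)
    qed
    show "?F ` topspace ?Z = topspace (topo ?Y)"
      unfolding tZ tY proof (intro equalityI subsetI)
      fix y assume "y \<in> \<rho> ` Q"
      then obtain u where "u \<in> Q" "y = \<rho> u" by blast
      then show "y \<in> ?F ` Z" using \<rho>[of u] \<theta>_in[of u] by (auto intro!: image_eqI[of _ _ "\<theta> u"])
    qed (use \<sigma>_in in auto)
    show "inj_on ?F (topspace ?Z)"
      unfolding tZ
    proof (rule inj_onI)
      fix c d assume "c \<in> Z" "d \<in> Z" "?F c = ?F d"
      then show "c = d" using inv[of "\<sigma> c" "\<sigma> d"] \<sigma>_in inj by simp
    qed
  qed
  have smooth: "smooth ?Y V f \<longleftrightarrow> smooth (sub_space X Z) {c \<in> Z. ?F c \<in> V} (f \<circ> ?F)" (is "?L \<longleftrightarrow> ?R")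
    if V: "openin (topo ?Y) V" for V f
  proof
    assume L: ?L
    show ?R
      unfolding smooth_sub_space_iff
    proof (intro conjI ballI F_open[OF V])
      fix c assume "c \<in> {c \<in> Z. ?F c \<in> V}"
      then have c: "c \<in> Z" "?F c \<in> V" by auto
      obtain G g where G: "\<sigma> c \<in> G" "smooth_on G g" "\<forall>u\<in>{u \<in> Q. \<rho> u \<in> V} \<inter> G. f (\<rho> u) = g u"
        using L c \<sigma>_in[OF c(1)] unfolding smooth_quotient_iff smooth_sub_euclidean_iff by auto
      let ?U = "{c \<in> topspace ?Z. \<sigma> c \<in> G}"
      have "smooth (sub_space X Z) ?U (g \<circ> \<sigma>)"
        using smooth_mapD(1)[OF \<sigma>, of G g] G(2) smooth_on_open[OF G(2)]
        by (simp add: smooth_euclidean_iff)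
      then obtain W h where W: "openin (topo X) W" "c \<in> W" "smooth X W h"
          "\<forall>y\<in>?U \<inter> W. g (\<sigma> y) = h y" and U: "openin ?Z ?U"
        using c(1) G(1) unfolding smooth_sub_space_iff tZ by auto
      from U obtain T where T: "openin (topo X) T" "?U = T \<inter> Z" by (rule openin_subtopologyE)
      have WT: "openin (topo X) (W \<inter> T)" using W(1) T(1) by blast
      have "smooth X (W \<inter> T) h"
        using X W(3) WT unfolding smooth_restricts_def by blast
      moreover have "c \<in> W \<inter> T" using W(2) T(2) c(1) G(1) tZ by blast
      moreover have "f (\<rho> (\<sigma> y)) = h y" if "y \<in> Z" "?F y \<in> V" "y \<in> W \<inter> T" for y
      proof -
        have y: "y \<in> ?U" using T(2) that by blast
        then have "\<sigma> y \<in> G" by simp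
        then have "f (\<rho> (\<sigma> y)) = g (\<sigma> y)" using G(3) that(2) \<sigma>_in[OF that(1)] by blast
        with W(4) y that(3) show ?thesis by simp
      qed
      ultimately show "\<exists>V' g. openin (topo X) V' \<and> c \<in> V' \<and> smooth X V' g \<and>
          (\<forall>y\<in>{c \<in> Z. ?F c \<in> V} \<inter> V'. (f \<circ> ?F) y = g y)"
        using WT by (intro exI[of _ "W \<inter> T"] exI[of _ h]) auto
    qed
  next
    assume R: ?R
    show ?L
      unfolding smooth_quotient_iff smooth_sub_euclidean_iff topspace_sub_euclidean
    proof (intro conjI ballI)
      show "openin (top_of_set Q) {u \<in> Q. \<rho> u \<in> V}"
        using V by (simp add: openin_quotient_space)
      fix u assume "u \<in> {u \<in> Q. \<rho> u \<in> V}"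
      then have u: "u \<in> Q" "\<rho> u \<in> V" by auto
      have "\<theta> u \<in> {c \<in> Z. ?F c \<in> V}" using \<theta>_in[OF u(1)] \<rho>[OF u(1)] u(2) by simp
      then obtain W h where W: "openin (topo X) W" "\<theta> u \<in> W" "smooth X W h"
          "\<forall>y\<in>{c \<in> Z. ?F c \<in> V} \<inter> W. f (?F y) = h y"
        using R unfolding smooth_sub_space_iff by auto
      have "smooth (sub_space euclidean_smooth Q) {u \<in> Q. \<theta> u \<in> W} (h \<circ> \<theta>)"
        using smooth_mapD(1)[OF \<theta> W(1,3)] by simp
      then obtain G g where G: "u \<in> G" "smooth_on G g"
          "\<forall>y\<in>{u \<in> Q. \<theta> u \<in> W} \<inter> G. h (\<theta> y) = g y"
        and opW: "openin (top_of_set Q) {u \<in> Q. \<theta> u \<in> W}"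
        unfolding smooth_sub_euclidean_iff using u W(2) by auto
      from opW obtain T where T: "open T" "{u \<in> Q. \<theta> u \<in> W} = Q \<inter> T" by (rule openin_top_of_setE)
      have GT: "smooth_on (G \<inter> T) g"
        using G(2) T(1) smooth_on_open[OF G(2)] by (intro smooth_on_subset[OF G(2)]) auto
      have "f (\<rho> y) = g y" if y: "y \<in> Q" "\<rho> y \<in> V" "y \<in> G \<inter> T" for y
      proof -
        have W': "y \<in> {u \<in> Q. \<theta> u \<in> W}" using T(2) y by blast
        moreover have "\<theta> y \<in> {c \<in> Z. ?F c \<in> V}" using \<theta>_in[OF y(1)] \<rho>[OF y(1)] y(2) by simp
        ultimately have "f (?F (\<theta> y)) = h (\<theta> y)" using W(4) by blast
        with G(3) W' y(3) \<rho>[OF y(1)] show ?thesis by simp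
      qed
      moreover have "u \<in> G \<inter> T" using G(1) T(2) u W(2) by blast
      ultimately show "\<exists>W g. u \<in> W \<and> smooth_on W g \<and>
          (\<forall>y\<in>{u \<in> Q. \<rho> u \<in> V} \<inter> W. (f \<circ> \<rho>) y = g y)"
        using GT by (intro exI[of _ "G \<inter> T"] exI[of _ g]) auto
    qed
  qed
  have "diffeomorphism (sub_space X Z) ?Y ?F"
    unfolding diffeomorphism_def topo_sub_space tZ using homeo smooth by blast
  then show ?thesis unfolding diffeomorphic_def by blast
qed

section \<open>The common model of the three spaces\<close>

text \<open>The last two conditions are the two off-diagonal entries of \<open>\<Sum>N\<^sub>i = 0\<close> for residues in off-diagonal form.\<close>

definition config :: "'n::finite set \<Rightarrow> (complex^'n) set" where
  "config S = {l. (\<forall>i. l $ i \<noteq> 0) \<and> (\<Sum>i\<in>S. l $ i) = 0 \<and> (\<Sum>i\<in>-S. l $ i) = 0}"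

text \<open>The effect on off-diagonal residues of conjugation by a diagonal matrix.\<close>

definition config_scale :: "'n::finite set \<Rightarrow> complex \<Rightarrow> complex^'n \<Rightarrow> complex^'n" where
  "config_scale S c l = (\<chi> i. if i \<in> S then c * l $ i else l $ i / c)"

definition config_rel :: "'n::finite set \<Rightarrow> complex^'n \<Rightarrow> complex^'n \<Rightarrow> bool" where
  "config_rel S l m \<longleftrightarrow> (\<exists>c. c \<noteq> 0 \<and> m = config_scale S c l)"

lemma config_scale_mult:
  "config_scale S c (config_scale S d l) = config_scale S (c * d) l"
  by (simp add: config_scale_def vec_eq_iff)

lemma config_scale_1 [simp]: "config_scale S 1 l = l"
  by (simp add: config_scale_def vec_eq_iff)

lemma config_rel_trans: "config_rel S l m \<Longrightarrow> config_rel S m k \<Longrightarrow> config_rel S l k"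
  unfolding config_rel_def using config_scale_mult by (metis no_zero_divisors)

lemma config_scale_in: "l \<in> config S \<Longrightarrow> c \<noteq> 0 \<Longrightarrow> config_scale S c l \<in> config S"
  by (auto simp: config_def config_scale_def sum_distrib_left[symmetric] sum_divide_distrib[symmetric])

text \<open>All entries but one can be taken equal to \<open>1\<close>.  With a single index the sum could not vanish, which is why
  both \<open>S\<close> and its complement must have two elements.\<close>

lemma nonzero_zero_sum_exists:
  assumes "finite A" "2 \<le> card A"
  shows "\<exists>l :: 'n \<Rightarrow> complex. (\<forall>i. l i \<noteq> 0) \<and> (\<Sum>i\<in>A. l i) = 0"
proof -
  obtain a where a: "a \<in> A" using assms by fastforce
  have c: "card (A - {a}) = card A - 1" using assms a by simp
  define l :: "'n \<Rightarrow> complex" where "l = (\<lambda>i. if i = a then - of_nat (card A - 1) else 1)"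
  have "(\<Sum>i\<in>A. l i) = l a + (\<Sum>i\<in>A - {a}. l i)" using assms(1) a by (rule sum.remove)
  also have "(\<Sum>i\<in>A - {a}. l i) = of_nat (card A - 1)" using c by (simp add: l_def)
  finally have "(\<Sum>i\<in>A. l i) = 0" by (simp add: l_def)
  moreover have "l i \<noteq> 0" for i using assms by (simp add: l_def)
  ultimately show ?thesis by blast
qed

lemma config_nonempty:
  fixes S :: "'n::finite set"
  assumes "2 \<le> card S" "card S + 2 \<le> CARD('n)"
  shows "config S \<noteq> {}"
proof -
  have "card (- S) = CARD('n) - card S" by (simp add: Compl_eq_Diff_UNIV card_Diff_subset)
  then have "2 \<le> card (- S)" using assms by simp
  then obtain l m :: "'n \<Rightarrow> complex" where "\<forall>i. l i \<noteq> 0" "(\<Sum>i\<in>S. l i) = 0"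
      "\<forall>i. m i \<noteq> 0" "(\<Sum>i\<in>-S. m i) = 0"
    using nonzero_zero_sum_exists[of S] nonzero_zero_sum_exists[of "- S"] assms by auto
  then have "(\<chi> i. if i \<in> S then l i else m i) \<in> config S" by (simp add: config_def)
  then show ?thesis by blast
qed

text \<open>Two configurations lie on an affine complex line on which each coordinate vanishes at
  most once, and a complex line stays connected when finitely many points are removed.\<close>

lemma connected_config: "connected (config S)"
  unfolding connected_iff_connected_component[of "config S"] connected_component_def
proof (intro ballI)
  fix l m assume lm: "l \<in> config S" "m \<in> config S"
  let ?g = "\<lambda>c. \<chi> i. l $ i + c * (m $ i - l $ i)"
  let ?B = "{c. \<exists>i. l $ i + c * (m $ i - l $ i) = 0}"
  have "c \<in> range (\<lambda>i. l $ i / (l $ i - m $ i))" if "c \<in> ?B" for c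
  proof -
    obtain i where i: "l $ i + c * (m $ i - l $ i) = 0" using \<open>c \<in> ?B\<close> by blast
    moreover have "l $ i \<noteq> 0" using lm by (simp add: config_def)
    ultimately have "l $ i - m $ i \<noteq> 0" by auto
    then have "c = l $ i / (l $ i - m $ i)" using i by (simp add: field_simps)
    then show ?thesis by blast
  qed
  then have "?B \<subseteq> range (\<lambda>i. l $ i / (l $ i - m $ i))" by blast
  then have "finite ?B" by (rule finite_subset) simp
  then have "connected (UNIV - ?B)"
    by (intro connected_open_delete_finite) auto
  moreover have "continuous_on (UNIV - ?B) ?g"
    by (intro continuous_intros)
  ultimately have "connected (?g ` (UNIV - ?B))" by (rule connected_continuous_image[rotated])
  moreover have "?g ` (UNIV - ?B) \<subseteq> config S"
  proof (rule image_subsetI)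
    fix c assume "c \<in> UNIV - ?B"
    moreover have "(\<Sum>i\<in>A. l $ i + c * (m $ i - l $ i)) = 0"
      if "(\<Sum>i\<in>A. l $ i) = 0" "(\<Sum>i\<in>A. m $ i) = 0" for A
      using that by (simp add: sum.distrib sum_distrib_left[symmetric] sum_subtractf)
    ultimately show "?g c \<in> config S" using lm by (auto simp: config_def)
  qed
  moreover have "l \<in> ?g ` (UNIV - ?B)"
    by (rule image_eqI[of _ _ 0]) (use lm in \<open>auto simp: config_def vec_eq_iff\<close>)
  moreover have "m \<in> ?g ` (UNIV - ?B)"
    by (rule image_eqI[of _ _ 1]) (use lm in \<open>auto simp: config_def vec_eq_iff\<close>)
  ultimately show "\<exists>T. connected T \<and> T \<subseteq> config S \<and> l \<in> T \<and> m \<in> T" by blast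
qed

definition half_length :: "'n::finite set \<Rightarrow> complex^'n \<Rightarrow> real" where
  "half_length A l = (\<Sum>i\<in>A. cmod (l $ i))"

text \<open>The balanced configurations, those whose two halves have the same total length, form a slice for the action of
  the positive reals.  Both polygons and hyperpolygons live on this slice; \<open>balance\<close> is the projection to it.\<close>

definition balance :: "'n::finite set \<Rightarrow> complex^'n \<Rightarrow> complex^'n" where
  "balance S l = config_scale S (of_real (sqrt (half_length (-S) l / half_length S l))) l"

lemma half_length_pos:
  fixes A :: "'n::finite set"
  shows "A \<noteq> {} \<Longrightarrow> \<forall>i. l $ i \<noteq> 0 \<Longrightarrow> half_length A l > 0"
  unfolding half_length_def by (rule sum_pos) auto

lemma half_length_scale:
  "half_length S (config_scale S c l) = cmod c * half_length S l"
  "half_length (-S) (config_scale S c l) = half_length (-S) l / cmod c"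
  by (simp_all add: half_length_def config_scale_def norm_mult norm_divide sum_distrib_left
      sum_divide_distrib)

lemma balance_rel:
  fixes S :: "'n::finite set"
  assumes "S \<noteq> {}" "-S \<noteq> {}" "l \<in> config S"
  shows "config_rel S l (balance S l)"
proof -
  have "half_length S l > 0" "half_length (-S) l > 0"
    using half_length_pos[of S l] half_length_pos[of "-S" l] assms by (simp_all add: config_def)
  then show ?thesis unfolding config_rel_def balance_def
    by (intro exI[of _ "of_real (sqrt (half_length (-S) l / half_length S l))"]) auto
qed

lemma config_rel_in: "l \<in> config S \<Longrightarrow> config_rel S l m \<Longrightarrow> m \<in> config S"
  by (auto simp: config_rel_def config_scale_in)

lemma balance_in: "S \<noteq> {} \<Longrightarrow> -S \<noteq> {} \<Longrightarrow> l \<in> config S \<Longrightarrow> balance S l \<in> config S"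
  using balance_rel config_rel_in by blast

lemma balance_balanced:
  fixes S :: "'n::finite set"
  assumes "S \<noteq> {}" "-S \<noteq> {}" "l \<in> config S"
  shows "half_length S (balance S l) = half_length (-S) (balance S l)"
proof -
  let ?a = "half_length S l" and ?b = "half_length (-S) l"
  have p: "?a > 0" "?b > 0"
    using half_length_pos[of S l] half_length_pos[of "-S" l] assms by (simp_all add: config_def)
  then have "sqrt (?b / ?a) * ?a = ?b / sqrt (?b / ?a)"
    by (simp add: field_simps real_sqrt_divide)
  then show ?thesis
    unfolding balance_def half_length_scale using p by simp
qed

lemma balance_id:
  fixes S :: "'n::finite set"
  assumes "S \<noteq> {}" "l \<in> config S" "half_length S l = half_length (-S) l"
  shows "balance S l = l"
  using half_length_pos[of S l] assms by (simp add: balance_def config_def)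

lemma balance_scale:
  fixes S :: "'n::finite set"
  assumes "c \<noteq> 0"
  shows "balance S (config_scale S c l) = config_scale S (c / of_real (cmod c)) (balance S l)"
proof -
  have "half_length (-S) (config_scale S c l) / half_length S (config_scale S c l)
      = (half_length (-S) l / half_length S l) / (cmod c)\<^sup>2"
    unfolding half_length_scale by (simp add: power2_eq_square)
  then have "sqrt (half_length (-S) (config_scale S c l) / half_length S (config_scale S c l))
      = sqrt (half_length (-S) l / half_length S l) / cmod c"
    by (simp add: real_sqrt_divide real_sqrt_mult)
  then show ?thesis
    by (simp add: balance_def config_scale_mult mult.commute)
qed

text \<open>After projection to the slice only scalars of modulus one are left.\<close>

lemma balance_unit_rel:
  fixes S :: "'n::finite set"
  assumes "config_rel S l m"
  obtains u where "cmod u = 1" "balance S m = config_scale S u (balance S l)"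
proof -
  obtain c where c: "c \<noteq> 0" "m = config_scale S c l" using assms by (auto simp: config_rel_def)
  show thesis
    by (rule that[of "c / of_real (cmod c)"]) (use c in \<open>auto simp: balance_scale norm_divide\<close>)
qed

definition nonzero_vecs :: "(complex^'n::finite) set" where
  "nonzero_vecs = {l. \<forall>i. l $ i \<noteq> 0}"

lemma open_nonzero_vecs: "open (nonzero_vecs :: (complex^'n::finite) set)"
proof -
  have "open (\<Inter>i\<in>UNIV. {l :: complex^'n. l $ i \<noteq> 0})"
    by (intro open_INT ballI open_Collect_neq continuous_intros finite)
  moreover have "(\<Inter>i\<in>UNIV. {l :: complex^'n. l $ i \<noteq> 0}) = nonzero_vecs"
    by (auto simp: nonzero_vecs_def)
  ultimately show ?thesis by metis
qed

lemma config_subset: "config S \<subseteq> nonzero_vecs"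
  by (auto simp: config_def nonzero_vecs_def)

lemma balance_nonzero:
  fixes S :: "'n::finite set"
  assumes "S \<noteq> {}" "-S \<noteq> {}" "l \<in> nonzero_vecs"
  shows "balance S l $ i \<noteq> 0"
proof -
  have "half_length S l > 0" "half_length (-S) l > 0"
    using half_length_pos[of S l] half_length_pos[of "-S" l] assms by (simp_all add: nonzero_vecs_def)
  then show ?thesis using assms(3) by (auto simp: balance_def config_scale_def nonzero_vecs_def)
qed

lemma smooth_on_balance:
  fixes S :: "'n::finite set"
  assumes "S \<noteq> {}" "-S \<noteq> {}"
  shows "smooth_on nonzero_vecs (balance S)"
proof -
  have n: "smooth_on nonzero_vecs (\<lambda>l. cmod ((l :: complex^'n) $ i))" for i
    by (intro smooth_intros open_nonzero_vecs) (simp add: nonzero_vecs_def)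
  have c: "smooth_on nonzero_vecs (\<lambda>l. (l :: complex^'n) $ i)" for i
    by (intro smooth_intros open_nonzero_vecs)
  have h: "smooth_on nonzero_vecs (half_length A :: complex^'n \<Rightarrow> real)" for A
    unfolding half_length_def by (intro smooth_on_sum n open_nonzero_vecs)
  have p: "half_length S l > 0" "half_length (-S) l > 0" if "l \<in> nonzero_vecs" for l
    using half_length_pos[of S l] half_length_pos[of "-S" l] assms that
    by (simp_all add: nonzero_vecs_def)
  have r: "smooth_on nonzero_vecs (\<lambda>l. sqrt (half_length (-S) l / half_length S l))"
    by (intro smooth_on_sqrt smooth_on_divide h) (use p in force)+
  have r0: "complex_of_real (sqrt (half_length (-S) l / half_length S l)) \<noteq> 0"
    if "l \<in> nonzero_vecs" for l
    using p[OF that] by simp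
  show ?thesis
    unfolding balance_def config_scale_def
    by (intro smooth_on_vec_lambda smooth_on_if smooth_on_mult smooth_on_divide c r r0
        smooth_on_complex_parts(4) open_nonzero_vecs)
qed

section \<open>Null polygons and the rest frame\<close>

definition planar :: "real^3 \<Rightarrow> complex" where
  "planar u = Complex (u $ 1) (u $ 2)"

definition event :: "complex \<Rightarrow> real \<Rightarrow> real^3" where
  "event w t = vector [Re w, Im w, t]"

lemma planar_event [simp]: "planar (event w t) = w" "event w t $ 3 = t"
  by (simp_all add: planar_def event_def complex_eq_iff)

lemma event_eqI: "planar u = planar v \<Longrightarrow> u $ 3 = v $ 3 \<Longrightarrow> u = v"
  by (simp add: planar_def vec_eq_iff forall_3)

lemma event_planar: "event (planar u) (u $ 3) = u"
  by (rule event_eqI) simp_all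

lemma planar_simps:
  "planar (u + v) = planar u + planar v" "planar 0 = 0" "planar (r *\<^sub>R u) = of_real r * planar u"
  "planar (\<Sum>i\<in>A. f i) = (\<Sum>i\<in>A. planar (f i))"
proof -
  show *: "planar (u + v) = planar u + planar v" "planar 0 = 0" for u v
    by (simp_all add: planar_def complex_eq_iff)
  show "planar (r *\<^sub>R u) = of_real r * planar u" by (simp add: planar_def complex_eq_iff)
  show "planar (\<Sum>i\<in>A. f i) = (\<Sum>i\<in>A. planar (f i))"
    by (induction A rule: infinite_finite_induct) (simp_all add: *)
qed

lemma cmod_planar: "cmod (planar u) = sqrt ((u $ 1)\<^sup>2 + (u $ 2)\<^sup>2)"
  by (simp add: planar_def cmod_def)

lemma event_eq_0: "u = 0 \<longleftrightarrow> planar u = 0 \<and> u $ 3 = 0"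
  by (auto simp: planar_def vec_eq_iff forall_3 complex_eq_iff)

lemma future_cone_iff: "u \<in> future_cone \<longleftrightarrow> u $ 3 = cmod (planar u) \<and> planar u \<noteq> 0"
  unfolding future_cone_def by (auto simp: cmod_planar[symmetric] event_eq_0)

lemma past_cone_iff: "u \<in> past_cone \<longleftrightarrow> u $ 3 = - cmod (planar u) \<and> planar u \<noteq> 0"
  unfolding past_cone_def by (auto simp: cmod_planar[symmetric] event_eq_0)

subsection \<open>The action of SU(1,1)\<close>

lemma SU11_planar:
  "planar (SU11_matrix \<alpha> \<beta> *v u) =
     \<alpha>\<^sup>2 * planar u - \<beta>\<^sup>2 * cnj (planar u) + 2 * \<i> * \<alpha> * \<beta> * of_real (u $ 3)"
  by (simp add: planar_def SU11_matrix_def matrix_vector_mult_def sum_3 complex_eq_iff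
      power2_eq_square algebra_simps)

lemma SU11_time:
  "(SU11_matrix \<alpha> \<beta> *v u) $ 3 =
     2 * Im (\<alpha> * cnj \<beta> * planar u) + ((cmod \<alpha>)\<^sup>2 + (cmod \<beta>)\<^sup>2) * u $ 3"
  by (simp add: planar_def SU11_matrix_def matrix_vector_mult_def sum_3 algebra_simps)

lemma SU11_time_complex:
  "complex_of_real ((SU11_matrix \<alpha> \<beta> *v u) $ 3) =
     - \<i> * (\<alpha> * cnj \<beta> * planar u - cnj \<alpha> * \<beta> * cnj (planar u))
     + (\<alpha> * cnj \<alpha> + \<beta> * cnj \<beta>) * of_real (u $ 3)"
  unfolding SU11_time of_real_add of_real_mult complex_norm_square[symmetric]
  by (simp add: complex_eq_iff algebra_simps)

text \<open>\<open>\<alpha>, \<beta>\<close> act on a spinor \<open>\<xi>\<close> by \<open>\<xi> \<mapsto> \<alpha> \<xi> + i \<beta> cnj \<xi>\<close>, and on light-like vectors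
  \<open>(\<xi>\<^sup>2, |\<xi>|\<^sup>2)\<close> accordingly; this dictates the composition law.\<close>

lemma SU11_compose:
  "SU11_matrix \<gamma> \<delta> *v (SU11_matrix \<alpha> \<beta> *v u) =
     SU11_matrix (\<gamma> * \<alpha> + \<delta> * cnj \<beta>) (\<gamma> * \<beta> + \<delta> * cnj \<alpha>) *v u"
proof (rule event_eqI)
  show "planar (SU11_matrix \<gamma> \<delta> *v (SU11_matrix \<alpha> \<beta> *v u)) =
      planar (SU11_matrix (\<gamma> * \<alpha> + \<delta> * cnj \<beta>) (\<gamma> * \<beta> + \<delta> * cnj \<alpha>) *v u)"
    unfolding SU11_planar SU11_time_complex
    by (simp add: power2_eq_square algebra_simps)
  have "complex_of_real ((SU11_matrix \<gamma> \<delta> *v (SU11_matrix \<alpha> \<beta> *v u)) $ 3) =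
      of_real ((SU11_matrix (\<gamma> * \<alpha> + \<delta> * cnj \<beta>) (\<gamma> * \<beta> + \<delta> * cnj \<alpha>) *v u) $ 3)"
    unfolding SU11_planar SU11_time_complex
    by (simp add: power2_eq_square algebra_simps)
  then show "(SU11_matrix \<gamma> \<delta> *v (SU11_matrix \<alpha> \<beta> *v u)) $ 3 =
      (SU11_matrix (\<gamma> * \<alpha> + \<delta> * cnj \<beta>) (\<gamma> * \<beta> + \<delta> * cnj \<alpha>) *v u) $ 3"
    by (simp only: of_real_eq_iff)
qed

lemma SU11_one: "SU11_matrix 1 0 *v u = u"
  by (rule event_eqI) (simp_all add: SU11_planar SU11_time)

lemma SU11_det_mult:
  assumes "(cmod \<alpha>)\<^sup>2 - (cmod \<beta>)\<^sup>2 = 1" "(cmod \<gamma>)\<^sup>2 - (cmod \<delta>)\<^sup>2 = 1"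
  shows "(cmod (\<gamma> * \<alpha> + \<delta> * cnj \<beta>))\<^sup>2 - (cmod (\<gamma> * \<beta> + \<delta> * cnj \<alpha>))\<^sup>2 = 1"
proof -
  have "complex_of_real ((cmod (\<gamma> * \<alpha> + \<delta> * cnj \<beta>))\<^sup>2 - (cmod (\<gamma> * \<beta> + \<delta> * cnj \<alpha>))\<^sup>2)
     = of_real (((cmod \<alpha>)\<^sup>2 - (cmod \<beta>)\<^sup>2) * ((cmod \<gamma>)\<^sup>2 - (cmod \<delta>)\<^sup>2))"
    unfolding of_real_diff of_real_mult complex_norm_square by (simp add: algebra_simps)
  then have "(cmod (\<gamma> * \<alpha> + \<delta> * cnj \<beta>))\<^sup>2 - (cmod (\<gamma> * \<beta> + \<delta> * cnj \<alpha>))\<^sup>2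
     = ((cmod \<alpha>)\<^sup>2 - (cmod \<beta>)\<^sup>2) * ((cmod \<gamma>)\<^sup>2 - (cmod \<delta>)\<^sup>2)"
    by (simp only: of_real_eq_iff)
  then show ?thesis using assms by simp
qed

definition SU11_act :: "complex \<Rightarrow> complex \<Rightarrow> (real^3)^'n::finite \<Rightarrow> (real^3)^'n" where
  "SU11_act \<alpha> \<beta> u = (\<chi> i. SU11_matrix \<alpha> \<beta> *v u $ i)"

text \<open>Elements of \<open>SU(1,1)\<close> form a group by the composition law, so two orbits that meet coincide.\<close>

lemma SU11_orbit_eq_iff:
  "SU11_orbit u = SU11_orbit v \<longleftrightarrow>
     (\<exists>\<alpha> \<beta>. (cmod \<alpha>)\<^sup>2 - (cmod \<beta>)\<^sup>2 = 1 \<and> v = SU11_act \<alpha> \<beta> u)"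
proof -
  have orb: "w \<in> SU11_orbit z \<longleftrightarrow> (\<exists>\<alpha> \<beta>. (cmod \<alpha>)\<^sup>2 - (cmod \<beta>)\<^sup>2 = 1 \<and> w = SU11_act \<alpha> \<beta> z)"
    for w z :: "(real^3)^'n"
    unfolding SU11_orbit_def SU11_act_def by blast
  have tr: "x \<in> SU11_orbit z" if xw: "x \<in> SU11_orbit w" and wz: "w \<in> SU11_orbit z" for x w z :: "(real^3)^'n"
  proof -
    obtain \<alpha> \<beta> where 1: "(cmod \<alpha>)\<^sup>2 - (cmod \<beta>)\<^sup>2 = 1" "w = SU11_act \<alpha> \<beta> z"
      using wz unfolding orb by blast
    obtain \<gamma> \<delta> where 2: "(cmod \<gamma>)\<^sup>2 - (cmod \<delta>)\<^sup>2 = 1" "x = SU11_act \<gamma> \<delta> w"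
      using xw unfolding orb by blast
    have "x = SU11_act (\<gamma> * \<alpha> + \<delta> * cnj \<beta>) (\<gamma> * \<beta> + \<delta> * cnj \<alpha>) z"
      using 1(2) 2(2) by (simp add: SU11_act_def SU11_compose)
    with SU11_det_mult[OF 1(1) 2(1)] show ?thesis unfolding orb by blast
  qed
  have sy: "z \<in> SU11_orbit w" if wz: "w \<in> SU11_orbit z" for w z :: "(real^3)^'n"
  proof -
    obtain \<alpha> \<beta> where 1: "(cmod \<alpha>)\<^sup>2 - (cmod \<beta>)\<^sup>2 = 1" "w = SU11_act \<alpha> \<beta> z"
      using wz unfolding orb by blast
    have "complex_of_real ((cmod \<alpha>)\<^sup>2 - (cmod \<beta>)\<^sup>2) = 1" using 1(1) by simp
    then have e1: "cnj \<alpha> * \<alpha> + - \<beta> * cnj \<beta> = 1"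
      unfolding of_real_diff complex_norm_square by (simp add: mult.commute)
    have e2: "cnj \<alpha> * \<beta> + - \<beta> * cnj \<alpha> = 0" by simp
    have "SU11_matrix (cnj \<alpha>) (- \<beta>) *v (SU11_matrix \<alpha> \<beta> *v y) = y" for y
      by (simp only: SU11_compose e1 e2 SU11_one)
    then have "z = SU11_act (cnj \<alpha>) (- \<beta>) w"
      using 1(2) by (simp add: SU11_act_def)
    moreover have "(cmod (cnj \<alpha>))\<^sup>2 - (cmod (- \<beta>))\<^sup>2 = 1" using 1(1) by simp
    ultimately show ?thesis unfolding orb by blast
  qed
  have re: "z \<in> SU11_orbit z" for z :: "(real^3)^'n"
  proof -
    have "z = SU11_act 1 0 z" by (simp add: SU11_act_def SU11_one)
    then show ?thesis unfolding orb by (intro exI[of _ 1] exI[of _ 0]) simp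
  qed
  show ?thesis
    unfolding orb[symmetric]
  proof
    assume "SU11_orbit u = SU11_orbit v"
    then show "v \<in> SU11_orbit u" using re[of v] by simp
  next
    assume "v \<in> SU11_orbit u"
    then show "SU11_orbit u = SU11_orbit v" using tr sy by blast
  qed
qed

text \<open>For a light-like \<open>u\<close> with planar part \<open>w\<close> and energy \<open>t\<close>, the planar part of the image times \<open>w\<close> is the square of
  \<open>\<alpha> w + i \<beta> t\<close>, and the modulus of this square is the new energy times \<open>t\<close>.  The latter is therefore positive:
  time orientation is preserved.\<close>

lemma SU11_null:
  fixes u :: "real^3"
  assumes "cmod \<beta> < cmod \<alpha>" "(u $ 3)\<^sup>2 = (cmod (planar u))\<^sup>2" "planar u \<noteq> 0"
  defines "v \<equiv> SU11_matrix \<alpha> \<beta> *v u"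
  shows "planar v \<noteq> 0" "v $ 3 * u $ 3 = cmod (planar v) * cmod (planar u)"
proof -
  let ?w = "planar u" and ?t = "u $ 3"
  have tc: "(complex_of_real ?t)\<^sup>2 = ?w * cnj ?w"
    using assms(2) complex_norm_square[of ?w] by (metis of_real_power)
  have sq: "planar v * ?w = (\<alpha> * ?w + \<i> * \<beta> * of_real ?t)\<^sup>2"
  proof -
    have "(\<alpha> * ?w + \<i> * \<beta> * of_real ?t)\<^sup>2
        = (\<alpha> * ?w)\<^sup>2 + 2 * \<i> * \<alpha> * \<beta> * of_real ?t * ?w - \<beta>\<^sup>2 * (complex_of_real ?t)\<^sup>2"
      by (simp add: power2_eq_square algebra_simps)
    also have "\<dots> = (\<alpha> * ?w)\<^sup>2 + 2 * \<i> * \<alpha> * \<beta> * of_real ?t * ?w - \<beta>\<^sup>2 * (?w * cnj ?w)"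
      unfolding tc ..
    also have "\<dots> = planar v * ?w"
      unfolding v_def SU11_planar by (simp add: power2_eq_square algebra_simps)
    finally show ?thesis ..
  qed
  have t: "\<bar>?t\<bar> = cmod ?w" using assms(2) by (auto simp: power2_eq_iff)
  have nz: "\<alpha> * ?w + \<i> * \<beta> * of_real ?t \<noteq> 0"
  proof
    assume "\<alpha> * ?w + \<i> * \<beta> * of_real ?t = 0"
    then have "\<alpha> * ?w = - (\<i> * \<beta> * of_real ?t)" by (simp add: eq_neg_iff_add_eq_0)
    then have "cmod (\<alpha> * ?w) = cmod (\<i> * \<beta> * of_real ?t)" by simp
    then have "cmod \<alpha> * cmod ?w = cmod \<beta> * cmod ?w" using t by (simp add: norm_mult)
    with assms(1,3) show False by simp
  qed
  show "planar v \<noteq> 0" using sq nz by force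
  have "complex_of_real (cmod (planar v) * cmod ?w) = of_real ((cmod (\<alpha> * ?w + \<i> * \<beta> * of_real ?t))\<^sup>2)"
    using sq by (metis norm_mult norm_power)
  also have "\<dots> = (\<alpha> * ?w + \<i> * \<beta> * of_real ?t) * cnj (\<alpha> * ?w + \<i> * \<beta> * of_real ?t)"
    by (rule complex_norm_square)
  also have "\<dots> = \<alpha> * cnj \<alpha> * (?w * cnj ?w) + \<beta> * cnj \<beta> * (complex_of_real ?t)\<^sup>2
      - \<i> * (\<alpha> * cnj \<beta> * ?w - cnj \<alpha> * \<beta> * cnj ?w) * of_real ?t"
    by (simp add: power2_eq_square algebra_simps)
  also have "\<dots> = complex_of_real (v $ 3) * of_real ?t"
    unfolding v_def SU11_time_complex tc[symmetric] by (simp add: power2_eq_square algebra_simps)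
  finally have "complex_of_real (cmod (planar v) * cmod ?w) = of_real (v $ 3 * ?t)" by simp
  then show "v $ 3 * ?t = cmod (planar v) * cmod ?w" by (simp only: of_real_eq_iff)
qed

lemma SU11_cone:
  assumes "cmod \<beta> < cmod \<alpha>"
  shows "u \<in> future_cone \<Longrightarrow> SU11_matrix \<alpha> \<beta> *v u \<in> future_cone"
    and "u \<in> past_cone \<Longrightarrow> SU11_matrix \<alpha> \<beta> *v u \<in> past_cone"
proof -
  let ?v = "SU11_matrix \<alpha> \<beta> *v u"
  assume "u \<in> future_cone"
  then show "?v \<in> future_cone"
    unfolding future_cone_iff using SU11_null[OF assms, of u] by auto
next
  let ?v = "SU11_matrix \<alpha> \<beta> *v u"
  assume u: "u \<in> past_cone"
  then have v: "planar ?v \<noteq> 0" "?v $ 3 * u $ 3 = cmod (planar ?v) * cmod (planar u)"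
    unfolding past_cone_iff using SU11_null[OF assms, of u] by auto
  then have "(?v $ 3 + cmod (planar ?v)) * cmod (planar u) = 0"
    using u unfolding past_cone_iff by (simp add: algebra_simps)
  with u v show "?v \<in> past_cone"
    unfolding past_cone_iff by (simp add: eq_neg_iff_add_eq_0)
qed

subsection \<open>Regular points\<close>

text \<open>The two tangent directions are the velocities of dilating and of rotating \<open>u\<close> within the cone.\<close>

lemma tangent_cone_contains:
  assumes C: "C = future_cone \<or> C = past_cone" and u: "u \<in> C"
  shows "event (Complex a b * planar u) (a * u $ 3) \<in> tangent C u"
proof -
  define \<gamma> where "\<gamma> = (\<lambda>s::real. event (of_real (1 + s * a) * (cis (s * b) * planar u)) ((1 + s * a) * u $ 3))"
  have "\<gamma> 0 = u" by (simp add: \<gamma>_def event_planar)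
  moreover have "\<forall>\<^sub>F s in at 0. \<gamma> s \<in> C"
  proof -
    have "((\<lambda>s. 1 + s * a) \<longlongrightarrow> 1 + 0 * a) (at (0::real))" by (intro tendsto_intros)
    then have "\<forall>\<^sub>F s in at (0::real). 0 < 1 + s * a" by (rule order_tendstoD) simp
    then show ?thesis
    proof eventually_elim
      case (elim s)
      have "cmod (of_real (1 + s * a) * (cis (s * b) * planar u)) = (1 + s * a) * cmod (planar u)"
        using elim by (simp only: norm_mult norm_of_real norm_cis)
      moreover have "complex_of_real (1 + s * a) \<noteq> 0" using elim by (simp only: of_real_eq_0_iff)
      ultimately show ?case
        using C u unfolding \<gamma>_def
        by (auto simp: future_cone_iff past_cone_iff simp del: of_real_add of_real_mult of_real_1)
    qed
  qed
  moreover have "(\<gamma> has_vector_derivative event (Complex a b * planar u) (a * u $ 3)) (at 0)"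
  proof -
    have c: "(\<gamma> has_vector_derivative v) (at 0)"
      if "\<And>k. ((\<lambda>s. \<gamma> s $ k) has_vector_derivative v $ k) (at 0)" for v
    proof -
      have "((\<lambda>s. \<Sum>k\<in>UNIV. \<gamma> s $ k *\<^sub>R axis k (1::real)) has_vector_derivative
          (\<Sum>k\<in>UNIV. v $ k *\<^sub>R axis k 1)) (at 0)"
        by (intro has_vector_derivative_sum
            bounded_linear.has_vector_derivative[OF bounded_linear_scaleR_left] that)
      moreover have "(\<Sum>k\<in>UNIV. y $ k *\<^sub>R axis k (1::real)) = y" for y :: "real^3"
        by (simp add: vec_eq_iff axis_def if_distrib cong: if_cong)
      ultimately show ?thesis by simp
    qed
    have e: "\<gamma> = (\<lambda>s. vector [(1 + s * a) * (cos (s * b) * u $ 1 - sin (s * b) * u $ 2),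
        (1 + s * a) * (cos (s * b) * u $ 2 + sin (s * b) * u $ 1), (1 + s * a) * u $ 3])"
      by (simp add: \<gamma>_def event_def planar_def fun_eq_iff)
    have d1: "((\<lambda>s. (1 + s * a) * (cos (s * b) * u $ 1 - sin (s * b) * u $ 2))
        has_real_derivative a * u $ 1 - b * u $ 2) (at 0)"
      by (auto intro!: derivative_eq_intros)
    have d2: "((\<lambda>s. (1 + s * a) * (cos (s * b) * u $ 2 + sin (s * b) * u $ 1))
        has_real_derivative a * u $ 2 + b * u $ 1) (at 0)"
      by (auto intro!: derivative_eq_intros)
    have d3: "((\<lambda>s. (1 + s * a) * u $ 3) has_real_derivative a * u $ 3) (at 0)"
      by (auto intro!: derivative_eq_intros)
    have "\<forall>k. ((\<lambda>s. \<gamma> s $ k) has_vector_derivative (event (Complex a b * planar u) (a * u $ 3)) $ k) (at 0)"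
      unfolding forall_3 e using d1 d2 d3
      by (simp add: event_def planar_def has_real_derivative_iff_has_vector_derivative)
    then show ?thesis by (intro c) blast
  qed
  ultimately show ?thesis unfolding tangent_def by blast
qed

text \<open>Conversely, along a curve in the cone the Minkowski square vanishes identically.\<close>

lemma tangent_cone_orthogonal:
  assumes C: "C = future_cone \<or> C = past_cone" and u: "u \<in> C" and v: "v \<in> tangent C u"
  shows "v $ 3 * u $ 3 = v $ 1 * u $ 1 + v $ 2 * u $ 2"
proof -
  obtain \<gamma> :: "real \<Rightarrow> real^3" where g: "\<gamma> 0 = u" "\<forall>\<^sub>F t in at 0. \<gamma> t \<in> C"
      "(\<gamma> has_vector_derivative v) (at 0)"
    using v by (auto simp: tangent_def)
  define f where "f = (\<lambda>t. (\<gamma> t $ 3)\<^sup>2 - ((\<gamma> t $ 1)\<^sup>2 + (\<gamma> t $ 2)\<^sup>2))"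
  have null: "(y $ 3)\<^sup>2 - ((y $ 1)\<^sup>2 + (y $ 2)\<^sup>2) = 0" if "y \<in> C" for y
    using C that by (auto simp: future_cone_def past_cone_def)
  have d: "((\<lambda>t. \<gamma> t $ k) has_real_derivative v $ k) (at 0)" for k
    using bounded_linear.has_vector_derivative[OF bounded_linear_vec_nth g(3)]
    by (simp add: has_real_derivative_iff_has_vector_derivative)
  have "(f has_real_derivative 2 * (v $ 3 * u $ 3) - (2 * (v $ 1 * u $ 1) + 2 * (v $ 2 * u $ 2))) (at 0)"
    unfolding f_def by (auto intro!: derivative_eq_intros d simp: g(1))
  moreover have "(f has_real_derivative 0) (at 0)"
  proof -
    have "\<forall>\<^sub>F t in at 0. f t = 0" using g(2) by eventually_elim (simp add: f_def null)
    moreover have "f 0 = 0" using null[OF u] by (simp add: f_def g(1))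
    ultimately have "\<forall>\<^sub>F t in nhds 0. f t = 0" by (auto simp: eventually_at_filter elim: eventually_mono)
    then show ?thesis using DERIV_cong_ev[of 0 0 f "\<lambda>t. 0" 0 0] by simp
  qed
  ultimately have "2 * (v $ 3 * u $ 3) - (2 * (v $ 1 * u $ 1) + 2 * (v $ 2 * u $ 2)) = 0"
    by (rule DERIV_unique)
  then show ?thesis by simp
qed

lemma cone_factor_cases: "cone_factor k i = future_cone \<or> cone_factor k i = past_cone"
  by (simp add: cone_factor_def)

lemma cone_factor_null:
  assumes "u \<in> cone_factor k i"
  shows "\<bar>u $ 3\<bar> = cmod (planar u)" "u $ 3 \<noteq> 0" "planar u \<noteq> 0"
  using assms by (auto simp: cone_factor_def future_cone_iff past_cone_iff split: if_splits)

text \<open>The differential of \<open>\<mu>\<close> is onto iff two of the tangent planes differ, that is, iff two of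
  the light-like vectors are not parallel.\<close>

lemma null_polygon_level_iff:
  "u \<in> null_polygon_level k \<longleftrightarrow> (\<forall>i. u $ i \<in> cone_factor k i) \<and> (\<Sum>i\<in>UNIV. u $ i) = 0 \<and>
     (\<exists>i j. planar (u $ i) * of_real (u $ j $ 3) \<noteq> planar (u $ j) * of_real (u $ i $ 3))"
proof -
  have "(\<forall>y. \<exists>v. (\<forall>i. v i \<in> tangent (cone_factor k i) (u $ i)) \<and> (\<Sum>i\<in>UNIV. v i) = y) \<longleftrightarrow>
      (\<exists>i j. planar (u $ i) * of_real (u $ j $ 3) \<noteq> planar (u $ j) * of_real (u $ i $ 3))"
    (is "?L \<longleftrightarrow> ?R")
    if cone: "\<And>i. u $ i \<in> cone_factor k i"
  proof
    assume L: ?L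
    show ?R
    proof (rule ccontr)
      assume "\<not> ?R"
      then have par: "planar (u $ i) * of_real (u $ j $ 3) = planar (u $ j) * of_real (u $ i $ 3)" for i j
        by blast
      \<comment> \<open>parallel light-like vectors have the same tangent plane, which does not contain the time axis\<close>
      obtain v where v: "\<And>i. v i \<in> tangent (cone_factor k i) (u $ i)"
          "(\<Sum>i\<in>UNIV. v i) = event 0 1"
        using L by meson
      \<comment> \<open>any index will do\<close>
      define j where "j = (undefined :: 'a)"
      have "v i $ 3 * u $ j $ 3 = v i $ 1 * u $ j $ 1 + v i $ 2 * u $ j $ 2" for i
      proof -
        have p: "u $ i $ 1 * u $ j $ 3 = u $ j $ 1 * u $ i $ 3"
            "u $ i $ 2 * u $ j $ 3 = u $ j $ 2 * u $ i $ 3"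
          using par[of i j] by (simp_all add: planar_def complex_eq_iff)
        have o: "v i $ 3 * u $ i $ 3 = v i $ 1 * u $ i $ 1 + v i $ 2 * u $ i $ 2"
          by (rule tangent_cone_orthogonal[OF cone_factor_cases cone v(1)])
        have "(v i $ 3 * u $ j $ 3) * u $ i $ 3 = (v i $ 3 * u $ i $ 3) * u $ j $ 3" by simp
        also have "\<dots> = v i $ 1 * (u $ i $ 1 * u $ j $ 3) + v i $ 2 * (u $ i $ 2 * u $ j $ 3)"
          unfolding o by (simp add: algebra_simps)
        also have "\<dots> = (v i $ 1 * u $ j $ 1 + v i $ 2 * u $ j $ 2) * u $ i $ 3"
          unfolding p by (simp add: algebra_simps)
        finally show ?thesis using cone_factor_null(2)[OF cone] by simp
      qed
      then have "(\<Sum>i\<in>UNIV. v i $ 3 * u $ j $ 3) = (\<Sum>i\<in>UNIV. v i $ 1 * u $ j $ 1 + v i $ 2 * u $ j $ 2)"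
        by simp
      then have "(\<Sum>i\<in>UNIV. v i) $ 3 * u $ j $ 3
          = (\<Sum>i\<in>UNIV. v i) $ 1 * u $ j $ 1 + (\<Sum>i\<in>UNIV. v i) $ 2 * u $ j $ 2"
        by (simp add: sum_distrib_right sum.distrib)
      then show False unfolding v(2) using cone_factor_null(2)[OF cone] by (simp add: event_def)
    qed
  next
    assume ?R
    then obtain i j where ij: "planar (u $ i) * of_real (u $ j $ 3) \<noteq> planar (u $ j) * of_real (u $ i $ 3)"
      by blast
    then have "i \<noteq> j" by auto
    define ti tj where "ti = u $ i $ 3" and "tj = u $ j $ 3"
    define m n where "m = planar (u $ i) / of_real ti" and "n = planar (u $ j) / of_real tj"
    have t: "ti \<noteq> 0" "tj \<noteq> 0" and mn1: "cmod m = 1" "cmod n = 1"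
      using cone_factor_null[OF cone[of i]] cone_factor_null[OF cone[of j]]
      by (auto simp: ti_def tj_def m_def n_def norm_divide)
    have mn: "m \<noteq> n" using ij t by (simp add: m_def n_def field_simps ti_def tj_def)
    have m0: "m \<noteq> 0" using mn1 by auto
    define \<nu> where "\<nu> = n / m"
    have \<nu>: "cmod \<nu> = 1" "\<nu> \<noteq> 1" using mn1 mn m0 by (auto simp: \<nu>_def norm_divide)
    have re: "Re \<nu> \<noteq> 1"
    proof
      assume "Re \<nu> = 1"
      moreover have "(Re \<nu>)\<^sup>2 + (Im \<nu>)\<^sup>2 = 1" using \<nu>(1) cmod_power2[of \<nu>] by simp
      ultimately have "\<nu> = 1" by (simp add: complex_eq_iff)
      with \<nu>(2) show False ..
    qed
    show ?L
    proof
      fix y :: "real^3"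
      \<comment> \<open>Only the vectors at \<open>i\<close> and \<open>j\<close> move.  Their radial parts \<open>a\<close>, \<open>y\<^sub>3 - a\<close> have the required energy, and the complex equation \<open>ab\<close> for \<open>a\<close> and the rotational part \<open>b\<close> is solvable since \<open>Re \<nu> \<noteq> 1\<close>.\<close>
      define \<zeta> where "\<zeta> = planar y / m - of_real (y $ 3) * \<nu>"
      define a where "a = Re \<zeta> / (1 - Re \<nu>)"
      define b where "b = Im (\<zeta> - of_real a * (1 - \<nu>))"
      have ab: "of_real a * (1 - \<nu>) + \<i> * of_real b = \<zeta>"
        using re by (simp add: complex_eq_iff a_def b_def)
      define A where "A = (\<lambda>l. if l = i then a / ti else if l = j then (y $ 3 - a) / tj else 0)"
      define B where "B = (\<lambda>l. if l = i then b / ti else 0)"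
      define v where "v = (\<lambda>l. event (Complex (A l) (B l) * planar (u $ l)) (A l * u $ l $ 3))"
      have "v l \<in> tangent (cone_factor k l) (u $ l)" for l
        unfolding v_def by (rule tangent_cone_contains[OF cone_factor_cases cone])
      moreover have "(\<Sum>l\<in>UNIV. v l) = y"
      proof -
        have "v l = 0" if "l \<noteq> i" "l \<noteq> j" for l
          using that by (simp add: v_def A_def B_def event_eq_0 Complex_eq_0)
        then have "(\<Sum>l\<in>UNIV. v l) = (\<Sum>l\<in>{i, j}. v l)"
          by (intro sum.mono_neutral_right) auto
        then have s: "(\<Sum>l\<in>UNIV. v l) = v i + v j" using \<open>i \<noteq> j\<close> by simp
        have "planar (v i + v j) = (of_real a + \<i> * of_real b) * m + of_real (y $ 3 - a) * n"
          using t \<open>i \<noteq> j\<close> unfolding planar_simps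
          by (simp add: v_def A_def B_def m_def n_def ti_def tj_def Complex_eq field_simps)
        also have "\<dots> = m * ((of_real a * (1 - \<nu>) + \<i> * of_real b) + of_real (y $ 3) * \<nu>)"
          using m0 by (simp add: \<nu>_def algebra_simps)
        also have "\<dots> = planar y" unfolding ab \<zeta>_def using m0 by simp
        finally have "planar (v i + v j) = planar y" .
        moreover have "(v i + v j) $ 3 = y $ 3"
          using t \<open>i \<noteq> j\<close> by (simp add: v_def A_def ti_def tj_def)
        ultimately show ?thesis unfolding s by (rule event_eqI)
      qed
      ultimately show "\<exists>v. (\<forall>i. v i \<in> tangent (cone_factor k i) (u $ i)) \<and> (\<Sum>i\<in>UNIV. v i) = y"
        by blast
    qed
  qed
  then show ?thesis unfolding null_polygon_level_def by blast
qed

text \<open>In a finite linear order the cardinality of \<open>{..i}\<close> is the position of \<open>i\<close>.\<close>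

lemma card_position:
  fixes k :: nat
  assumes "k \<le> CARD('n::{finite,linorder})"
  shows "card {i :: 'n. card {..i} \<le> k} = k"
proof -
  let ?p = "\<lambda>i :: 'n. card {..i}"
  have inj: "inj ?p"
  proof (rule injI)
    fix i j :: 'n assume e: "?p i = ?p j"
    have "{..i} \<subseteq> {..j} \<or> {..j} \<subseteq> {..i}" by (metis atMost_subset_iff linear)
    then have "{..i} = {..j}" using e by (metis card_subset_eq finite)
    then show "i = j" by simp
  qed
  have "?p ` UNIV \<subseteq> {1..CARD('n)}"
    by (auto simp: card_mono Suc_le_eq card_gt_0_iff)
  moreover have "card (?p ` UNIV) = card {1..CARD('n)}" using inj by (simp add: card_image)
  ultimately have im: "?p ` UNIV = {1..CARD('n)}" by (intro card_subset_eq) auto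
  have "?p ` {i. ?p i \<le> k} = {1..k}"
  proof (intro equalityI subsetI)
    fix x assume "x \<in> {1..k}"
    then have "x \<in> ?p ` UNIV" unfolding im using assms by auto
    then show "x \<in> ?p ` {i. ?p i \<le> k}" using \<open>x \<in> {1..k}\<close> by auto
  next
    fix x assume x: "x \<in> ?p ` {i. ?p i \<le> k}"
    then have "x \<in> {1..CARD('n)}" using im by blast
    with x show "x \<in> {1..k}" by auto
  qed
  then have "card (?p ` {i. ?p i \<le> k}) = k" by simp
  then show ?thesis using inj by (metis card_image inj_on_subset subset_UNIV)
qed

text \<open>The polygons list the past vectors first; \<open>\<tau>\<close> moves the indices in \<open>S\<close> to the front.\<close>

locale past_indexing =
  fixes S :: "'n::{finite,linorder} set" and \<tau> :: "'n \<Rightarrow> 'n"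
  assumes bij: "bij \<tau>" and past: "card {..\<tau> i} \<le> card S \<longleftrightarrow> i \<in> S"
    and S: "S \<noteq> {}" "- S \<noteq> {}"

lemma past_indexing_exists:
  fixes S :: "'n::{finite,linorder} set"
  assumes "S \<noteq> {}" "- S \<noteq> {}"
  shows "\<exists>\<tau>. past_indexing S \<tau>"
proof -
  let ?K = "{i :: 'n. card {..i} \<le> card S}"
  have c: "card ?K = card S" by (rule card_position) (simp add: card_mono)
  then obtain f where f: "bij_betw f S ?K" by (metis finite finite_same_card_bij)
  have "card (- S) = card (- ?K)"
    using c by (simp add: Compl_eq_Diff_UNIV card_Diff_subset)
  then obtain g where g: "bij_betw g (- S) (- ?K)" by (metis finite finite_same_card_bij)
  let ?t = "\<lambda>i. if i \<in> S then f i else g i"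
  have "bij_betw ?t (S \<union> - S) (?K \<union> - ?K)"
    using f g by (intro bij_betw_disjoint_Un) auto
  then have "bij ?t" by simp
  moreover have "card {..?t i} \<le> card S \<longleftrightarrow> i \<in> S" for i
    using bij_betwE[OF f] bij_betwE[OF g] by auto
  ultimately have "past_indexing S ?t" using assms by unfold_locales
  then show ?thesis by blast
qed

context past_indexing
begin

abbreviation "polygons \<equiv> null_polygon_level (card S) :: (real^3,'n) vec set"

lemma cone_factor_\<tau>: "cone_factor (card S) (\<tau> i) = (if i \<in> S then past_cone else future_cone)"
  by (simp add: cone_factor_def past)

lemma sum_\<tau>: "(\<Sum>k\<in>UNIV. f k) = (\<Sum>i\<in>S. f (\<tau> i)) + (\<Sum>i\<in>-S. f (\<tau> i))"
  for f :: "'n \<Rightarrow> 'b::comm_monoid_add"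
proof -
  have "(\<Sum>k\<in>UNIV. f k) = (\<Sum>i\<in>UNIV. f (\<tau> i))"
    using sum.reindex_bij_betw[OF bij, of f] by simp
  also have "\<dots> = (\<Sum>i\<in>S. f (\<tau> i)) + (\<Sum>i\<in>-S. f (\<tau> i))"
    using sum.union_disjoint[of S "- S" "\<lambda>i. f (\<tau> i)"] by simp
  finally show ?thesis .
qed

lemma ex_\<tau>: "(\<exists>k. P k) \<longleftrightarrow> (\<exists>i. P (\<tau> i))"
  using bij by (metis bij_pointE)

lemma all_\<tau>: "(\<forall>k. P k) \<longleftrightarrow> (\<forall>i. P (\<tau> i))"
  using ex_\<tau>[of "\<lambda>k. \<not> P k"] by blast

lemma vec_eqI_\<tau>:
  assumes "\<And>i. u $ \<tau> i = v $ \<tau> i"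
  shows "u = v"
proof -
  have "\<forall>k. u $ k = v $ k" using assms all_\<tau>[of "\<lambda>k. u $ k = v $ k"] by blast
  then show ?thesis by (rule vec_eq_iff[THEN iffD2])
qed

lemma polygons_iff:
  "u \<in> polygons \<longleftrightarrow> (\<forall>i\<in>S. u $ \<tau> i \<in> past_cone) \<and> (\<forall>i\<in>-S. u $ \<tau> i \<in> future_cone) \<and>
     (\<Sum>i\<in>S. u $ \<tau> i) + (\<Sum>i\<in>-S. u $ \<tau> i) = 0 \<and>
     (\<exists>i j. planar (u $ \<tau> i) * of_real (u $ \<tau> j $ 3) \<noteq> planar (u $ \<tau> j) * of_real (u $ \<tau> i $ 3))"
  unfolding null_polygon_level_iff sum_\<tau>[of "\<lambda>k. u $ k"]
    all_\<tau>[of "\<lambda>k. u $ k \<in> cone_factor (card S) k"] cone_factor_\<tau>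
    ex_\<tau>[of "\<lambda>k. \<exists>j. planar (u $ k) * of_real (u $ j $ 3) \<noteq> planar (u $ j) * of_real (u $ k $ 3)"]
    ex_\<tau>[of "\<lambda>j. planar (u $ \<tau> _) * of_real (u $ j $ 3) \<noteq> planar (u $ j) * of_real (u $ \<tau> _ $ 3)"]
  by auto

subsection \<open>Polygons in their rest frame\<close>

text \<open>The energies are determined by the planar parts; conjugation on the future half turns division by a scalar of modulus
  one into multiplication, so that the scaling action becomes a common rotation.\<close>

definition polygon_of :: "(complex,'n) vec \<Rightarrow> (real^3,'n) vec" where
  "polygon_of l = (\<chi> k. let i = inv \<tau> k; z = balance S l $ i in
     if i \<in> S then event z (- cmod z) else event (cnj z) (cmod z))"

lemma polygon_of_\<tau>:
  "polygon_of l $ \<tau> i = (if i \<in> S then event (balance S l $ i) (- cmod (balance S l $ i))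
     else event (cnj (balance S l $ i)) (cmod (balance S l $ i)))"
  using bij by (simp add: polygon_of_def Let_def bij_is_inj inv_f_f)

lemma smooth_on_polygon_of: "smooth_on nonzero_vecs polygon_of"
proof -
  note op = open_nonzero_vecs
  have z: "smooth_on nonzero_vecs (\<lambda>l. balance S l $ i)" for i
    by (intro smooth_intros smooth_on_balance S)
  note nz = balance_nonzero[OF S]
  have ev: "smooth_on nonzero_vecs (\<lambda>l. event (f l) (g l))"
    if "smooth_on nonzero_vecs f" "smooth_on nonzero_vecs g" for f and g :: "(complex,'n) vec \<Rightarrow> real"
  proof -
    have e: "event w t = (\<chi> k. if k = 1 then Re w else if k = 2 then Im w else t)" for w t
      by (simp add: event_def vec_eq_iff forall_3)
    show ?thesis unfolding e using that op by (intro smooth_intros)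
  qed
  show ?thesis
    unfolding polygon_of_def Let_def
    by (intro smooth_on_vec_lambda smooth_on_if ev z smooth_intros op nz)
qed

lemma polygon_of_in:
  assumes "l \<in> config S"
  shows "polygon_of l \<in> polygons"
proof -
  let ?z = "balance S l"
  have z: "?z \<in> config S" "half_length S ?z = half_length (- S) ?z"
    using assms S by (simp_all add: balance_in balance_balanced)
  have z0: "?z $ i \<noteq> 0" for i using z(1) by (simp add: config_def)
  have zs: "(\<Sum>i\<in>S. ?z $ i) = 0" "(\<Sum>i\<in>-S. ?z $ i) = 0" using z(1) by (simp_all add: config_def)
  have "(\<Sum>i\<in>S. polygon_of l $ \<tau> i) + (\<Sum>i\<in>-S. polygon_of l $ \<tau> i) = 0" (is "?s = 0")
  proof -
    have "planar ?s = (\<Sum>i\<in>S. ?z $ i) + cnj (\<Sum>i\<in>-S. ?z $ i)"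
      unfolding planar_simps by (simp add: polygon_of_\<tau>)
    moreover have "?s $ 3 = - half_length S ?z + half_length (- S) ?z"
      by (simp add: polygon_of_\<tau> half_length_def sum_negf)
    ultimately show ?thesis unfolding event_eq_0[of ?s] using zs z(2) by simp
  qed
  moreover have "\<exists>i j. planar (polygon_of l $ \<tau> i) * of_real (polygon_of l $ \<tau> j $ 3)
      \<noteq> planar (polygon_of l $ \<tau> j) * of_real (polygon_of l $ \<tau> i $ 3)"
  proof (rule ccontr)
    assume "\<not> ?thesis"
    then have e: "planar (polygon_of l $ \<tau> i) * of_real (polygon_of l $ \<tau> j $ 3)
      = planar (polygon_of l $ \<tau> j) * of_real (polygon_of l $ \<tau> i $ 3)" for i j by blast
    have par: "?z $ i * of_real (cmod (?z $ j)) = ?z $ j * of_real (cmod (?z $ i))"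
      if "i \<in> S" "j \<in> S" for i j
      using e[of i j] that by (simp add: polygon_of_\<tau>)
    obtain j where j: "j \<in> S" using S by blast
    have "(\<Sum>i\<in>S. ?z $ i * of_real (cmod (?z $ j))) = (\<Sum>i\<in>S. ?z $ j * of_real (cmod (?z $ i)))"
      by (intro sum.cong refl par j)
    then have "(\<Sum>i\<in>S. ?z $ i) * of_real (cmod (?z $ j)) = ?z $ j * of_real (half_length S ?z)"
      by (simp add: sum_distrib_left sum_distrib_right half_length_def)
    then show False using zs z0 half_length_pos[of S ?z] S by auto
  qed
  ultimately show ?thesis
    unfolding polygons_iff by (auto simp: polygon_of_\<tau> past_cone_iff future_cone_iff z0)
qed

text \<open>A rotation by \<open>c\<close> is the action of the diagonal matrix with entry \<open>\<surd>c\<close>.\<close>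

lemma polygon_of_rel:
  assumes "config_rel S l m"
  shows "SU11_orbit (polygon_of l) = SU11_orbit (polygon_of m)"
proof -
  obtain c where c: "cmod c = 1" "balance S m = config_scale S c (balance S l)"
    using balance_unit_rel[OF assms] .
  have cc: "z / c = cnj c * z" for z
  proof -
    have "cnj c * z * c = z * (c * cnj c)" by (simp only: ac_simps)
    also have "c * cnj c = 1" using complex_norm_square[of c] c(1) by simp
    finally have "cnj c * z * c = z" by simp
    moreover have "c \<noteq> 0" using c(1) by auto
    ultimately show ?thesis by (simp add: nonzero_divide_eq_eq)
  qed
  have n: "(cmod (csqrt c))\<^sup>2 = 1" using c(1) by (simp flip: norm_power)
  then have a: "(cmod (csqrt c))\<^sup>2 - (cmod 0)\<^sup>2 = 1" by simp
  have "polygon_of m $ \<tau> i = SU11_act (csqrt c) 0 (polygon_of l) $ \<tau> i" for i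
  proof (cases "i \<in> S")
    case True
    then show ?thesis unfolding SU11_act_def
      by (intro event_eqI)
        (simp_all add: polygon_of_\<tau> SU11_planar SU11_time c config_scale_def norm_mult n)
  next
    case False
    then have z: "balance S m $ i = cnj c * balance S l $ i"
      by (simp add: c(2) config_scale_def cc)
    from False show ?thesis unfolding SU11_act_def
      by (intro event_eqI)
        (simp_all add: polygon_of_\<tau> SU11_planar SU11_time z norm_mult n c(1))
  qed
  then have "polygon_of m = SU11_act (csqrt c) 0 (polygon_of l)"
    by (rule vec_eqI_\<tau>)
  with a show ?thesis unfolding SU11_orbit_eq_iff by blast
qed

subsection \<open>The boost to the rest frame\<close>

definition energy :: "(real^3,'n) vec \<Rightarrow> real" where
  "energy u = - (\<Sum>i\<in>S. u $ \<tau> i $ 3)"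

definition momentum :: "(real^3,'n) vec \<Rightarrow> complex" where
  "momentum u = (\<Sum>i\<in>S. planar (u $ \<tau> i))"

definition mass :: "(real^3,'n) vec \<Rightarrow> real" where
  "mass u = sqrt ((energy u)\<^sup>2 - ((Re (momentum u))\<^sup>2 + (Im (momentum u))\<^sup>2))"

text \<open>With total momentum \<open>(P, E)\<close> and mass \<open>M = \<surd>(E\<^sup>2 - |P|\<^sup>2)\<close>, the pure boost to the rest frame has \<open>\<alpha>\<^sup>2 = (E + M) / 2M\<close> and
  \<open>\<beta> = - i \<alpha> P / (E + M)\<close>.  The formulas are smooth on the set of timelike total momenta.\<close>

definition boost_\<alpha> :: "(real^3,'n) vec \<Rightarrow> complex" where
  "boost_\<alpha> u = of_real (sqrt ((energy u + mass u) / (2 * mass u)))"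

definition boost_\<beta> :: "(real^3,'n) vec \<Rightarrow> complex" where
  "boost_\<beta> u = - \<i> * boost_\<alpha> u * (momentum u / of_real (energy u + mass u))"

definition config_of :: "(real^3,'n) vec \<Rightarrow> (complex,'n) vec" where
  "config_of u = (\<chi> i. let w = (boost_\<alpha> u)\<^sup>2 * planar (u $ \<tau> i)
       - (boost_\<beta> u)\<^sup>2 * cnj (planar (u $ \<tau> i)) + 2 * \<i> * boost_\<alpha> u * boost_\<beta> u * of_real (u $ \<tau> i $ 3)
     in if i \<in> S then w else cnj w)"

definition timelike :: "((real^3,'n) vec) set" where
  "timelike = {u. sqrt ((Re (momentum u))\<^sup>2 + (Im (momentum u))\<^sup>2) < energy u}"

lemma timelike_iff: "u \<in> timelike \<longleftrightarrow> cmod (momentum u) < energy u"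
  by (simp add: timelike_def cmod_def)

lemma config_of_nth:
  "config_of u $ i = (let w = planar (SU11_matrix (boost_\<alpha> u) (boost_\<beta> u) *v u $ \<tau> i)
     in if i \<in> S then w else cnj w)"
  by (simp add: config_of_def SU11_planar)

lemma mass_facts:
  assumes "u \<in> timelike"
  shows "mass u > 0" "energy u > 0" "(mass u)\<^sup>2 = (energy u)\<^sup>2 - (cmod (momentum u))\<^sup>2"
proof -
  have e: "cmod (momentum u) < energy u" using assms by (simp add: timelike_iff)
  then show "energy u > 0" using norm_ge_zero[of "momentum u"] by linarith
  have "(cmod (momentum u))\<^sup>2 < (energy u)\<^sup>2" using e by (intro power_strict_mono) auto
  then show "mass u > 0" "(mass u)\<^sup>2 = (energy u)\<^sup>2 - (cmod (momentum u))\<^sup>2"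
    by (simp_all add: mass_def cmod_power2)
qed

lemma smooth_on_config_of: "smooth_on timelike config_of"
proof -
  have pl: "planar = (\<lambda>v. Complex (v $ 1) (v $ 2))" by (simp add: planar_def fun_eq_iff)
  have UE: "smooth_on UNIV energy" unfolding energy_def by (intro smooth_intros) auto
  have Up: "smooth_on UNIV (\<lambda>u :: (real^3,'n) vec. planar (u $ \<tau> i))" for i
    unfolding planar_def by (intro smooth_intros) auto
  have UW: "smooth_on UNIV momentum" unfolding momentum_def by (intro smooth_intros Up) auto
  have op: "open timelike"
    unfolding timelike_def using smooth_on_continuous[OF UE] smooth_on_continuous[OF UW]
    by (intro open_Collect_less continuous_intros) 
  note sub = smooth_on_subset[OF _ op subset_UNIV]
  note E = sub[OF UE] and W = sub[OF UW] and P = sub[OF Up]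
  have M: "smooth_on timelike mass"
    unfolding mass_def
  proof (intro smooth_intros E W)
    fix u assume "u \<in> timelike"
    from mass_facts(1)[OF this] show "0 < (energy u)\<^sup>2 - ((Re (momentum u))\<^sup>2 + (Im (momentum u))\<^sup>2)"
      by (simp add: mass_def)
  qed
  have p: "mass u > 0" "energy u > 0" if "u \<in> timelike" for u using mass_facts[OF that] by auto
  have A: "smooth_on timelike boost_\<alpha>"
    unfolding boost_\<alpha>_def
  proof (intro smooth_intros E M op)
    fix u assume "u \<in> timelike"
    with p show "2 * mass u \<noteq> 0" "0 < (energy u + mass u) / (2 * mass u)" by force+
  qed
  have B: "smooth_on timelike boost_\<beta>"
    unfolding boost_\<beta>_def
  proof (intro smooth_intros A E M W op)
    fix u assume "u \<in> timelike"
    from p[OF this] have "energy u + mass u \<noteq> 0" by simp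
    then show "complex_of_real (energy u + mass u) \<noteq> 0" by (simp only: of_real_eq_0_iff not_False_eq_True)
  qed
  show ?thesis
    unfolding config_of_def Let_def by (intro smooth_intros A B P op)
qed

lemma boost_det:
  assumes "u \<in> timelike"
  shows "(cmod (boost_\<alpha> u))\<^sup>2 - (cmod (boost_\<beta> u))\<^sup>2 = 1"
proof -
  note p = mass_facts[OF assms]
  have s: "energy u + mass u > 0" using p by simp
  have a: "(cmod (boost_\<alpha> u))\<^sup>2 = (energy u + mass u) / (2 * mass u)"
    using p by (simp add: boost_\<alpha>_def)
  have b: "(cmod (boost_\<beta> u))\<^sup>2 = (cmod (boost_\<alpha> u))\<^sup>2 * ((cmod (momentum u))\<^sup>2 / (energy u + mass u)\<^sup>2)"
    using s unfolding boost_\<beta>_def norm_mult norm_minus_cancel norm_divide norm_of_real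
    by (simp add: power_mult_distrib power_divide)
  have w: "(cmod (momentum u))\<^sup>2 = (energy u + mass u) * (energy u - mass u)"
    using p(3) by (simp add: power2_eq_square algebra_simps)
  have w': "(cmod (momentum u))\<^sup>2 / (energy u + mass u)\<^sup>2 = (energy u - mass u) / (energy u + mass u)"
    unfolding w using s by (simp add: power2_eq_square)
  have "(cmod (boost_\<alpha> u))\<^sup>2 - (cmod (boost_\<beta> u))\<^sup>2
      = (energy u + mass u) / (2 * mass u) * (1 - (energy u - mass u) / (energy u + mass u))"
    unfolding b a w' by (simp add: right_diff_distrib)
  also have "1 - (energy u - mass u) / (energy u + mass u) = 2 * mass u / (energy u + mass u)"
    using s by (simp add: field_simps)
  also have "(energy u + mass u) / (2 * mass u) * (2 * mass u / (energy u + mass u)) = 1"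
    using s p(1) by simp
  finally show ?thesis .
qed

lemma boost_momentum:
  assumes "u \<in> timelike"
  shows "(\<Sum>i\<in>S. planar (SU11_matrix (boost_\<alpha> u) (boost_\<beta> u) *v u $ \<tau> i)) = 0"
proof -
  note p = mass_facts[OF assms]
  define r W E where "r = complex_of_real (1 / (energy u + mass u))"
    and "W = momentum u" and "E = complex_of_real (energy u)"
  let ?a = "boost_\<alpha> u" and ?b = "boost_\<beta> u"
  have b: "?b = - \<i> * ?a * (r * W)" by (simp add: boost_\<beta>_def r_def W_def)
  have r: "1 - 2 * r * E + r\<^sup>2 * (W * cnj W) = 0"
  proof -
    have "1 - 2 * (1 / (energy u + mass u)) * energy u + (1 / (energy u + mass u))\<^sup>2 * (cmod (momentum u))\<^sup>2 = 0"
    proof -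
      have s: "energy u + mass u \<noteq> 0" using p by simp
      have w: "(cmod (momentum u))\<^sup>2 = (energy u + mass u) * (energy u - mass u)"
        using p(3) by (simp add: power2_eq_square algebra_simps)
      have "(1 / (energy u + mass u))\<^sup>2 * (cmod (momentum u))\<^sup>2 = (energy u - mass u) / (energy u + mass u)"
        unfolding w using s by (simp add: power2_eq_square)
      moreover have "1 - 2 * (1 / (energy u + mass u)) * energy u
          + (energy u - mass u) / (energy u + mass u) = 0"
        using s by (simp add: field_simps)
      ultimately show ?thesis by (simp only:)
    qed
    moreover have "1 - 2 * r * E + r\<^sup>2 * (W * cnj W) = of_real
        (1 - 2 * (1 / (energy u + mass u)) * energy u + (1 / (energy u + mass u))\<^sup>2 * (cmod (momentum u))\<^sup>2)"
      unfolding r_def W_def E_def complex_norm_square[symmetric] by simp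
    ultimately show ?thesis by (simp only: of_real_0)
  qed
  have "(\<Sum>i\<in>S. planar (SU11_matrix ?a ?b *v u $ \<tau> i)) = ?a\<^sup>2 * W - ?b\<^sup>2 * cnj W - 2 * \<i> * ?a * ?b * E"
    unfolding SU11_planar
    by (simp add: sum.distrib sum_subtractf sum_distrib_left[symmetric] W_def momentum_def E_def
        energy_def)
  also have "\<dots> = ?a\<^sup>2 * W * (1 - 2 * r * E + r\<^sup>2 * (W * cnj W))"
    unfolding b by (simp add: power2_eq_square algebra_simps)
  finally show ?thesis unfolding r by simp
qed

text \<open>A polygon with light-like total past momentum would have equality in the triangle inequality
  on both halves, and hence all its edges parallel.\<close>

lemma polygons_timelike:
  assumes "u \<in> polygons"
  shows "u \<in> timelike"
proof (rule ccontr)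
  let ?w = "\<lambda>i. planar (u $ \<tau> i)" and ?t = "\<lambda>i. u $ \<tau> i $ 3"
  let ?W = "momentum u" and ?E = "energy u"
  have tS: "?t i = - cmod (?w i)" if "i \<in> S" for i
    using assms that by (simp add: polygons_iff past_cone_iff)
  have tC: "?t i = cmod (?w i)" if "i \<notin> S" for i
    using assms that by (simp add: polygons_iff future_cone_iff)
  have w0: "?w i \<noteq> 0" for i
    using assms by (cases "i \<in> S") (simp_all add: polygons_iff future_cone_iff past_cone_iff)
  have sum0: "(\<Sum>i\<in>S. u $ \<tau> i) + (\<Sum>i\<in>-S. u $ \<tau> i) = 0" using assms by (simp add: polygons_iff)
  have E: "?E = (\<Sum>i\<in>S. cmod (?w i))" by (simp add: energy_def tS sum_negf)
  have EC: "?E = (\<Sum>i\<in>-S. cmod (?w i))"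
  proof -
    have "((\<Sum>i\<in>S. u $ \<tau> i) + (\<Sum>i\<in>-S. u $ \<tau> i)) $ 3 = 0" unfolding sum0 by simp
    then show ?thesis by (simp add: energy_def tC)
  qed
  have WC: "- ?W = (\<Sum>i\<in>-S. ?w i)"
  proof -
    have "planar ((\<Sum>i\<in>S. u $ \<tau> i) + (\<Sum>i\<in>-S. u $ \<tau> i)) = 0" unfolding sum0 by (simp add: planar_simps)
    then show ?thesis by (simp add: planar_simps momentum_def add_eq_0_iff)
  qed
  assume "u \<notin> timelike"
  moreover have "cmod ?W \<le> ?E" unfolding E momentum_def by (rule norm_sum)
  ultimately have eq: "cmod ?W = ?E" by (simp add: timelike_iff)
  \<comment> \<open>the equality case of the triangle inequality\<close>
  have al: "?w i * of_real ?E = of_real (cmod (?w i)) * V"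
    if "V = (\<Sum>i\<in>A. ?w i)" "?E = (\<Sum>i\<in>A. cmod (?w i))" "cmod V = ?E" "i \<in> A" for V A i
  proof -
    have le: "Re (?w j * cnj V) \<le> cmod (?w j) * ?E" for j
      using complex_Re_le_cmod[of "?w j * cnj V"] that(3) by (simp add: norm_mult)
    have "(\<Sum>j\<in>A. Re (?w j * cnj V)) = Re (V * cnj V)"
      unfolding that(1) sum_distrib_right Re_sum ..
    moreover have "(\<Sum>j\<in>A. cmod (?w j) * ?E) = ?E * ?E"
      by (simp only: sum_distrib_right[symmetric] that(2)[symmetric])
    ultimately have "(\<Sum>j\<in>A. cmod (?w j) * ?E - Re (?w j * cnj V)) = ?E * ?E - Re (V * cnj V)"
      by (simp only: sum_subtractf)
    also have "\<dots> = 0"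
      unfolding complex_norm_square[of V, symmetric] Re_complex_of_real that(3) power2_eq_square by simp
    finally have "\<forall>j\<in>A. cmod (?w j) * ?E - Re (?w j * cnj V) = 0"
      using le by (subst (asm) sum_nonneg_eq_0_iff) auto
    then have re: "Re (?w i * cnj V) = cmod (?w i * cnj V)"
      using that(3,4) by (simp add: norm_mult)
    then have im: "Im (?w i * cnj V) = 0"
      using cmod_power2[of "?w i * cnj V"] unfolding re by simp
    have "cmod (?w i * cnj V) = cmod (?w i) * ?E" unfolding norm_mult complex_mod_cnj that(3) ..
    then have "?w i * cnj V = of_real (cmod (?w i) * ?E)"
      using re im by (intro complex_eqI) (simp_all only: Re_complex_of_real Im_complex_of_real)
    then have wV: "?w i * cnj V * V = of_real (cmod (?w i) * ?E) * V" by simp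
    have VV: "cnj V * V = of_real ?E * of_real ?E"
      using that(3) complex_norm_square[of V] by (simp add: power2_eq_square mult.commute)
    have "of_real ?E * (?w i * of_real ?E) = ?w i * (cnj V * V)" unfolding VV by (simp only: ac_simps)
    also have "\<dots> = of_real ?E * (of_real (cmod (?w i)) * V)"
      using wV by (simp only: ac_simps of_real_mult)
    finally have "of_real ?E * (?w i * of_real ?E) = of_real ?E * (of_real (cmod (?w i)) * V)" .
    moreover have "?E \<noteq> 0"
    proof
      assume "?E = 0"
      then have "cmod (?w i) = 0" using that(2,4) by (simp add: sum_nonneg_eq_0_iff)
      with w0 show False by simp
    qed
    ultimately show ?thesis by simp
  qed
  have par: "?w i * of_real ?E = - of_real (?t i) * ?W" for i
  proof (cases "i \<in> S")
    case True
    with al[of ?W S i] eq E tS show ?thesis by (simp add: momentum_def)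
  next
    case False
    have "cmod (- ?W) = ?E" using eq by simp
    from al[OF WC EC this, of i] False have "?w i * of_real ?E = of_real (cmod (?w i)) * - ?W" by simp
    then show ?thesis using tC[OF False] by simp
  qed
  have E0: "?E \<noteq> 0"
  proof -
    have "?E > 0" unfolding E using S w0 by (intro sum_pos) auto
    then show ?thesis by simp
  qed
  have "?w i * of_real (?t j) = ?w j * of_real (?t i)" for i j
  proof -
    have "(?w i * of_real (?t j)) * of_real ?E = (?w i * of_real ?E) * of_real (?t j)" by simp
    also have "\<dots> = (?w j * of_real ?E) * of_real (?t i)" unfolding par by simp
    finally show ?thesis using E0 by simp
  qed
  with assms show False unfolding polygons_iff by blast
qed

lemma boosted_polygon:
  assumes "u \<in> polygons"
  shows "config_of u \<in> config S" "half_length S (config_of u) = half_length (-S) (config_of u)"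
    "polygon_of (config_of u) = SU11_act (boost_\<alpha> u) (boost_\<beta> u) u"
proof -
  note tl = polygons_timelike[OF assms]
  let ?g = "SU11_matrix (boost_\<alpha> u) (boost_\<beta> u)"
  let ?v = "\<lambda>i. ?g *v u $ \<tau> i"
  have lt: "cmod (boost_\<beta> u) < cmod (boost_\<alpha> u)"
  proof (rule power2_less_imp_less)
    show "(cmod (boost_\<beta> u))\<^sup>2 < (cmod (boost_\<alpha> u))\<^sup>2" using boost_det[OF tl] by linarith
  qed simp
  have past: "?v i $ 3 = - cmod (planar (?v i)) \<and> planar (?v i) \<noteq> 0" if "i \<in> S" for i
    using SU11_cone(2)[OF lt, of "u $ \<tau> i"] assms that by (simp add: polygons_iff past_cone_iff)
  have fut: "?v i $ 3 = cmod (planar (?v i)) \<and> planar (?v i) \<noteq> 0" if "i \<notin> S" for i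
    using SU11_cone(1)[OF lt, of "u $ \<tau> i"] assms that by (simp add: polygons_iff future_cone_iff)
  have "(\<Sum>i\<in>S. ?v i) + (\<Sum>i\<in>-S. ?v i) = ?g *v ((\<Sum>i\<in>S. u $ \<tau> i) + (\<Sum>i\<in>-S. u $ \<tau> i))"
    by (simp add: linear_add[OF matrix_vector_mul_linear] linear_sum[OF matrix_vector_mul_linear])
  also have "\<dots> = 0" using assms by (simp add: polygons_iff)
  finally have sum0: "(\<Sum>i\<in>S. ?v i) + (\<Sum>i\<in>-S. ?v i) = 0" .
  have pS: "(\<Sum>i\<in>S. planar (?v i)) = 0" by (rule boost_momentum[OF tl])
  have pC: "(\<Sum>i\<in>-S. planar (?v i)) = 0"
  proof -
    have "planar ((\<Sum>i\<in>S. ?v i) + (\<Sum>i\<in>-S. ?v i)) = 0" unfolding sum0 by (simp add: planar_simps)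
    then show ?thesis using pS by (simp add: planar_simps)
  qed
  have l: "config_of u $ i = (if i \<in> S then planar (?v i) else cnj (planar (?v i)))" for i
    by (simp add: config_of_nth Let_def)
  show c: "config_of u \<in> config S"
    using past fut pS pC by (auto simp: config_def l simp flip: cnj_sum)
  show h: "half_length S (config_of u) = half_length (-S) (config_of u)"
  proof -
    have "((\<Sum>i\<in>S. ?v i) + (\<Sum>i\<in>-S. ?v i)) $ 3 = 0" unfolding sum0 by simp
    then show ?thesis by (simp add: half_length_def l past fut sum_negf)
  qed
  have "polygon_of (config_of u) $ \<tau> i = SU11_act (boost_\<alpha> u) (boost_\<beta> u) u $ \<tau> i" for i
    using past[of i] fut[of i]
    by (intro event_eqI) (auto simp: SU11_act_def polygon_of_\<tau> balance_id[OF S(1) c h] l)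
  then show "polygon_of (config_of u) = SU11_act (boost_\<alpha> u) (boost_\<beta> u) u"
    by (rule vec_eqI_\<tau>)
qed

lemma polygon_of_config_of:
  assumes "u \<in> polygons"
  shows "SU11_orbit (polygon_of (config_of u)) = SU11_orbit u"
  using boosted_polygon(3)[OF assms] boost_det[OF polygons_timelike[OF assms]] SU11_orbit_eq_iff
  by metis

lemma config_of_polygon_of:
  assumes "l \<in> config S"
  shows "config_rel S l (config_of (polygon_of l))"
proof -
  let ?u = "polygon_of l" and ?z = "balance S l"
  have z: "?z \<in> config S" using assms S by (simp add: balance_in)
  \<comment> \<open>the polygon of a configuration is in its rest frame already, so its boost is the identity\<close>
  have W: "momentum ?u = 0" using z by (simp add: momentum_def polygon_of_\<tau> config_def)
  have tl: "?u \<in> timelike" by (rule polygons_timelike[OF polygon_of_in[OF assms]])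
  have M: "mass ?u = energy ?u" using mass_facts[OF tl] W by (simp add: mass_def)
  have "boost_\<alpha> ?u = 1" using mass_facts(2)[OF tl] by (simp add: boost_\<alpha>_def M)
  moreover have "boost_\<beta> ?u = 0" by (simp add: boost_\<beta>_def W)
  ultimately have "config_of ?u = ?z"
    by (simp add: vec_eq_iff config_of_nth SU11_one polygon_of_\<tau>)
  then show ?thesis using balance_rel[OF S assms] by simp
qed

text \<open>An element of \<open>SU(1,1)\<close> relating two polygons in their rest frames maps the total momentum, which has no
  planar part, to such a vector; this forces \<open>\<alpha> \<beta> = 0\<close>, so that the element is a rotation.\<close>

lemma config_of_orbit:
  assumes u: "u \<in> polygons" and v: "v \<in> polygons" and uv: "SU11_orbit u = SU11_orbit v"
  shows "config_rel S (config_of u) (config_of v)"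
proof -
  let ?l = "config_of u" and ?m = "config_of v"
  have "SU11_orbit (polygon_of ?l) = SU11_orbit (polygon_of ?m)"
    using polygon_of_config_of[OF u] polygon_of_config_of[OF v] uv by simp
  then obtain \<alpha> \<beta> where ab: "(cmod \<alpha>)\<^sup>2 - (cmod \<beta>)\<^sup>2 = 1"
      "polygon_of ?m = SU11_act \<alpha> \<beta> (polygon_of ?l)"
    unfolding SU11_orbit_eq_iff by blast
  have bl: "balance S ?l = ?l" and bm: "balance S ?m = ?m"
    using boosted_polygon[OF u] boosted_polygon[OF v] S by (simp_all add: balance_id)
  have l: "?l \<in> config S" and m: "?m \<in> config S"
    using boosted_polygon u v by blast+
  have pt: "polygon_of ?m $ \<tau> i = SU11_matrix \<alpha> \<beta> *v polygon_of ?l $ \<tau> i" for i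
    unfolding ab(2) by (simp add: SU11_act_def)
  have eqS: "?m $ i = \<alpha>\<^sup>2 * ?l $ i - \<beta>\<^sup>2 * cnj (?l $ i) - 2 * \<i> * \<alpha> * \<beta> * of_real (cmod (?l $ i))"
    if "i \<in> S" for i
    using arg_cong[OF pt[of i], of planar] that by (simp add: polygon_of_\<tau> SU11_planar bl bm)
  have "(\<Sum>i\<in>S. ?m $ i) = \<alpha>\<^sup>2 * (\<Sum>i\<in>S. ?l $ i) - \<beta>\<^sup>2 * cnj (\<Sum>i\<in>S. ?l $ i)
      - 2 * \<i> * \<alpha> * \<beta> * of_real (half_length S ?l)"
    by (simp add: eqS sum_subtractf sum_distrib_left half_length_def)
  moreover have "(\<Sum>i\<in>S. ?m $ i) = 0" "(\<Sum>i\<in>S. ?l $ i) = 0" using l m by (simp_all add: config_def)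
  ultimately have "\<alpha> * \<beta> * of_real (half_length S ?l) = 0"
    by (simp del: cnj_sum)
  moreover have "half_length S ?l > 0" using half_length_pos[of S ?l] S l by (simp add: config_def)
  moreover have "\<alpha> \<noteq> 0" using ab(1) zero_le_power2[of "cmod \<beta>"] by (intro notI) simp
  ultimately have \<beta>: "\<beta> = 0" by simp
  then have \<alpha>: "cmod \<alpha> = 1" using ab(1) norm_ge_zero[of \<alpha>] by (auto simp: power2_eq_1_iff)
  have "cnj \<alpha> * \<alpha> = 1" using complex_norm_square[of \<alpha>] \<alpha> by (simp add: mult.commute)
  then have cn: "cnj (\<alpha>\<^sup>2) = 1 / \<alpha>\<^sup>2"
    using \<open>\<alpha> \<noteq> 0\<close> by (simp add: field_simps flip: power_mult_distrib)
  have eqC: "?m $ i = ?l $ i / \<alpha>\<^sup>2" if "i \<notin> S" for i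
  proof -
    have "cnj (?m $ i) = \<alpha>\<^sup>2 * cnj (?l $ i)"
      using arg_cong[OF pt[of i], of planar] that by (simp add: polygon_of_\<tau> SU11_planar bl bm \<beta>)
    then have "?m $ i = cnj (\<alpha>\<^sup>2) * ?l $ i" by (metis complex_cnj_cnj complex_cnj_mult)
    then show ?thesis unfolding cn by simp
  qed
  have "?m = config_scale S (\<alpha>\<^sup>2) ?l"
    using eqS eqC by (simp add: vec_eq_iff config_scale_def \<beta>)
  then show ?thesis unfolding config_rel_def using \<open>\<alpha> \<noteq> 0\<close> by (intro exI[of _ "\<alpha>\<^sup>2"]) simp
qed

end

text \<open>A space \<open>Z\<close> that is parametrised by configurations modulo scaling is diffeomorphic to the space of polygons: \<open>s\<close> followed by
  \<open>polygon_of\<close>, and \<open>config_of\<close> followed by \<open>\<Theta>\<close>, are smooth and mutually inverse on classes.\<close>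

lemma diffeomorphic_null_polygon_spaceI:
  fixes X :: "'a smooth_space" and S :: "'n::{finite,linorder} set" and s :: "'a \<Rightarrow> (complex,'n) vec"
  assumes X: "smooth_restricts X" and Z: "Z \<subseteq> topspace (topo X)" and S: "S \<noteq> {}" "- S \<noteq> {}"
    and s: "smooth_map (sub_space X Z) euclidean_smooth s" "\<And>c. c \<in> Z \<Longrightarrow> s c \<in> config S"
    and \<Theta>: "smooth_map (sub_space euclidean_smooth (config S)) X \<Theta>"
      "\<And>l. l \<in> config S \<Longrightarrow> \<Theta> l \<in> Z"
    and s\<Theta>: "\<And>l. l \<in> config S \<Longrightarrow> config_rel S l (s (\<Theta> l))"
    and \<Theta>s: "\<And>c. c \<in> Z \<Longrightarrow> \<Theta> (s c) = c"
    and inv: "\<And>l m. l \<in> config S \<Longrightarrow> config_rel S l m \<Longrightarrow> \<Theta> l = \<Theta> m"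
  shows "diffeomorphic (sub_space X Z) (null_polygon_space (card S) :: ((real^3,'n) vec) set smooth_space)"
proof -
  obtain \<tau> where "past_indexing S \<tau>" using past_indexing_exists[OF S] by blast
  then interpret past_indexing S \<tau> .
  have cfg: "config_of u \<in> config S" if "u \<in> polygons" for u
    by (rule boosted_polygon(1)[OF that])
  show ?thesis
    unfolding null_polygon_space_def
  proof (rule diffeomorphic_quotientI[OF X Z, of "polygon_of \<circ> s" _ "\<Theta> \<circ> config_of"])
    show "smooth_map (sub_space X Z) euclidean_smooth (polygon_of \<circ> s)"
      by (rule smooth_map_compose_smooth_on[OF s(1) _ smooth_on_polygon_of])
        (use Z s(2) config_subset in auto)
    show "smooth_map (sub_space euclidean_smooth polygons) X (\<Theta> \<circ> config_of)"
      by (rule smooth_map_compose[OF smooth_map_sub_euclidean[OF smooth_on_config_of] \<Theta>(1)])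
        (use polygons_timelike cfg in auto)
    show "(polygon_of \<circ> s) ` Z \<subseteq> polygons" using s(2) polygon_of_in by auto
    show "(\<Theta> \<circ> config_of) ` polygons \<subseteq> Z" using cfg \<Theta>(2) by auto
    show "SU11_orbit ((polygon_of \<circ> s) ((\<Theta> \<circ> config_of) u)) = SU11_orbit u"
      if "u \<in> polygons" for u
      using polygon_of_rel[OF s\<Theta>[OF cfg[OF that]]] polygon_of_config_of[OF that] by simp
    show "(\<Theta> \<circ> config_of) ((polygon_of \<circ> s) c) = c" if "c \<in> Z" for c
      using inv[OF s(2)[OF that] config_of_polygon_of[OF s(2)[OF that]]] \<Theta>s[OF that] by simp
    show "(\<Theta> \<circ> config_of) u = (\<Theta> \<circ> config_of) v"
      if "u \<in> polygons" "v \<in> polygons" "SU11_orbit u = SU11_orbit v" for u v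
      using inv[OF cfg[OF that(1)] config_of_orbit[OF that]] by simp
  qed
qed

section \<open>Traces of products of nilpotent two by two matrices\<close>

text \<open>Nonzero nilpotent \<open>2 \<times> 2\<close> matrices have the same kernel iff the trace of their product vanishes.
  All incidence conditions are therefore visible in these traces, which are invariant under
  simultaneous conjugation.\<close>

definition pair_trace :: "('n \<Rightarrow> complex^2^2) \<Rightarrow> 'n \<Rightarrow> 'n \<Rightarrow> complex" where
  "pair_trace N i k = trace (N i ** N k)"

lemma pair_trace_expand:
  "pair_trace N i k = N i $ 1 $ 1 * N k $ 1 $ 1 + N i $ 1 $ 2 * N k $ 2 $ 1
     + N i $ 2 $ 1 * N k $ 1 $ 2 + N i $ 2 $ 2 * N k $ 2 $ 2"
  by (simp add: pair_trace_def trace_def matrix_matrix_mult_def sum_2)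

lemma pair_trace_sym: "pair_trace N i k = pair_trace N k i"
  by (simp add: pair_trace_expand mult.commute)

lemma pair_trace_conj:
  assumes "invertible g" "\<And>i. g ** N i = M i ** g"
  shows "pair_trace N i k = pair_trace M i k"
proof -
  obtain h where h: "g ** h = mat 1" "h ** g = mat 1" using assms(1) by (auto simp: invertible_def)
  have M: "M i = g ** (N i ** h)" for i
  proof -
    have "g ** (N i ** h) = M i ** (g ** h)" using assms(2)[of i] by (simp add: matrix_mul_assoc)
    then show ?thesis by (simp add: h)
  qed
  have "M i ** M k = g ** (N i ** (h ** g) ** (N k ** h))"
    unfolding M by (simp add: matrix_mul_assoc)
  then have "trace (M i ** M k) = trace ((N i ** (N k ** h)) ** g)"
    unfolding h by (simp add: trace_mul_sym[of g])
  also have "\<dots> = trace (N i ** (N k ** (h ** g)))" by (simp add: matrix_mul_assoc)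
  finally show ?thesis by (simp add: pair_trace_def h)
qed

text \<open>With \<open>t i k = l\<^sub>i l\<^sub>k\<close> this is \<open>l\<close> scaled by \<open>1 / l\<^sub>j\<close>.\<close>

definition trace_config :: "'n::finite set \<Rightarrow> 'n \<Rightarrow> 'n \<Rightarrow> ('n \<Rightarrow> 'n \<Rightarrow> complex) \<Rightarrow> complex^'n" where
  "trace_config S j k t = (\<chi> i. if i \<in> S then t i k / t j k else t i j)"

lemma trace_config_model:
  assumes "l \<in> config S" "j \<in> S" "k \<notin> S"
    and "\<And>i k. i \<in> S \<Longrightarrow> k \<notin> S \<Longrightarrow> t i k = l $ i * l $ k"
    and "\<And>i k. i \<in> S \<Longrightarrow> k \<notin> S \<Longrightarrow> t k i = l $ i * l $ k"
  shows "config_rel S l (trace_config S j k t)"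
proof -
  have nz: "l $ j \<noteq> 0" "l $ k \<noteq> 0" using assms(1) by (auto simp: config_def)
  have "trace_config S j k t = config_scale S (1 / l $ j) l"
    using assms(2-5) nz by (simp add: trace_config_def config_scale_def vec_eq_iff)
  then show ?thesis unfolding config_rel_def using nz by (intro exI[of _ "1 / l $ j"]) simp
qed

text \<open>If the third line on which a nonzero binary quadratic form vanishes is different from the first two, then
  these coincide.\<close>

lemma quadratic_form_lines:
  fixes a b c :: complex
  assumes q: "a * x1\<^sup>2 + b * x1 * y1 + c * y1\<^sup>2 = 0" "a * x2\<^sup>2 + b * x2 * y2 + c * y2\<^sup>2 = 0"
      "a * x3\<^sup>2 + b * x3 * y3 + c * y3\<^sup>2 = 0"
    and n: "x1 * y3 \<noteq> x3 * y1" "x2 * y3 \<noteq> x3 * y2" "a \<noteq> 0 \<or> b \<noteq> 0 \<or> c \<noteq> 0"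
  shows "x1 * y2 = x2 * y1"
proof -
  \<comment> \<open>the Vandermonde determinant of the three conditions is the product of the three minors\<close>
  let ?d = "(x1 * y2 - x2 * y1) * (x1 * y3 - x3 * y1) * (x2 * y3 - x3 * y2)"
  have "a * ?d = 0" "b * ?d = 0" "c * ?d = 0" using q by algebra+
  with n show ?thesis by auto
qed

section \<open>Recognising a connected component\<close>

lemma connected_component_clopenI:
  assumes "connectedin T Z" "Z \<noteq> {}" "openin T Z" "closedin T Z"
  shows "Z \<in> connected_components_of T"
proof -
  obtain z where z: "z \<in> Z" using assms(2) by blast
  have zT: "z \<in> topspace T" using z openin_subset[OF assms(3)] by blast
  let ?C = "connected_component_of_set T z"
  have "Z \<subseteq> ?C" using connected_component_of_maximal[OF assms(1) z] .
  moreover have "?C \<subseteq> Z"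
  proof -
    have "connectedin T ?C" by (rule connectedin_connected_component_of)
    then have "?C \<subseteq> Z \<or> disjnt ?C Z" by (rule connectedin_clopen_cases[OF _ assms(4,3)])
    moreover have "z \<in> ?C" using zT by (simp add: connected_component_of_refl)
    ultimately show ?thesis using z by (auto simp: disjnt_def)
  qed
  ultimately have "Z = ?C" by blast
  then show ?thesis using zT by (simp add: connected_components_of_def)
qed

text \<open>Within the fixed-point set, membership in the component is both a closed and an
  open condition on the traces \<open>t\<close>.\<close>

lemma trace_component:
  fixes t :: "'a \<Rightarrow> 'n::finite \<Rightarrow> 'n \<Rightarrow> complex"
  assumes op: "\<And>i k. openin T {c \<in> topspace T. t c i k \<noteq> 0}"
    and F: "F \<subseteq> topspace T" and Z: "Z \<subseteq> F" "connectedin T Z" "Z \<noteq> {}"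
    and cl: "\<And>c. c \<in> F \<Longrightarrow> c \<in> Z \<longleftrightarrow> (\<forall>i k. (i \<in> S \<longleftrightarrow> k \<in> S) \<longrightarrow> t c i k = 0)"
    and opn: "\<And>c. c \<in> F \<Longrightarrow> c \<in> Z \<longleftrightarrow> (\<forall>i k. i \<in> S \<and> k \<notin> S \<longrightarrow> t c i k \<noteq> 0)"
  shows "Z \<in> connected_components_of (subtopology T F)"
proof (rule connected_component_clopenI)
  let ?U = "\<lambda>i k. {c \<in> topspace T. t c i k \<noteq> 0}"
  show "connectedin (subtopology T F) Z" using Z by (simp add: connectedin_subtopology)
  show "Z \<noteq> {}" by (rule Z)
  have "openin T (topspace T \<inter> (\<Inter>(i, k)\<in>S \<times> (-S). ?U i k))"
    using op by (intro openin_Int_Inter) auto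
  moreover have "Z = (topspace T \<inter> (\<Inter>(i, k)\<in>S \<times> (-S). ?U i k)) \<inter> F"
    using opn F Z(1) by auto
  ultimately show "openin (subtopology T F) Z" unfolding openin_subtopology by blast
  have "openin T (\<Union>(i, k)\<in>{(i, k). i \<in> S \<longleftrightarrow> k \<in> S}. ?U i k)"
    using op by (intro openin_Union) auto
  then have "openin (subtopology T F) ((\<Union>(i, k)\<in>{(i, k). i \<in> S \<longleftrightarrow> k \<in> S}. ?U i k) \<inter> F)"
    unfolding openin_subtopology by blast
  moreover have "((\<Union>(i, k)\<in>{(i, k). i \<in> S \<longleftrightarrow> k \<in> S}. ?U i k) \<inter> F) = topspace (subtopology T F) - Z"
    using cl F Z(1) by auto
  ultimately show "closedin (subtopology T F) Z"
    using F Z(1) by (simp add: closedin_def)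
qed

section \<open>Null hyperpolygons\<close>

lemma matrix_inv_eqI:
  fixes A B :: "complex^2^2"
  assumes "A ** B = mat 1" "B ** A = mat 1"
  shows "matrix_inv A = B"
proof -
  have "A ** matrix_inv A = mat 1 \<and> matrix_inv A ** A = mat 1"
    unfolding matrix_inv_def by (rule someI[of "\<lambda>X. A ** X = mat 1 \<and> X ** A = mat 1" B]) (simp add: assms)
  then have "B ** (A ** matrix_inv A) = B" by simp
  then show ?thesis by (simp add: matrix_mul_assoc assms)
qed

lemma SU2_adjoint:
  assumes "A \<in> SU2"
  shows "A ** adjoint_mat A = mat 1" "adjoint_mat A ** A = mat 1" "matrix_inv A = adjoint_mat A"
proof -
  show 1: "A ** adjoint_mat A = mat 1" using assms by (simp add: SU2_def)
  then show 2: "adjoint_mat A ** A = mat 1" using matrix_left_right_inverse by blast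
  show "matrix_inv A = adjoint_mat A" by (rule matrix_inv_eqI[OF 1 2])
qed

lemma SU2_rows:
  assumes A: "A \<in> SU2"
  shows "A $ 1 $ 1 * cnj (A $ 1 $ 1) + A $ 1 $ 2 * cnj (A $ 1 $ 2) = 1"
      "A $ 1 $ 1 * cnj (A $ 2 $ 1) + A $ 1 $ 2 * cnj (A $ 2 $ 2) = 0"
      "A $ 2 $ 1 * cnj (A $ 1 $ 1) + A $ 2 $ 2 * cnj (A $ 1 $ 2) = 0"
      "A $ 2 $ 1 * cnj (A $ 2 $ 1) + A $ 2 $ 2 * cnj (A $ 2 $ 2) = 1"
  using SU2_adjoint(1)[OF A]
  by (simp_all add: vec_eq_iff forall_2 matrix_matrix_mult_def sum_2 adjoint_mat_def mat_def)

lemma adjoint_mult: "adjoint_mat (A ** B) = adjoint_mat B ** adjoint_mat A"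
  by (simp add: adjoint_mat_def matrix_matrix_mult_def vec_eq_iff sum_2 mult.commute)

lemma adjoint_adjoint [simp]: "adjoint_mat (adjoint_mat A) = A"
  by (simp add: adjoint_mat_def vec_eq_iff)

lemma SU2_mult: "A \<in> SU2 \<Longrightarrow> B \<in> SU2 \<Longrightarrow> A ** B \<in> SU2"
proof -
  assume A: "A \<in> SU2" and B: "B \<in> SU2"
  have "(A ** B) ** adjoint_mat (A ** B) = A ** (B ** adjoint_mat B) ** adjoint_mat A"
    by (simp add: adjoint_mult matrix_mul_assoc)
  then have "(A ** B) ** adjoint_mat (A ** B) = mat 1" by (simp add: SU2_adjoint(1)[OF A] SU2_adjoint(1)[OF B])
  then show ?thesis using A B by (simp add: SU2_def det_mul)
qed

lemma SU2_adjoint_in: "A \<in> SU2 \<Longrightarrow> adjoint_mat A \<in> SU2"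
proof -
  assume A: "A \<in> SU2"
  have "det A * det (adjoint_mat A) = det (A ** adjoint_mat A)" by (simp add: det_mul)
  also have "\<dots> = 1" by (simp add: SU2_adjoint(1)[OF A])
  finally show ?thesis using A SU2_adjoint(2)[OF A] by (simp add: SU2_def)
qed

lemma hyperpolygon_act_fst:
  "A \<in> SU2 \<Longrightarrow> fst (hyperpolygon_act x A e) $ i $ b
     = inverse (e $ i) * (fst x $ i $ 1 * A $ 1 $ b + fst x $ i $ 2 * A $ 2 $ b)"
  by (cases x) (simp add: hyperpolygon_act_def vector_matrix_mult_def sum_2 mult.commute)

lemma hyperpolygon_act_snd:
  "A \<in> SU2 \<Longrightarrow> snd (hyperpolygon_act x A e) $ i $ a
     = e $ i * (cnj (A $ 1 $ a) * snd x $ i $ 1 + cnj (A $ 2 $ a) * snd x $ i $ 2)"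
  by (cases x) (simp add: hyperpolygon_act_def SU2_adjoint(3) matrix_vector_mult_def sum_2 adjoint_mat_def)

lemma hyperpolygon_eqI:
  fixes x y :: "'n::finite hyperpolygon"
  assumes "\<And>i. fst x $ i $ 1 = fst y $ i $ 1" "\<And>i. fst x $ i $ 2 = fst y $ i $ 2"
    "\<And>i. snd x $ i $ 1 = snd y $ i $ 1" "\<And>i. snd x $ i $ 2 = snd y $ i $ 2"
  shows "x = y"
  using assms by (simp add: prod_eq_iff vec_eq_iff forall_2)

definition unit_phases :: "(complex^'n::finite) set" where
  "unit_phases = {e. \<forall>i. cmod (e $ i) = 1}"

lemma unit_phases_nz: "e \<in> unit_phases \<Longrightarrow> e $ i \<noteq> 0"
proof -
  assume "e \<in> unit_phases"
  then have "cmod (e $ i) = 1" by (simp add: unit_phases_def)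
  then show ?thesis by force
qed

lemma hyperpolygon_act_act:
  assumes "A \<in> SU2" "B \<in> SU2" "e \<in> unit_phases" "f \<in> unit_phases"
  shows "hyperpolygon_act (hyperpolygon_act x A e) B f = hyperpolygon_act x (A ** B) (\<chi> i. e $ i * f $ i)"
proof -
  have m: "(A ** B) $ a $ b = A $ a $ 1 * B $ 1 $ b + A $ a $ 2 * B $ 2 $ b" for a b
    by (simp add: matrix_matrix_mult_def sum_2)
  note AB = SU2_mult[OF assms(1,2)]
  show ?thesis
    by (rule hyperpolygon_eqI; unfold hyperpolygon_act_fst[OF assms(1)] hyperpolygon_act_fst[OF assms(2)]
        hyperpolygon_act_fst[OF AB] hyperpolygon_act_snd[OF assms(1)] hyperpolygon_act_snd[OF assms(2)]
        hyperpolygon_act_snd[OF AB] m; simp add: algebra_simps)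
qed

lemma mat_1_in_SU2: "mat 1 \<in> SU2"
  by (simp add: SU2_def adjoint_mat_def vec_eq_iff mat_def matrix_matrix_mult_def forall_2 sum_2 det_2)

lemma hyperpolygon_act_one: "hyperpolygon_act x (mat 1) (\<chi> i. 1) = x"
  by (rule hyperpolygon_eqI; unfold hyperpolygon_act_fst[OF mat_1_in_SU2]
      hyperpolygon_act_snd[OF mat_1_in_SU2]; simp add: mat_def)

lemma hyperpolygon_orbit_iff:
  "y \<in> hyperpolygon_orbit x \<longleftrightarrow> (\<exists>A\<in>SU2. \<exists>e\<in>unit_phases. y = hyperpolygon_act x A e)"
  unfolding hyperpolygon_orbit_def unit_phases_def by blast

lemma hyperpolygon_orbit_eq_iff:
  "hyperpolygon_orbit x = hyperpolygon_orbit y \<longleftrightarrow> y \<in> hyperpolygon_orbit x"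
proof -
  have tr: "z \<in> hyperpolygon_orbit x"
    if zy: "z \<in> hyperpolygon_orbit y" and yx: "y \<in> hyperpolygon_orbit x" for x y z :: "'a hyperpolygon"
  proof -
    obtain A e where A: "A \<in> SU2" "e \<in> unit_phases" "y = hyperpolygon_act x A e"
      using yx unfolding hyperpolygon_orbit_iff by blast
    obtain B f where B: "B \<in> SU2" "f \<in> unit_phases" "z = hyperpolygon_act y B f"
      using zy unfolding hyperpolygon_orbit_iff by blast
    have "z = hyperpolygon_act x (A ** B) (\<chi> i. e $ i * f $ i)"
      using A B by (simp add: hyperpolygon_act_act)
    moreover have "(\<chi> i. e $ i * f $ i) \<in> unit_phases"
      using A(2) B(2) by (simp add: unit_phases_def norm_mult)
    ultimately show ?thesis unfolding hyperpolygon_orbit_iff using SU2_mult[OF A(1) B(1)] by blast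
  qed
  have re: "x \<in> hyperpolygon_orbit x" for x :: "'a hyperpolygon"
    unfolding hyperpolygon_orbit_iff using hyperpolygon_act_one[of x] mat_1_in_SU2
    by (intro bexI[of _ "mat 1"] bexI[of _ "\<chi> i. 1"]) (simp_all add: unit_phases_def)
  have sy: "x \<in> hyperpolygon_orbit y" if yx: "y \<in> hyperpolygon_orbit x" for x y :: "'a hyperpolygon"
  proof -
    obtain A e where A: "A \<in> SU2" "e \<in> unit_phases" "y = hyperpolygon_act x A e"
      using yx unfolding hyperpolygon_orbit_iff by blast
    let ?f = "\<chi> i. inverse (e $ i)"
    have f: "?f \<in> unit_phases" using A(2) by (simp add: unit_phases_def norm_inverse)
    have "(\<chi> i. e $ i * ?f $ i) = (\<chi> i. 1)" using A(2) by (simp add: vec_eq_iff unit_phases_nz)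
    then have "hyperpolygon_act y (adjoint_mat A) ?f = x"
      using A f by (simp add: hyperpolygon_act_act SU2_adjoint_in SU2_adjoint(1) hyperpolygon_act_one)
    then show ?thesis unfolding hyperpolygon_orbit_iff using SU2_adjoint_in[OF A(1)] f by blast
  qed
  show ?thesis using tr re sy by blast
qed

lemma self_in_hyperpolygon_orbit: "x \<in> hyperpolygon_orbit x"
  using hyperpolygon_orbit_eq_iff by blast

lemma norm2_vec2: "(norm (v :: complex^2))\<^sup>2 = (cmod (v $ 1))\<^sup>2 + (cmod (v $ 2))\<^sup>2"
  by (simp add: norm_vec_def L2_set_def sum_2)

text \<open>Since \<open>p\<^sub>i q\<^sub>i = 0\<close> and \<open>|p\<^sub>i| = |q\<^sub>i|\<close>, all matrices in the moment map equations are traceless already.\<close>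

lemma null_hyperpolygon_level_iff:
  "x \<in> null_hyperpolygon_level \<longleftrightarrow>
     (\<forall>i. fst x $ i $ 1 * snd x $ i $ 1 + fst x $ i $ 2 * snd x $ i $ 2 = 0) \<and>
     (\<forall>i. (cmod (snd x $ i $ 1))\<^sup>2 + (cmod (snd x $ i $ 2))\<^sup>2 = (cmod (fst x $ i $ 1))\<^sup>2 + (cmod (fst x $ i $ 2))\<^sup>2) \<and>
     (\<forall>i. snd x $ i \<noteq> 0) \<and>
     (\<forall>a b. (\<Sum>i\<in>UNIV. snd x $ i $ a * fst x $ i $ b) = 0) \<and>
     (\<forall>a b. (\<Sum>i\<in>UNIV. snd x $ i $ a * cnj (snd x $ i $ b) - cnj (fst x $ i $ a) * fst x $ i $ b) = 0)"
proof -
  obtain p q where x: "x = (p, q)" by (cases x)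
  have n: "norm (q $ i) = norm (p $ i) \<longleftrightarrow>
      (cmod (q $ i $ 1))\<^sup>2 + (cmod (q $ i $ 2))\<^sup>2 = (cmod (p $ i $ 1))\<^sup>2 + (cmod (p $ i $ 2))\<^sup>2" for i
    unfolding norm2_vec2[symmetric] by simp
  have z: "(norm (p $ i))\<^sup>2 + (norm (q $ i))\<^sup>2 \<noteq> 0 \<longleftrightarrow> q $ i \<noteq> 0" if "norm (q $ i) = norm (p $ i)" for i
    using that by (auto simp: sum_power2_eq_zero_iff)
  have m1: "traceless (\<chi> a b. q $ i $ a * p $ i $ b) = (\<chi> a b. q $ i $ a * p $ i $ b)"
    if "p $ i $ 1 * q $ i $ 1 + p $ i $ 2 * q $ i $ 2 = 0" for i
  proof -
    have "trace (\<chi> a b. q $ i $ a * p $ i $ b) = 0"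
      using that by (simp add: trace_def sum_2 mult.commute)
    then show ?thesis by (simp add: traceless_def mat_def vec_eq_iff)
  qed
  have m2: "traceless ((\<chi> a b. q $ i $ a * cnj (q $ i $ b)) - (\<chi> a b. cnj (p $ i $ a) * p $ i $ b))
      = (\<chi> a b. q $ i $ a * cnj (q $ i $ b) - cnj (p $ i $ a) * p $ i $ b)"
    if "(cmod (q $ i $ 1))\<^sup>2 + (cmod (q $ i $ 2))\<^sup>2 = (cmod (p $ i $ 1))\<^sup>2 + (cmod (p $ i $ 2))\<^sup>2" for i
  proof -
    have "complex_of_real ((cmod (q $ i $ 1))\<^sup>2 + (cmod (q $ i $ 2))\<^sup>2)
        = of_real ((cmod (p $ i $ 1))\<^sup>2 + (cmod (p $ i $ 2))\<^sup>2)" by (simp only: that)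
    then have "trace ((\<chi> a b. q $ i $ a * cnj (q $ i $ b)) - (\<chi> a b. cnj (p $ i $ a) * p $ i $ b)) = 0"
      unfolding of_real_add complex_norm_square by (simp add: trace_def sum_2 algebra_simps)
    then show ?thesis by (simp add: traceless_def mat_def vec_eq_iff)
  qed
  have s: "(\<Sum>i\<in>UNIV. (\<chi> a b. f i a b) :: complex^2^2) = 0 \<longleftrightarrow> (\<forall>a b. (\<Sum>i\<in>UNIV. f i a b) = 0)"
    for f :: "'a \<Rightarrow> 2 \<Rightarrow> 2 \<Rightarrow> complex"
    by (simp add: vec_eq_iff)
  show ?thesis
  proof (cases "(\<forall>i. p $ i $ 1 * q $ i $ 1 + p $ i $ 2 * q $ i $ 2 = 0) \<and> (\<forall>i. norm (q $ i) = norm (p $ i))")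
    case True
    then have "p $ i = 0 \<longleftrightarrow> q $ i = 0" for i by (metis norm_eq_zero)
    with True show ?thesis
      unfolding null_hyperpolygon_level_def x
      by (simp add: sum_2 m1 m2[OF n[THEN iffD1]] s z n[symmetric])
  next
    case False
    then show ?thesis
      unfolding null_hyperpolygon_level_def x by (auto simp: sum_2 n)
  qed
qed

text \<open>The moment maps are equivariant: \<open>q\<^sub>i p\<^sub>i\<close> and \<open>q\<^sub>i q\<^sub>i\<^sup>* - p\<^sub>i\<^sup>* p\<^sub>i\<close> are conjugated by \<open>A\<close>, whatever the phases are.\<close>

lemma hyperpolygon_act_level:
  assumes x: "x \<in> null_hyperpolygon_level" and A: "A \<in> SU2" and e: "e \<in> unit_phases"
  shows "hyperpolygon_act x A e \<in> null_hyperpolygon_level"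
proof -
  let ?y = "hyperpolygon_act x A e"
  note L = x[unfolded null_hyperpolygon_level_iff]
  note u = SU2_rows[OF A]
  have ee: "inverse (e $ i) * e $ i = 1" "e $ i * cnj (e $ i) = 1" "inverse (e $ i) = cnj (e $ i)" for i
  proof -
    show 1: "inverse (e $ i) * e $ i = 1" using unit_phases_nz[OF e] by simp
    show 2: "e $ i * cnj (e $ i) = 1"
      using complex_norm_square[of "e $ i"] e by (simp add: unit_phases_def)
    show "inverse (e $ i) = cnj (e $ i)" using 2 by (rule inverse_unique)
  qed
  have qp: "snd ?y $ i $ a * fst ?y $ i $ b = 
       cnj (A $ 1 $ a) * A $ 1 $ b * (snd x $ i $ 1 * fst x $ i $ 1)
     + cnj (A $ 1 $ a) * A $ 2 $ b * (snd x $ i $ 1 * fst x $ i $ 2)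
     + cnj (A $ 2 $ a) * A $ 1 $ b * (snd x $ i $ 2 * fst x $ i $ 1)
     + cnj (A $ 2 $ a) * A $ 2 $ b * (snd x $ i $ 2 * fst x $ i $ 2)" for i a b
  proof -
    have "snd ?y $ i $ a * fst ?y $ i $ b = (inverse (e $ i) * e $ i) *
        ((cnj (A $ 1 $ a) * snd x $ i $ 1 + cnj (A $ 2 $ a) * snd x $ i $ 2) *
         (fst x $ i $ 1 * A $ 1 $ b + fst x $ i $ 2 * A $ 2 $ b))"
      unfolding hyperpolygon_act_fst[OF A] hyperpolygon_act_snd[OF A] by (simp only: mult_ac)
    then show ?thesis unfolding ee(1) by (simp add: algebra_simps)
  qed
  have H: "snd ?y $ i $ a * cnj (snd ?y $ i $ b) - cnj (fst ?y $ i $ a) * fst ?y $ i $ b =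
       cnj (A $ 1 $ a) * A $ 1 $ b * (snd x $ i $ 1 * cnj (snd x $ i $ 1) - cnj (fst x $ i $ 1) * fst x $ i $ 1)
     + cnj (A $ 1 $ a) * A $ 2 $ b * (snd x $ i $ 1 * cnj (snd x $ i $ 2) - cnj (fst x $ i $ 1) * fst x $ i $ 2)
     + cnj (A $ 2 $ a) * A $ 1 $ b * (snd x $ i $ 2 * cnj (snd x $ i $ 1) - cnj (fst x $ i $ 2) * fst x $ i $ 1)
     + cnj (A $ 2 $ a) * A $ 2 $ b * (snd x $ i $ 2 * cnj (snd x $ i $ 2) - cnj (fst x $ i $ 2) * fst x $ i $ 2)"
    for i a b
  proof -
    have "snd ?y $ i $ a * cnj (snd ?y $ i $ b) = (e $ i * cnj (e $ i)) *
        ((cnj (A $ 1 $ a) * snd x $ i $ 1 + cnj (A $ 2 $ a) * snd x $ i $ 2) *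
         (A $ 1 $ b * cnj (snd x $ i $ 1) + A $ 2 $ b * cnj (snd x $ i $ 2)))"
      unfolding hyperpolygon_act_snd[OF A] by (simp add: mult_ac)
    moreover have "cnj (fst ?y $ i $ a) * fst ?y $ i $ b = (e $ i * cnj (e $ i)) *
        ((cnj (fst x $ i $ 1) * cnj (A $ 1 $ a) + cnj (fst x $ i $ 2) * cnj (A $ 2 $ a)) *
         (fst x $ i $ 1 * A $ 1 $ b + fst x $ i $ 2 * A $ 2 $ b))"
      unfolding hyperpolygon_act_fst[OF A] ee(3) by (simp add: mult_ac)
    ultimately show ?thesis unfolding ee(2) by (simp add: algebra_simps)
  qed
  \<comment> \<open>the trace of \<open>q p\<close> and of \<open>q q\<^sup>* - p\<^sup>* p\<close> are conjugation invariant\<close>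
  have t1: "fst ?y $ i $ 1 * snd ?y $ i $ 1 + fst ?y $ i $ 2 * snd ?y $ i $ 2 = 0" for i
  proof -
    have "fst ?y $ i $ 1 * snd ?y $ i $ 1 + fst ?y $ i $ 2 * snd ?y $ i $ 2
       = (A $ 1 $ 1 * cnj (A $ 1 $ 1) + A $ 1 $ 2 * cnj (A $ 1 $ 2)) * (snd x $ i $ 1 * fst x $ i $ 1)
       + (A $ 2 $ 1 * cnj (A $ 1 $ 1) + A $ 2 $ 2 * cnj (A $ 1 $ 2)) * (snd x $ i $ 1 * fst x $ i $ 2)
       + (A $ 1 $ 1 * cnj (A $ 2 $ 1) + A $ 1 $ 2 * cnj (A $ 2 $ 2)) * (snd x $ i $ 2 * fst x $ i $ 1)
       + (A $ 2 $ 1 * cnj (A $ 2 $ 1) + A $ 2 $ 2 * cnj (A $ 2 $ 2)) * (snd x $ i $ 2 * fst x $ i $ 2)"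
      unfolding mult.commute[of "fst ?y $ i $ _"] qp by (simp add: algebra_simps)
    also have "\<dots> = fst x $ i $ 1 * snd x $ i $ 1 + fst x $ i $ 2 * snd x $ i $ 2"
      unfolding u by (simp add: mult.commute)
    also have "\<dots> = 0" using L by blast
    finally show ?thesis .
  qed
  have t2: "(cmod (snd ?y $ i $ 1))\<^sup>2 + (cmod (snd ?y $ i $ 2))\<^sup>2
      = (cmod (fst ?y $ i $ 1))\<^sup>2 + (cmod (fst ?y $ i $ 2))\<^sup>2" for i
  proof -
    have nn: "complex_of_real ((cmod (snd z $ i $ 1))\<^sup>2 + (cmod (snd z $ i $ 2))\<^sup>2
        - ((cmod (fst z $ i $ 1))\<^sup>2 + (cmod (fst z $ i $ 2))\<^sup>2))
       = (snd z $ i $ 1 * cnj (snd z $ i $ 1) - cnj (fst z $ i $ 1) * fst z $ i $ 1)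
       + (snd z $ i $ 2 * cnj (snd z $ i $ 2) - cnj (fst z $ i $ 2) * fst z $ i $ 2)"
      for z :: "'a hyperpolygon"
      unfolding of_real_add of_real_diff complex_norm_square by (simp add: algebra_simps)
    let ?h = "\<lambda>a b. snd x $ i $ a * cnj (snd x $ i $ b) - cnj (fst x $ i $ a) * fst x $ i $ b"
    have "complex_of_real ((cmod (snd ?y $ i $ 1))\<^sup>2 + (cmod (snd ?y $ i $ 2))\<^sup>2
        - ((cmod (fst ?y $ i $ 1))\<^sup>2 + (cmod (fst ?y $ i $ 2))\<^sup>2))
       = (A $ 1 $ 1 * cnj (A $ 1 $ 1) + A $ 1 $ 2 * cnj (A $ 1 $ 2)) * ?h 1 1
       + (A $ 2 $ 1 * cnj (A $ 1 $ 1) + A $ 2 $ 2 * cnj (A $ 1 $ 2)) * ?h 1 2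
       + (A $ 1 $ 1 * cnj (A $ 2 $ 1) + A $ 1 $ 2 * cnj (A $ 2 $ 2)) * ?h 2 1
       + (A $ 2 $ 1 * cnj (A $ 2 $ 1) + A $ 2 $ 2 * cnj (A $ 2 $ 2)) * ?h 2 2"
      unfolding nn H by (simp add: algebra_simps)
    also have "\<dots> = complex_of_real ((cmod (snd x $ i $ 1))\<^sup>2 + (cmod (snd x $ i $ 2))\<^sup>2
        - ((cmod (fst x $ i $ 1))\<^sup>2 + (cmod (fst x $ i $ 2))\<^sup>2))"
      unfolding nn u by simp
    also have "\<dots> = 0" using L by simp
    finally show ?thesis by (simp only: of_real_eq_0_iff right_minus_eq)
  qed
  have t3: "snd ?y $ i \<noteq> 0" for i
  proof
    assume z: "snd ?y $ i = 0"
    have "adjoint_mat A *v snd x $ i = 0"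
    proof -
      have "snd ?y $ i = e $ i *s (adjoint_mat A *v snd x $ i)"
        by (cases x) (simp add: hyperpolygon_act_def SU2_adjoint(3)[OF A])
      then show ?thesis using z unit_phases_nz[OF e, of i] by (simp add: vec_eq_iff)
    qed
    then have "(A ** adjoint_mat A) *v snd x $ i = 0" by (simp add: matrix_vector_mul_assoc[symmetric])
    then show False using L SU2_adjoint(1)[OF A] by simp
  qed
  have t4: "(\<Sum>i\<in>UNIV. snd ?y $ i $ a * fst ?y $ i $ b) = 0" for a b
    unfolding qp sum.distrib sum_distrib_left[symmetric] using L by simp
  have t5: "(\<Sum>i\<in>UNIV. snd ?y $ i $ a * cnj (snd ?y $ i $ b) - cnj (fst ?y $ i $ a) * fst ?y $ i $ b) = 0" for a b
    unfolding H sum.distrib sum_distrib_left[symmetric] using L by simp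
  show ?thesis unfolding null_hyperpolygon_level_iff using t1 t2 t3 t4 t5 by blast
qed

subsection \<open>Traces and straightness\<close>

definition hyperpolygon_trace :: "'n::finite hyperpolygon \<Rightarrow> 'n \<Rightarrow> 'n \<Rightarrow> complex" where
  "hyperpolygon_trace x = pair_trace (\<lambda>i. \<chi> a b. snd x $ i $ a * fst x $ i $ b)"

text \<open>It vanishes iff \<open>q\<^sub>i\<close> and \<open>q\<^sub>k\<close> are proportional.\<close>

definition minor :: "'n::finite hyperpolygon \<Rightarrow> 'n \<Rightarrow> 'n \<Rightarrow> complex" where
  "minor x i k = snd x $ i $ 1 * snd x $ k $ 2 - snd x $ k $ 1 * snd x $ i $ 2"

lemma hyperpolygon_trace_expand:
  "hyperpolygon_trace x i k = (fst x $ i $ 1 * snd x $ k $ 1 + fst x $ i $ 2 * snd x $ k $ 2)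
     * (fst x $ k $ 1 * snd x $ i $ 1 + fst x $ k $ 2 * snd x $ i $ 2)"
  by (simp add: hyperpolygon_trace_def pair_trace_expand algebra_simps)

lemma hyperpolygon_trace_act:
  assumes A: "A \<in> SU2" and e: "e \<in> unit_phases"
  shows "hyperpolygon_trace (hyperpolygon_act x A e) i k = hyperpolygon_trace x i k"
proof -
  note u = SU2_rows[OF A]
  let ?y = "hyperpolygon_act x A e"
  have p: "fst ?y $ i $ 1 * snd ?y $ k $ 1 + fst ?y $ i $ 2 * snd ?y $ k $ 2
     = inverse (e $ i) * e $ k * (fst x $ i $ 1 * snd x $ k $ 1 + fst x $ i $ 2 * snd x $ k $ 2)" for i k
  proof -
    have "fst ?y $ i $ 1 * snd ?y $ k $ 1 + fst ?y $ i $ 2 * snd ?y $ k $ 2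
      = inverse (e $ i) * e $ k * (
         (A $ 1 $ 1 * cnj (A $ 1 $ 1) + A $ 1 $ 2 * cnj (A $ 1 $ 2)) * (fst x $ i $ 1 * snd x $ k $ 1)
       + (A $ 2 $ 1 * cnj (A $ 1 $ 1) + A $ 2 $ 2 * cnj (A $ 1 $ 2)) * (fst x $ i $ 2 * snd x $ k $ 1)
       + (A $ 1 $ 1 * cnj (A $ 2 $ 1) + A $ 1 $ 2 * cnj (A $ 2 $ 2)) * (fst x $ i $ 1 * snd x $ k $ 2)
       + (A $ 2 $ 1 * cnj (A $ 2 $ 1) + A $ 2 $ 2 * cnj (A $ 2 $ 2)) * (fst x $ i $ 2 * snd x $ k $ 2))"
      unfolding hyperpolygon_act_fst[OF A] hyperpolygon_act_snd[OF A] by (simp add: algebra_simps)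
    then show ?thesis unfolding u by simp
  qed
  show ?thesis
    unfolding hyperpolygon_trace_expand p using unit_phases_nz[OF e] by (simp add: field_simps)
qed

lemma hyperpolygon_trace_orbit:
  "hyperpolygon_orbit x = hyperpolygon_orbit y \<Longrightarrow> hyperpolygon_trace x = hyperpolygon_trace y"
  unfolding hyperpolygon_orbit_eq_iff hyperpolygon_orbit_iff
  by (auto simp: fun_eq_iff hyperpolygon_trace_act)

text \<open>Since \<open>p\<^sub>i\<close> annihilates \<open>q\<^sub>i\<close>, the trace is a nonzero multiple of the square of the minor.\<close>

lemma hyperpolygon_trace_eq_0_iff:
  assumes x: "x \<in> null_hyperpolygon_level"
  shows "hyperpolygon_trace x i k = 0 \<longleftrightarrow> minor x i k = 0"
proof -
  note L = x[unfolded null_hyperpolygon_level_iff]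
  \<comment> \<open>\<open>p\<^sub>i\<close> is a multiple of the covector \<open>(- q\<^sub>2, q\<^sub>1)\<close> that annihilates \<open>q\<^sub>i\<close>\<close>
  have ex: "\<exists>f. f \<noteq> 0 \<and> fst x $ i $ 1 = - f * snd x $ i $ 2 \<and> fst x $ i $ 2 = f * snd x $ i $ 1" for i
  proof -
    let ?p = "fst x $ i" and ?q = "snd x $ i"
    have o: "?p $ 1 * ?q $ 1 + ?p $ 2 * ?q $ 2 = 0"
      and n: "(cmod (?q $ 1))\<^sup>2 + (cmod (?q $ 2))\<^sup>2 = (cmod (?p $ 1))\<^sup>2 + (cmod (?p $ 2))\<^sup>2"
      using L by blast+
    have "?q \<noteq> 0" using L by blast
    then have q: "?q $ 1 \<noteq> 0 \<or> ?q $ 2 \<noteq> 0" by (simp add: vec_eq_iff forall_2)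
    have pnz: "\<not> (?p $ 1 = 0 \<and> ?p $ 2 = 0)"
      using n q by (auto simp: sum_power2_eq_zero_iff)
    define f where "f = (if ?q $ 1 \<noteq> 0 then ?p $ 2 / ?q $ 1 else - ?p $ 1 / ?q $ 2)"
    have "?p $ 1 = - f * ?q $ 2 \<and> ?p $ 2 = f * ?q $ 1"
    proof (cases "?q $ 1 = 0")
      case True
      with o q show ?thesis by (simp add: f_def)
    next
      case False
      have "?p $ 1 * ?q $ 1 = - ?p $ 2 * ?q $ 2" using o by (simp add: eq_neg_iff_add_eq_0)
      then have "?p $ 1 = - ?p $ 2 * ?q $ 2 / ?q $ 1" by (rule nonzero_eq_divide_eq[OF False, THEN iffD2])
      with False show ?thesis by (simp add: f_def)
    qed
    moreover from this pnz have "f \<noteq> 0" by auto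
    ultimately show ?thesis by blast
  qed
  obtain f where f: "f \<noteq> 0" "fst x $ i $ 1 = - f * snd x $ i $ 2" "fst x $ i $ 2 = f * snd x $ i $ 1"
    using ex by blast
  obtain g where g: "g \<noteq> 0" "fst x $ k $ 1 = - g * snd x $ k $ 2" "fst x $ k $ 2 = g * snd x $ k $ 1"
    using ex by blast
  have "hyperpolygon_trace x i k = - (f * g) * (minor x i k)\<^sup>2"
    unfolding hyperpolygon_trace_expand f(2,3) g(2,3) minor_def by (simp add: power2_eq_square algebra_simps)
  then show ?thesis using f g by simp
qed

lemma straight_iff:
  assumes x: "x \<in> null_hyperpolygon_level"
  shows "straight A x \<longleftrightarrow> (\<forall>i\<in>A. \<forall>k\<in>A. hyperpolygon_trace x i k = 0)"
proof -
  note L = x[unfolded null_hyperpolygon_level_iff]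
  have "(\<exists>c. snd x $ i = c *s snd x $ k) \<longleftrightarrow> minor x i k = 0" for i k
  proof
    assume "\<exists>c. snd x $ i = c *s snd x $ k"
    then show "minor x i k = 0" by (auto simp: minor_def)
  next
    let ?q = "snd x $ i" and ?r = "snd x $ k"
    assume "minor x i k = 0"
    then have m: "?q $ 1 * ?r $ 2 = ?r $ 1 * ?q $ 2" by (simp add: minor_def)
    have "?r \<noteq> 0" using L by blast
    then have "?r $ 1 \<noteq> 0 \<or> ?r $ 2 \<noteq> 0" by (simp add: vec_eq_iff forall_2)
    then show "\<exists>c. ?q = c *s ?r"
    proof
      assume "?r $ 1 \<noteq> 0"
      then show ?thesis using m
        by (intro exI[of _ "?q $ 1 / ?r $ 1"]) (simp add: vec_eq_iff forall_2 field_simps)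
    next
      assume "?r $ 2 \<noteq> 0"
      then show ?thesis using m
        by (intro exI[of _ "?q $ 2 / ?r $ 2"]) (simp add: vec_eq_iff forall_2 field_simps)
    qed
  qed
  then show ?thesis unfolding straight_def using hyperpolygon_trace_eq_0_iff[OF x] by blast
qed

subsection \<open>Standard form of a hyperpolygon with two straight parts\<close>

text \<open>All \<open>q\<^sub>i\<close> lie on the first axis for \<open>i \<in> S\<close> and on the second one otherwise, and are positive; \<open>z\<^sub>i\<close> is the nonzero entry of \<open>q\<^sub>i p\<^sub>i\<close>.\<close>

definition standard_hyperpolygon :: "'n::finite set \<Rightarrow> complex^'n \<Rightarrow> 'n hyperpolygon" where
  "standard_hyperpolygon S z =
     (\<chi> i b. if (b = 1) = (i \<in> S) then 0 else z $ i / of_real (sqrt (cmod (z $ i))),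
      \<chi> i a. if (a = 1) = (i \<in> S) then of_real (sqrt (cmod (z $ i))) else 0)"

definition hyperpolygon_of :: "'n::finite set \<Rightarrow> complex^'n \<Rightarrow> 'n hyperpolygon" where
  "hyperpolygon_of S l = standard_hyperpolygon S (balance S l)"

lemma sum_UNIV_if: "(\<Sum>i\<in>UNIV. if i \<in> S then f i else g i) = sum f S + sum g (- S)"
  for S :: "'n::finite set"
  using sum.If_cases[of UNIV "\<lambda>i. i \<in> S" f g] by simp

lemma standard_hyperpolygon_trace:
  assumes "z $ i \<noteq> 0" "z $ k \<noteq> 0"
  shows "hyperpolygon_trace (standard_hyperpolygon S z) i k = (if (i \<in> S) = (k \<in> S) then 0 else z $ i * z $ k)"
  using assms by (auto simp: hyperpolygon_trace_expand standard_hyperpolygon_def)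

lemma standard_hyperpolygon_level:
  fixes S :: "'n::finite set"
  assumes z: "z \<in> config S" and b: "half_length S z = half_length (- S) z"
  shows "standard_hyperpolygon S z \<in> null_hyperpolygon_level"
proof -
  let ?x = "standard_hyperpolygon S z"
  let ?r = "\<lambda>i. complex_of_real (sqrt (cmod (z $ i)))"
  have z0: "z $ i \<noteq> 0" for i using z by (simp add: config_def)
  have r0: "?r i \<noteq> 0" for i using z0 by simp
  have nr: "(cmod (?r i))\<^sup>2 = cmod (z $ i)" "(cmod (z $ i / ?r i))\<^sup>2 = cmod (z $ i)" for i
    using z0[of i] by (simp_all add: norm_divide power_divide power2_eq_square)
  have cr: "?r i * cnj (?r i) = of_real (cmod (z $ i))"
      "cnj (z $ i / ?r i) * (z $ i / ?r i) = of_real (cmod (z $ i))" for i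
    using complex_norm_square[of "?r i"] complex_norm_square[of "z $ i / ?r i"] nr[of i]
    by (simp_all only: mult.commute)
  have qp: "snd ?x $ i $ a * fst ?x $ i $ b
      = (if i \<in> S then (if a = 1 \<and> b \<noteq> 1 then z $ i else 0) else (if a \<noteq> 1 \<and> b = 1 then z $ i else 0))" for i a b
    using r0[of i] by (simp add: standard_hyperpolygon_def)
  have H: "snd ?x $ i $ a * cnj (snd ?x $ i $ b) - cnj (fst ?x $ i $ a) * fst ?x $ i $ b
      = (if i \<in> S then (if a = 1 \<and> b = 1 then of_real (cmod (z $ i)) else if a \<noteq> 1 \<and> b \<noteq> 1 then - of_real (cmod (z $ i)) else 0)
        else (if a = 1 \<and> b = 1 then - of_real (cmod (z $ i)) else if a \<noteq> 1 \<and> b \<noteq> 1 then of_real (cmod (z $ i)) else 0))" for i a b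
    using cr[of i] by (simp add: standard_hyperpolygon_def)
  have hl: "(\<Sum>i\<in>S. complex_of_real (cmod (z $ i))) = (\<Sum>i\<in>-S. complex_of_real (cmod (z $ i)))"
    using b unfolding half_length_def by (simp flip: of_real_sum)
  have "fst ?x $ i $ 1 * snd ?x $ i $ 1 + fst ?x $ i $ 2 * snd ?x $ i $ 2 = 0" for i
    by (simp add: standard_hyperpolygon_def)
  moreover have "(cmod (snd ?x $ i $ 1))\<^sup>2 + (cmod (snd ?x $ i $ 2))\<^sup>2
      = (cmod (fst ?x $ i $ 1))\<^sup>2 + (cmod (fst ?x $ i $ 2))\<^sup>2" for i
    using nr[of i] by (simp add: standard_hyperpolygon_def)
  moreover have "snd ?x $ i \<noteq> 0" for i
    using r0[of i] by (auto simp: standard_hyperpolygon_def vec_eq_iff forall_2)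
  moreover have "(\<Sum>i\<in>UNIV. snd ?x $ i $ a * fst ?x $ i $ b) = 0" for a b
    unfolding qp sum_UNIV_if using z by (cases "a = 1"; cases "b = 1"; simp add: config_def)
  moreover have "(\<Sum>i\<in>UNIV. snd ?x $ i $ a * cnj (snd ?x $ i $ b) - cnj (fst ?x $ i $ a) * fst ?x $ i $ b) = 0" for a b
    unfolding H sum_UNIV_if using hl by (cases "a = 1"; cases "b = 1"; simp add: sum_negf)
  ultimately show ?thesis unfolding null_hyperpolygon_level_iff by blast
qed

text \<open>The unitary frame adapted to the first line turns the second line into the orthogonal one
  by the real moment map equation; the phases then normalise \<open>q\<close>.\<close>

lemma hyperpolygon_standard_form:
  fixes S :: "'n::finite set"
  assumes x: "x \<in> null_hyperpolygon_level" and S: "S \<noteq> {}" "- S \<noteq> {}"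
    and tr: "\<And>i k. (i \<in> S) = (k \<in> S) \<Longrightarrow> hyperpolygon_trace x i k = 0"
  shows "\<exists>z\<in>config S. half_length S z = half_length (- S) z \<and>
    hyperpolygon_orbit x = hyperpolygon_orbit (standard_hyperpolygon S z)"
proof -
  note Lx = x[unfolded null_hyperpolygon_level_iff]
  obtain j where j: "j \<in> S" using S by blast
  let ?v = "snd x $ j"
  have "?v \<noteq> 0" using Lx by blast
  then have n: "norm ?v > 0" "complex_of_real (norm ?v) \<noteq> 0" by simp_all
  \<comment> \<open>the frame whose first vector is the direction of \<open>q\<^sub>j\<close>\<close>
  define A :: "complex^2^2" where
    "A = vector [vector [?v $ 1 / norm ?v, - cnj (?v $ 2) / norm ?v], vector [?v $ 2 / norm ?v, cnj (?v $ 1) / norm ?v]]"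
  have nn: "?v $ 1 * cnj (?v $ 1) + ?v $ 2 * cnj (?v $ 2) = of_real (norm ?v) * of_real (norm ?v)"
  proof -
    have "complex_of_real ((norm ?v)\<^sup>2) = of_real ((cmod (?v $ 1))\<^sup>2 + (cmod (?v $ 2))\<^sup>2)"
      by (simp only: norm2_vec2)
    then show ?thesis unfolding of_real_add complex_norm_square by (simp add: power2_eq_square)
  qed
  have A: "A \<in> SU2"
    unfolding SU2_def mem_Collect_eq
  proof
    show "A ** adjoint_mat A = mat 1"
      using n nn by (simp add: A_def vec_eq_iff forall_2 matrix_matrix_mult_def sum_2 adjoint_mat_def mat_def
          add_divide_distrib[symmetric] mult.commute add.commute)
    show "det A = 1"
      using n nn by (simp add: A_def det_2 add_divide_distrib[symmetric] mult.commute)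
  qed
  have one: "(\<chi> i. 1) \<in> (unit_phases :: (complex^'n) set)" by (simp add: unit_phases_def)
  define y where "y = hyperpolygon_act x A (\<chi> i. 1)"
  have y: "y \<in> null_hyperpolygon_level" unfolding y_def by (rule hyperpolygon_act_level[OF x A one])
  note L = y[unfolded null_hyperpolygon_level_iff]
  have ytr: "minor y i k = 0" if "(i \<in> S) = (k \<in> S)" for i k
    using tr[OF that] hyperpolygon_trace_eq_0_iff[OF y]
    unfolding y_def hyperpolygon_trace_act[OF A one] by blast
  have ort: "fst y $ i $ 1 * snd y $ i $ 1 + fst y $ i $ 2 * snd y $ i $ 2 = 0"
    and nrm: "(cmod (snd y $ i $ 1))\<^sup>2 + (cmod (snd y $ i $ 2))\<^sup>2 = (cmod (fst y $ i $ 1))\<^sup>2 + (cmod (fst y $ i $ 2))\<^sup>2"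
    and qnz: "snd y $ i \<noteq> 0" for i
    using L by blast+
  have mom: "(\<Sum>i\<in>UNIV. snd y $ i $ a * fst y $ i $ b) = 0"
    and Mom: "(\<Sum>i\<in>UNIV. snd y $ i $ a * cnj (snd y $ i $ b) - cnj (fst y $ i $ a) * fst y $ i $ b) = 0" for a b
    using L by blast+
  have S2: "snd y $ i $ 2 = 0" if "i \<in> S" for i
  proof -
    have "minor x i j = 0" using tr[of i j] that j hyperpolygon_trace_eq_0_iff[OF x] by simp
    then have "snd x $ i $ 1 * ?v $ 2 = ?v $ 1 * snd x $ i $ 2" by (simp add: minor_def)
    then show ?thesis unfolding y_def hyperpolygon_act_snd[OF A]
      using n by (simp add: A_def field_simps)
  qed
  have S1: "snd y $ i $ 1 \<noteq> 0" "fst y $ i $ 1 = 0" "cmod (fst y $ i $ 2) = cmod (snd y $ i $ 1)" if "i \<in> S" for i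
  proof -
    show 1: "snd y $ i $ 1 \<noteq> 0" using qnz[of i] S2[OF that] by (simp add: vec_eq_iff forall_2)
    then show 2: "fst y $ i $ 1 = 0" using ort[of i] S2[OF that] by simp
    show "cmod (fst y $ i $ 2) = cmod (snd y $ i $ 1)" using nrm[of i] by (simp add: 2 S2[OF that])
  qed
  have C1: "snd y $ k $ 1 = 0" if "k \<notin> S" for k
  proof (rule ccontr)
    \<comment> \<open>If the second line is not the second axis, let \<open>m\<close> be its slope.  The off-diagonal entry of the real moment map is a positive multiple of \<open>cnj m\<close>, so \<open>m = 0\<close>; then both lines are the first axis, and the diagonal entry cannot vanish.\<close>
    assume k1: "snd y $ k $ 1 \<noteq> 0"
    define m where "m = snd y $ k $ 2 / snd y $ k $ 1"
    have q2: "snd y $ i $ 2 = snd y $ i $ 1 * m" if "i \<notin> S" for i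
      using ytr[of i k] that \<open>k \<notin> S\<close> k1 by (simp add: minor_def m_def field_simps)
    have q1: "snd y $ i $ 1 \<noteq> 0" if "i \<notin> S" for i
      using qnz[of i] q2[OF that] by (auto simp: vec_eq_iff forall_2)
    have p1: "fst y $ i $ 1 = - fst y $ i $ 2 * m" if "i \<notin> S" for i
    proof -
      have "snd y $ i $ 1 * (fst y $ i $ 1 + fst y $ i $ 2 * m) = 0"
        using ort[of i] by (simp add: q2[OF that] algebra_simps)
      then show ?thesis using q1[OF that] by (simp add: eq_neg_iff_add_eq_0)
    qed
    have pq: "(cmod (fst y $ i $ 2))\<^sup>2 = (cmod (snd y $ i $ 1))\<^sup>2" if "i \<notin> S" for i
    proof -
      have "(cmod (snd y $ i $ 1))\<^sup>2 * (1 + (cmod m)\<^sup>2) = (cmod (fst y $ i $ 2))\<^sup>2 * (1 + (cmod m)\<^sup>2)"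
        using nrm[of i] by (simp add: q2[OF that] p1[OF that] norm_mult power_mult_distrib algebra_simps)
      moreover have "1 + (cmod m)\<^sup>2 \<noteq> 0" using zero_le_power2[of "cmod m"] by linarith
      ultimately show ?thesis by simp
    qed
    have cq: "cnj (fst y $ i $ 2) * fst y $ i $ 2 = snd y $ i $ 1 * cnj (snd y $ i $ 1)" if "i \<notin> S" for i
      using complex_norm_square[of "fst y $ i $ 2"] complex_norm_square[of "snd y $ i $ 1"] pq[OF that]
      by (simp only: mult.commute[of "cnj _"])
    have "0 = (\<Sum>i\<in>UNIV. snd y $ i $ 1 * cnj (snd y $ i $ 2) - cnj (fst y $ i $ 1) * fst y $ i $ 2)"
      using Mom[of 1 2] by simp
    also have "\<dots> = (\<Sum>i\<in>UNIV. if i \<in> S then 0 else 2 * cnj m * (snd y $ i $ 1 * cnj (snd y $ i $ 1)))"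
    proof (rule sum.cong[OF refl])
      fix i
      show "snd y $ i $ 1 * cnj (snd y $ i $ 2) - cnj (fst y $ i $ 1) * fst y $ i $ 2
          = (if i \<in> S then 0 else 2 * cnj m * (snd y $ i $ 1 * cnj (snd y $ i $ 1)))"
      proof (cases "i \<in> S")
        case False
        have "snd y $ i $ 1 * cnj (snd y $ i $ 2) - cnj (fst y $ i $ 1) * fst y $ i $ 2
            = cnj m * (snd y $ i $ 1 * cnj (snd y $ i $ 1)) + cnj m * (cnj (fst y $ i $ 2) * fst y $ i $ 2)"
          by (simp add: q2[OF False] p1[OF False] algebra_simps)
        then show ?thesis unfolding cq[OF False] using False by simp
      qed (simp add: S2 S1)
    qed
    also have "\<dots> = 2 * cnj m * (\<Sum>i\<in>-S. snd y $ i $ 1 * cnj (snd y $ i $ 1))"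
      unfolding sum_UNIV_if by (simp add: sum_distrib_left)
    also have "(\<Sum>i\<in>-S. snd y $ i $ 1 * cnj (snd y $ i $ 1)) = of_real (\<Sum>i\<in>-S. (cmod (snd y $ i $ 1))\<^sup>2)"
      unfolding of_real_sum complex_norm_square ..
    finally have "2 * cnj m * complex_of_real (\<Sum>i\<in>-S. (cmod (snd y $ i $ 1))\<^sup>2) = 0" by (rule sym)
    then have "m = 0 \<or> (\<Sum>i\<in>-S. (cmod (snd y $ i $ 1))\<^sup>2) = 0"
      by (simp only: mult_eq_0_iff of_real_eq_0_iff complex_cnj_zero_iff zero_neq_numeral[symmetric] simp_thms)
    moreover have pos: "(\<Sum>i\<in>-S. (cmod (snd y $ i $ 1))\<^sup>2) > 0"
      by (rule sum_pos) (use S q1 in auto)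
    ultimately have m: "m = 0" by simp
    have "0 = (\<Sum>i\<in>UNIV. snd y $ i $ 1 * cnj (snd y $ i $ 1) - cnj (fst y $ i $ 1) * fst y $ i $ 1)"
      using Mom[of 1 1] by simp
    also have "\<dots> = (\<Sum>i\<in>UNIV. snd y $ i $ 1 * cnj (snd y $ i $ 1))"
    proof (rule sum.cong[OF refl])
      fix i
      have "fst y $ i $ 1 = 0" using S1(2)[of i] p1[of i] m by (cases "i \<in> S") auto
      then show "snd y $ i $ 1 * cnj (snd y $ i $ 1) - cnj (fst y $ i $ 1) * fst y $ i $ 1
          = snd y $ i $ 1 * cnj (snd y $ i $ 1)" by simp
    qed
    also have "\<dots> = of_real (\<Sum>i\<in>UNIV. (cmod (snd y $ i $ 1))\<^sup>2)"
      unfolding of_real_sum complex_norm_square ..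
    finally have "complex_of_real (\<Sum>i\<in>UNIV. (cmod (snd y $ i $ 1))\<^sup>2) = 0" by (rule sym)
    then have "(\<Sum>i\<in>UNIV. (cmod (snd y $ i $ 1))\<^sup>2) = 0" by (simp only: of_real_eq_0_iff)
    then have "cmod (snd y $ k $ 1) = 0" by (simp add: sum_nonneg_eq_0_iff)
    with k1 show False by simp
  qed
  have C2: "snd y $ k $ 2 \<noteq> 0" "fst y $ k $ 2 = 0" "cmod (fst y $ k $ 1) = cmod (snd y $ k $ 2)" if "k \<notin> S" for k
  proof -
    show 1: "snd y $ k $ 2 \<noteq> 0" using qnz[of k] C1[OF that] by (simp add: vec_eq_iff forall_2)
    then show 2: "fst y $ k $ 2 = 0" using ort[of k] C1[OF that] by simp
    show "cmod (fst y $ k $ 1) = cmod (snd y $ k $ 2)" using nrm[of k] by (simp add: 2 C1[OF that])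
  qed
  define z :: "complex^'n" where
    "z = (\<chi> i. if i \<in> S then snd y $ i $ 1 * fst y $ i $ 2 else snd y $ i $ 2 * fst y $ i $ 1)"
  define r where "r = (\<lambda>i. if i \<in> S then snd y $ i $ 1 else snd y $ i $ 2)"
  have r0: "r i \<noteq> 0" for i using S1(1) C2(1) by (simp add: r_def)
  have zr: "cmod (z $ i) = cmod (r i) * cmod (r i)" for i
    using S1(3)[of i] C2(3)[of i] by (simp add: z_def r_def norm_mult)
  have sz: "sqrt (cmod (z $ i)) = cmod (r i)" for i unfolding zr by simp
  have zS: "(\<Sum>i\<in>S. z $ i) = 0"
  proof -
    have "(\<Sum>i\<in>UNIV. snd y $ i $ 1 * fst y $ i $ 2) = (\<Sum>i\<in>UNIV. if i \<in> S then z $ i else 0)"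
      by (rule sum.cong) (auto simp: z_def C1)
    then show ?thesis unfolding mom sum_UNIV_if by simp
  qed
  have zC: "(\<Sum>i\<in>-S. z $ i) = 0"
  proof -
    have "(\<Sum>i\<in>UNIV. snd y $ i $ 2 * fst y $ i $ 1) = (\<Sum>i\<in>UNIV. if i \<in> S then 0 else z $ i)"
      by (rule sum.cong) (auto simp: z_def S2)
    then show ?thesis unfolding mom sum_UNIV_if by simp
  qed
  have z: "z \<in> config S"
  proof -
    have "z $ i \<noteq> 0" for i
    proof -
      have "cmod (z $ i) \<noteq> 0" unfolding zr using r0[of i] by simp
      then show ?thesis by (simp only: norm_eq_zero not_False_eq_True)
    qed
    then show ?thesis using zS zC by (simp add: config_def)
  qed
  have b: "half_length S z = half_length (- S) z"
  proof -
    have "0 = (\<Sum>i\<in>UNIV. snd y $ i $ 1 * cnj (snd y $ i $ 1) - cnj (fst y $ i $ 1) * fst y $ i $ 1)"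
      using Mom[of 1 1] by simp
    also have "\<dots> = (\<Sum>i\<in>UNIV. if i \<in> S then complex_of_real (cmod (z $ i)) else - complex_of_real (cmod (z $ i)))"
    proof (rule sum.cong[OF refl])
      fix i
      have "snd y $ i $ 1 * cnj (snd y $ i $ 1) - cnj (fst y $ i $ 1) * fst y $ i $ 1
          = of_real ((cmod (snd y $ i $ 1))\<^sup>2 - (cmod (fst y $ i $ 1))\<^sup>2)"
        unfolding of_real_diff complex_norm_square by (simp add: mult.commute)
      then show "snd y $ i $ 1 * cnj (snd y $ i $ 1) - cnj (fst y $ i $ 1) * fst y $ i $ 1
          = (if i \<in> S then complex_of_real (cmod (z $ i)) else - complex_of_real (cmod (z $ i)))"
        by (simp add: zr r_def S1 C1 C2 power2_eq_square)
    qed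
    also have "\<dots> = of_real (half_length S z - half_length (- S) z)"
      unfolding sum_UNIV_if by (simp add: half_length_def sum_negf)
    finally have "complex_of_real (half_length S z - half_length (- S) z) = 0" by (rule sym)
    then show ?thesis by (simp only: of_real_eq_0_iff right_minus_eq)
  qed
  define e :: "complex^'n" where "e = (\<chi> i. of_real (cmod (r i)) / r i)"
  have e: "e \<in> unit_phases" using r0 by (simp add: unit_phases_def e_def norm_divide)
  have "hyperpolygon_act y (mat 1) e = standard_hyperpolygon S z"
    by (rule hyperpolygon_eqI; unfold hyperpolygon_act_fst[OF mat_1_in_SU2] hyperpolygon_act_snd[OF mat_1_in_SU2];
        insert r0; simp add: mat_def standard_hyperpolygon_def sz e_def;
        auto simp: r_def z_def S1 S2 C1 C2)
  then have "standard_hyperpolygon S z \<in> hyperpolygon_orbit y"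
    unfolding hyperpolygon_orbit_iff using mat_1_in_SU2 e by (intro bexI[of _ "mat 1"] bexI[of _ e]) simp_all
  moreover have "y \<in> hyperpolygon_orbit x"
    unfolding hyperpolygon_orbit_iff y_def using A one by blast
  ultimately have "hyperpolygon_orbit x = hyperpolygon_orbit (standard_hyperpolygon S z)"
    using hyperpolygon_orbit_eq_iff[of x y] hyperpolygon_orbit_eq_iff[of y] by simp
  with z b show ?thesis by blast
qed

text \<open>A diagonal element of \<open>SU(2)\<close> multiplies the two off-diagonal entries of \<open>q\<^sub>i p\<^sub>i\<close> by inverse scalars; the phases make the \<open>q\<^sub>i\<close>
  positive again.\<close>

lemma hyperpolygon_of_rel:
  assumes "config_rel S l m"
  shows "hyperpolygon_orbit (hyperpolygon_of S l) = hyperpolygon_orbit (hyperpolygon_of S m)"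
proof -
  let ?z = "balance S l"
  obtain u where u: "cmod u = 1" "balance S m = config_scale S u ?z"
    using balance_unit_rel[OF assms] .
  \<comment> \<open>the entry of \<open>q\<^sub>i p\<^sub>i\<close> with \<open>i \<in> S\<close> is multiplied by the inverse square of \<open>a\<close>\<close>
  define a where "a = csqrt (inverse u)"
  have a2: "a\<^sup>2 = inverse u" by (simp add: a_def)
  have a1: "cmod a = 1" using u(1) by (simp add: a_def norm_inverse)
  have a0: "a \<noteq> 0" using a1 by force
  have u0: "u \<noteq> 0" using u(1) by force
  have ca: "a * cnj a = 1" using complex_norm_square[of a] a1 by simp
  have ci: "cnj a = inverse a" using ca by (simp add: inverse_unique)
  have uu: "u = inverse a * inverse a" using a2 by (simp add: power2_eq_square flip: inverse_mult_distrib)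
  define A :: "complex^2^2" where "A = vector [vector [a, 0], vector [0, cnj a]]"
  have A: "A \<in> SU2"
    using ca by (simp add: SU2_def A_def vec_eq_iff forall_2 matrix_matrix_mult_def sum_2 adjoint_mat_def
        mat_def det_2 mult.commute)
  define e :: "complex^'a" where "e = (\<chi> i. if i \<in> S then a else inverse a)"
  have e: "e \<in> unit_phases" using a1 by (simp add: unit_phases_def e_def norm_inverse)
  have nz: "cmod (config_scale S u ?z $ i) = cmod (?z $ i)" for i
    using u(1) by (simp add: config_scale_def norm_mult norm_divide)
  have "hyperpolygon_act (hyperpolygon_of S l) A e = hyperpolygon_of S m"
    unfolding hyperpolygon_of_def u(2)
    by (rule hyperpolygon_eqI; unfold hyperpolygon_act_fst[OF A] hyperpolygon_act_snd[OF A];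
        simp add: standard_hyperpolygon_def nz A_def e_def ci;
        auto simp: config_scale_def uu a0 field_simps)
  then show ?thesis
    unfolding hyperpolygon_orbit_eq_iff hyperpolygon_orbit_iff using A e
    by (intro bexI[of _ A] bexI[of _ e]) simp_all
qed

lemma smooth_on_hyperpolygon_of:
  fixes S :: "'n::finite set"
  assumes S: "S \<noteq> {}" "- S \<noteq> {}"
  shows "smooth_on nonzero_vecs (hyperpolygon_of S)"
proof -
  note op = open_nonzero_vecs
  have z: "smooth_on nonzero_vecs (\<lambda>l. balance S l $ i)" for i
    by (intro smooth_intros smooth_on_balance S)
  note nz = balance_nonzero[OF S]
  have r: "smooth_on nonzero_vecs (\<lambda>l. sqrt (cmod (balance S l $ i)))" for i
    by (intro smooth_on_sqrt smooth_on_cmod z) (use nz in auto)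
  have r0: "complex_of_real (sqrt (cmod (balance S l $ i))) \<noteq> 0" if "l \<in> nonzero_vecs" for l i
    using nz[OF that] by simp
  show ?thesis
    unfolding hyperpolygon_of_def standard_hyperpolygon_def
    by (intro smooth_on_Pair smooth_on_vec_lambda smooth_on_if smooth_on_const smooth_on_divide
        smooth_on_complex_parts(4) z r r0 op)
qed

subsection \<open>The involution and its fixed points\<close>

text \<open>An element of \<open>SU(2)\<close> exchanges the two axes up to phases, and further phases restore the normalisation.\<close>

lemma standard_hyperpolygon_swap:
  assumes z0: "\<And>i. z $ i \<noteq> 0"
  shows "hyperpolygon_orbit (snd (standard_hyperpolygon S z), fst (standard_hyperpolygon S z))
     = hyperpolygon_orbit (standard_hyperpolygon S z)"
proof -
  let ?x = "standard_hyperpolygon S z"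
  define A :: "complex^2^2" where "A = vector [vector [0, \<i>], vector [\<i>, 0]]"
  have A: "A \<in> SU2"
    by (simp add: SU2_def A_def vec_eq_iff forall_2 matrix_matrix_mult_def sum_2 adjoint_mat_def mat_def det_2)
  define e :: "complex^'a" where "e = (\<chi> i. \<i> * of_real (cmod (z $ i)) / z $ i)"
  have e: "e \<in> unit_phases" using z0 by (simp add: unit_phases_def e_def norm_divide norm_mult)
  have r: "complex_of_real (cmod (z $ i)) = of_real (sqrt (cmod (z $ i))) * of_real (sqrt (cmod (z $ i)))" for i
    by (simp flip: of_real_mult)
  have r0: "complex_of_real (sqrt (cmod (z $ i))) \<noteq> 0" for i using z0 by simp
  have "hyperpolygon_act (snd ?x, fst ?x) A e = ?x"
    by (rule hyperpolygon_eqI; unfold hyperpolygon_act_fst[OF A] hyperpolygon_act_snd[OF A];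
        insert z0 r0; simp add: standard_hyperpolygon_def A_def e_def r; simp add: mult_ac)
  then show ?thesis
    unfolding hyperpolygon_orbit_eq_iff hyperpolygon_orbit_iff using A e
    by (intro bexI[of _ A] bexI[of _ e]) simp_all
qed

text \<open>Exchanging \<open>p\<close> and \<open>q\<close> carries the action of \<open>(A, e)\<close> to that of the complex conjugate of \<open>A\<close> and the inverse of \<open>e\<close>.\<close>

lemma swap_hyperpolygon_orbit:
  "hyperpolygon_involution (hyperpolygon_orbit x) = hyperpolygon_orbit (snd x, fst x)"
proof -
  have sub: "(snd y, fst y) \<in> hyperpolygon_orbit (snd x, fst x)" if y: "y \<in> hyperpolygon_orbit x" for x y :: "'a hyperpolygon"
  proof -
    obtain A e where A: "A \<in> SU2" "e \<in> unit_phases" "y = hyperpolygon_act x A e"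
      using y unfolding hyperpolygon_orbit_iff by blast
    let ?B = "\<chi> a b. cnj (A $ a $ b)" and ?f = "\<chi> i. inverse (e $ i)"
    have B: "?B \<in> SU2"
    proof -
      have "?B ** adjoint_mat ?B = (\<chi> a b. cnj ((A ** adjoint_mat A) $ a $ b))"
        by (simp add: vec_eq_iff matrix_matrix_mult_def adjoint_mat_def sum_2)
      also have "\<dots> = mat 1" using SU2_adjoint(1)[OF A(1)] by (simp add: vec_eq_iff mat_def)
      finally have "?B ** adjoint_mat ?B = mat 1" .
      moreover have "det ?B = cnj (det A)" by (simp add: det_2)
      ultimately show ?thesis using A(1) by (simp add: SU2_def)
    qed
    have f: "?f \<in> unit_phases" using A(2) by (simp add: unit_phases_def norm_inverse)
    have "(snd y, fst y) = hyperpolygon_act (snd x, fst x) ?B ?f"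
      unfolding A(3)
      by (rule hyperpolygon_eqI; unfold fst_conv snd_conv hyperpolygon_act_fst[OF A(1)] hyperpolygon_act_snd[OF A(1)]
          hyperpolygon_act_fst[OF B] hyperpolygon_act_snd[OF B]; simp add: mult.commute)
    then show ?thesis unfolding hyperpolygon_orbit_iff using B f by blast
  qed
  show ?thesis
  proof (intro equalityI subsetI)
    fix w assume "w \<in> hyperpolygon_involution (hyperpolygon_orbit x)"
    then show "w \<in> hyperpolygon_orbit (snd x, fst x)"
      using sub[of _ x] by (auto simp: hyperpolygon_involution_def)
  next
    fix w assume "w \<in> hyperpolygon_orbit (snd x, fst x)"
    from sub[OF this] have "(snd w, fst w) \<in> hyperpolygon_orbit x" by simp
    then show "w \<in> hyperpolygon_involution (hyperpolygon_orbit x)"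
      unfolding hyperpolygon_involution_def by (intro image_eqI[of _ _ "(snd w, fst w)"]) simp_all
  qed
qed

text \<open>At a fixed point all \<open>q\<^sub>i\<close> are isotropic for a nonzero quadratic form, whose zero set consists of at
  most two lines.\<close>

lemma hyperpolygon_fixed_straight:
  assumes x: "x \<in> null_hyperpolygon_level"
    and fixed: "hyperpolygon_involution (hyperpolygon_orbit x) = hyperpolygon_orbit x"
    and ik: "hyperpolygon_trace x i k \<noteq> 0" "hyperpolygon_trace x i' k \<noteq> 0"
  shows "hyperpolygon_trace x i i' = 0"
proof -
  note L = x[unfolded null_hyperpolygon_level_iff]
  have "(snd x, fst x) \<in> hyperpolygon_orbit x"
    using fixed self_in_hyperpolygon_orbit[of "(snd x, fst x)"] unfolding swap_hyperpolygon_orbit by simp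
  then obtain A e where A: "A \<in> SU2" and e: "e \<in> unit_phases" and sw: "(snd x, fst x) = hyperpolygon_act x A e"
    unfolding hyperpolygon_orbit_iff by blast
  have q: "snd x $ i $ b = inverse (e $ i) * (fst x $ i $ 1 * A $ 1 $ b + fst x $ i $ 2 * A $ 2 $ b)" for i b
    using hyperpolygon_act_fst[OF A, of x e i b] unfolding sw[symmetric] by simp
  have p: "fst x $ i $ b = e $ i * (cnj (A $ 1 $ b) * snd x $ i $ 1 + cnj (A $ 2 $ b) * snd x $ i $ 2)" for i b
    using hyperpolygon_act_snd[OF A, of x e i b] unfolding sw[symmetric] by simp
  let ?a = "cnj (A $ 1 $ 1)" and ?b = "cnj (A $ 2 $ 1) + cnj (A $ 1 $ 2)" and ?c = "cnj (A $ 2 $ 2)"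
  have form: "?a * (snd x $ i $ 1)\<^sup>2 + ?b * snd x $ i $ 1 * snd x $ i $ 2 + ?c * (snd x $ i $ 2)\<^sup>2 = 0" for i
  proof -
    have "fst x $ i $ 1 * snd x $ i $ 1 + fst x $ i $ 2 * snd x $ i $ 2 = 0" using L by blast
    then have "e $ i * (?a * (snd x $ i $ 1)\<^sup>2 + ?b * snd x $ i $ 1 * snd x $ i $ 2 + ?c * (snd x $ i $ 2)\<^sup>2) = 0"
      unfolding p by (simp add: power2_eq_square algebra_simps)
    then show ?thesis using unit_phases_nz[OF e] by simp
  qed
  \<comment> \<open>if the form vanished, \<open>A\<close> would be alternating, and applying it twice would give \<open>q = - q\<close>\<close>
  have nz: "?a \<noteq> 0 \<or> ?b \<noteq> 0 \<or> ?c \<noteq> 0"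
  proof (rule ccontr)
    assume "\<not> ?thesis"
    then have a: "A $ 1 $ 1 = 0" "A $ 2 $ 2 = 0" and "cnj (A $ 2 $ 1 + A $ 1 $ 2) = 0" by simp_all
    then have b: "A $ 2 $ 1 = - A $ 1 $ 2" by (simp only: complex_cnj_zero_iff eq_neg_iff_add_eq_0)
    have "A $ 1 $ 2 * cnj (A $ 1 $ 2) = 1"
      using SU2_adjoint(1)[OF A] a
      by (simp add: vec_eq_iff forall_2 matrix_matrix_mult_def sum_2 adjoint_mat_def mat_def)
    moreover have ee: "e $ i * (inverse (e $ i) * y) = y" for y
      using unit_phases_nz[OF e, of i] by (simp flip: mult.assoc)
    moreover have "snd x $ i $ 1 = - (A $ 1 $ 2 * cnj (A $ 1 $ 2)) * snd x $ i $ 1"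
        "snd x $ i $ 2 = - (A $ 1 $ 2 * cnj (A $ 1 $ 2)) * snd x $ i $ 2"
      using q[of i 1] q[of i 2] unfolding p a b by (simp_all add: mult_ac ee)
    ultimately have "snd x $ i $ 1 = - snd x $ i $ 1" "snd x $ i $ 2 = - snd x $ i $ 2"
      by simp_all
    then have "snd x $ i = 0" by (simp add: vec_eq_iff forall_2)
    then show False using L by blast
  qed
  have "minor x i i' = 0"
    using quadratic_form_lines[OF form[of i] form[of i'] form[of k] _ _ nz] ik
    unfolding hyperpolygon_trace_eq_0_iff[OF x] minor_def by simp
  then show ?thesis using hyperpolygon_trace_eq_0_iff[OF x] by blast
qed

subsection \<open>The component of null hyperpolygons\<close>

text \<open>Traces are constant on orbits, so any representative may be chosen.\<close>

definition class_trace :: "'n::finite hyperpolygon set \<Rightarrow> 'n \<Rightarrow> 'n \<Rightarrow> complex" where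
  "class_trace c = hyperpolygon_trace (SOME x. x \<in> null_hyperpolygon_level \<and> hyperpolygon_orbit x = c)"

lemma class_trace_orbit:
  assumes "x \<in> null_hyperpolygon_level"
  shows "class_trace (hyperpolygon_orbit x) = hyperpolygon_trace x"
proof -
  have "hyperpolygon_orbit (SOME y. y \<in> null_hyperpolygon_level \<and> hyperpolygon_orbit y = hyperpolygon_orbit x)
      = hyperpolygon_orbit x"
    using someI[of "\<lambda>y. y \<in> null_hyperpolygon_level \<and> hyperpolygon_orbit y = hyperpolygon_orbit x" x] assms by blast
  then show ?thesis unfolding class_trace_def by (rule hyperpolygon_trace_orbit)
qed

lemma topspace_null_hyperpolygon_space: "topspace (topo null_hyperpolygon_space) = (null_hyperpolygons :: 'n::finite hyperpolygon set set)"
  by (simp add: null_hyperpolygon_space_def null_hyperpolygons_def)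

lemma smooth_on_hyperpolygon_trace: "smooth_on UNIV (\<lambda>x :: 'n::finite hyperpolygon. hyperpolygon_trace x i k)"
  unfolding hyperpolygon_trace_expand by (intro smooth_intros) auto

lemma openin_hyperpolygon_trace:
  fixes i k :: "'n::finite"
  shows "openin (topo null_hyperpolygon_space) {c \<in> topspace (topo null_hyperpolygon_space). class_trace c i k \<noteq> 0}"
proof -
  let ?P = "null_hyperpolygon_level :: 'n hyperpolygon set"
  have "open {x :: 'n hyperpolygon. hyperpolygon_trace x i k \<noteq> 0}"
    using smooth_on_continuous[OF smooth_on_hyperpolygon_trace]
    by (intro open_Collect_neq continuous_on_const) auto
  then have "openin (top_of_set ?P) (?P \<inter> {x. hyperpolygon_trace x i k \<noteq> 0})" by blast
  moreover have "{x \<in> ?P. hyperpolygon_orbit x \<in> {c \<in> null_hyperpolygons. class_trace c i k \<noteq> 0}}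
      = ?P \<inter> {x. hyperpolygon_trace x i k \<noteq> 0}"
    by (auto simp: null_hyperpolygons_def class_trace_orbit)
  ultimately show ?thesis
    unfolding topspace_null_hyperpolygon_space
    by (simp add: null_hyperpolygon_space_def openin_quotient_space) (auto simp: null_hyperpolygons_def)
qed

context
  fixes S :: "'n::finite set"
  assumes S: "2 \<le> card S" "card S + 2 \<le> CARD('n)"
begin

lemma parts_nonempty: "S \<noteq> {}" "- S \<noteq> {}"
proof -
  show "S \<noteq> {}" using S by auto
  show "- S \<noteq> {}"
  proof
    assume "- S = {}"
    then have "S = UNIV" by auto
    with S show False by simp
  qed
qed

lemma hyperpolygon_component_iff:
  assumes x: "x \<in> null_hyperpolygon_level"
  shows "hyperpolygon_orbit x \<in> hyperpolygon_component S \<longleftrightarrow>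
    (\<forall>i k. (i \<in> S \<longleftrightarrow> k \<in> S) \<longrightarrow> hyperpolygon_trace x i k = 0)"
proof -
  have *: "straight S y \<and> straight (- S) y \<longleftrightarrow> (\<forall>i k. (i \<in> S \<longleftrightarrow> k \<in> S) \<longrightarrow> hyperpolygon_trace y i k = 0)"
    if "y \<in> null_hyperpolygon_level" for y
    unfolding straight_iff[OF that] by auto
  show ?thesis
  proof
    assume "hyperpolygon_orbit x \<in> hyperpolygon_component S"
    then obtain y where y: "y \<in> null_hyperpolygon_level" "straight S y \<and> straight (- S) y"
        "hyperpolygon_orbit x = hyperpolygon_orbit y"
      by (auto simp: hyperpolygon_component_def)
    then show "\<forall>i k. (i \<in> S \<longleftrightarrow> k \<in> S) \<longrightarrow> hyperpolygon_trace x i k = 0"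
      using *[OF y(1)] hyperpolygon_trace_orbit[OF y(3)] by simp
  next
    assume "\<forall>i k. (i \<in> S \<longleftrightarrow> k \<in> S) \<longrightarrow> hyperpolygon_trace x i k = 0"
    then show "hyperpolygon_orbit x \<in> hyperpolygon_component S"
      using *[OF x] x unfolding hyperpolygon_component_def by blast
  qed
qed

lemma hyperpolygon_of_level: "l \<in> config S \<Longrightarrow> hyperpolygon_of S l \<in> null_hyperpolygon_level"
  unfolding hyperpolygon_of_def
  by (intro standard_hyperpolygon_level balance_in balance_balanced parts_nonempty)

lemma hyperpolygon_of_trace:
  assumes "l \<in> config S"
  shows "hyperpolygon_trace (hyperpolygon_of S l) i k
     = (if (i \<in> S) = (k \<in> S) then 0 else balance S l $ i * balance S l $ k)"
  unfolding hyperpolygon_of_def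
  using balance_in[OF parts_nonempty assms] by (intro standard_hyperpolygon_trace) (simp_all add: config_def)

lemma hyperpolygon_of_in_component:
  assumes "l \<in> config S"
  shows "hyperpolygon_orbit (hyperpolygon_of S l) \<in> hyperpolygon_component S"
  unfolding hyperpolygon_component_iff[OF hyperpolygon_of_level[OF assms]] hyperpolygon_of_trace[OF assms] by simp

lemma hyperpolygon_component_form:
  assumes "c \<in> hyperpolygon_component S"
  obtains z where "z \<in> config S" "balance S z = z" "c = hyperpolygon_orbit (hyperpolygon_of S z)"
proof -
  obtain x where x: "x \<in> null_hyperpolygon_level" "c = hyperpolygon_orbit x"
    using assms by (auto simp: hyperpolygon_component_def)
  then obtain z where z: "z \<in> config S" "half_length S z = half_length (- S) z"
      "c = hyperpolygon_orbit (standard_hyperpolygon S z)"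
    using hyperpolygon_standard_form[OF x(1) parts_nonempty] hyperpolygon_component_iff[OF x(1)] assms by blast
  have b: "balance S z = z" by (rule balance_id[OF parts_nonempty(1) z(1,2)])
  show thesis by (rule that[OF z(1) b]) (simp add: hyperpolygon_of_def b z(3))
qed

lemma smooth_map_hyperpolygon_of:
  "smooth_map (sub_space euclidean_smooth (config S)) null_hyperpolygon_space
     (hyperpolygon_orbit \<circ> hyperpolygon_of S)"
  unfolding null_hyperpolygon_space_def
  by (rule smooth_map_compose[OF smooth_map_sub_euclidean[OF smooth_on_hyperpolygon_of[OF parts_nonempty]]
        smooth_map_quotient_projection])
    (use config_subset hyperpolygon_of_level in auto)

lemma hyperpolygon_component_image:
  "hyperpolygon_component S = (hyperpolygon_orbit \<circ> hyperpolygon_of S) ` config S"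
  using hyperpolygon_of_in_component hyperpolygon_component_form
  by (auto elim!: hyperpolygon_component_form)

theorem hyperpolygon_component_is_component:
  "hyperpolygon_component S \<in> connected_components_of
     (subtopology (topo null_hyperpolygon_space) {c \<in> null_hyperpolygons. hyperpolygon_involution c = c})"
proof (rule trace_component[where t = class_trace and S = S])
  let ?F = "{c \<in> null_hyperpolygons. hyperpolygon_involution c = c} :: 'n hyperpolygon set set"
  let ?Z = "hyperpolygon_component S"
  show "openin (topo null_hyperpolygon_space) {c \<in> topspace (topo null_hyperpolygon_space). class_trace c i k \<noteq> 0}" for i k
    by (rule openin_hyperpolygon_trace)
  show "?F \<subseteq> topspace (topo null_hyperpolygon_space)"
    unfolding topspace_null_hyperpolygon_space by blast
  show ZF: "?Z \<subseteq> ?F"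
  proof
    fix c assume "c \<in> ?Z"
    then obtain z where z: "z \<in> config S" "balance S z = z" "c = hyperpolygon_orbit (hyperpolygon_of S z)"
      by (rule hyperpolygon_component_form)
    have "hyperpolygon_involution c = c"
      unfolding z(3) swap_hyperpolygon_orbit hyperpolygon_of_def z(2)
      using z(1) by (intro standard_hyperpolygon_swap) (simp add: config_def)
    then show "c \<in> ?F" using hyperpolygon_of_level[OF z(1)] z(3) by (simp add: null_hyperpolygons_def)
  qed
  show "connectedin (topo null_hyperpolygon_space) ?Z"
    unfolding hyperpolygon_component_image
  proof (rule connectedin_continuous_map_image)
    show "continuous_map (top_of_set (config S)) (topo null_hyperpolygon_space) (hyperpolygon_orbit \<circ> hyperpolygon_of S)"
      using smooth_mapD(3)[OF smooth_map_hyperpolygon_of] by simp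
    show "connectedin (top_of_set (config S)) (config S)"
      using connected_config by (simp add: connectedin_subtopology connectedin_iff_connected)
  qed
  show "?Z \<noteq> {}" unfolding hyperpolygon_component_image using config_nonempty[OF S] by simp
  fix c assume c: "c \<in> ?F"
  then obtain x where x: "x \<in> null_hyperpolygon_level" "c = hyperpolygon_orbit x"
    by (auto simp: null_hyperpolygons_def)
  show cl: "c \<in> ?Z \<longleftrightarrow> (\<forall>i k. (i \<in> S \<longleftrightarrow> k \<in> S) \<longrightarrow> class_trace c i k = 0)"
    unfolding x(2) class_trace_orbit[OF x(1)] hyperpolygon_component_iff[OF x(1)] ..
  show "c \<in> ?Z \<longleftrightarrow> (\<forall>i k. i \<in> S \<and> k \<notin> S \<longrightarrow> class_trace c i k \<noteq> 0)"
  proof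
    assume "c \<in> ?Z"
    then obtain z where z: "z \<in> config S" "balance S z = z" "c = hyperpolygon_orbit (hyperpolygon_of S z)"
      by (rule hyperpolygon_component_form)
    show "\<forall>i k. i \<in> S \<and> k \<notin> S \<longrightarrow> class_trace c i k \<noteq> 0"
      unfolding z(3) class_trace_orbit[OF hyperpolygon_of_level[OF z(1)]] hyperpolygon_of_trace[OF z(1)] z(2)
      using z(1) by (auto simp: config_def)
  next
    assume R: "\<forall>i k. i \<in> S \<and> k \<notin> S \<longrightarrow> class_trace c i k \<noteq> 0"
    have fixed: "hyperpolygon_involution (hyperpolygon_orbit x) = hyperpolygon_orbit x" using c x(2) by blast
    note R' = R[unfolded x(2) class_trace_orbit[OF x(1)], rule_format]
    have sym: "hyperpolygon_trace x i k = hyperpolygon_trace x k i" for i k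
      unfolding hyperpolygon_trace_def by (rule pair_trace_sym)
    obtain a b where ab: "a \<in> S" "b \<notin> S" using parts_nonempty by blast
    have "hyperpolygon_trace x i i' = 0" if "(i \<in> S) = (i' \<in> S)" for i i'
    proof (cases "i \<in> S")
      case True
      with that have "i' \<in> S" by simp
      show ?thesis
        by (rule hyperpolygon_fixed_straight[OF x(1) fixed, of i b i']) (use R' True \<open>i' \<in> S\<close> ab in auto)
    next
      case False
      with that have "i' \<notin> S" by simp
      show ?thesis
        by (rule hyperpolygon_fixed_straight[OF x(1) fixed, of i a i'])
          (use R'[of a i] R'[of a i'] False \<open>i' \<notin> S\<close> ab sym[of a] in auto)
    qed
    then show "c \<in> ?Z" unfolding x(2) hyperpolygon_component_iff[OF x(1)] by blast
  qed
qed

end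

theorem hyperpolygon_component_diffeomorphic:
  fixes S :: "'n::{finite,linorder} set"
  assumes S: "2 \<le> card S" "card S + 2 \<le> CARD('n)"
  shows "diffeomorphic (sub_space null_hyperpolygon_space (hyperpolygon_component S))
     (null_polygon_space (card S) :: (real^3, 'n) vec set smooth_space)"
proof -
  let ?Z = "hyperpolygon_component S" and ?P = "null_hyperpolygon_level :: 'n hyperpolygon set"
  note ne = parts_nonempty[OF S]
  obtain j k where jk: "j \<in> S" "k \<notin> S" using ne by blast
  define s where "s = (\<lambda>c. trace_config S j k (class_trace c))"
  have s\<Theta>: "config_rel S l (s (hyperpolygon_orbit (hyperpolygon_of S l)))" if l: "l \<in> config S" for l
  proof -
    have "config_rel S (balance S l) (trace_config S j k (hyperpolygon_trace (hyperpolygon_of S l)))"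
      by (rule trace_config_model[OF balance_in[OF ne l] jk]) (simp_all add: hyperpolygon_of_trace[OF S l])
    then show ?thesis
      unfolding s_def class_trace_orbit[OF hyperpolygon_of_level[OF S l]]
      using balance_rel[OF ne l] config_rel_trans by blast
  qed
  show ?thesis
  proof (rule diffeomorphic_null_polygon_spaceI[where s = s and \<Theta> = "hyperpolygon_orbit \<circ> hyperpolygon_of S", OF _ _ ne])
    show "smooth_restricts (null_hyperpolygon_space :: 'n hyperpolygon set smooth_space)"
      unfolding null_hyperpolygon_space_def by (intro smooth_restricts_quotient smooth_restricts_sub_euclidean)
    show "?Z \<subseteq> topspace (topo null_hyperpolygon_space)"
      unfolding topspace_null_hyperpolygon_space by (auto simp: hyperpolygon_component_def null_hyperpolygons_def)
    let ?O = "{x :: 'n hyperpolygon. hyperpolygon_trace x j k \<noteq> 0}"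
    have oO: "open ?O"
      using smooth_on_continuous[OF smooth_on_hyperpolygon_trace]
      by (intro open_Collect_neq continuous_on_const) auto
    show "smooth_map (sub_space null_hyperpolygon_space ?Z) euclidean_smooth s"
      unfolding null_hyperpolygon_space_def
    proof (rule smooth_map_quotient_invariant[where ?O1.0 = ?O and s = "\<lambda>x. trace_config S j k (hyperpolygon_trace x)"])
      show "smooth_on ?O (\<lambda>x. trace_config S j k (hyperpolygon_trace x))"
        unfolding trace_config_def
        by (intro smooth_on_vec_lambda smooth_on_if smooth_on_divide
            smooth_on_subset[OF smooth_on_hyperpolygon_trace oO subset_UNIV] oO) auto
      show "y \<in> ?O \<and> trace_config S j k (hyperpolygon_trace x) = trace_config S j k (hyperpolygon_trace y)"
        if "hyperpolygon_orbit x = hyperpolygon_orbit y" "x \<in> ?O" for x y :: "'n hyperpolygon"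
        using hyperpolygon_trace_orbit[OF that(1)] that(2) by simp
      show "?Z \<subseteq> hyperpolygon_orbit ` (?P \<inter> ?O)"
      proof
        fix c assume "c \<in> ?Z"
        then obtain z where z: "z \<in> config S" "balance S z = z" "c = hyperpolygon_orbit (hyperpolygon_of S z)"
          by (rule hyperpolygon_component_form[OF S])
        then have "hyperpolygon_trace (hyperpolygon_of S z) j k \<noteq> 0"
          unfolding hyperpolygon_of_trace[OF S z(1)] z(2) using jk by (simp add: config_def)
        then show "c \<in> hyperpolygon_orbit ` (?P \<inter> ?O)" using z hyperpolygon_of_level[OF S z(1)] by blast
      qed
      show "s (hyperpolygon_orbit x) = trace_config S j k (hyperpolygon_trace x)" if "x \<in> ?P \<inter> ?O" for x
        using that by (simp add: s_def class_trace_orbit)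
    qed
    show "smooth_map (sub_space euclidean_smooth (config S)) null_hyperpolygon_space (hyperpolygon_orbit \<circ> hyperpolygon_of S)"
      by (rule smooth_map_hyperpolygon_of[OF S])
    show "(hyperpolygon_orbit \<circ> hyperpolygon_of S) l \<in> ?Z" if "l \<in> config S" for l
      using hyperpolygon_of_in_component[OF S that] by simp
    show "config_rel S l (s ((hyperpolygon_orbit \<circ> hyperpolygon_of S) l))" if "l \<in> config S" for l
      using s\<Theta>[OF that] by simp
    show "(hyperpolygon_orbit \<circ> hyperpolygon_of S) l = (hyperpolygon_orbit \<circ> hyperpolygon_of S) m"
      if "config_rel S l m" for l m
      using hyperpolygon_of_rel[OF that] by simp
    fix c assume "c \<in> ?Z"
    then obtain z where z: "z \<in> config S" "balance S z = z" "c = hyperpolygon_orbit (hyperpolygon_of S z)"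
      by (rule hyperpolygon_component_form[OF S])
    have r: "config_rel S z (s c)" unfolding z(3) by (rule s\<Theta>[OF z(1)])
    show "s c \<in> config S" by (rule config_rel_in[OF z(1) r])
    show "(hyperpolygon_orbit \<circ> hyperpolygon_of S) (s c) = c"
      using hyperpolygon_of_rel[OF r] z(3) by simp
  qed
qed

section \<open>Function theory on the Riemann sphere\<close>

text \<open>The singularities are removable, so Liouville's theorem applies.\<close>

lemma liouville_punctured:
  assumes D: "finite D" and hol: "f holomorphic_on - D"
    and lim: "\<And>c. c \<in> D \<Longrightarrow> \<exists>l. (f \<longlongrightarrow> l) (at c)" and inf: "(f \<longlongrightarrow> L) at_infinity"
    and z: "z \<notin> D"
  shows "f z = L"
proof -
  obtain l where l: "\<And>c. c \<in> D \<Longrightarrow> (f \<longlongrightarrow> l c) (at c)" using lim by metis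
  define g where "g = (\<lambda>z. if z \<in> D then l z else f z)"
  have ev: "\<forall>\<^sub>F z in at c. f z = g z" for c
  proof -
    have "open (- (D - {c}))" using D by (intro open_Compl finite_imp_closed finite_Diff)
    then have "\<forall>\<^sub>F z in at c. z \<in> - (D - {c})" by (rule eventually_at_in_open') simp
    then have "\<forall>\<^sub>F z in at c. z \<notin> D"
      using eventually_neq_at_within[of c c UNIV] by eventually_elim auto
    then show ?thesis by eventually_elim (simp add: g_def)
  qed
  have "g holomorphic_on UNIV"
  proof (rule no_isolated_singularity'[where K = D])
    fix c assume "c \<in> D"
    then have "(f \<longlongrightarrow> g c) (at c)" using l by (simp add: g_def)
    then show "(g \<longlongrightarrow> g c) (at c)" using tendsto_cong[OF ev[of c]] by simp
  next
    have "f holomorphic_on UNIV - D" using hol by (simp add: Compl_eq_Diff_UNIV)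
    then show "g holomorphic_on UNIV - D" by (rule holomorphic_transform) (simp add: g_def)
  qed (use D in auto)
  moreover have "(g \<longlongrightarrow> L) at_infinity"
  proof -
    obtain B where B: "\<And>z. z \<in> D \<Longrightarrow> cmod z \<le> B" using finite_imp_bounded[OF D] by (auto simp: bounded_iff)
    have "\<forall>\<^sub>F z in at_infinity. f z = g z"
      unfolding eventually_at_infinity
    proof (intro exI[of _ "B + 1"] allI impI)
      fix z assume "B + 1 \<le> cmod z"
      then have "z \<notin> D" using B[of z] by auto
      then show "f z = g z" by (simp add: g_def)
    qed
    then show ?thesis using inf tendsto_cong by metis
  qed
  ultimately have "g z = L" by (rule Liouville_weak)
  with z show ?thesis by (simp add: g_def)
qed

lemma holomorphic_cp1_constant:
  assumes "holomorphic_cp1 f"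
  shows "f y = f Pt_inf"
proof (cases y)
  case (Pt z)
  have an: "(\<lambda>w. f (local_coord y w)) analytic_on {0}" for y using assms by (simp add: holomorphic_cp1_def)
  have "(\<lambda>z. f (Pt z)) holomorphic_on UNIV"
  proof (rule analytic_imp_holomorphic, unfold analytic_on_analytic_at[of _ UNIV], intro ballI)
    fix a :: complex
    have "(\<lambda>w. f (Pt (a + w))) analytic_on {a - a}" using an[of "Pt a"] by simp
    then have "(\<lambda>w. f (Pt (a + w))) \<circ> (\<lambda>z. z - a) analytic_on {a}"
      by (intro analytic_on_compose) (auto intro!: analytic_intros)
    then show "(\<lambda>z. f (Pt z)) analytic_on {a}" by (simp add: o_def)
  qed
  moreover have "((\<lambda>z. f (Pt z)) \<longlongrightarrow> f Pt_inf) at_infinity"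
  proof -
    have "isCont (\<lambda>w. f (local_coord Pt_inf w)) 0"
      using an[of Pt_inf] analytic_at_imp_isCont by blast
    then have "((\<lambda>w. f (local_coord Pt_inf w)) \<longlongrightarrow> f Pt_inf) (at 0)" by (simp add: isCont_def)
    moreover have "\<forall>\<^sub>F w in at 0. f (local_coord Pt_inf w) = ((\<lambda>z. f (Pt z)) \<circ> inverse) w"
      using eventually_neq_at_within[of 0 0 UNIV] by eventually_elim (simp add: divide_inverse)
    ultimately have "(((\<lambda>z. f (Pt z)) \<circ> inverse) \<longlongrightarrow> f Pt_inf) (at 0)" by (rule Lim_transform_eventually)
    then show ?thesis by (simp add: lim_at_infinity_0)
  qed
  ultimately have "f (Pt z) = f Pt_inf" by (rule Liouville_weak)
  with Pt show ?thesis by simp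
qed simp

subsection \<open>Partial fractions\<close>

primrec scalar_form_at :: "(complex \<Rightarrow> complex) \<Rightarrow> cp1 \<Rightarrow> complex \<Rightarrow> complex" where
  "scalar_form_at f (Pt c) w = f (c + w)"
| "scalar_form_at f Pt_inf w = - f (1 / w) / w\<^sup>2"

lemma form_at_nth: "form_at \<phi> y w $ a $ b = scalar_form_at (\<lambda>z. \<phi> z $ a $ b) y w"
  by (cases y) simp_all

definition scalar_simple_pole :: "cp1 set \<Rightarrow> (complex \<Rightarrow> complex) \<Rightarrow> bool" where
  "scalar_simple_pole D f \<longleftrightarrow> f holomorphic_on {z. Pt z \<notin> D} \<and>
     (\<forall>y. \<exists>h. h analytic_on {0} \<and> (y \<notin> D \<longrightarrow> h 0 = 0) \<and>
        (\<forall>\<^sub>F w in at 0. scalar_form_at f y w = h w / w))"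

definition scalar_res :: "(complex \<Rightarrow> complex) \<Rightarrow> cp1 \<Rightarrow> complex" where
  "scalar_res f y = residue (scalar_form_at f y) 0"

lemma Res_nth: "Res \<phi> y $ a $ b = scalar_res (\<lambda>z. \<phi> z $ a $ b) y"
  by (simp add: Res_def scalar_res_def form_at_nth[abs_def])

lemma simple_pole_form_iff:
  "simple_pole_form D \<phi> \<longleftrightarrow> (\<forall>a b. scalar_simple_pole D (\<lambda>z. \<phi> z $ a $ b))"
  unfolding simple_pole_form_def scalar_simple_pole_def form_at_nth by blast

lemma residue_quotient:
  assumes "h analytic_on {0}" "\<forall>\<^sub>F w in at 0. F w = h w / w"
  shows "residue F 0 = h 0"
proof -
  obtain U where U: "open U" "0 \<in> U" "h holomorphic_on U"
    using assms(1) by (auto simp: analytic_at)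
  have "residue F 0 = residue (\<lambda>w. h w / (w - 0)) 0"
    using assms(2) by (intro residue_cong) simp_all
  also have "\<dots> = h 0" by (rule residue_simple[OF U])
  finally show ?thesis .
qed

lemma finite_finite_part: "finite D \<Longrightarrow> finite {a. Pt a \<in> D}"
  using finite_vimageI[of D Pt] by (simp add: inj_on_def vimage_def)

text \<open>The difference of \<open>f\<close> and its principal parts extends to an entire function that tends to zero at infinity.
  The residue theorem is the comparison of the coefficients of \<open>1 / z\<close> at infinity.\<close>

lemma simple_pole_partial_fractions:
  assumes D: "finite D" and f: "scalar_simple_pole D f"
  shows "Pt z \<notin> D \<Longrightarrow> f z = (\<Sum>a | Pt a \<in> D. scalar_res f (Pt a) / (z - a))"
    and "(\<Sum>y\<in>D. scalar_res f y) = 0"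
proof -
  let ?D = "{a. Pt a \<in> D}" and ?r = "\<lambda>a. scalar_res f (Pt a)"
  have fin: "finite ?D" using D by (rule finite_finite_part)
  have h: "\<exists>h. h analytic_on {0} \<and> (y \<notin> D \<longrightarrow> h 0 = 0) \<and> (\<forall>\<^sub>F w in at 0. scalar_form_at f y w = h w / w)
      \<and> scalar_res f y = h 0" for y
    using f residue_quotient unfolding scalar_simple_pole_def scalar_res_def by meson
  obtain k where k: "k analytic_on {0}" "Pt_inf \<notin> D \<longrightarrow> k 0 = 0"
      "\<forall>\<^sub>F w in at 0. scalar_form_at f Pt_inf w = k w / w" "scalar_res f Pt_inf = k 0"
    using h by blast
  have kcont: "(k \<longlongrightarrow> k 0) (at 0)"
    using k(1) analytic_at_imp_isCont isCont_def by blast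
  \<comment> \<open>in the coordinate \<open>w = 1 / z\<close> the form is \<open>- f (1 / w) / w\<^sup>2 dw\<close>, so a simple pole at infinity means \<open>f = O(1 / z)\<close>\<close>
  have finf: "\<forall>\<^sub>F w in at 0. f (inverse w) = - w * k w"
    using k(3) eventually_neq_at_within[of 0 0 UNIV]
  proof eventually_elim
    case (elim w)
    have "f (inverse w) = - ((- f (1 / w) / w\<^sup>2) * w\<^sup>2)" using elim(2) by (simp add: inverse_eq_divide)
    also have "- f (1 / w) / w\<^sup>2 = k w / w" using elim by simp
    finally have F: "f (inverse w) = - (k w / w * w\<^sup>2)" .
    have "k w / w * w\<^sup>2 = w * k w" using elim(2) by (simp add: power2_eq_square)
    then show ?case unfolding F by simp
  qed
  define g where "g = (\<lambda>z. f z - (\<Sum>a\<in>?D. ?r a / (z - a)))"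
  have g0: "g z = 0" if "z \<notin> ?D" for z
  proof (rule liouville_punctured[OF fin _ _ _ that])
    have "f holomorphic_on - ?D" using f by (simp add: scalar_simple_pole_def Collect_neg_eq)
    then show "g holomorphic_on - ?D" unfolding g_def by (intro holomorphic_intros) auto
  next
    fix c assume c: "c \<in> ?D"
    obtain h where h: "h analytic_on {0}" "\<forall>\<^sub>F w in at 0. scalar_form_at f (Pt c) w = h w / w" "?r c = h 0"
      using h by blast
    have "h field_differentiable at 0" using h(1) analytic_on_imp_differentiable_at by blast
    then have "(h has_field_derivative deriv h 0) (at 0)" using DERIV_deriv_iff_field_differentiable by blast
    then have "((\<lambda>w. (h w - h 0) / w) \<longlongrightarrow> deriv h 0) (at 0)"
      by (simp add: has_field_derivative_iff)
    moreover have "\<forall>\<^sub>F w in at 0. (h w - h 0) / w = f (c + w) - ?r c / w"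
      using h(2) by eventually_elim (simp add: h(3) diff_divide_distrib)
    ultimately have "((\<lambda>w. f (c + w) - ?r c / w) \<longlongrightarrow> deriv h 0) (at 0)" by (rule Lim_transform_eventually)
    then have 1: "((\<lambda>z. f z - ?r c / (z - c)) \<longlongrightarrow> deriv h 0) (at c)"
      by (subst LIM_offset_zero_iff[of c]) simp_all
    have "((\<lambda>z. (f z - ?r c / (z - c)) - (\<Sum>a\<in>?D - {c}. ?r a / (z - a))) \<longlongrightarrow>
        deriv h 0 - (\<Sum>a\<in>?D - {c}. ?r a / (c - a))) (at c)"
      by (intro tendsto_diff 1 tendsto_sum tendsto_divide tendsto_const tendsto_ident_at) auto
    moreover have "(f z - ?r c / (z - c)) - (\<Sum>a\<in>?D - {c}. ?r a / (z - a)) = g z" for z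
      unfolding g_def using sum.remove[OF fin c, of "\<lambda>a. ?r a / (z - a)"] by simp
    ultimately show "\<exists>l. (g \<longlongrightarrow> l) (at c)" by auto
  next
    have "((\<lambda>w. - w * k w - (\<Sum>a\<in>?D. ?r a * w / (1 - a * w))) \<longlongrightarrow> - 0 * k 0 - (\<Sum>a\<in>?D. ?r a * 0 / (1 - a * 0))) (at 0)"
      by (intro tendsto_intros kcont) auto
    moreover have "\<forall>\<^sub>F w in at 0. - w * k w - (\<Sum>a\<in>?D. ?r a * w / (1 - a * w)) = (g \<circ> inverse) w"
      using finf eventually_neq_at_within[of 0 0 UNIV]
    proof eventually_elim
      case (elim w)
      have "?r a * w / (1 - a * w) = ?r a / (inverse w - a)" for a
      proof -
        have "inverse w - a = (1 - a * w) / w" using elim by (simp add: field_simps)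
        then show ?thesis by simp
      qed
      with elim show ?case by (simp add: g_def)
    qed
    ultimately have "((g \<circ> inverse) \<longlongrightarrow> - 0 * k 0 - (\<Sum>a\<in>?D. ?r a * 0 / (1 - a * 0))) (at 0)"
      by (rule Lim_transform_eventually)
    then show "(g \<longlongrightarrow> 0) at_infinity" by (simp add: lim_at_infinity_0)
  qed
  show pf: "f z = (\<Sum>a\<in>?D. ?r a / (z - a))" if "Pt z \<notin> D" for z
    using g0[of z] that by (simp add: g_def)
  have "k 0 = - (\<Sum>a\<in>?D. ?r a)"
  proof -
    have "((\<lambda>w. - (\<Sum>a\<in>?D. ?r a / (1 - a * w))) \<longlongrightarrow> - (\<Sum>a\<in>?D. ?r a / (1 - a * 0))) (at 0)"
      by (intro tendsto_intros) auto
    moreover have "\<forall>\<^sub>F w in at 0. - (\<Sum>a\<in>?D. ?r a / (1 - a * w)) = k w"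
    proof -
      have "\<forall>\<^sub>F w in at 0. inverse w \<notin> ?D"
      proof -
        have "open (- (inverse ` ?D - {0}))"
          using fin by (intro open_Compl finite_imp_closed finite_Diff finite_imageI)
        then have "\<forall>\<^sub>F w in at 0. w \<in> - (inverse ` ?D - {0})" by (rule eventually_at_in_open') simp
        with eventually_neq_at_within[of 0 0 UNIV] show ?thesis
        proof eventually_elim
          case (elim w)
          show ?case
          proof
            assume "inverse w \<in> ?D"
            then have "inverse (inverse w) \<in> inverse ` ?D" by (rule imageI)
            with elim show False by simp
          qed
        qed
      qed
      with finf eventually_neq_at_within[of 0 0 UNIV] show ?thesis
      proof eventually_elim
        case (elim w)
        have e: "?r a / (inverse w - a) = w * (?r a / (1 - a * w))" for a
        proof -
          have "inverse w - a = (1 - a * w) / w" using elim by (simp add: field_simps)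
          then show ?thesis by simp
        qed
        have "- w * k w = (\<Sum>a\<in>?D. ?r a / (inverse w - a))" using elim pf[of "inverse w"] by simp
        also have "\<dots> = w * (\<Sum>a\<in>?D. ?r a / (1 - a * w))" unfolding e sum_distrib_left ..
        finally have s: "- w * k w = w * (\<Sum>a\<in>?D. ?r a / (1 - a * w))" .
        have "w * - (\<Sum>a\<in>?D. ?r a / (1 - a * w)) = w * k w"
          unfolding mult_minus_right s[symmetric] by simp
        then have "w = 0 \<or> - (\<Sum>a\<in>?D. ?r a / (1 - a * w)) = k w" by (simp only: mult_cancel_left)
        with elim(2) show ?case by blast
      qed
    qed
    ultimately have "(k \<longlongrightarrow> - (\<Sum>a\<in>?D. ?r a / (1 - a * 0))) (at 0)" by (rule Lim_transform_eventually)
    from tendsto_unique[OF _ kcont this] show ?thesis by simp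
  qed
  moreover have "(\<Sum>y\<in>D. scalar_res f y) = (\<Sum>a\<in>?D. ?r a) + (if Pt_inf \<in> D then k 0 else 0)"
  proof -
    have im: "D - {Pt_inf} = Pt ` ?D"
      by (auto simp: image_iff) (metis cp1.exhaust)
    have "(\<Sum>y\<in>D - {Pt_inf}. scalar_res f y) = (\<Sum>a\<in>?D. ?r a)"
      unfolding im by (subst sum.reindex) (auto simp: inj_on_def)
    then show ?thesis
      using sum.remove[OF D, of Pt_inf "scalar_res f"] k(4) by (cases "Pt_inf \<in> D") auto
  qed
  ultimately show "(\<Sum>y\<in>D. scalar_res f y) = 0" using k(2) by auto
qed

text \<open>A marked point at infinity contributes no term: its residue is determined by the other ones.\<close>

definition pole_sum :: "('n::finite \<Rightarrow> cp1) \<Rightarrow> ('n \<Rightarrow> complex) \<Rightarrow> complex \<Rightarrow> complex" where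
  "pole_sum x r z = (\<Sum>i\<in>UNIV. case x i of Pt a \<Rightarrow> r i / (z - a) | Pt_inf \<Rightarrow> 0)"

text \<open>At infinity the vanishing of the sum of all residues gives the correct value of \<open>h\<close>.\<close>

lemma pole_sum_local:
  assumes r: "(\<Sum>i\<in>UNIV. r i) = 0"
  shows "\<exists>h. h analytic_on {0} \<and> h 0 = (\<Sum>i\<in>UNIV. if x i = y then r i else 0) \<and>
    (\<forall>\<^sub>F w in at 0. scalar_form_at (pole_sum x r) y w = h w / w)"
proof (cases y)
  case (Pt c)
  define h where "h = (\<lambda>w. \<Sum>i\<in>UNIV. case x i of Pt a \<Rightarrow> (if a = c then r i else r i * w / (c + w - a)) | Pt_inf \<Rightarrow> 0)"
  have "(\<lambda>w. case x i of Pt a \<Rightarrow> (if a = c then r i else r i * w / (c + w - a)) | Pt_inf \<Rightarrow> 0) analytic_on {0}" for i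
  proof (cases "x i")
    case (Pt a)
    then show ?thesis by (cases "a = c") (auto intro!: analytic_intros)
  qed (simp add: analytic_on_const)
  then have "h analytic_on {0}" unfolding h_def by (intro analytic_on_sum)
  moreover have "h 0 = (\<Sum>i\<in>UNIV. if x i = y then r i else 0)"
    unfolding h_def Pt by (intro sum.cong refl) (auto split: cp1.split)
  moreover have "\<forall>\<^sub>F w in at 0. scalar_form_at (pole_sum x r) y w = h w / w"
    using eventually_neq_at_within[of 0 0 UNIV]
  proof eventually_elim
    case (elim w)
    have "(case x i of Pt a \<Rightarrow> r i / (c + w - a) | Pt_inf \<Rightarrow> 0)
        = (case x i of Pt a \<Rightarrow> (if a = c then r i else r i * w / (c + w - a)) | Pt_inf \<Rightarrow> 0) / w" for i
      using elim by (auto split: cp1.split)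
    then show ?case unfolding Pt by (simp add: pole_sum_def h_def sum_divide_distrib)
  qed
  ultimately show ?thesis by blast
next
  case Pt_inf
  define h where "h = (\<lambda>w. - (\<Sum>i\<in>UNIV. case x i of Pt a \<Rightarrow> r i / (1 - a * w) | Pt_inf \<Rightarrow> 0))"
  have "(\<lambda>w. case x i of Pt a \<Rightarrow> r i / (1 - a * w) | Pt_inf \<Rightarrow> 0) analytic_on {0}" for i
    by (cases "x i") (auto intro!: analytic_intros)
  then have "h analytic_on {0}" unfolding h_def by (intro analytic_on_neg analytic_on_sum)
  moreover have "h 0 = (\<Sum>i\<in>UNIV. if x i = y then r i else 0)"
  proof -
    have "(\<Sum>i\<in>UNIV. if x i = y then r i else 0) + (\<Sum>i\<in>UNIV. case x i of Pt a \<Rightarrow> r i | Pt_inf \<Rightarrow> 0)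
        = (\<Sum>i\<in>UNIV. r i)"
      unfolding sum.distrib[symmetric] Pt_inf by (intro sum.cong refl) (simp split: cp1.split)
    then have "(\<Sum>i\<in>UNIV. if x i = y then r i else 0) = - (\<Sum>i\<in>UNIV. case x i of Pt a \<Rightarrow> r i | Pt_inf \<Rightarrow> 0)"
      unfolding r by (simp only: eq_neg_iff_add_eq_0)
    moreover have "h 0 = - (\<Sum>i\<in>UNIV. case x i of Pt a \<Rightarrow> r i | Pt_inf \<Rightarrow> 0)"
      by (simp add: h_def cong: cp1.case_cong)
    ultimately show ?thesis by (rule trans[OF _ sym, rotated])
  qed
  moreover have "\<forall>\<^sub>F w in at 0. scalar_form_at (pole_sum x r) y w = h w / w"
    using eventually_neq_at_within[of 0 0 UNIV]
  proof eventually_elim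
    case (elim w)
    have "(case x i of Pt a \<Rightarrow> r i / (1 / w - a) | Pt_inf \<Rightarrow> 0)
        = w * (case x i of Pt a \<Rightarrow> r i / (1 - a * w) | Pt_inf \<Rightarrow> 0)" for i
    proof (cases "x i")
      case (Pt a)
      have "1 / w - a = (1 - a * w) / w" using elim by (simp add: field_simps)
      with Pt show ?thesis by simp
    qed simp
    then have "pole_sum x r (1 / w) = w * - h w"
      by (simp add: pole_sum_def h_def sum_distrib_left)
    then show ?case unfolding Pt_inf using elim by (simp add: power2_eq_square)
  qed
  ultimately show ?thesis by blast
qed

lemma pole_sum_simple_pole:
  assumes "(\<Sum>i\<in>UNIV. r i) = 0"
  shows "scalar_simple_pole (range x) (pole_sum x r)"
  unfolding scalar_simple_pole_def
proof (intro conjI allI)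
  have "(\<lambda>z. case x i of Pt a \<Rightarrow> r i / (z - a) | Pt_inf \<Rightarrow> 0) holomorphic_on {z. Pt z \<notin> range x}" for i
  proof (cases "x i")
    case (Pt a)
    then have "Pt a \<in> range x" by (metis rangeI)
    then show ?thesis using Pt by (auto intro!: holomorphic_intros)
  qed simp
  then show "pole_sum x r holomorphic_on {z. Pt z \<notin> range x}"
    unfolding pole_sum_def by (intro holomorphic_on_sum)
  fix y
  obtain h where h: "h analytic_on {0}" "h 0 = (\<Sum>i\<in>UNIV. if x i = y then r i else 0)"
      "\<forall>\<^sub>F w in at 0. scalar_form_at (pole_sum x r) y w = h w / w"
    using pole_sum_local[OF assms] by metis
  moreover have "h 0 = 0" if "y \<notin> range x"
    unfolding h(2) using that by (intro sum.neutral) auto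
  ultimately show "\<exists>h. h analytic_on {0} \<and> (y \<notin> range x \<longrightarrow> h 0 = 0) \<and>
        (\<forall>\<^sub>F w in at 0. scalar_form_at (pole_sum x r) y w = h w / w)" by blast
qed

lemma pole_sum_res:
  assumes "(\<Sum>i\<in>UNIV. r i) = 0" "inj x"
  shows "scalar_res (pole_sum x r) (x j) = r j"
proof -
  obtain h where h: "h analytic_on {0}" "h 0 = (\<Sum>i\<in>UNIV. if x i = x j then r i else 0)"
      "\<forall>\<^sub>F w in at 0. scalar_form_at (pole_sum x r) (x j) w = h w / w"
    using pole_sum_local[OF assms(1)] by metis
  have "scalar_res (pole_sum x r) (x j) = h 0"
    unfolding scalar_res_def by (rule residue_quotient[OF h(1,3)])
  also have "\<dots> = (\<Sum>i\<in>UNIV. if i = j then r i else 0)"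
    unfolding h(2) using assms(2) by (intro sum.cong refl) (simp add: inj_eq)
  finally show ?thesis by simp
qed

lemma simple_pole_eq_pole_sum:
  assumes "inj x" "scalar_simple_pole (range x) f" "Pt z \<notin> range x"
  shows "f z = pole_sum x (\<lambda>i. scalar_res f (x i)) z" "(\<Sum>i\<in>UNIV. scalar_res f (x i)) = 0"
proof -
  have "(\<Sum>i\<in>UNIV. scalar_res f (x i)) = (\<Sum>y\<in>range x. scalar_res f y)"
    using sum.reindex[OF assms(1), of "scalar_res f"] by simp
  then show "(\<Sum>i\<in>UNIV. scalar_res f (x i)) = 0"
    using simple_pole_partial_fractions(2)[OF _ assms(2)] by simp
  have "f z = (\<Sum>a | Pt a \<in> range x. scalar_res f (Pt a) / (z - a))"
    using simple_pole_partial_fractions(1)[OF _ assms(2,3)] by simp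
  also have "\<dots> = (\<Sum>y\<in>range x - {Pt_inf}. case y of Pt a \<Rightarrow> scalar_res f y / (z - a) | Pt_inf \<Rightarrow> 0)"
  proof -
    have im: "range x - {Pt_inf} = Pt ` {a. Pt a \<in> range x}"
      by (auto simp: image_iff) (metis cp1.exhaust)
    show ?thesis unfolding im by (subst sum.reindex) (auto simp: inj_on_def)
  qed
  also have "\<dots> = (\<Sum>y\<in>range x. case y of Pt a \<Rightarrow> scalar_res f y / (z - a) | Pt_inf \<Rightarrow> 0)"
    by (rule sum.mono_neutral_left) auto
  also have "\<dots> = pole_sum x (\<lambda>i. scalar_res f (x i)) z"
    unfolding pole_sum_def by (subst sum.reindex[OF assms(1)]) (simp add: o_def)
  finally show "f z = pole_sum x (\<lambda>i. scalar_res f (x i)) z" .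
qed

subsection \<open>Line subbundles of nonnegative degree are constant\<close>

text \<open>A meromorphic section is only constrained on punctured neighbourhoods, so its values at the centres have to be
  replaced by limits.\<close>

lemma entire_from_punctured:
  fixes u :: "complex \<Rightarrow> complex"
  assumes loc: "\<And>c. \<exists>H. H analytic_on {c} \<and> (\<forall>\<^sub>F z in at c. u z = H z)"
  obtains F where "F holomorphic_on UNIV"
    "\<And>c H. H analytic_on {c} \<Longrightarrow> \<forall>\<^sub>F z in at c. u z = H z \<Longrightarrow> F c = H c \<and> (\<forall>\<^sub>F z in at c. u z = F z)"
proof -
  \<comment> \<open>\<open>Lim\<close> forgets the values of \<open>u\<close> at isolated points\<close>
  define F where "F = (\<lambda>c. Lim (at c) u)"
  have key: "\<forall>\<^sub>F z in nhds c. F z = H z" "\<forall>\<^sub>F z in at c. u z = F z"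
    if H: "H analytic_on {c}" and ev: "\<forall>\<^sub>F z in at c. u z = H z" for c H
  proof -
    have lim: "F z = H z" if "isCont H z" "\<forall>\<^sub>F y in at z. u y = H y" for z
    proof -
      have "(H \<longlongrightarrow> H z) (at z)" using that(1) by (simp add: isCont_def)
      then have "(u \<longlongrightarrow> H z) (at z)"
        using that(2) tendsto_cong by (metis (mono_tags, lifting))
      then show ?thesis unfolding F_def by (intro tendsto_Lim) auto
    qed
    obtain U where U: "open U" "c \<in> U" "H holomorphic_on U" using H by (auto simp: analytic_at)
    obtain V where V: "open V" "c \<in> V" "\<And>z. z \<in> V \<Longrightarrow> z \<noteq> c \<Longrightarrow> u z = H z"
      using ev unfolding eventually_at_topological by blast
    have eqF: "F z = H z" if z: "z \<in> U \<inter> V" for z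
    proof (rule lim)
      show "isCont H z"
        using U z holomorphic_on_imp_continuous_on continuous_on_eq_continuous_at by blast
      show "\<forall>\<^sub>F y in at z. u y = H y"
      proof (cases "z = c")
        case False
        have "\<forall>\<^sub>F y in at z. y \<in> V - {c}"
          using V(1) z False by (intro eventually_at_in_open') auto
        then show ?thesis by eventually_elim (use V(3) in auto)
      qed (use ev in simp)
    qed
    have nh: "\<forall>\<^sub>F z in nhds c. z \<in> U \<inter> V" using U V by (intro eventually_nhds_in_open) auto
    then show e: "\<forall>\<^sub>F z in nhds c. F z = H z" by eventually_elim (rule eqF)
    from e have "\<forall>\<^sub>F z in at c. F z = H z" by (simp add: eventually_at_filter eventually_mono)
    with ev show "\<forall>\<^sub>F z in at c. u z = F z" by eventually_elim simp
  qed
  show thesis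
  proof (rule that)
    show "F holomorphic_on UNIV"
    proof (rule analytic_imp_holomorphic, unfold analytic_on_analytic_at[of _ UNIV], intro ballI)
      fix c :: complex
      obtain H where H: "H analytic_on {c}" "\<forall>\<^sub>F z in at c. u z = H z" using loc by blast
      show "F analytic_on {c}" using key(1)[OF H] H(1) analytic_at_cong by blast
    qed
    show "F c = H c \<and> (\<forall>\<^sub>F z in at c. u z = F z)"
      if "H analytic_on {c}" "\<forall>\<^sub>F z in at c. u z = H z" for c H
      using key[OF that] eventually_nhds_x_imp_x by blast
  qed
qed

lemma is_line_iff: "is_line L \<longleftrightarrow> (\<exists>v. v \<noteq> 0 \<and> L = vec.span {v})"
proof
  assume "is_line L"
  then have L: "vec.subspace L" "vec.dim L = 1" by (simp_all add: is_line_def)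
  obtain B where B: "B \<subseteq> L" "vec.independent B" "L \<subseteq> vec.span B" "card B = 1"
    using vec.basis_exists[of L] L(2) by metis
  then obtain v where v: "B = {v}" by (metis card_1_singletonE)
  have "v \<noteq> 0" using B(2) unfolding v by (simp add: vec.dependent_single)
  moreover have "vec.span {v} \<subseteq> L" using B(1) L(1) unfolding v by (simp add: vec.span_minimal)
  ultimately show "\<exists>v. v \<noteq> 0 \<and> L = vec.span {v}" using B(3) unfolding v by blast
next
  assume "\<exists>v. v \<noteq> 0 \<and> L = vec.span {v}"
  then obtain v where v: "v \<noteq> 0" "L = vec.span {v}" by blast
  have "vec.dim {v} = 1" using v(1) by (intro vec.dim_eq_card_independent[THEN trans]) (simp_all add: vec.dependent_single)
  then show "is_line L" unfolding is_line_def v(2) by (simp add: vec.subspace_span)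
qed

lemma in_span_single: "w \<in> vec.span {v :: complex^2} \<longleftrightarrow> (\<exists>c. w = c *s v)"
  by (auto simp: vec.span_singleton)

lemma in_span_iff_minor:
  assumes "v \<noteq> (0 :: complex^2)"
  shows "w \<in> vec.span {v} \<longleftrightarrow> w $ 1 * v $ 2 = v $ 1 * w $ 2"
proof
  assume "w \<in> vec.span {v}"
  then show "w $ 1 * v $ 2 = v $ 1 * w $ 2" by (auto simp: in_span_single)
next
  assume m: "w $ 1 * v $ 2 = v $ 1 * w $ 2"
  have "v $ 1 \<noteq> 0 \<or> v $ 2 \<noteq> 0" using assms by (simp add: vec_eq_iff forall_2)
  then show "w \<in> vec.span {v}"
  proof
    assume "v $ 1 \<noteq> 0"
    then show ?thesis unfolding in_span_single using m
      by (intro exI[of _ "w $ 1 / v $ 1"]) (simp add: vec_eq_iff forall_2 field_simps)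
  next
    assume "v $ 2 \<noteq> 0"
    then show ?thesis unfolding in_span_single using m
      by (intro exI[of _ "w $ 2 / v $ 2"]) (simp add: vec_eq_iff forall_2 field_simps)
  qed
qed

lemma line_eq_span:
  assumes "is_line L" "c \<in> L" "c \<noteq> 0"
  shows "L = vec.span {c}"
proof -
  obtain v where v: "v \<noteq> 0" "L = vec.span {v}" using assms(1) by (auto simp: is_line_iff)
  then obtain k where k: "c = k *s v" using assms(2) by (auto simp: in_span_single)
  have "k \<noteq> 0" using k assms(3) by auto
  then have "v = inverse k *s c" using k by (simp add: vector_smult_assoc)
  then have "v \<in> vec.span {c}" by (auto simp: in_span_single)
  then have "L \<subseteq> vec.span {c}" unfolding v(2) by (simp add: vec.span_minimal)
  moreover have "vec.span {c} \<subseteq> L" using assms(2) unfolding v(2) by (simp add: vec.span_minimal)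
  ultimately show ?thesis by blast
qed

lemma prod_power_int:
  assumes "(w :: complex) \<noteq> 0"
  shows "(\<Prod>b\<in>B. w powi g b) = w powi (\<Sum>b\<in>B. g b)"
  using assms by (induction B rule: infinite_finite_induct) (simp_all add: power_int_add)

text \<open>Clearing zeros and poles by a rational function turns a meromorphic section into a pair of
  entire functions without common zero, which grow like \<open>z ^ (- d)\<close>.  For \<open>d \<ge> 0\<close> they are constant by Liouville's theorem.\<close>

lemma nonneg_degree_constant:
  assumes L: "line_subbundle L" and deg: "has_degree L d" and d: "d \<ge> 0"
  obtains c where "c \<noteq> 0" "\<And>y. L y = vec.span {c}"
proof -
  obtain \<sigma> ord where loc: "\<forall>y. \<exists>s. frame_germ s \<and> (\<forall>\<^sub>F w in at 0. s w \<in> L (local_coord y w) \<and>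
        \<sigma> (local_coord y w) = w powi (ord y) *s s w)"
    and fin: "finite {y. ord y \<noteq> 0}" and dsum: "d = (\<Sum>y | ord y \<noteq> 0. ord y)"
    using deg unfolding has_degree_def by (elim exE conjE)
  from choice[OF loc] obtain s where "\<forall>y. frame_germ (s y) \<and> (\<forall>\<^sub>F w in at 0. s y w \<in> L (local_coord y w) \<and>
        \<sigma> (local_coord y w) = w powi (ord y) *s s y w)" by (elim exE)
  then have s: "frame_germ (s y)"
      "\<forall>\<^sub>F w in at 0. s y w \<in> L (local_coord y w) \<and> \<sigma> (local_coord y w) = w powi (ord y) *s s y w" for y
    by blast+
  define B where "B = {b. ord (Pt b) \<noteq> 0}"
  have finB: "finite B" using finite_finite_part[OF fin] by (simp add: B_def)
  \<comment> \<open>\<open>R B\<close> clears the zeros and poles of \<open>\<sigma>\<close> at finite points; \<open>H c\<close> is the resulting section near \<open>c\<close> and \<open>K\<close> the one near infinity\<close>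
  define R where "R = (\<lambda>C z. \<Prod>b\<in>C. (z - b) powi (- ord (Pt b)))"
  define u where "u = (\<lambda>a z. R B z * \<sigma> (Pt z) $ a)"
  define H where "H = (\<lambda>c a z. R (B - {c}) z * s (Pt c) (z - c) $ a)"
  have Ran: "R (B - {c}) analytic_on {c}" "R (B - {c}) c \<noteq> 0" for c
  proof -
    show "R (B - {c}) analytic_on {c}" unfolding R_def
      by (intro analytic_on_prod analytic_on_power_int analytic_intros) auto
    show "R (B - {c}) c \<noteq> 0" unfolding R_def using finB by simp
  qed
  have san: "(\<lambda>z. s (Pt c) (z - c) $ a) analytic_on {c}" for c a
  proof -
    have "(\<lambda>w. s (Pt c) w $ a) analytic_on {c - c}" using s(1)[of "Pt c"] by (simp add: frame_germ_def)
    then have "(\<lambda>w. s (Pt c) w $ a) \<circ> (\<lambda>z. z - c) analytic_on {c}"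
      by (intro analytic_on_compose) (auto intro!: analytic_intros)
    then show ?thesis by (simp add: o_def)
  qed
  have Han: "H c a analytic_on {c}" for c a
    unfolding H_def by (intro analytic_on_mult Ran san)
  have ev: "\<forall>\<^sub>F z in at c. u a z = H c a z" for c a
  proof -
    have "\<forall>\<^sub>F w in at 0. \<sigma> (Pt (c + w)) = w powi (ord (Pt c)) *s s (Pt c) w"
      using s(2)[of "Pt c"] by eventually_elim simp
    then have "\<forall>\<^sub>F z in at c. \<sigma> (Pt z) = (z - c) powi (ord (Pt c)) *s s (Pt c) (z - c)"
      unfolding eventually_at_to_0[of _ c] by (simp add: add.commute)
    then show ?thesis using eventually_neq_at_within[of c c UNIV]
    proof eventually_elim
      case (elim z)
      have "R B z * (z - c) powi (ord (Pt c)) = R (B - {c}) z"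
      proof (cases "c \<in> B")
        case True
        have "R B z = (z - c) powi (- ord (Pt c)) * R (B - {c}) z"
          unfolding R_def using finB True by (rule prod.remove)
        moreover have "(z - c) powi (- ord (Pt c)) * (z - c) powi (ord (Pt c)) = 1"
          using elim(2) by (simp add: power_int_minus)
        ultimately show ?thesis by simp
      next
        case False
        then show ?thesis by (simp add: B_def)
      qed
      then show ?case unfolding u_def H_def elim(1) by (simp add: mult.assoc[symmetric])
    qed
  qed
  have "\<forall>a. \<exists>F. F holomorphic_on UNIV \<and> (\<forall>c H. H analytic_on {c} \<longrightarrow> (\<forall>\<^sub>F z in at c. u a z = H z) \<longrightarrow>
      F c = H c \<and> (\<forall>\<^sub>F z in at c. u a z = F z))"
  proof
    fix a
    have "\<exists>H. H analytic_on {c} \<and> (\<forall>\<^sub>F z in at c. u a z = H z)" for c using Han ev by blast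
    from entire_from_punctured[of "u a", OF this]
    show "\<exists>F. F holomorphic_on UNIV \<and> (\<forall>c H. H analytic_on {c} \<longrightarrow> (\<forall>\<^sub>F z in at c. u a z = H z) \<longrightarrow>
      F c = H c \<and> (\<forall>\<^sub>F z in at c. u a z = F z))" by metis
  qed
  from choice[OF this] obtain F where F: "\<And>a. F a holomorphic_on UNIV"
      "\<And>a c H. H analytic_on {c} \<Longrightarrow> \<forall>\<^sub>F z in at c. u a z = H z \<Longrightarrow> F a c = H c \<and> (\<forall>\<^sub>F z in at c. u a z = F a z)"
    by blast
  define K where "K = (\<lambda>a w. w powi d * (\<Prod>b\<in>B. (1 - b * w) powi (- ord (Pt b))) * s Pt_inf w $ a)"
  have dB: "d = (\<Sum>b\<in>B. ord (Pt b)) + ord Pt_inf"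
  proof -
    have im: "{y. ord y \<noteq> 0} - {Pt_inf} = Pt ` B"
      by (auto simp: image_iff B_def) (metis cp1.exhaust)
    have "(\<Sum>y\<in>{y. ord y \<noteq> 0} - {Pt_inf}. ord y) = (\<Sum>b\<in>B. ord (Pt b))"
      unfolding im by (subst sum.reindex) (auto simp: inj_on_def)
    then show ?thesis unfolding dsum using sum.remove[OF fin, of Pt_inf ord] by (cases "ord Pt_inf = 0") auto
  qed
  have uK: "\<forall>\<^sub>F w in at 0. u a (inverse w) = K a w" for a
  proof -
    have "\<forall>\<^sub>F w in at 0. \<sigma> (local_coord Pt_inf w) = w powi (ord Pt_inf) *s s Pt_inf w"
      using s(2)[of Pt_inf] by eventually_elim simp
    then show ?thesis using eventually_neq_at_within[of 0 0 UNIV]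
    proof eventually_elim
      case (elim w)
      have "(inverse w - b) powi (- ord (Pt b)) = w powi (ord (Pt b)) * (1 - b * w) powi (- ord (Pt b))" for b
      proof -
        have "inverse w - b = inverse w * (1 - b * w)" using elim(2) by (simp add: field_simps)
        then show ?thesis by (simp add: power_int_mult_distrib power_int_minus power_int_inverse)
      qed
      then have "R B (inverse w) = (\<Prod>b\<in>B. w powi (ord (Pt b))) * (\<Prod>b\<in>B. (1 - b * w) powi (- ord (Pt b)))"
        unfolding R_def by (simp add: prod.distrib)
      also have "(\<Prod>b\<in>B. w powi (ord (Pt b))) = w powi (\<Sum>b\<in>B. ord (Pt b))"
        by (rule prod_power_int[OF elim(2)])
      finally have R: "R B (inverse w) = w powi (\<Sum>b\<in>B. ord (Pt b)) * (\<Prod>b\<in>B. (1 - b * w) powi (- ord (Pt b)))" .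
      have "\<sigma> (Pt (inverse w)) = w powi (ord Pt_inf) *s s Pt_inf w"
        using elim by (simp add: inverse_eq_divide)
      then show ?case unfolding u_def K_def R dB using elim(2) by (simp add: power_int_add)
    qed
  qed
  have Kan: "K a analytic_on {0}" for a
  proof -
    have e: "w powi d = w ^ nat d" for w :: complex using d by (simp add: power_int_def)
    have "(\<lambda>w. s Pt_inf w $ a) analytic_on {0}" using s(1)[of Pt_inf] by (simp add: frame_germ_def)
    then show ?thesis unfolding K_def e
      by (intro analytic_on_mult analytic_on_prod analytic_on_power_int analytic_on_power analytic_intros) auto
  qed
  have FK: "\<forall>\<^sub>F w in at 0. F a (inverse w) = K a w \<and> u a (inverse w) = K a w" for a
  proof -
    obtain U where U: "open U" "0 \<in> U" "K a holomorphic_on U" using Kan[of a] by (auto simp: analytic_at)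
    obtain V where V: "open V" "0 \<in> V" "\<And>w. w \<in> V \<Longrightarrow> w \<noteq> 0 \<Longrightarrow> u a (inverse w) = K a w"
      using uK[of a] unfolding eventually_at_topological by blast
    have "F a (inverse w) = K a w" if w: "w \<in> U \<inter> V" "w \<noteq> 0" for w
    proof -
      let ?c = "inverse w"
      have "K a analytic_on {inverse ?c}" using U w(1) by (auto simp: analytic_at)
      then have "K a \<circ> inverse analytic_on {?c}"
        using w(2) by (intro analytic_on_compose) (auto intro!: analytic_intros)
      moreover have "\<forall>\<^sub>F z in at ?c. u a z = (K a \<circ> inverse) z"
      proof -
        have "(inverse \<longlongrightarrow> inverse ?c) (at ?c)" using w(2) by (intro tendsto_intros) auto
        then have "\<forall>\<^sub>F z in at ?c. inverse z \<in> V - {0}"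
          using V(1) w by (intro topological_tendstoD) auto
        then show ?thesis
        proof eventually_elim
          case (elim z)
          then show ?case using V(3)[of "inverse z"] by simp
        qed
      qed
      ultimately have "F a ?c = (K a \<circ> inverse) ?c" using F(2) by blast
      then show ?thesis by simp
    qed
    moreover have "\<forall>\<^sub>F w in at 0. w \<in> U \<inter> V" using U V by (intro eventually_at_in_open') auto
    ultimately show ?thesis using eventually_neq_at_within[of 0 0 UNIV]
      by (auto elim!: eventually_elim2 intro: V(3))
  qed
  have const: "F a z = K a 0" for a z
  proof (rule Liouville_weak[OF F(1)])
    have "(K a \<longlongrightarrow> K a 0) (at 0)" using Kan analytic_at_imp_isCont isCont_def by blast
    moreover have "\<forall>\<^sub>F w in at 0. K a w = (F a \<circ> inverse) w" using FK[of a] by eventually_elim simp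
    ultimately have "((F a \<circ> inverse) \<longlongrightarrow> K a 0) (at 0)" by (rule Lim_transform_eventually)
    then show "(F a \<longlongrightarrow> K a 0) at_infinity" by (simp add: lim_at_infinity_0)
  qed
  define c :: "complex^2" where "c = (\<chi> a. K a 0)"
  have FH: "F a z = H z a z" for a z using F(2)[OF Han ev] by blast
  \<comment> \<open>the frame of \<open>L\<close> at the point \<open>0\<close> does not vanish, and \<open>R\<close> has no zero there\<close>
  have "c \<noteq> 0"
  proof
    assume "c = 0"
    then have "H 0 a 0 = 0" for a using const[of a 0] FH[of a 0] by (simp add: c_def vec_eq_iff)
    then have "s (Pt 0) 0 = 0" using Ran(2)[of 0] by (simp add: H_def vec_eq_iff)
    then show False using s(1)[of "Pt 0"] by (simp add: frame_germ_def)
  qed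
  have isL: "is_line (L y)" for y using L by (simp add: line_subbundle_def)
  have sub: "k *s v \<in> L y" if "v \<in> L y" for k v y
    using isL[of y] that by (simp add: is_line_def vec.subspace_scale)
  have cL: "\<forall>\<^sub>F w in at 0. c \<in> L (local_coord y w)" for y
  proof (cases y)
    case (Pt b)
    have ev': "\<forall>\<^sub>F z in at b. u a z = F a z" for a using F(2)[OF Han ev] by blast
    have "\<forall>\<^sub>F z in at b. u 1 z = F 1 z \<and> u 2 z = F 2 z"
      using ev'[of 1] ev'[of 2] by eventually_elim simp
    then have "\<forall>\<^sub>F w in at 0. u 1 (b + w) = F 1 (b + w) \<and> u 2 (b + w) = F 2 (b + w)"
      unfolding eventually_at_to_0[of _ b] by (simp add: add.commute)
    with s(2)[of y] show ?thesis
    proof eventually_elim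
      case (elim w)
      have "c = R B (b + w) *s \<sigma> (Pt (b + w))"
        using elim(2) const by (simp add: u_def c_def vec_eq_iff forall_2)
      also have "\<dots> = (R B (b + w) * w powi (ord y)) *s s y w"
        using elim(1) Pt by (simp add: vector_smult_assoc)
      finally show ?case using sub elim(1) by metis
    qed
  next
    case Pt_inf
    show ?thesis
      using s(2)[of y] FK[of 1] FK[of 2] eventually_neq_at_within[of 0 0 UNIV]
    proof eventually_elim
      case (elim w)
      have "c = R B (inverse w) *s \<sigma> (Pt (inverse w))"
        using elim(2,3) const by (simp add: u_def c_def vec_eq_iff forall_2)
      also have "\<sigma> (Pt (inverse w)) = w powi (ord y) *s s y w"
        using elim(1,4) Pt_inf by (simp add: inverse_eq_divide)
      finally have "c = (R B (inverse w) * w powi (ord y)) *s s y w" by (simp add: vector_smult_assoc)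
      then show ?case using sub elim(1) by metis
    qed
  qed
  have "c \<in> L y" for y
  proof -
    obtain t where t: "frame_germ t" "\<forall>\<^sub>F w in nhds 0. L (local_coord y w) = vec.span {t w}"
      using L unfolding line_subbundle_def by blast
    have tc: "((\<lambda>w. t w $ a) \<longlongrightarrow> t 0 $ a) (at 0)" for a
      using t(1) analytic_at_imp_isCont unfolding frame_germ_def isCont_def by blast
    have t0: "t 0 \<noteq> 0" using t(1) by (simp add: frame_germ_def)
    have "\<forall>\<^sub>F w in at 0. L (local_coord y w) = vec.span {t w}"
      using t(2) by (simp add: eventually_at_filter eventually_mono)
    with cL[of y] have E: "\<forall>\<^sub>F w in at 0. c $ 1 * t w $ 2 - t w $ 1 * c $ 2 = 0"
      by eventually_elim (auto simp: in_span_single)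
    have T: "((\<lambda>w. c $ 1 * t w $ 2 - t w $ 1 * c $ 2) \<longlongrightarrow> c $ 1 * t 0 $ 2 - t 0 $ 1 * c $ 2) (at 0)"
      by (intro tendsto_intros tc)
    have "((\<lambda>w. 0) \<longlongrightarrow> c $ 1 * t 0 $ 2 - t 0 $ 1 * c $ 2) (at (0::complex))"
      by (rule Lim_transform_eventually[OF T E])
    then have "c $ 1 * t 0 $ 2 - t 0 $ 1 * c $ 2 = 0" by (simp add: tendsto_const_iff)
    then have "c \<in> vec.span {t 0}" using in_span_iff_minor[OF t0] by simp
    moreover have "L y = vec.span {t 0}"
      using eventually_nhds_x_imp_x[OF t(2)] by (cases y) simp_all
    ultimately show ?thesis by simp
  qed
  then have "L y = vec.span {c}" for y using line_eq_span[OF isL _ \<open>c \<noteq> 0\<close>] by blast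
  with \<open>c \<noteq> 0\<close> show thesis by (rule that)
qed

text \<open>Constant subbundles are the test objects for stability and the summands \<open>L\<^sub>0\<close>, \<open>L\<^sub>1\<close> of the component.\<close>

lemma constant_line_subbundle:
  assumes "v \<noteq> 0"
  shows "line_subbundle (\<lambda>y. vec.span {v})" "has_degree (\<lambda>y. vec.span {v}) 0"
    "trivial_line_subbundle (\<lambda>y. vec.span {v})"
proof -
  have fr: "frame_germ (\<lambda>w. v)" using assms by (simp add: frame_germ_def)
  have vs: "v \<in> vec.span {v}" by (simp add: vec.span_base)
  show 1: "line_subbundle (\<lambda>y. vec.span {v})"
    unfolding line_subbundle_def using fr assms by (auto simp: is_line_iff)
  show "has_degree (\<lambda>y. vec.span {v}) 0"
    unfolding has_degree_def using fr vs by (intro exI[of _ "\<lambda>y. v"] exI[of _ "\<lambda>y. 0"]) auto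
  show "trivial_line_subbundle (\<lambda>y. vec.span {v})"
    unfolding trivial_line_subbundle_def using 1 vs assms
    by (intro conjI exI[of _ "\<lambda>y. v"]) (auto simp: holomorphic_cp1_def)
qed

lemma trivial_line_subbundle_constant:
  assumes "trivial_line_subbundle L"
  obtains v where "v \<noteq> 0" "\<And>y. L y = vec.span {v}"
proof -
  obtain s where s: "\<And>a. holomorphic_cp1 (\<lambda>y. s y $ a)" "\<And>y. s y \<noteq> 0 \<and> s y \<in> L y"
    using assms by (auto simp: trivial_line_subbundle_def)
  have "s y = s Pt_inf" for y
    using holomorphic_cp1_constant[OF s(1)] by (simp add: vec_eq_iff)
  moreover have "is_line (L y)" for y
    using assms by (simp add: trivial_line_subbundle_def line_subbundle_def)
  ultimately have "L y = vec.span {s Pt_inf}" for y using s(2)[of y] line_eq_span by metis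
  with s(2) show thesis using that by blast
qed

section \<open>Higgs bundles as tuples of nilpotent matrices\<close>

definition nilpotent2 :: "complex^2^2 \<Rightarrow> bool" where
  "nilpotent2 M \<longleftrightarrow> M \<noteq> 0 \<and> M $ 2 $ 2 = - M $ 1 $ 1 \<and> M $ 1 $ 1 * M $ 1 $ 1 + M $ 1 $ 2 * M $ 2 $ 1 = 0"

definition kernel :: "complex^2^2 \<Rightarrow> (complex^2) set" where
  "kernel M = {v. M *v v = 0}"

lemma mat2_eq_iff: "(M :: complex^2^2) = N \<longleftrightarrow> M $ 1 $ 1 = N $ 1 $ 1 \<and> M $ 1 $ 2 = N $ 1 $ 2 \<and>
    M $ 2 $ 1 = N $ 2 $ 1 \<and> M $ 2 $ 2 = N $ 2 $ 2"
  by (auto simp: vec_eq_iff forall_2)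

lemma mult2_nth:
  "((M :: complex^2^2) ** N) $ a $ b = M $ a $ 1 * N $ 1 $ b + M $ a $ 2 * N $ 2 $ b"
  "((M :: complex^2^2) *v v) $ a = M $ a $ 1 * v $ 1 + M $ a $ 2 * v $ 2"
  by (simp_all add: matrix_matrix_mult_def matrix_vector_mult_def sum_2)

lemma vec2_eq_iff: "(v :: complex^2) = w \<longleftrightarrow> v $ 1 = w $ 1 \<and> v $ 2 = w $ 2"
  by (auto simp: vec_eq_iff forall_2)

lemma mat2_scale: "(M :: complex^2^2) *v (k *s v) = k *s (M *v v)"
  by (simp add: vec2_eq_iff mult2_nth algebra_simps)

lemma mat2_zero: "(M :: complex^2^2) ** 0 = 0" "0 ** (M :: complex^2^2) = 0"
  by (simp_all add: mat2_eq_iff mult2_nth)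

text \<open>A nonzero nilpotent matrix is a multiple of \<open>w \<otimes> \<omega>(w, -)\<close> for the symplectic form \<open>\<omega>\<close>.\<close>

lemma nilpotent2_form:
  assumes "nilpotent2 M"
  obtains w :: "complex^2" and c where "w \<noteq> 0" "c \<noteq> 0" "M $ 1 $ 1 = c * w $ 1 * w $ 2" "M $ 1 $ 2 = - (c * w $ 1 * w $ 1)"
    "M $ 2 $ 1 = c * w $ 2 * w $ 2" "M $ 2 $ 2 = - (c * w $ 1 * w $ 2)"
proof (cases "M $ 1 $ 2 = 0")
  case True
  then have "M $ 1 $ 1 = 0" "M $ 2 $ 2 = 0" "M $ 2 $ 1 \<noteq> 0"
    using assms by (auto simp: nilpotent2_def mat2_eq_iff)
  with True show thesis by (intro that[of "vector [0, 1]" "M $ 2 $ 1"]) (auto simp: vec2_eq_iff)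
next
  case False
  have "M $ 1 $ 1 * M $ 1 $ 1 = - (M $ 1 $ 2 * M $ 2 $ 1)" "M $ 2 $ 2 = - M $ 1 $ 1"
    using assms by (auto simp: nilpotent2_def eq_neg_iff_add_eq_0)
  with False show thesis
    by (intro that[of "vector [1, - M $ 1 $ 1 / M $ 1 $ 2]" "- M $ 1 $ 2"]) (auto simp: vec2_eq_iff)
qed

lemma kernel_eq_span:
  assumes M: "M \<noteq> 0" and w: "w \<noteq> 0" "M *v w = 0"
  shows "kernel M = vec.span {w}"
proof (intro equalityI subsetI)
  fix v assume "v \<in> kernel M"
  then have v: "M $ a $ 1 * v $ 1 + M $ a $ 2 * v $ 2 = 0" for a
    by (simp add: kernel_def vec_eq_iff mult2_nth)
  have w': "M $ a $ 1 * w $ 1 + M $ a $ 2 * w $ 2 = 0" for a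
    using w(2) by (simp add: vec_eq_iff mult2_nth)
  have "M $ a $ 1 * (v $ 1 * w $ 2 - w $ 1 * v $ 2) = 0" "M $ a $ 2 * (v $ 1 * w $ 2 - w $ 1 * v $ 2) = 0" for a
    using v[of a] w'[of a] by algebra+
  then have "v $ 1 * w $ 2 = w $ 1 * v $ 2" using M by (auto simp: mat2_eq_iff)
  then show "v \<in> vec.span {w}" using in_span_iff_minor[OF w(1)] by simp
next
  fix v assume "v \<in> vec.span {w}"
  then obtain k where "v = k *s w" by (auto simp: in_span_single)
  then have "M *v v = k *s (M *v w)" by (simp add: mat2_scale)
  then show "v \<in> kernel M" using w(2) by (simp add: kernel_def)
qed

lemma nilpotent2_kernel:
  assumes "nilpotent2 M"
  shows "is_line (kernel M)" "M *v v \<in> kernel M"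
proof -
  obtain w :: "complex^2" and c where w: "w \<noteq> 0" "c \<noteq> 0" "M $ 1 $ 1 = c * w $ 1 * w $ 2" "M $ 1 $ 2 = - (c * w $ 1 * w $ 1)"
    "M $ 2 $ 1 = c * w $ 2 * w $ 2" "M $ 2 $ 2 = - (c * w $ 1 * w $ 2)"
    using nilpotent2_form[OF assms] .
  have "M *v w = 0" by (simp add: vec2_eq_iff mult2_nth w)
  then have "kernel M = vec.span {w}" using kernel_eq_span w(1) assms by (simp add: nilpotent2_def)
  then show "is_line (kernel M)" using w(1) by (auto simp: is_line_iff)
  show "M *v v \<in> kernel M" by (simp add: kernel_def vec2_eq_iff mult2_nth w algebra_simps)
qed

text \<open>The conditions on residues at a flag say exactly that the residue, if nonzero, is nilpotent with the flag as kernel; the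
  flags of a stable Higgs bundle carry no information of their own.\<close>

lemma nilpotent2_of_flag:
  assumes M: "M \<noteq> 0" and X: "is_line X" "\<And>v. M *v v \<in> X" "\<And>v. v \<in> X \<Longrightarrow> M *v v = 0"
  shows "nilpotent2 M" "X = kernel M"
proof -
  obtain w where w: "w \<noteq> 0" "X = vec.span {w}" using X(1) by (auto simp: is_line_iff)
  then have "M *v w = 0" using X(3)[of w] vec.span_base[of w "{w}"] by simp
  then show "X = kernel M" using kernel_eq_span[OF M w(1)] w(2) by simp
  have "M *v (M *v v) = 0" for v using X(2,3) by blast
  from this[of "vector [1, 0]"] this[of "vector [0, 1]"]
  have e: "M $ 1 $ 1 * M $ 1 $ 1 + M $ 1 $ 2 * M $ 2 $ 1 = 0" "M $ 2 $ 1 * M $ 1 $ 1 + M $ 2 $ 2 * M $ 2 $ 1 = 0"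
      "M $ 1 $ 1 * M $ 1 $ 2 + M $ 1 $ 2 * M $ 2 $ 2 = 0" "M $ 2 $ 1 * M $ 1 $ 2 + M $ 2 $ 2 * M $ 2 $ 2 = 0"
    by (simp_all add: vec2_eq_iff mult2_nth)
  have "M $ 1 $ 1 + M $ 2 $ 2 = 0"
  proof (cases "M $ 1 $ 2 = 0 \<and> M $ 2 $ 1 = 0")
    case True
    with e show ?thesis by simp
  next
    case False
    moreover have "M $ 1 $ 2 * (M $ 1 $ 1 + M $ 2 $ 2) = 0" "M $ 2 $ 1 * (M $ 1 $ 1 + M $ 2 $ 2) = 0"
      using e by algebra+
    ultimately show ?thesis by auto
  qed
  then show "nilpotent2 M" using e(1) M by (simp add: nilpotent2_def eq_neg_iff_add_eq_0 add.commute)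
qed

lemma pair_trace_eq_0_iff:
  assumes "nilpotent2 (N i)" "nilpotent2 (N k)"
  shows "pair_trace N i k = 0 \<longleftrightarrow> kernel (N i) = kernel (N k)"
proof -
  obtain w :: "complex^2" and c where w: "w \<noteq> 0" "c \<noteq> 0" "N i $ 1 $ 1 = c * w $ 1 * w $ 2" "N i $ 1 $ 2 = - (c * w $ 1 * w $ 1)"
    "N i $ 2 $ 1 = c * w $ 2 * w $ 2" "N i $ 2 $ 2 = - (c * w $ 1 * w $ 2)"
    using nilpotent2_form[OF assms(1)] .
  obtain u :: "complex^2" and d where u: "u \<noteq> 0" "d \<noteq> 0" "N k $ 1 $ 1 = d * u $ 1 * u $ 2" "N k $ 1 $ 2 = - (d * u $ 1 * u $ 1)"
    "N k $ 2 $ 1 = d * u $ 2 * u $ 2" "N k $ 2 $ 2 = - (d * u $ 1 * u $ 2)"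
    using nilpotent2_form[OF assms(2)] .
  have kw: "kernel (N i) = vec.span {w}"
    using assms(1) by (intro kernel_eq_span w(1)) (simp_all add: nilpotent2_def vec2_eq_iff mult2_nth w)
  have ku: "kernel (N k) = vec.span {u}"
    using assms(2) by (intro kernel_eq_span u(1)) (simp_all add: nilpotent2_def vec2_eq_iff mult2_nth u)
  have "pair_trace N i k = - (c * d) * (w $ 1 * u $ 2 - u $ 1 * w $ 2)\<^sup>2"
    unfolding pair_trace_expand w u by (simp add: power2_eq_square algebra_simps)
  then have "pair_trace N i k = 0 \<longleftrightarrow> w $ 1 * u $ 2 = u $ 1 * w $ 2" using w(2) u(2) by simp
  also have "\<dots> \<longleftrightarrow> w \<in> vec.span {u}" using in_span_iff_minor[OF u(1)] by simp
  also have "\<dots> \<longleftrightarrow> kernel (N i) = kernel (N k)"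
  proof
    assume "w \<in> vec.span {u}"
    moreover have "is_line (vec.span {u})" using u(1) by (auto simp: is_line_iff)
    ultimately show "kernel (N i) = kernel (N k)" unfolding kw ku using line_eq_span w(1) by blast
  next
    assume "kernel (N i) = kernel (N k)"
    then show "w \<in> vec.span {u}" unfolding kw ku using vec.span_base[of w "{w}"] by simp
  qed
  finally show ?thesis .
qed

subsection \<open>Higgs fields with prescribed residues\<close>

lemma eventually_local_coord:
  assumes "finite D"
  shows "\<forall>\<^sub>F w in at 0. local_coord y w \<notin> D"
proof -
  have "inj (local_coord y)" by (cases y) (auto simp: inj_on_def split: if_splits)
  then have "finite (local_coord y -` D)" using assms by (rule finite_vimageI[rotated])
  then have "open (- (local_coord y -` D - {0}))" by (intro open_Compl finite_imp_closed finite_Diff)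
  then have "\<forall>\<^sub>F w in at 0. w \<in> - (local_coord y -` D - {0})" by (rule eventually_at_in_open') simp
  with eventually_neq_at_within[of 0 0 UNIV] show ?thesis by eventually_elim auto
qed

lemma pole_sum_linear:
  "pole_sum x (\<lambda>i. r i + s i) z = pole_sum x r z + pole_sum x s z"
  "pole_sum x (\<lambda>i. r i - s i) z = pole_sum x r z - pole_sum x s z"
  "pole_sum x (\<lambda>i. k * r i) z = k * pole_sum x r z"
  "pole_sum x (\<lambda>i. r i * k) z = pole_sum x r z * k"
  unfolding pole_sum_def
  by (simp_all add: sum_distrib_left sum_distrib_right flip: sum.distrib sum_subtractf)
    (intro sum.cong refl, simp split: cp1.split add: add_divide_distrib diff_divide_distrib)+

lemma pole_sum_zero: "pole_sum x (\<lambda>i. 0) z = 0"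
  unfolding pole_sum_def by (intro sum.neutral ballI) (simp split: cp1.split)

text \<open>Uniqueness of partial fractions: a linear relation between Higgs fields is one between their residues.\<close>

lemma pole_sum_eq_0D:
  assumes "inj x" "(\<Sum>i\<in>UNIV. r i) = 0" "\<And>z. Pt z \<notin> range x \<Longrightarrow> pole_sum x r z = 0"
  shows "r j = 0"
proof -
  have "\<forall>\<^sub>F w in at 0. scalar_form_at (pole_sum x r) (x j) w = 0"
    using eventually_local_coord[of "range x" "x j"] eventually_neq_at_within[of 0 0 UNIV]
    by (auto elim!: eventually_elim2) (cases "x j"; simp add: assms(3))
  then have "residue (scalar_form_at (pole_sum x r) (x j)) 0 = residue (\<lambda>w. 0) 0"
    by (intro residue_cong) simp_all
  then have "scalar_res (pole_sum x r) (x j) = 0" by (simp add: scalar_res_def residue_const)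
  then show ?thesis using pole_sum_res[OF assms(2,1)] by simp
qed

definition residue_form :: "('n::finite \<Rightarrow> cp1) \<Rightarrow> ('n \<Rightarrow> complex^2^2) \<Rightarrow> complex \<Rightarrow> complex^2^2" where
  "residue_form x N z = (\<chi> a b. pole_sum x (\<lambda>i. N i $ a $ b) z)"

abbreviation residues_of :: "('n::finite \<Rightarrow> cp1) \<Rightarrow> (complex \<Rightarrow> complex^2^2) \<Rightarrow> 'n \<Rightarrow> complex^2^2" where
  "residues_of x \<phi> \<equiv> \<lambda>i. Res \<phi> (x i)"

lemma simple_pole_form_residues:
  assumes "inj x" "simple_pole_form (range x) \<phi>"
  shows "Pt z \<notin> range x \<Longrightarrow> \<phi> z = residue_form x (residues_of x \<phi>) z"
    and "(\<Sum>i\<in>UNIV. Res \<phi> (x i) $ a $ b) = 0"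
proof -
  have s: "scalar_simple_pole (range x) (\<lambda>z. \<phi> z $ a $ b)" for a b
    using assms(2) by (simp add: simple_pole_form_iff)
  show "\<phi> z = residue_form x (residues_of x \<phi>) z" if "Pt z \<notin> range x"
    using simple_pole_eq_pole_sum(1)[OF assms(1) s that] by (simp add: residue_form_def Res_nth vec_eq_iff)
  have "(\<Sum>y\<in>range x. scalar_res (\<lambda>z. \<phi> z $ a $ b) y) = 0"
    using simple_pole_partial_fractions(2)[OF _ s] by simp
  then show "(\<Sum>i\<in>UNIV. Res \<phi> (x i) $ a $ b) = 0"
    using sum.reindex[OF assms(1), of "scalar_res (\<lambda>z. \<phi> z $ a $ b)"] by (simp add: Res_nth)
qed

lemma residue_form_props:
  assumes "inj x" "\<And>a b. (\<Sum>i\<in>UNIV. N i $ a $ b) = 0"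
  shows "simple_pole_form (range x) (residue_form x N)" "residues_of x (residue_form x N) = N"
proof -
  have e: "(\<lambda>z. residue_form x N z $ a $ b) = pole_sum x (\<lambda>i. N i $ a $ b)" for a b
    by (simp add: residue_form_def fun_eq_iff)
  show "simple_pole_form (range x) (residue_form x N)"
    unfolding simple_pole_form_iff e using pole_sum_simple_pole assms(2) by blast
  show "residues_of x (residue_form x N) = N"
    using pole_sum_res[OF assms(2,1)] by (simp add: fun_eq_iff vec_eq_iff Res_nth e)
qed

definition conjugate :: "('n \<Rightarrow> complex^2^2) \<Rightarrow> ('n \<Rightarrow> complex^2^2) \<Rightarrow> bool" where
  "conjugate N M \<longleftrightarrow> (\<exists>g. invertible g \<and> (\<forall>i. g ** N i = M i ** g))"

lemma conjugate_refl: "conjugate N N"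
  unfolding conjugate_def by (intro exI[of _ "mat 1"]) (auto simp: invertible_def)

lemma conjugate_sym: "conjugate N M \<Longrightarrow> conjugate M N"
proof -
  assume "conjugate N M"
  then obtain g h where g: "\<And>i. g ** N i = M i ** g" "g ** h = mat 1" "h ** g = mat 1"
    by (auto simp: conjugate_def invertible_def)
  have "h ** M i = N i ** h" for i
  proof -
    have "h ** (M i ** g) ** h = h ** (g ** N i) ** h" using g(1) by simp
    then have "h ** M i ** (g ** h) = (h ** g) ** N i ** h" by (simp add: matrix_mul_assoc)
    then show ?thesis by (simp add: g)
  qed
  then show ?thesis unfolding conjugate_def using g(2,3) by (intro exI[of _ h]) (auto simp: invertible_def)
qed

lemma conjugate_trans: "conjugate N M \<Longrightarrow> conjugate M K \<Longrightarrow> conjugate N K"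
proof -
  assume "conjugate N M" "conjugate M K"
  then obtain g h where g: "invertible g" "\<And>i. g ** N i = M i ** g" and h: "invertible h" "\<And>i. h ** M i = K i ** h"
    by (auto simp: conjugate_def)
  have "(h ** g) ** N i = K i ** (h ** g)" for i
    using g(2)[of i] h(2)[of i] by (metis matrix_mul_assoc)
  then show ?thesis unfolding conjugate_def using g(1) h(1) invertible_mult by blast
qed

lemma conjugate_pair_trace: "conjugate N M \<Longrightarrow> pair_trace N = pair_trace M"
proof -
  assume "conjugate N M"
  then obtain g where g: "invertible g" "\<And>i. g ** N i = M i ** g" by (auto simp: conjugate_def)
  show ?thesis by (intro ext pair_trace_conj[OF g])
qed

lemma conjugate_zero_iff: "conjugate N M \<Longrightarrow> N i = 0 \<longleftrightarrow> M i = 0"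
proof -
  have *: "M i = 0" if c: "conjugate N M" and z: "N i = 0" for N M :: "'a \<Rightarrow> complex^2^2"
  proof -
    obtain g h where g: "g ** N i = M i ** g" "g ** h = mat 1"
      using c unfolding conjugate_def invertible_def by blast
    have "M i = M i ** (g ** h)" by (simp add: g(2))
    also have "\<dots> = (g ** N i) ** h" unfolding g(1) by (simp add: matrix_mul_assoc)
    also have "\<dots> = 0" by (simp add: z mat2_zero)
    finally show ?thesis .
  qed
  assume "conjugate N M"
  then show ?thesis using * conjugate_sym by blast
qed

lemma higgs_bundle_residues:
  assumes "inj x" "(X, \<phi>) \<in> higgs_bundles x" "\<And>i. Res \<phi> (x i) \<noteq> 0"
  shows "nilpotent2 (Res \<phi> (x i))" "X i = kernel (Res \<phi> (x i))"
  using nilpotent2_of_flag[of "Res \<phi> (x i)" "X i"] assms by (auto simp: higgs_bundles_def)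

lemma higgs_bundles_iff:
  assumes "inj x" "\<And>i. Res \<phi> (x i) \<noteq> 0"
  shows "(X, \<phi>) \<in> higgs_bundles x \<longleftrightarrow> simple_pole_form (range x) \<phi> \<and>
    (\<forall>i. nilpotent2 (Res \<phi> (x i)) \<and> X i = kernel (Res \<phi> (x i)))"
proof
  assume "(X, \<phi>) \<in> higgs_bundles x"
  then show "simple_pole_form (range x) \<phi> \<and> (\<forall>i. nilpotent2 (Res \<phi> (x i)) \<and> X i = kernel (Res \<phi> (x i)))"
    using higgs_bundle_residues[OF assms(1) _ assms(2)] by (auto simp: higgs_bundles_def)
next
  assume R: "simple_pole_form (range x) \<phi> \<and> (\<forall>i. nilpotent2 (Res \<phi> (x i)) \<and> X i = kernel (Res \<phi> (x i)))"
  have "trace (\<phi> z) = 0" if "Pt z \<notin> range x" for z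
  proof -
    have "trace (\<phi> z) = pole_sum x (\<lambda>i. Res \<phi> (x i) $ 1 $ 1) z + pole_sum x (\<lambda>i. Res \<phi> (x i) $ 2 $ 2) z"
      using simple_pole_form_residues(1)[OF assms(1) _ that, of \<phi>] R by (simp add: trace_def sum_2 residue_form_def)
    also have "\<dots> = pole_sum x (\<lambda>i. Res \<phi> (x i) $ 1 $ 1 + Res \<phi> (x i) $ 2 $ 2) z"
      by (simp only: pole_sum_linear)
    also have "(\<lambda>i. Res \<phi> (x i) $ 1 $ 1 + Res \<phi> (x i) $ 2 $ 2) = (\<lambda>i. 0)"
      using R by (auto simp: nilpotent2_def)
    finally show ?thesis by (simp only: pole_sum_zero)
  qed
  then show "(X, \<phi>) \<in> higgs_bundles x"
    using R nilpotent2_kernel by (auto simp: higgs_bundles_def kernel_def)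
qed

subsection \<open>Stability\<close>

text \<open>A destabilising line subbundle has nonnegative degree, hence is constant, and an invariant constant line is an eigenline of
  each residue; as residues are nilpotent it is their common kernel.  Conversely the common kernel of all
  residues has degree zero and meets every flag.\<close>

lemma stable_iff:
  fixes x :: "'n::finite \<Rightarrow> cp1"
  assumes inj: "inj x" and h: "(X, \<phi>) \<in> higgs_bundles x" and nz: "\<And>i. Res \<phi> (x i) \<noteq> 0"
  shows "stable_higgs x (X, \<phi>) \<longleftrightarrow> (\<exists>i k. pair_trace (residues_of x \<phi>) i k \<noteq> 0)"
proof -
  let ?N = "residues_of x \<phi>"
  note nil = higgs_bundle_residues[OF inj h nz]
  have sp: "simple_pole_form (range x) \<phi>" using h by (simp add: higgs_bundles_def)
  note pf = simple_pole_form_residues[OF inj sp]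
  show ?thesis
  proof
    assume st: "stable_higgs x (X, \<phi>)"
    show "\<exists>i k. pair_trace ?N i k \<noteq> 0"
    proof (rule ccontr)
      assume "\<not> ?thesis"
      then have eq: "kernel (?N i) = kernel (?N k)" for i k
        using pair_trace_eq_0_iff[of ?N i k] nil(1) by blast
      \<comment> \<open>any index will do\<close>
      define i0 where "i0 = (undefined :: 'n)"
      obtain v where v: "v \<noteq> 0" "kernel (?N i0) = vec.span {v}"
        using nilpotent2_kernel(1)[OF nil(1)[of i0]] by (auto simp: is_line_iff)
      have Xv: "X i = vec.span {v}" for i using nil(2)[of i] eq[of i i0] v(2) by simp
      have Nv: "?N i *v v = 0" for i
        using eq[of i i0] v(2) vec.span_base[of v "{v}"] by (auto simp: kernel_def)
      have "preserved_by x \<phi> (\<lambda>y. vec.span {v})"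
        unfolding preserved_by_def
      proof (intro allI impI ballI)
        fix z u assume z: "Pt z \<notin> range x" and u: "u \<in> vec.span {v}"
        obtain k where k: "u = k *s v" using u by (auto simp: in_span_single)
        have "(\<phi> z *v v) $ a = 0" for a
        proof -
          have "(\<phi> z *v v) $ a = pole_sum x (\<lambda>i. ?N i $ a $ 1 * v $ 1 + ?N i $ a $ 2 * v $ 2) z"
            unfolding pf(1)[OF z] mult2_nth by (simp add: residue_form_def pole_sum_linear)
          also have "(\<lambda>i. ?N i $ a $ 1 * v $ 1 + ?N i $ a $ 2 * v $ 2) = (\<lambda>i. 0)"
            using Nv by (simp add: vec_eq_iff mult2_nth)
          finally show ?thesis by (simp only: pole_sum_zero)
        qed
        then have "\<phi> z *v v = 0" by (simp add: vec_eq_iff)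
        then have "\<phi> z *v u = 0" by (simp add: k mat2_scale)
        then show "\<phi> z *v u \<in> vec.span {v}" by (simp add: vec.span_zero)
      qed
      then have "1/2 * 0 + 1/2 * real CARD('n)
          > real_of_int 0 + 1/2 * real (card {i. vec.span {v} \<inter> X i \<noteq> {0}})"
        using st constant_line_subbundle[OF v(1)] unfolding stable_higgs_def by blast
      moreover have "{i. vec.span {v} \<inter> X i \<noteq> {0}} = UNIV"
        unfolding Xv using v(1) vec.span_base[of v "{v}"] by auto
      ultimately show False by simp
    qed
  next
    assume ex: "\<exists>i k. pair_trace ?N i k \<noteq> 0"
    have "1/2 * 0 + 1/2 * real CARD('n) > real_of_int d + 1/2 * real (card {i. L (x i) \<inter> X i \<noteq> {0}})"
      if L: "line_subbundle L" "has_degree L d" "preserved_by x \<phi> L" for L d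
    proof (cases "d \<ge> 0")
      case False
      have "card {i. L (x i) \<inter> X i \<noteq> {0}} \<le> CARD('n)" by (intro card_mono) auto
      moreover have "real_of_int d \<le> -1" using False by linarith
      ultimately show ?thesis by simp
    next
      case True
      obtain c where c: "c \<noteq> 0" "\<And>y. L y = vec.span {c}"
        using nonneg_degree_constant[OF L(1,2) True] by blast
      \<comment> \<open>the determinant of \<open>N\<^sub>i c\<close> and \<open>c\<close>\<close>
      let ?r = "\<lambda>i. (?N i $ 1 $ 1 * c $ 1 + ?N i $ 1 $ 2 * c $ 2) * c $ 2 - c $ 1 * (?N i $ 2 $ 1 * c $ 1 + ?N i $ 2 $ 2 * c $ 2)"
      have "?r i = 0" for i
      proof (rule pole_sum_eq_0D[OF inj, of ?r])
        show "(\<Sum>i\<in>UNIV. ?r i) = 0"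
          by (simp add: sum.distrib sum_subtractf sum_distrib_left[symmetric] sum_distrib_right[symmetric] pf(2))
        fix z assume z: "Pt z \<notin> range x"
        have "\<phi> z *v c \<in> vec.span {c}"
          using L(3) z c(2) vec.span_base[of c "{c}"] by (auto simp: preserved_by_def)
        then have "(\<phi> z *v c) $ 1 * c $ 2 - c $ 1 * (\<phi> z *v c) $ 2 = 0"
          using in_span_iff_minor[OF c(1)] by simp
        then show "pole_sum x ?r z = 0"
          unfolding pf(1)[OF z] mult2_nth by (simp add: residue_form_def pole_sum_linear)
      qed
      then have Nc: "?N i *v c \<in> vec.span {c}" for i
        using in_span_iff_minor[OF c(1)] by (simp add: mult2_nth)
      have "?N i *v c = 0" for i
      proof -
        obtain k where k: "?N i *v c = k *s c" using Nc[of i] by (auto simp: in_span_single)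
        have "?N i *v (?N i *v c) = 0" using nilpotent2_kernel(2)[OF nil(1)[of i]] by (simp add: kernel_def)
        then have "(k * k) *s c = 0" by (simp add: k mat2_scale vector_smult_assoc)
        then have "k = 0" using c(1) by (auto simp: vec2_eq_iff)
        with k show ?thesis by simp
      qed
      then have "kernel (?N i) = vec.span {c}" for i using kernel_eq_span[OF nz c(1)] by blast
      then have "pair_trace ?N i k = 0" for i k using pair_trace_eq_0_iff[of ?N i k] nil(1) by simp
      with ex show ?thesis by blast
    qed
    then show "stable_higgs x (X, \<phi>)" unfolding stable_higgs_def using nz by auto
  qed
qed

subsection \<open>Isomorphism classes\<close>

lemma pole_sum_intertwine:
  assumes "\<And>i. g ** N i = M i ** g"
  shows "g ** residue_form x N z = residue_form x M z ** g"
proof -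
  have "(g ** residue_form x N z) $ a $ b = (residue_form x M z ** g) $ a $ b" for a b
  proof -
    have "(g ** residue_form x N z) $ a $ b = pole_sum x (\<lambda>i. (g ** N i) $ a $ b) z"
      by (simp add: mult2_nth residue_form_def pole_sum_linear)
    also have "\<dots> = (residue_form x M z ** g) $ a $ b"
      unfolding assms by (simp add: mult2_nth residue_form_def pole_sum_linear)
    finally show ?thesis .
  qed
  then show ?thesis by (simp add: mat2_eq_iff)
qed

text \<open>A holomorphic map from the sphere to \<open>GL(2)\<close> is constant, and it intertwines two Higgs fields iff
  it intertwines their residues.\<close>

lemma higgs_iso_conjugate:
  assumes inj: "inj x" and iso: "((X, \<phi>), (Y, \<psi>)) \<in> higgs_iso x"
  shows "conjugate (residues_of x \<phi>) (residues_of x \<psi>)"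
proof -
  obtain g where g: "\<forall>a b. holomorphic_cp1 (\<lambda>y. g y $ a $ b)" "\<forall>y. invertible (g y)"
      "\<forall>z. Pt z \<notin> range x \<longrightarrow> g (Pt z) ** \<phi> z = \<psi> z ** g (Pt z)"
    and bun: "(X, \<phi>) \<in> higgs_bundles x" "(Y, \<psi>) \<in> higgs_bundles x"
    using iso unfolding higgs_iso_def by blast
  let ?G = "g Pt_inf" and ?N = "residues_of x \<phi>" and ?M = "residues_of x \<psi>"
  have G: "g y = ?G" for y
    using g(1) holomorphic_cp1_constant[of "\<lambda>y. g y $ _ $ _" y] by (simp add: vec_eq_iff)
  have sp: "simple_pole_form (range x) \<phi>" "simple_pole_form (range x) \<psi>"
    using bun by (simp_all add: higgs_bundles_def)
  note pf = simple_pole_form_residues[OF inj sp(1)] and pf' = simple_pole_form_residues[OF inj sp(2)]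
  have "?G ** ?N i = ?M i ** ?G" for i
  proof -
    have "(?G ** ?N i) $ a $ b - (?M i ** ?G) $ a $ b = 0" for a b
    proof (rule pole_sum_eq_0D[OF inj, of "\<lambda>i. (?G ** ?N i) $ a $ b - (?M i ** ?G) $ a $ b"])
      show "(\<Sum>i\<in>UNIV. (?G ** ?N i) $ a $ b - (?M i ** ?G) $ a $ b) = 0"
        by (simp add: mult2_nth sum.distrib sum_subtractf sum_distrib_left[symmetric]
            sum_distrib_right[symmetric] pf(2) pf'(2))
      fix z assume z: "Pt z \<notin> range x"
      have "?G ** residue_form x ?N z = residue_form x ?M z ** ?G"
        using g(3) z G pf(1)[OF z] pf'(1)[OF z] by metis
      then have "(?G ** residue_form x ?N z) $ a $ b - (residue_form x ?M z ** ?G) $ a $ b = 0" by simp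
      then show "pole_sum x (\<lambda>i. (?G ** ?N i) $ a $ b - (?M i ** ?G) $ a $ b) z = 0"
        by (simp add: mult2_nth residue_form_def pole_sum_linear)
    qed
    then show ?thesis by (simp add: mat2_eq_iff)
  qed
  then show ?thesis unfolding conjugate_def using g(2) by blast
qed

lemma conjugate_higgs_iso:
  assumes inj: "inj x" and bun: "(X, \<phi>) \<in> higgs_bundles x" "(Y, \<psi>) \<in> higgs_bundles x"
    and nz: "\<And>i. Res \<phi> (x i) \<noteq> 0" and conj: "conjugate (residues_of x \<phi>) (residues_of x \<psi>)"
  shows "((X, \<phi>), (Y, \<psi>)) \<in> higgs_iso x"
proof -
  let ?N = "residues_of x \<phi>" and ?M = "residues_of x \<psi>"
  have nz': "Res \<psi> (x i) \<noteq> 0" for i using conjugate_zero_iff[OF conj, of i] nz by simp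
  obtain g h where g: "\<And>i. g ** ?N i = ?M i ** g" "g ** h = mat 1" "h ** g = mat 1"
    using conj unfolding conjugate_def invertible_def by blast
  have inv: "invertible g" using g(2,3) by (auto simp: invertible_def)
  have X: "X i = kernel (?N i)" and Y: "Y i = kernel (?M i)" for i
    using higgs_bundle_residues(2)[OF inj bun(1) nz] higgs_bundle_residues(2)[OF inj bun(2) nz'] by auto
  have "(\<lambda>v. g *v v) ` X i = Y i" for i
  proof (intro equalityI subsetI)
    fix w assume "w \<in> (\<lambda>v. g *v v) ` X i"
    then obtain v where v: "w = g *v v" "?N i *v v = 0" by (auto simp: X kernel_def)
    have "?M i *v w = g *v (?N i *v v)" unfolding v(1) by (simp only: matrix_vector_mul_assoc g(1))
    with v(2) show "w \<in> Y i" by (simp add: Y kernel_def)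
  next
    fix w assume "w \<in> Y i"
    then have w: "?M i *v w = 0" by (simp add: Y kernel_def)
    have hM: "h ** ?M i = ?N i ** h"
    proof -
      have "h ** ?M i = h ** (?M i ** g) ** h" by (simp add: g(2) flip: matrix_mul_assoc)
      also have "\<dots> = (h ** g) ** ?N i ** h" unfolding g(1)[symmetric] by (simp add: matrix_mul_assoc)
      finally show ?thesis by (simp add: g(3))
    qed
    have "?N i *v (h *v w) = h *v (?M i *v w)" using hM by (simp add: matrix_vector_mul_assoc)
    then have "h *v w \<in> X i" using w by (simp add: X kernel_def)
    moreover have "w = g *v (h *v w)" by (simp add: matrix_vector_mul_assoc g(2))
    ultimately show "w \<in> (\<lambda>v. g *v v) ` X i" by blast
  qed
  moreover have "g ** \<phi> z = \<psi> z ** g" if z: "Pt z \<notin> range x" for z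
  proof -
    have sp: "simple_pole_form (range x) \<phi>" "simple_pole_form (range x) \<psi>"
      using bun by (simp_all add: higgs_bundles_def)
    show ?thesis
      unfolding simple_pole_form_residues(1)[OF inj sp(1) z] simple_pole_form_residues(1)[OF inj sp(2) z]
      by (rule pole_sum_intertwine[OF g(1)])
  qed
  ultimately show ?thesis
    unfolding higgs_iso_def using bun inv
    by (auto intro!: exI[of _ "\<lambda>y. g"] simp: holomorphic_cp1_def)
qed

definition stable_residues :: "('n::finite \<Rightarrow> complex^2^2) \<Rightarrow> bool" where
  "stable_residues N \<longleftrightarrow> (\<forall>i. nilpotent2 (N i)) \<and> (\<forall>a b. (\<Sum>i\<in>UNIV. N i $ a $ b) = 0) \<and>
     (\<exists>i k. pair_trace N i k \<noteq> 0)"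

definition higgs_class :: "('n::finite \<Rightarrow> cp1) \<Rightarrow> ('n \<Rightarrow> complex^2^2) \<Rightarrow> 'n higgs set" where
  "higgs_class x N = higgs_iso x `` {(\<lambda>i. kernel (N i), residue_form x N)}"

context
  fixes x :: "'n::finite \<Rightarrow> cp1"
  assumes inj: "inj x"
begin

lemma stable_residues_bundle:
  assumes "stable_residues N"
  shows "(\<lambda>i. kernel (N i), residue_form x N) \<in> higgs_bundles x"
    "stable_higgs x (\<lambda>i. kernel (N i), residue_form x N)" "residues_of x (residue_form x N) = N"
proof -
  have N: "\<And>i. nilpotent2 (N i)" "\<And>a b. (\<Sum>i\<in>UNIV. N i $ a $ b) = 0" "\<exists>i k. pair_trace N i k \<noteq> 0"
    using assms unfolding stable_residues_def by blast+
  note p = residue_form_props[OF inj N(2)]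
  show r: "residues_of x (residue_form x N) = N" by (rule p(2))
  have ri: "Res (residue_form x N) (x i) = N i" for i using fun_cong[OF r, of i] by simp
  have nz: "Res (residue_form x N) (x i) \<noteq> 0" for i unfolding ri using N(1) by (simp add: nilpotent2_def)
  show b: "(\<lambda>i. kernel (N i), residue_form x N) \<in> higgs_bundles x"
    unfolding higgs_bundles_iff[OF inj nz] using p(1) N(1) by (simp add: ri)
  show "stable_higgs x (\<lambda>i. kernel (N i), residue_form x N)"
    unfolding stable_iff[OF inj b nz] r by (rule N(3))
qed

lemma higgs_class_iff:
  assumes "stable_residues N"
  shows "(Y, \<psi>) \<in> higgs_class x N \<longleftrightarrow> (Y, \<psi>) \<in> higgs_bundles x \<and> conjugate N (residues_of x \<psi>)"
proof -
  note b = stable_residues_bundle[OF assms]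
  have nz: "Res (residue_form x N) (x i) \<noteq> 0" for i
    using fun_cong[OF b(3), of i] assms by (simp add: stable_residues_def nilpotent2_def)
  show ?thesis
    unfolding higgs_class_def Image_singleton_iff
    using higgs_iso_conjugate[OF inj, of "\<lambda>i. kernel (N i)" "residue_form x N" Y \<psi>]
      conjugate_higgs_iso[OF inj b(1) _ nz, of Y \<psi>] unfolding b(3)
    by (auto simp: higgs_iso_def)
qed

lemma stable_residues_conjugate: "stable_residues N \<Longrightarrow> conjugate N M \<Longrightarrow> stable_residues M"
proof -
  assume N: "stable_residues N" and c: "conjugate N M"
  obtain g h where g: "\<And>i. g ** N i = M i ** g" "g ** h = mat 1" "h ** g = mat 1"
    using c unfolding conjugate_def invertible_def by blast
  have M: "M i = g ** N i ** h" for i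
    unfolding g(1) by (simp add: g(2) flip: matrix_mul_assoc)
  have s: "(\<Sum>i\<in>UNIV. M i $ a $ b) = 0" for a b
    using N unfolding M mult2_nth stable_residues_def
    by (simp add: sum.distrib sum_distrib_left[symmetric] sum_distrib_right[symmetric])
  have "nilpotent2 (M i)" for i
  proof (rule nilpotent2_of_flag(1))
    let ?X = "(\<lambda>v. g *v v) ` kernel (N i)"
    have n: "nilpotent2 (N i)" using N by (simp add: stable_residues_def)
    show "M i \<noteq> 0" using conjugate_zero_iff[OF c, of i] n by (simp add: nilpotent2_def)
    obtain w where w: "w \<noteq> 0" "kernel (N i) = vec.span {w}"
      using nilpotent2_kernel(1)[OF n] by (auto simp: is_line_iff)
    have gw: "?X = vec.span {g *v w}"
      unfolding w(2) by (auto simp: in_span_single mat2_scale) (metis in_span_single mat2_scale imageI)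
    have "g *v w \<noteq> 0"
    proof
      assume "g *v w = 0"
      then have "h *v (g *v w) = 0" by simp
      then show False using w(1) by (simp add: matrix_vector_mul_assoc g(3))
    qed
    then show "is_line ?X" unfolding gw by (auto simp: is_line_iff)
    show "M i *v v \<in> ?X" for v
      using nilpotent2_kernel(2)[OF n, of "h *v v"] unfolding M by (auto simp: matrix_vector_mul_assoc[symmetric])
    show "M i *v v = 0" if "v \<in> ?X" for v
    proof -
      obtain u where u: "v = g *v u" "N i *v u = 0" using \<open>v \<in> ?X\<close> by (auto simp: kernel_def)
      have "M i *v v = g *v (N i *v u)" unfolding u(1) by (simp add: matrix_vector_mul_assoc g(1))
      then show ?thesis by (simp add: u(2))
    qed
  qed
  then show ?thesis using s N conjugate_pair_trace[OF c] by (simp add: stable_residues_def)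
qed

lemma higgs_class_eq_iff:
  assumes N: "stable_residues N" and M: "stable_residues M"
  shows "higgs_class x N = higgs_class x M \<longleftrightarrow> conjugate N M"
proof
  assume "higgs_class x N = higgs_class x M"
  moreover have "(\<lambda>i. kernel (M i), residue_form x M) \<in> higgs_class x M"
    unfolding higgs_class_iff[OF M] stable_residues_bundle(3)[OF M]
    using stable_residues_bundle(1)[OF M] conjugate_refl by blast
  ultimately show "conjugate N M"
    using higgs_class_iff[OF N] stable_residues_bundle(3)[OF M] by simp
next
  assume c: "conjugate N M"
  have "p \<in> higgs_class x N \<longleftrightarrow> p \<in> higgs_class x M" for p
  proof (cases p)
    case (Pair Y \<psi>)
    show ?thesis
      unfolding Pair higgs_class_iff[OF N] higgs_class_iff[OF M]
      using conjugate_trans[OF conjugate_sym[OF c]] conjugate_trans[OF c] by blast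
  qed
  then show "higgs_class x N = higgs_class x M" by blast
qed

lemma stable_pair_residues:
  assumes "(X, \<phi>) \<in> higgs_bundles x" "stable_higgs x (X, \<phi>)"
  shows "stable_residues (residues_of x \<phi>)" "higgs_iso x `` {(X, \<phi>)} = higgs_class x (residues_of x \<phi>)"
proof -
  have nz: "Res \<phi> (x i) \<noteq> 0" for i using assms(2) by (simp add: stable_higgs_def)
  have sp: "simple_pole_form (range x) \<phi>" using assms(1) by (simp add: higgs_bundles_def)
  show s: "stable_residues (residues_of x \<phi>)"
    unfolding stable_residues_def
    using higgs_bundle_residues(1)[OF inj assms(1) nz] simple_pole_form_residues(2)[OF inj sp]
      stable_iff[OF inj assms(1) nz] assms(2) by blast
  have "p \<in> higgs_iso x `` {(X, \<phi>)} \<longleftrightarrow> p \<in> higgs_class x (residues_of x \<phi>)" for p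
  proof (cases p)
    case (Pair Y \<psi>)
    show ?thesis
      unfolding Pair higgs_class_iff[OF s] Image_singleton_iff
      using higgs_iso_conjugate[OF inj, of X \<phi> Y \<psi>] conjugate_higgs_iso[OF inj assms(1) _ nz, of Y \<psi>]
      by (auto simp: higgs_iso_def)
  qed
  then show "higgs_iso x `` {(X, \<phi>)} = higgs_class x (residues_of x \<phi>)" by blast
qed

lemma higgs_moduli_eq: "higgs_moduli x = higgs_class x ` {N. stable_residues N}"
proof (intro equalityI subsetI)
  fix c assume "c \<in> higgs_moduli x"
  then obtain X \<phi> where "(X, \<phi>) \<in> higgs_bundles x" "stable_higgs x (X, \<phi>)" "c = higgs_iso x `` {(X, \<phi>)}"
    unfolding higgs_moduli_def by (auto elim!: quotientE)
  then show "c \<in> higgs_class x ` {N. stable_residues N}" using stable_pair_residues by blast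
next
  fix c assume "c \<in> higgs_class x ` {N. stable_residues N}"
  then obtain N where N: "stable_residues N" "c = higgs_class x N" by blast
  then show "c \<in> higgs_moduli x"
    unfolding higgs_moduli_def N(2) higgs_class_def
    using stable_residues_bundle[OF N(1)] by (intro quotientI) simp
qed

subsection \<open>The involution on classes\<close>

lemma nilpotent2_transpose:
  assumes "nilpotent2 M"
  shows "nilpotent2 (transpose M)" "annihilator (kernel M) = kernel (transpose M)"
proof -
  show n: "nilpotent2 (transpose M)"
    using assms by (auto simp: nilpotent2_def transpose_def mat2_eq_iff mult.commute)
  obtain w :: "complex^2" and c where w: "w \<noteq> 0" "c \<noteq> 0" "M $ 1 $ 1 = c * w $ 1 * w $ 2" "M $ 1 $ 2 = - (c * w $ 1 * w $ 1)"
    "M $ 2 $ 1 = c * w $ 2 * w $ 2" "M $ 2 $ 2 = - (c * w $ 1 * w $ 2)"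
    using nilpotent2_form[OF assms] .
  have kw: "kernel M = vec.span {w}"
    using assms by (intro kernel_eq_span w(1)) (simp_all add: nilpotent2_def vec2_eq_iff mult2_nth w)
  have "f \<in> annihilator (kernel M) \<longleftrightarrow> f $ 1 * w $ 1 + f $ 2 * w $ 2 = 0" for f
  proof
    assume "f \<in> annihilator (kernel M)"
    then show "f $ 1 * w $ 1 + f $ 2 * w $ 2 = 0"
      unfolding annihilator_def kw using vec.span_base[of w "{w}"] by (simp add: sum_2)
  next
    assume f: "f $ 1 * w $ 1 + f $ 2 * w $ 2 = 0"
    have "f $ 1 * (k * w $ 1) + f $ 2 * (k * w $ 2) = k * (f $ 1 * w $ 1 + f $ 2 * w $ 2)" for k
      by (simp add: algebra_simps)
    then show "f \<in> annihilator (kernel M)"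
      unfolding annihilator_def kw using f by (auto simp: sum_2 in_span_single)
  qed
  moreover have "f \<in> kernel (transpose M) \<longleftrightarrow> f $ 1 * w $ 1 + f $ 2 * w $ 2 = 0" for f
  proof -
    have "transpose M *v f = (c * (f $ 1 * w $ 1 + f $ 2 * w $ 2)) *s vector [w $ 2, - w $ 1]"
      by (simp add: vec2_eq_iff mult2_nth transpose_def w algebra_simps)
    moreover have "vector [w $ 2, - w $ 1] \<noteq> (0 :: complex^2)" using w(1) by (auto simp: vec2_eq_iff)
    ultimately show ?thesis using w(2) by (auto simp: kernel_def)
  qed
  ultimately show "annihilator (kernel M) = kernel (transpose M)" by blast
qed

lemma conjugate_transpose: "conjugate N M \<Longrightarrow> conjugate (\<lambda>i. transpose (N i)) (\<lambda>i. transpose (M i))"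
proof -
  assume "conjugate N M"
  then obtain g h where g: "\<And>i. g ** N i = M i ** g" "g ** h = mat 1" "h ** g = mat 1"
    unfolding conjugate_def invertible_def by blast
  have "transpose g ** transpose (M i) = transpose (N i) ** transpose g" for i
    using arg_cong[OF g(1)[of i], of transpose] by (simp add: matrix_transpose_mul)
  moreover have "invertible (transpose g)"
    unfolding invertible_def using arg_cong[OF g(2), of transpose] arg_cong[OF g(3), of transpose]
    by (intro exI[of _ "transpose h"]) (simp add: matrix_transpose_mul transpose_mat)
  ultimately have "conjugate (\<lambda>i. transpose (M i)) (\<lambda>i. transpose (N i))"
    unfolding conjugate_def by blast
  then show ?thesis by (rule conjugate_sym)
qed

lemma Res_transpose: "Res (\<lambda>z. transpose (\<phi> z)) y = transpose (Res \<phi> y)"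
  by (simp add: vec_eq_iff Res_nth transpose_def)

lemma stable_residues_transpose:
  "stable_residues N \<Longrightarrow> stable_residues (\<lambda>i. transpose (N i))"
proof -
  assume N: "stable_residues N"
  have "pair_trace (\<lambda>i. transpose (N i)) = pair_trace N"
    by (simp add: fun_eq_iff pair_trace_expand transpose_def)
  moreover have "transpose (N i) $ a $ b = N i $ b $ a" for i a b by (simp add: transpose_def)
  ultimately show ?thesis using N by (simp add: stable_residues_def nilpotent2_transpose(1))
qed

text \<open>Dual flags are the kernels of the transposed residues.\<close>

lemma higgs_involution_class:
  assumes N: "stable_residues N"
  shows "higgs_involution x (higgs_class x N) = higgs_class x (\<lambda>i. transpose (N i))"
proof -
  let ?T = "\<lambda>i. transpose (N i)"
  note T = stable_residues_transpose[OF N]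
  have dual: "higgs_iso x `` {dual_higgs (Y, \<psi>)} = higgs_class x ?T" if Y: "(Y, \<psi>) \<in> higgs_class x N" for Y \<psi>
  proof -
    have Yb: "(Y, \<psi>) \<in> higgs_bundles x" and c: "conjugate N (residues_of x \<psi>)"
      using Y higgs_class_iff[OF N] by blast+
    have nz: "Res \<psi> (x i) \<noteq> 0" for i
      using conjugate_zero_iff[OF c, of i] N by (simp add: stable_residues_def nilpotent2_def)
    have "Res (\<lambda>z. transpose (\<psi> z)) (x i) \<noteq> 0" for i
      using nz[of i] unfolding Res_transpose by (simp add: transpose_def mat2_eq_iff)
    note hb = higgs_bundles_iff[OF inj this]
    have st: "stable_residues (residues_of x \<psi>)" by (rule stable_residues_conjugate[OF N c])
    have n: "nilpotent2 (Res \<psi> (x i))" "Y i = kernel (Res \<psi> (x i))" for i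
      using higgs_bundle_residues[OF inj Yb nz] by blast+
    have b: "(\<lambda>i. annihilator (Y i), \<lambda>z. transpose (\<psi> z)) \<in> higgs_bundles x"
      unfolding hb Res_transpose using n nilpotent2_transpose Yb
      by (auto simp: higgs_bundles_def simple_pole_form_iff transpose_def)
    have r: "residues_of x (\<lambda>z. transpose (\<psi> z)) = (\<lambda>i. transpose (Res \<psi> (x i)))"
      by (simp add: Res_transpose)
    have s: "stable_higgs x (\<lambda>i. annihilator (Y i), \<lambda>z. transpose (\<psi> z))"
      using stable_iff[OF inj b] stable_residues_transpose[OF st] nz unfolding r Res_transpose
      by (simp add: stable_residues_def nilpotent2_def)
    have "higgs_iso x `` {(\<lambda>i. annihilator (Y i), \<lambda>z. transpose (\<psi> z))} = higgs_class x (\<lambda>i. transpose (Res \<psi> (x i)))"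
      using stable_pair_residues(2)[OF b s] unfolding r .
    also have "\<dots> = higgs_class x ?T"
      using higgs_class_eq_iff[OF stable_residues_transpose[OF st] T] conjugate_transpose[OF conjugate_sym[OF c]] by blast
    finally show ?thesis by (simp add: dual_higgs_def)
  qed
  have ne: "(\<lambda>i. kernel (N i), residue_form x N) \<in> higgs_class x N"
    unfolding higgs_class_iff[OF N] stable_residues_bundle(3)[OF N]
    using stable_residues_bundle(1)[OF N] conjugate_refl by blast
  have "higgs_involution x (higgs_class x N) = (\<Union>p\<in>higgs_class x N. higgs_iso x `` {dual_higgs p})"
    unfolding higgs_involution_def by blast
  also have "\<dots> = higgs_class x ?T" using dual ne by (auto; fastforce)
  finally show ?thesis .
qed

text \<open>A conjugation \<open>g\<close> of a tuple to its transpose is a bilinear form for which all kernels are isotropic.  If it were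
  alternating, then each \<open>g N\<^sub>i\<close> would be antisymmetric by the intertwining relation but symmetric because \<open>N\<^sub>i\<close> is
  traceless, hence zero.\<close>

lemma higgs_fixed_traces:
  assumes N: "stable_residues N" and c: "conjugate N (\<lambda>i. transpose (N i))"
    and ik: "pair_trace N i k \<noteq> 0" "pair_trace N i' k \<noteq> 0"
  shows "pair_trace N i i' = 0"
proof -
  obtain g where g: "\<And>i. g ** N i = transpose (N i) ** g" "invertible g" using c by (auto simp: conjugate_def)
  have n: "nilpotent2 (N i)" for i using N by (simp add: stable_residues_def)
  let ?a = "g $ 1 $ 1" and ?b = "g $ 1 $ 2 + g $ 2 $ 1" and ?c = "g $ 2 $ 2"
  have "\<exists>w. w \<noteq> 0 \<and> kernel (N i) = vec.span {w} \<and> ?a * (w $ 1)\<^sup>2 + ?b * w $ 1 * w $ 2 + ?c * (w $ 2)\<^sup>2 = 0" for i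
  proof -
    obtain w where w: "w \<noteq> 0" "kernel (N i) = vec.span {w}"
      using nilpotent2_kernel(1)[OF n] by (auto simp: is_line_iff)
    have Nw: "N i *v w = 0" using w(2) vec.span_base[of w "{w}"] by (auto simp: kernel_def)
    have "transpose (N i) *v (g *v w) = g *v (N i *v w)" by (simp add: matrix_vector_mul_assoc g(1))
    then have "g *v w \<in> annihilator (kernel (N i))"
      unfolding nilpotent2_transpose(2)[OF n] using Nw by (simp add: kernel_def)
    then have "(g *v w) $ 1 * w $ 1 + (g *v w) $ 2 * w $ 2 = 0"
      unfolding annihilator_def w(2) using vec.span_base[of w "{w}"] by (simp add: sum_2)
    then have "?a * (w $ 1)\<^sup>2 + ?b * w $ 1 * w $ 2 + ?c * (w $ 2)\<^sup>2 = 0"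
      by (simp add: mult2_nth power2_eq_square algebra_simps)
    with w show ?thesis by blast
  qed
  then obtain w where w: "\<And>i. w i \<noteq> 0" "\<And>i. kernel (N i) = vec.span {w i}"
      "\<And>i. ?a * (w i $ 1)\<^sup>2 + ?b * w i $ 1 * w i $ 2 + ?c * (w i $ 2)\<^sup>2 = 0"
    by metis
  have nz: "?a \<noteq> 0 \<or> ?b \<noteq> 0 \<or> ?c \<noteq> 0"
  proof (rule ccontr)
    assume "\<not> ?thesis"
    then have z: "g $ 1 $ 1 = 0" "g $ 2 $ 2 = 0" "g $ 2 $ 1 = - g $ 1 $ 2"
      by (auto simp: eq_neg_iff_add_eq_0 add.commute)
    have "g $ 1 $ 2 \<noteq> 0"
    proof
      assume "g $ 1 $ 2 = 0"
      with z have "g = 0" by (simp add: mat2_eq_iff)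
      with g(2) show False by (auto simp: invertible_def mat2_zero mat_def mat2_eq_iff)
    qed
    moreover have "(g ** N i) $ a $ b = (transpose (N i) ** g) $ a $ b" for a b using g(1)[of i] by simp
    from this[of 1 1] this[of 1 2] this[of 2 1] this[of 2 2]
    have "g $ 1 $ 2 * N i $ 2 $ 1 = - (g $ 1 $ 2 * N i $ 2 $ 1)" "g $ 1 $ 2 * N i $ 2 $ 2 = g $ 1 $ 2 * N i $ 1 $ 1"
        "g $ 1 $ 2 * N i $ 1 $ 2 = - (g $ 1 $ 2 * N i $ 1 $ 2)"
      by (simp_all add: mult2_nth transpose_def z mult.commute)
    ultimately have "N i $ 2 $ 1 = 0" "N i $ 1 $ 2 = 0" "N i $ 2 $ 2 = N i $ 1 $ 1" by simp_all
    then show False using n[of i] by (simp add: nilpotent2_def mat2_eq_iff)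
  qed
  have min: "pair_trace N i k = 0 \<longleftrightarrow> w i $ 1 * w k $ 2 = w k $ 1 * w i $ 2" for i k
  proof -
    have "pair_trace N i k = 0 \<longleftrightarrow> vec.span {w i} = vec.span {w k}"
      using pair_trace_eq_0_iff[of N i k] n w(2) by simp
    also have "\<dots> \<longleftrightarrow> w i \<in> vec.span {w k}"
    proof
      assume "vec.span {w i} = vec.span {w k}"
      then show "w i \<in> vec.span {w k}" using vec.span_base[of "w i" "{w i}"] by simp
    next
      assume "w i \<in> vec.span {w k}"
      moreover have "is_line (vec.span {w k})" using w(1) by (auto simp: is_line_iff)
      ultimately show "vec.span {w i} = vec.span {w k}" using line_eq_span w(1) by metis
    qed
    also have "\<dots> \<longleftrightarrow> w i $ 1 * w k $ 2 = w k $ 1 * w i $ 2" by (rule in_span_iff_minor[OF w(1)])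
    finally show ?thesis .
  qed
  show ?thesis
    using quadratic_form_lines[OF w(3)[of i] w(3)[of i'] w(3)[of k] _ _ nz] ik unfolding min by blast
qed

end

section \<open>The charts of the Higgs moduli space\<close>

lemma normal_residue_nth:
  "normal_residue A m i $ 1 $ 1 = - (snd m $ i * fst m $ i)"
  "normal_residue A m i $ 2 $ 2 = snd m $ i * fst m $ i"
  "normal_residue A m i $ 1 $ 2 = (if i \<in> A then snd m $ i else snd m $ i * (fst m $ i)\<^sup>2)"
  "normal_residue A m i $ 2 $ 1 = - (if i \<in> A then snd m $ i * (fst m $ i)\<^sup>2 else snd m $ i)"
  by (cases m; simp add: normal_residue_def)+

lemma normal_residue_nilpotent:
  assumes "snd m $ i \<noteq> 0"
  shows "nilpotent2 (normal_residue A m i)" "kernel (normal_residue A m i) = normal_line A (fst m) i"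
proof -
  have nz: "normal_residue A m i \<noteq> 0"
    using assms by (auto simp: mat2_eq_iff normal_residue_nth split: if_splits)
  then show "nilpotent2 (normal_residue A m i)"
    by (simp add: nilpotent2_def normal_residue_nth power2_eq_square)
  show "kernel (normal_residue A m i) = normal_line A (fst m) i"
    unfolding normal_line_def
    by (rule kernel_eq_span[OF nz])
      (auto simp: vec2_eq_iff mult2_nth normal_residue_nth power2_eq_square)
qed

lemma normal_parameters_iff:
  "m \<in> normal_parameters A j k \<longleftrightarrow> fst m $ j = 0 \<and> fst m $ k = 0 \<and> (\<forall>i. snd m $ i \<noteq> 0) \<and> snd m $ j = 1 \<and>
     (\<Sum>i\<in>UNIV. snd m $ i * fst m $ i) = 0 \<and>
     (\<Sum>i\<in>UNIV. if i \<in> A then snd m $ i else snd m $ i * (fst m $ i)\<^sup>2) = 0 \<and>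
     (\<Sum>i\<in>UNIV. if i \<in> A then snd m $ i * (fst m $ i)\<^sup>2 else snd m $ i) = 0"
  by (cases m) (auto simp: normal_parameters_def mat2_eq_iff normal_residue_nth sum_negf)

text \<open>The residues with indices \<open>j\<close> and \<open>k\<close> have the two coordinate axes as kernels.\<close>

lemma normal_parameters_stable:
  assumes m: "m \<in> normal_parameters A j k" and jk: "j \<in> A" "k \<notin> A"
  shows "stable_residues (normal_residue A m)"
proof -
  note M = m[unfolded normal_parameters_iff]
  have "nilpotent2 (normal_residue A m i)" for i using M normal_residue_nilpotent by blast
  moreover have "(\<Sum>i\<in>UNIV. normal_residue A m i $ a $ b) = 0" for a b
    using M exhaust_2[of a] exhaust_2[of b] by (auto simp: normal_residue_nth sum_negf)
  moreover have "pair_trace (normal_residue A m) j k \<noteq> 0"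
    using M jk by (simp add: pair_trace_expand normal_residue_nth)
  ultimately show ?thesis unfolding stable_residues_def by blast
qed

text \<open>A conjugation between two normal forms fixes the lines with indices \<open>j\<close> and \<open>k\<close> and commutes
  with \<open>N\<^sub>j\<close>, so it is a scalar.\<close>

lemma normal_parameters_unique:
  assumes m: "m \<in> normal_parameters A j k" and m': "m' \<in> normal_parameters A j k" and jk: "j \<in> A" "k \<notin> A"
    and c: "conjugate (normal_residue A m) (normal_residue A m')"
  shows "m = m'"
proof -
  note M = m[unfolded normal_parameters_iff] and M' = m'[unfolded normal_parameters_iff]
  obtain g where g: "\<And>i. g ** normal_residue A m i = normal_residue A m' i ** g" "invertible g"
    using c by (auto simp: conjugate_def)
  have e: "(g ** normal_residue A m i) $ a $ b = (normal_residue A m' i ** g) $ a $ b" for i a b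
    using g(1)[of i] by simp
  \<comment> \<open>from the index \<open>j\<close>, where the two normal forms agree\<close>
  have d: "g $ 2 $ 1 = 0" "g $ 1 $ 1 = g $ 2 $ 2"
    using e[of j 1 1] e[of j 1 2] M M' jk by (simp_all add: mult2_nth normal_residue_nth)
  have "g $ 1 $ 2 * snd m $ k = 0"
    using e[of k 1 1] M M' jk by (simp add: mult2_nth normal_residue_nth)
  then have d': "g $ 1 $ 2 = 0" using M by simp
  have "g $ 1 $ 1 \<noteq> 0"
  proof
    assume "g $ 1 $ 1 = 0"
    with d d' have "g = 0" by (simp add: mat2_eq_iff)
    with g(2) show False by (auto simp: invertible_def mat2_zero mat_def mat2_eq_iff)
  qed
  then have N: "normal_residue A m i $ a $ b = normal_residue A m' i $ a $ b" for i a b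
    using e[of i a b] exhaust_2[of a] exhaust_2[of b] d d' by (auto simp: mult2_nth mult.commute)
  have l: "snd m $ i = snd m' $ i" for i
    using N[of i 1 2] N[of i 2 1] by (cases "i \<in> A") (simp_all add: normal_residue_nth)
  moreover have "fst m $ i = fst m' $ i" for i
    using N[of i 1 1] M l[of i] by (auto simp: normal_residue_nth)
  ultimately show ?thesis by (simp add: prod_eq_iff vec_eq_iff)
qed

text \<open>The three independent entries of \<open>\<Sum>N\<^sub>i = 0\<close> are, up to sign, \<open>\<Sum>\<lambda>\<^sub>i t\<^sub>i\<close> and the two sums that weight \<open>\<lambda>\<^sub>i\<close> by \<open>1\<close> or \<open>t\<^sub>i\<^sup>2\<close>.  In the next
  three definitions \<open>a\<close>, \<open>b\<close>, \<open>d\<close> are the contributions of the free parameters to them, including \<open>\<lambda>\<^sub>j = 1\<close> in \<open>b\<close>.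
  With \<open>i0\<close> in \<open>A\<close> the first two equations give \<open>\<lambda>\<^sub>i\<^sub>0 = - b\<close> and \<open>t\<^sub>i\<^sub>0 = a / b\<close>, the third one gives \<open>\<lambda>\<^sub>k\<close>; for \<open>i0\<close> outside \<open>A\<close> they
  give \<open>t\<^sub>i\<^sub>0 = b / a\<close> and \<open>\<lambda>\<^sub>i\<^sub>0 = - a\<^sup>2 / b\<close>.\<close>

definition chart_a :: "(complex^'n) \<times> (complex^'n::finite) \<Rightarrow> complex" where
  "chart_a y = (\<Sum>i\<in>UNIV. snd y $ i * fst y $ i)"

definition chart_b :: "'n set \<Rightarrow> (complex^'n) \<times> (complex^'n::finite) \<Rightarrow> complex" where
  "chart_b A y = 1 + (\<Sum>i\<in>UNIV. if i \<in> A then snd y $ i else snd y $ i * (fst y $ i)\<^sup>2)"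

definition chart_d :: "'n set \<Rightarrow> (complex^'n) \<times> (complex^'n::finite) \<Rightarrow> complex" where
  "chart_d A y = (\<Sum>i\<in>UNIV. if i \<in> A then snd y $ i * (fst y $ i)\<^sup>2 else snd y $ i)"

definition chart_params :: "'n set \<Rightarrow> 'n \<Rightarrow> 'n \<Rightarrow> 'n \<Rightarrow> (complex^'n) \<times> (complex^'n) \<Rightarrow> (complex^'n) \<times> (complex^'n::finite)" where
  "chart_params A j k i0 y =
     (\<chi> i. if i = i0 then (if i0 \<in> A then chart_a y / chart_b A y else chart_b A y / chart_a y)
           else if i = j \<or> i = k then 0 else fst y $ i,
      \<chi> i. if i = i0 then (if i0 \<in> A then - chart_b A y else - (chart_a y)\<^sup>2 / chart_b A y)
           else if i = j then 1
           else if i = k then ((chart_a y)\<^sup>2 - chart_d A y * chart_b A y) / chart_b A y else snd y $ i)"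

text \<open>The parameters for which the eliminated ones are defined and nonzero where they have to be.\<close>

definition chart_range :: "'n set \<Rightarrow> 'n \<Rightarrow> 'n \<Rightarrow> 'n \<Rightarrow> ((complex^'n) \<times> (complex^'n::finite)) set" where
  "chart_range A j k i0 = {y. chart_b A y \<noteq> 0} \<inter> {y. i0 \<in> A \<or> chart_a y \<noteq> 0} \<inter>
     {y. (chart_a y)\<^sup>2 - chart_d A y * chart_b A y \<noteq> 0} \<inter> (\<Inter>i\<in>-{j, k, i0}. {y. snd y $ i \<noteq> 0})"

definition drop_params :: "'n \<Rightarrow> 'n \<Rightarrow> 'n \<Rightarrow> (complex^'n) \<times> (complex^'n) \<Rightarrow> (complex^'n) \<times> (complex^'n::finite)" where
  "drop_params j k i0 m = (\<chi> i. if i \<in> {j, k, i0} then 0 else fst m $ i, \<chi> i. if i \<in> {j, k, i0} then 0 else snd m $ i)"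

abbreviation chart_space :: "'n \<Rightarrow> 'n \<Rightarrow> 'n \<Rightarrow> ((complex^'n) \<times> (complex^'n::finite)) set" where
  "chart_space j k i0 \<equiv> {(t, l). \<forall>i\<in>{j, k, i0}. t $ i = 0 \<and> l $ i = 0}"

lemma drop_params_in: "drop_params j k i0 m \<in> chart_space j k i0"
  by (simp add: drop_params_def)

text \<open>The three sums over all indices differ from those over the free parameters by the terms at \<open>j\<close>, \<open>k\<close> and \<open>i0\<close>.\<close>

lemma chart_sums:
  assumes y: "y \<in> chart_space j k i0" and d: "j \<in> A" "k \<notin> A" "i0 \<noteq> j" "i0 \<noteq> k"
    and m: "\<And>i. i \<notin> {j, k, i0} \<Longrightarrow> fst m $ i = fst y $ i \<and> snd m $ i = snd y $ i"
      "fst m $ j = 0" "fst m $ k = 0" "snd m $ j = 1"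
  shows "(\<Sum>i\<in>UNIV. snd m $ i * fst m $ i) = chart_a y + snd m $ i0 * fst m $ i0"
    "(\<Sum>i\<in>UNIV. if i \<in> A then snd m $ i else snd m $ i * (fst m $ i)\<^sup>2)
       = chart_b A y + (if i0 \<in> A then snd m $ i0 else snd m $ i0 * (fst m $ i0)\<^sup>2)"
    "(\<Sum>i\<in>UNIV. if i \<in> A then snd m $ i * (fst m $ i)\<^sup>2 else snd m $ i)
       = chart_d A y + (if i0 \<in> A then snd m $ i0 * (fst m $ i0)\<^sup>2 else snd m $ i0) + snd m $ k"
proof -
  have y0: "fst y $ i = 0" "snd y $ i = 0" if "i \<in> {j, k, i0}" for i using y that by auto
  have sd: "(\<Sum>i\<in>UNIV. f i + (if i = i0 then p else 0) + (if i = j then q else 0) + (if i = k then r else 0))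
      = (\<Sum>i\<in>UNIV. f i) + p + q + r" for f :: "'a \<Rightarrow> complex" and p q r
    by (simp add: sum.distrib)
  have pt: "snd m $ i * fst m $ i = snd y $ i * fst y $ i + (if i = i0 then snd m $ i0 * fst m $ i0 else 0)" for i
    using m(1)[of i] m(2-4) y0[of i] by (cases "i \<in> {j, k, i0}") auto
  have "(\<Sum>i\<in>UNIV. snd m $ i * fst m $ i)
      = (\<Sum>i\<in>UNIV. snd y $ i * fst y $ i + (if i = i0 then snd m $ i0 * fst m $ i0 else 0))"
    by (rule sum.cong[OF refl]) (rule pt)
  then show "(\<Sum>i\<in>UNIV. snd m $ i * fst m $ i) = chart_a y + snd m $ i0 * fst m $ i0"
    by (simp add: chart_a_def sum.distrib)
  have pt: "(if i \<in> A then snd m $ i else snd m $ i * (fst m $ i)\<^sup>2)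
      = (if i \<in> A then snd y $ i else snd y $ i * (fst y $ i)\<^sup>2) + (if i = i0 then (if i0 \<in> A then snd m $ i0 else snd m $ i0 * (fst m $ i0)\<^sup>2) else 0) + (if i = j then 1 else 0) + (if i = k then 0 else 0)" for i
    using m(1)[of i] m(2-4) y0[of i] d by (cases "i \<in> {j, k, i0}") auto
  have "(\<Sum>i\<in>UNIV. if i \<in> A then snd m $ i else snd m $ i * (fst m $ i)\<^sup>2) = (\<Sum>i\<in>UNIV. (if i \<in> A then snd y $ i else snd y $ i * (fst y $ i)\<^sup>2)
      + (if i = i0 then (if i0 \<in> A then snd m $ i0 else snd m $ i0 * (fst m $ i0)\<^sup>2) else 0) + (if i = j then 1 else 0) + (if i = k then 0 else 0))"
    by (rule sum.cong[OF refl]) (rule pt)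
  then show "(\<Sum>i\<in>UNIV. if i \<in> A then snd m $ i else snd m $ i * (fst m $ i)\<^sup>2) = chart_b A y + (if i0 \<in> A then snd m $ i0 else snd m $ i0 * (fst m $ i0)\<^sup>2)"
    unfolding sd by (simp add: chart_b_def)
  have pt: "(if i \<in> A then snd m $ i * (fst m $ i)\<^sup>2 else snd m $ i)
      = (if i \<in> A then snd y $ i * (fst y $ i)\<^sup>2 else snd y $ i) + (if i = i0 then (if i0 \<in> A then snd m $ i0 * (fst m $ i0)\<^sup>2 else snd m $ i0) else 0) + (if i = j then 0 else 0) + (if i = k then snd m $ k else 0)" for i
    using m(1)[of i] m(2-4) y0[of i] d by (cases "i \<in> {j, k, i0}") auto
  have "(\<Sum>i\<in>UNIV. if i \<in> A then snd m $ i * (fst m $ i)\<^sup>2 else snd m $ i) = (\<Sum>i\<in>UNIV. (if i \<in> A then snd y $ i * (fst y $ i)\<^sup>2 else snd y $ i)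
      + (if i = i0 then (if i0 \<in> A then snd m $ i0 * (fst m $ i0)\<^sup>2 else snd m $ i0) else 0) + (if i = j then 0 else 0) + (if i = k then snd m $ k else 0))"
    by (rule sum.cong[OF refl]) (rule pt)
  then show "(\<Sum>i\<in>UNIV. if i \<in> A then snd m $ i * (fst m $ i)\<^sup>2 else snd m $ i) = chart_d A y + (if i0 \<in> A then snd m $ i0 * (fst m $ i0)\<^sup>2 else snd m $ i0) + snd m $ k"
    unfolding sd by (simp add: chart_d_def)
qed

lemma chart_params_normal:
  assumes y: "y \<in> chart_space j k i0" "y \<in> chart_range A j k i0" and d: "j \<in> A" "k \<notin> A" "i0 \<noteq> j" "i0 \<noteq> k"
  shows "chart_params A j k i0 y \<in> normal_parameters A j k"
    "i0 \<in> A \<or> fst (chart_params A j k i0 y) $ i0 \<noteq> 0"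
    "drop_params j k i0 (chart_params A j k i0 y) = y"
proof -
  let ?m = "chart_params A j k i0 y" and ?a = "chart_a y" and ?b = "chart_b A y" and ?d = "chart_d A y"
  have jk: "j \<noteq> k" using d by blast
  have r: "?b \<noteq> 0" "i0 \<in> A \<or> ?a \<noteq> 0" "?a\<^sup>2 - ?d * ?b \<noteq> 0" "\<And>i. i \<notin> {j, k, i0} \<Longrightarrow> snd y $ i \<noteq> 0"
    using y(2) by (auto simp: chart_range_def)
  have y0: "fst y $ i = 0" "snd y $ i = 0" if "i \<in> {j, k, i0}" for i using y(1) that by auto
  have m: "fst ?m $ i = fst y $ i \<and> snd ?m $ i = snd y $ i" if "i \<notin> {j, k, i0}" for i
    using that by (simp add: chart_params_def)
  have mj: "fst ?m $ j = 0" "fst ?m $ k = 0" "snd ?m $ j = 1"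
    and mk: "snd ?m $ k = (?a\<^sup>2 - ?d * ?b) / ?b"
    using d jk by (simp_all add: chart_params_def)
  have mi: "fst ?m $ i0 = (if i0 \<in> A then ?a / ?b else ?b / ?a)"
      "snd ?m $ i0 = (if i0 \<in> A then - ?b else - ?a\<^sup>2 / ?b)"
    by (simp_all add: chart_params_def)
  note s = chart_sums[OF y(1) d m mj]
  have "snd ?m $ i \<noteq> 0" for i
  proof (cases "i \<in> {j, k, i0}")
    case True
    then show ?thesis using mj mk mi r by (auto split: if_splits)
  qed (use m r(4) in auto)
  moreover have "(\<Sum>i\<in>UNIV. snd ?m $ i * fst ?m $ i) = 0"
  proof -
    have "chart_a y + snd ?m $ i0 * fst ?m $ i0 = 0" unfolding mi using r by (auto simp: power2_eq_square)
    with s(1) show ?thesis by (rule trans)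
  qed
  moreover have "(\<Sum>i\<in>UNIV. if i \<in> A then snd ?m $ i else snd ?m $ i * (fst ?m $ i)\<^sup>2) = 0"
  proof -
    have "?b + (if i0 \<in> A then snd ?m $ i0 else snd ?m $ i0 * (fst ?m $ i0)\<^sup>2) = 0"
      unfolding mi using r by (auto simp: power2_eq_square)
    with s(2) show ?thesis by (rule trans)
  qed
  moreover have "(\<Sum>i\<in>UNIV. if i \<in> A then snd ?m $ i * (fst ?m $ i)\<^sup>2 else snd ?m $ i) = 0"
  proof -
    have "?d + (if i0 \<in> A then snd ?m $ i0 * (fst ?m $ i0)\<^sup>2 else snd ?m $ i0) + snd ?m $ k = 0"
      unfolding mi mk using r by (auto simp: power2_eq_square field_simps)
    with s(3) show ?thesis by (rule trans)
  qed
  ultimately show "?m \<in> normal_parameters A j k"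
    unfolding normal_parameters_iff using mj by blast
  show "i0 \<in> A \<or> fst ?m $ i0 \<noteq> 0" unfolding mi using r by auto
  show "drop_params j k i0 ?m = y"
    using m y0 by (auto simp: drop_params_def prod_eq_iff vec_eq_iff)
qed

lemma drop_params_chart:
  assumes m: "m \<in> normal_parameters A j k" "i0 \<in> A \<or> fst m $ i0 \<noteq> 0" and d: "j \<in> A" "k \<notin> A" "i0 \<noteq> j" "i0 \<noteq> k"
  shows "drop_params j k i0 m \<in> chart_range A j k i0" "chart_params A j k i0 (drop_params j k i0 m) = m"
proof -
  let ?y = "drop_params j k i0 m"
  let ?a = "chart_a ?y" and ?b = "chart_b A ?y" and ?d = "chart_d A ?y"
  let ?t = "fst m $ i0" and ?l = "snd m $ i0"
  note M = m(1)[unfolded normal_parameters_iff]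
  have my: "fst m $ i = fst ?y $ i \<and> snd m $ i = snd ?y $ i" if "i \<notin> {j, k, i0}" for i
    using that by (simp add: drop_params_def)
  have mj: "fst m $ j = 0" "fst m $ k = 0" "snd m $ j = 1" and nz: "snd m $ i \<noteq> 0" for i using M by blast+
  note s = chart_sums[OF drop_params_in d my mj]
  have a: "?a = - (?l * ?t)" using s(1) M by (simp add: eq_neg_iff_add_eq_0)
  have b: "?b = - (if i0 \<in> A then ?l else ?l * ?t\<^sup>2)" using s(2) M by (simp add: eq_neg_iff_add_eq_0)
  have k: "snd m $ k = - ?d - (if i0 \<in> A then ?l * ?t\<^sup>2 else ?l)"
    using s(3) M by (simp add: algebra_simps eq_neg_iff_add_eq_0)
  have b0: "?b \<noteq> 0" unfolding b using nz[of i0] m(2) by auto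
  have ab: "?a\<^sup>2 = ?b * - (if i0 \<in> A then ?l * ?t\<^sup>2 else ?l)" unfolding a b by (simp add: power2_eq_square)
  have kb: "?a\<^sup>2 - ?d * ?b = ?b * snd m $ k" unfolding ab k by (simp add: algebra_simps)
  have mr: "snd ?y $ i \<noteq> 0" if "i \<notin> {j, k, i0}" for i using my[OF that] nz[of i] by simp
  show "?y \<in> chart_range A j k i0"
    unfolding chart_range_def using b0 kb nz mr a m(2) by auto
  have "fst (chart_params A j k i0 ?y) $ i = fst m $ i" for i
    using my[of i] mj a b nz[of i0] m(2) by (auto simp: chart_params_def power2_eq_square)
  moreover have "snd (chart_params A j k i0 ?y) $ i = snd m $ i" for i
  proof -
    have "- ?a\<^sup>2 / ?b = ?l" if "i0 \<notin> A" unfolding ab using that b0 by simp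
    moreover have "(?a\<^sup>2 - ?d * ?b) / ?b = snd m $ k" unfolding kb using b0 by simp
    ultimately show ?thesis using my[of i] mj b by (auto simp: chart_params_def)
  qed
  ultimately show "chart_params A j k i0 ?y = m" by (simp add: prod_eq_iff vec_eq_iff)
qed

lemma smooth_on_chart_sums:
  "smooth_on UNIV (chart_a :: (complex^'n) \<times> (complex^'n::finite) \<Rightarrow> complex)"
  "smooth_on UNIV (chart_b A :: (complex^'n) \<times> (complex^'n::finite) \<Rightarrow> complex)"
  "smooth_on UNIV (chart_d A :: (complex^'n) \<times> (complex^'n::finite) \<Rightarrow> complex)"
  unfolding chart_a_def chart_b_def chart_d_def by (intro smooth_intros; simp)+

lemma open_chart_range: "open (chart_range A j k i0 :: ((complex^'n) \<times> (complex^'n::finite)) set)"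
proof -
  note c = smooth_on_chart_sums[THEN smooth_on_continuous]
  have 1: "open {y :: (complex^'n) \<times> (complex^'n). chart_b A y \<noteq> 0}"
    by (intro open_Collect_neq c continuous_on_const)
  have 2: "open {y :: (complex^'n) \<times> (complex^'n). i0 \<in> A \<or> chart_a y \<noteq> 0}"
    by (cases "i0 \<in> A") (auto intro!: open_Collect_neq c continuous_on_const)
  have 3: "open {y :: (complex^'n) \<times> (complex^'n). (chart_a y)\<^sup>2 - chart_d A y * chart_b A y \<noteq> 0}"
    by (intro open_Collect_neq continuous_intros c)
  have 4: "open (\<Inter>i\<in>-{j, k, i0}. {y :: (complex^'n) \<times> (complex^'n). snd y $ i \<noteq> 0})"
    by (intro open_INT ballI open_Collect_neq continuous_intros finite)
  show ?thesis unfolding chart_range_def by (intro open_Int 1 2 3 4)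
qed

definition chart_residues :: "'n set \<Rightarrow> 'n \<Rightarrow> 'n \<Rightarrow> 'n \<Rightarrow> (complex^'n) \<times> (complex^'n) \<Rightarrow> complex^2^2^'n::finite" where
  "chart_residues A j k i0 y = (\<chi> i. normal_residue A (chart_params A j k i0 y) i)"

lemma smooth_on_chart_residues:
  "smooth_on (chart_range A j k i0) (chart_residues A j k i0 :: (complex^'n) \<times> (complex^'n) \<Rightarrow> complex^2^2^'n::finite)"
proof -
  let ?R = "chart_range A j k i0 :: ((complex^'n) \<times> (complex^'n)) set"
  note op = open_chart_range[of A j k i0]
  note s = smooth_on_chart_sums[THEN smooth_on_subset, OF op subset_UNIV]
  have ne: "chart_b A y \<noteq> 0" "i0 \<notin> A \<Longrightarrow> chart_a y \<noteq> 0" if "y \<in> ?R" for y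
    using that by (auto simp: chart_range_def)
  have f: "smooth_on ?R (\<lambda>y. fst (chart_params A j k i0 y) $ i)" for i
  proof -
    have e: "fst (chart_params A j k i0 y) $ i
       = (if i = i0 then (if i0 \<in> A then chart_a y / chart_b A y else chart_b A y / chart_a y)
           else if i = j \<or> i = k then 0 else fst y $ i)" for y :: "(complex^'n) \<times> (complex^'n)"
      by (simp add: chart_params_def)
    show ?thesis unfolding e
      by (intro smooth_on_if smooth_on_divide s smooth_on_const smooth_on_components smooth_on_id op)
        (use ne in auto)
  qed
  have g: "smooth_on ?R (\<lambda>y. snd (chart_params A j k i0 y) $ i)" for i
  proof -
    have e: "snd (chart_params A j k i0 y) $ i
       = (if i = i0 then (if i0 \<in> A then - chart_b A y else - (chart_a y)\<^sup>2 / chart_b A y)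
           else if i = j then 1
           else if i = k then ((chart_a y)\<^sup>2 - chart_d A y * chart_b A y) / chart_b A y else snd y $ i)"
      for y :: "(complex^'n) \<times> (complex^'n)"
      by (simp add: chart_params_def)
    show ?thesis unfolding e
      by (intro smooth_on_if smooth_on_divide smooth_on_minus smooth_on_diff smooth_on_mult smooth_on_power
          s smooth_on_const smooth_on_components smooth_on_id op)
        (use ne in auto)
  qed
  have e: "chart_residues A j k i0 y = (\<chi> i a b. let t = fst (chart_params A j k i0 y) $ i; l = snd (chart_params A j k i0 y) $ i
      in if a = 1 then (if b = 1 then - (l * t) else if i \<in> A then l else l * t\<^sup>2)
         else (if b = 1 then - (if i \<in> A then l * t\<^sup>2 else l) else l * t))" for y :: "(complex^'n) \<times> (complex^'n)"
    by (simp add: chart_residues_def vec_eq_iff forall_2 normal_residue_nth Let_def)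
  show ?thesis unfolding e Let_def
    by (intro smooth_on_vec_lambda smooth_on_if smooth_on_minus smooth_on_mult smooth_on_power f g op)
qed

context
  fixes x :: "'n::finite \<Rightarrow> cp1"
  assumes inj: "inj x"
begin

text \<open>The flags of a normal form are the kernels of its residues.\<close>

lemma represents_iff:
  assumes N: "stable_residues N" and m: "\<And>i. snd m $ i \<noteq> 0" "stable_residues (normal_residue A m)"
  shows "represents x A m (higgs_class x N) \<longleftrightarrow> conjugate N (normal_residue A m)"
proof
  assume "represents x A m (higgs_class x N)"
  then obtain X \<phi> where "(X, \<phi>) \<in> higgs_class x N" "\<And>i. Res \<phi> (x i) = normal_residue A m i"
    unfolding represents_def by blast
  then show "conjugate N (normal_residue A m)" using higgs_class_iff[OF inj N] by simp
next
  assume c: "conjugate N (normal_residue A m)"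
  note b = stable_residues_bundle[OF inj m(2)]
  let ?p = "(\<lambda>i. kernel (normal_residue A m i), residue_form x (normal_residue A m))"
  have "?p \<in> higgs_class x N" unfolding higgs_class_iff[OF inj N] b(3) using b(1) c by blast
  moreover have "Res (residue_form x (normal_residue A m)) (x i) = normal_residue A m i" for i
    using fun_cong[OF b(3), of i] by simp
  ultimately show "represents x A m (higgs_class x N)"
    unfolding represents_def using normal_residue_nilpotent(2)[OF m(1)] by (intro bexI[of _ ?p]) auto
qed

text \<open>The chart drops the eliminated parameters of the normal form, and the solved equations recover them.\<close>

lemma chart_facts:
  assumes d: "j \<in> A" "k \<notin> A" "i0 \<noteq> j" "i0 \<noteq> k"
  defines "U \<equiv> higgs_chart_domain x A j k i0" and "\<kappa> \<equiv> higgs_chart x A j k i0"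
    and "W \<equiv> chart_space j k i0 \<inter> chart_range A j k i0"
    and "C \<equiv> \<lambda>y. higgs_class x (($) (chart_residues A j k i0 y))"
  shows "\<kappa> ` U = W" "\<And>y. y \<in> W \<Longrightarrow> inv_into U \<kappa> y = C y" "\<And>y. y \<in> W \<Longrightarrow> stable_residues (($) (chart_residues A j k i0 y))"
proof -
  have st: "stable_residues (normal_residue A m)" if "m \<in> normal_parameters A j k" for m
    using normal_parameters_stable[OF that d(1,2)] .
  have rep: "represents x A m (higgs_class x N) \<longleftrightarrow> conjugate N (normal_residue A m)"
    if "stable_residues N" "m \<in> normal_parameters A j k" for N m
    by (rule represents_iff[OF that(1) _ st[OF that(2)]]) (use that(2) in \<open>simp add: normal_parameters_iff\<close>)
  have repc: "represents x A m c \<longleftrightarrow> c = higgs_class x (normal_residue A m)"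
    if c: "c \<in> higgs_moduli x" and m: "m \<in> normal_parameters A j k" for c m
  proof -
    obtain N where N: "stable_residues N" "c = higgs_class x N" using c unfolding higgs_moduli_eq[OF inj] by blast
    show ?thesis unfolding N(2) rep[OF N(1) m] higgs_class_eq_iff[OF inj N(1) st[OF m]] ..
  qed
  have mod: "higgs_class x (normal_residue A m) \<in> higgs_moduli x" if "m \<in> normal_parameters A j k" for m
    unfolding higgs_moduli_eq[OF inj] using st[OF that] by blast
  have \<kappa>: "\<kappa> (higgs_class x (normal_residue A m)) = drop_params j k i0 m" if m: "m \<in> normal_parameters A j k" for m
  proof -
    have "(THE m'. m' \<in> normal_parameters A j k \<and> represents x A m' (higgs_class x (normal_residue A m))) = m"
    proof (rule the_equality)
      show "m \<in> normal_parameters A j k \<and> represents x A m (higgs_class x (normal_residue A m))"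
        using m repc[OF mod[OF m] m] by blast
      fix m' assume m': "m' \<in> normal_parameters A j k \<and> represents x A m' (higgs_class x (normal_residue A m))"
      then have "conjugate (normal_residue A m) (normal_residue A m')" using rep[OF st[OF m], of m'] by blast
      then show "m' = m" using normal_parameters_unique[OF m _ d(1,2)] m' by blast
    qed
    then show ?thesis unfolding \<kappa>_def higgs_chart_def drop_params_def by (simp only: Let_def)
  qed
  have U: "c \<in> U \<longleftrightarrow> (\<exists>m\<in>normal_parameters A j k. c = higgs_class x (normal_residue A m) \<and> (i0 \<in> A \<or> fst m $ i0 \<noteq> 0))" for c
    unfolding U_def higgs_chart_domain_def using repc mod by blast
  have res: "(($) (chart_residues A j k i0 y)) = normal_residue A (chart_params A j k i0 y)" for y
    by (simp add: chart_residues_def fun_eq_iff)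
  have CU: "C y \<in> U" "\<kappa> (C y) = y" "stable_residues (($) (chart_residues A j k i0 y))" if "y \<in> W" for y
  proof -
    have y: "y \<in> chart_space j k i0" "y \<in> chart_range A j k i0" using that by (auto simp: W_def)
    note p = chart_params_normal[OF y d]
    show "C y \<in> U" unfolding U C_def res using p by blast
    show "\<kappa> (C y) = y" unfolding C_def res using \<kappa>[OF p(1)] p(3) by simp
    show "stable_residues (($) (chart_residues A j k i0 y))" unfolding res using st p(1) by blast
  qed
  have retr: "\<kappa> c \<in> W \<and> C (\<kappa> c) = c" if cU: "c \<in> U" for c
  proof -
    obtain m where m: "m \<in> normal_parameters A j k" "c = higgs_class x (normal_residue A m)" "i0 \<in> A \<or> fst m $ i0 \<noteq> 0"
      using cU unfolding U by blast
    note p = drop_params_chart[OF m(1,3) d]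
    show ?thesis unfolding m(2) \<kappa>[OF m(1)] C_def res W_def using p drop_params_in[of j k i0 m] by simp
  qed
  show img: "\<kappa> ` U = W"
  proof (intro equalityI subsetI)
    fix y assume "y \<in> W"
    then show "y \<in> \<kappa> ` U" using CU(1,2)[of y] by (intro image_eqI[of _ _ "C y"]) simp_all
  qed (use retr in blast)
  have "inj_on \<kappa> U"
  proof (rule inj_onI)
    fix c d assume cd: "c \<in> U" "d \<in> U" "\<kappa> c = \<kappa> d"
    have "c = C (\<kappa> c)" using retr[OF cd(1)] by simp
    also have "\<dots> = d" unfolding cd(3) using retr[OF cd(2)] by simp
    finally show "c = d" .
  qed
  then show "inv_into U \<kappa> y = C y" if "y \<in> W" for y
    using inv_into_f_f[of \<kappa> U "C y"] CU(1,2)[OF that] by simp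
  show "\<And>y. y \<in> W \<Longrightarrow> stable_residues (($) (chart_residues A j k i0 y))" by (rule CU(3))
qed

lemma higgs_atlasE:
  assumes "(U, \<kappa>, W) \<in> higgs_atlas x"
  obtains A j k i0 where "j \<in> A" "k \<notin> A" "i0 \<noteq> j" "i0 \<noteq> k" "U = higgs_chart_domain x A j k i0"
    "\<kappa> = higgs_chart x A j k i0" "W = chart_space j k i0"
  using assms unfolding higgs_atlas_def by blast

lemma chart_preimage_eq:
  assumes d: "j \<in> A" "k \<notin> A" "i0 \<noteq> j" "i0 \<noteq> k"
  shows "chart_preimage (higgs_chart_domain x A j k i0) (higgs_chart x A j k i0) V
     = {y \<in> chart_space j k i0 \<inter> chart_range A j k i0. higgs_class x (($) (chart_residues A j k i0 y)) \<in> V}"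
  unfolding chart_preimage_def using chart_facts[OF d] by auto

text \<open>In a chart, an open condition on residues is pulled back along the smooth map \<open>chart_residues\<close>; invariance makes it
  independent of the normal form.\<close>

lemma openin_higgs_space:
  assumes P: "open P" and inv: "\<And>N M. stable_residues (($) N) \<Longrightarrow> conjugate (($) N) (($) M) \<Longrightarrow> N \<in> P \<Longrightarrow> M \<in> P"
  shows "openin (topo (higgs_space x)) {higgs_class x (($) N) | N. stable_residues (($) N) \<and> N \<in> P}"
    (is "openin _ ?V")
    and "j \<in> A \<Longrightarrow> k \<notin> A \<Longrightarrow> i0 \<noteq> j \<Longrightarrow> i0 \<noteq> k \<Longrightarrow>
      chart_preimage (higgs_chart_domain x A j k i0) (higgs_chart x A j k i0) {higgs_class x (($) N) | N. stable_residues (($) N) \<and> N \<in> P}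
       = chart_space j k i0 \<inter> (chart_range A j k i0 \<inter> chart_residues A j k i0 -` P)"
proof -
  have mem: "higgs_class x (($) N) \<in> ?V \<longleftrightarrow> N \<in> P" if N: "stable_residues (($) N)" for N
  proof
    assume "higgs_class x (($) N) \<in> ?V"
    then obtain M where M: "stable_residues (($) M)" "M \<in> P" "higgs_class x (($) N) = higgs_class x (($) M)" by blast
    then have "conjugate (($) M) (($) N)" using higgs_class_eq_iff[OF inj M(1) N] by simp
    then show "N \<in> P" using inv M by blast
  qed (use N in blast)
  have pre: "chart_preimage (higgs_chart_domain x A j k i0) (higgs_chart x A j k i0) ?V
       = chart_space j k i0 \<inter> (chart_range A j k i0 \<inter> chart_residues A j k i0 -` P)"
    if d: "j \<in> A" "k \<notin> A" "i0 \<noteq> j" "i0 \<noteq> k" for A j k i0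
    unfolding chart_preimage_eq[OF d] using mem[OF chart_facts(3)[OF d]] by blast
  then show "j \<in> A \<Longrightarrow> k \<notin> A \<Longrightarrow> i0 \<noteq> j \<Longrightarrow> i0 \<noteq> k \<Longrightarrow>
      chart_preimage (higgs_chart_domain x A j k i0) (higgs_chart x A j k i0) ?V
       = chart_space j k i0 \<inter> (chart_range A j k i0 \<inter> chart_residues A j k i0 -` P)" .
  show "openin (topo (higgs_space x)) ?V"
    unfolding higgs_space_def openin_atlas_space
  proof (intro conjI ballI)
    show "?V \<subseteq> higgs_moduli x" unfolding higgs_moduli_eq[OF inj] by blast
    fix c assume "c \<in> higgs_atlas x"
    then obtain U \<kappa> W where c: "c = (U, \<kappa>, W)" "(U, \<kappa>, W) \<in> higgs_atlas x" by (cases c) auto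
    obtain A j k i0 where A: "j \<in> A" "k \<notin> A" "i0 \<noteq> j" "i0 \<noteq> k" "U = higgs_chart_domain x A j k i0"
      "\<kappa> = higgs_chart x A j k i0" "W = chart_space j k i0"
      using higgs_atlasE[OF c(2)] .
    have "open (chart_range A j k i0 \<inter> chart_residues A j k i0 -` P)"
      using smooth_on_continuous[OF smooth_on_chart_residues] open_chart_range P by (rule continuous_open_preimage)
    then show "case c of (U, \<kappa>, W) \<Rightarrow> openin (top_of_set W) (chart_preimage U \<kappa> ?V)"
      unfolding c(1) prod.case A(5-7) pre[OF A(1-4)] by blast
  qed
qed

lemma topspace_higgs_space: "topspace (topo (higgs_space x)) = higgs_moduli x"
proof
  show "topspace (topo (higgs_space x)) \<subseteq> higgs_moduli x"
    using openin_atlas_space[of "higgs_moduli x" "higgs_atlas x" "topspace (topo (higgs_space x))"]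
    unfolding higgs_space_def by simp
  have "higgs_moduli x = {higgs_class x (($) N) | N. stable_residues (($) N) \<and> N \<in> UNIV}"
  proof -
    have e: "(($) (\<chi> i. N i)) = N" for N :: "'n \<Rightarrow> complex^2^2" by (simp add: fun_eq_iff)
    show ?thesis unfolding higgs_moduli_eq[OF inj]
    proof (intro equalityI subsetI)
      fix c assume "c \<in> higgs_class x ` {N. stable_residues N}"
      then obtain N where "stable_residues N" "c = higgs_class x N" by blast
      then show "c \<in> {higgs_class x (($) N) | N. stable_residues (($) N) \<and> N \<in> UNIV}"
        using e[of N] by (intro CollectI exI[of _ "\<chi> i. N i"]) simp
    qed blast
  qed
  then show "higgs_moduli x \<subseteq> topspace (topo (higgs_space x))"
    using openin_subset[OF openin_higgs_space(1)[of UNIV]] by simp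
qed

lemma smooth_higgs_iff:
  "smooth (higgs_space x) V f \<longleftrightarrow> (\<forall>(U, \<kappa>, W)\<in>higgs_atlas x.
     smooth (sub_space euclidean_smooth W) (chart_preimage U \<kappa> V) (f \<circ> inv_into U \<kappa>))"
  by (simp add: higgs_space_def atlas_space_def)

lemma smooth_restricts_higgs_space: "smooth_restricts (higgs_space x)"
  unfolding smooth_restricts_def
proof (intro allI impI, elim conjE)
  fix V V' f assume V: "smooth (higgs_space x) V f" "openin (topo (higgs_space x)) V'" "V' \<subseteq> V"
  show "smooth (higgs_space x) V' f"
    unfolding smooth_higgs_iff
  proof (intro ballI)
    fix c assume c: "c \<in> higgs_atlas x"
    obtain U \<kappa> W where cc: "c = (U, \<kappa>, W)" by (cases c) auto
    have "smooth (sub_space euclidean_smooth W) (chart_preimage U \<kappa> V) (f \<circ> inv_into U \<kappa>)"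
      using V(1) c unfolding smooth_higgs_iff cc by blast
    moreover have "openin (topo (sub_space euclidean_smooth W)) (chart_preimage U \<kappa> V')"
      using V(2) c unfolding higgs_space_def openin_atlas_space cc by auto
    moreover have "chart_preimage U \<kappa> V' \<subseteq> chart_preimage U \<kappa> V" using V(3) by (auto simp: chart_preimage_def)
    ultimately show "case c of (U, \<kappa>, W) \<Rightarrow>
        smooth (sub_space euclidean_smooth W) (chart_preimage U \<kappa> V') (f \<circ> inv_into U \<kappa>)"
      unfolding cc prod.case using smooth_restricts_sub_euclidean[of W] unfolding smooth_restricts_def by blast
  qed
qed

text \<open>As for quotients, invariant smooth functions of the residues are smooth on the moduli space, since in each chart they are composed with \<open>chart_residues\<close>.\<close>

lemma smooth_map_higgs_invariant:
  fixes s :: "complex^2^2^'n \<Rightarrow> 'f::euclidean_space"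
  assumes s: "smooth_on O1 s"
    and inv: "\<And>N M. stable_residues (($) N) \<Longrightarrow> conjugate (($) N) (($) M) \<Longrightarrow> N \<in> O1 \<Longrightarrow> M \<in> O1 \<and> s M = s N"
    and Z: "Z \<subseteq> {higgs_class x (($) N) | N. stable_residues (($) N) \<and> N \<in> O1}"
    and \<sigma>: "\<And>N. stable_residues (($) N) \<Longrightarrow> N \<in> O1 \<Longrightarrow> \<sigma> (higgs_class x (($) N)) = s N"
  shows "smooth_map (sub_space (higgs_space x) Z) euclidean_smooth \<sigma>"
proof -
  let ?X = "higgs_space x"
  let ?W = "\<lambda>G. {higgs_class x (($) N) | N. stable_residues (($) N) \<and> N \<in> O1 \<inter> s -` G}"
  have oP: "open (O1 \<inter> s -` G)" if "open G" for G
    using smooth_on_continuous[OF s] smooth_on_open[OF s] that by (rule continuous_open_preimage)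
  have iP: "M \<in> O1 \<inter> s -` G" if "stable_residues (($) N)" "conjugate (($) N) (($) M)" "N \<in> O1 \<inter> s -` G" for N M G
    using inv[OF that(1,2)] that(3) by simp
  have pt: "topspace (subtopology (topo ?X) Z) = Z"
    using Z unfolding topspace_subtopology topspace_higgs_space higgs_moduli_eq[OF inj] by blast
  have ZW: "{c \<in> Z. \<sigma> c \<in> G} = Z \<inter> ?W G" for G
  proof (intro equalityI subsetI)
    fix c assume "c \<in> {c \<in> Z. \<sigma> c \<in> G}"
    moreover then obtain N where "c = higgs_class x (($) N)" "stable_residues (($) N)" "N \<in> O1" using Z by blast
    ultimately show "c \<in> Z \<inter> ?W G" using \<sigma>[of N] by auto
  next
    fix c assume "c \<in> Z \<inter> ?W G"
    then obtain N where "c \<in> Z" "c = higgs_class x (($) N)" "stable_residues (($) N)" "N \<in> O1" "s N \<in> G" by blast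
    then show "c \<in> {c \<in> Z. \<sigma> c \<in> G}" using \<sigma>[of N] by simp
  qed
  have opW: "openin (topo ?X) (?W G)" if "open G" for G
    by (rule openin_higgs_space(1)[OF oP[OF that]]) (rule iP)
  have opZ: "openin (subtopology (topo ?X) Z) {c \<in> Z. \<sigma> c \<in> G}" if "open G" for G
    unfolding ZW by (rule openin_subtopology_Int2[OF opW[OF that]])
  have sm: "smooth ?X (?W G) (g \<circ> \<sigma>)" if g: "smooth_on G g" for G g
    unfolding smooth_higgs_iff
  proof (intro ballI)
    fix c assume "c \<in> higgs_atlas x"
    then obtain U \<kappa> W where c: "c = (U, \<kappa>, W)" "(U, \<kappa>, W) \<in> higgs_atlas x" by (cases c) auto
    obtain A j k i0 where A: "j \<in> A" "k \<notin> A" "i0 \<noteq> j" "i0 \<noteq> k" "U = higgs_chart_domain x A j k i0"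
      "\<kappa> = higgs_chart x A j k i0" "W = chart_space j k i0"
      using higgs_atlasE[OF c(2)] .
    note oG = smooth_on_open[OF g]
    let ?O = "chart_range A j k i0 \<inter> chart_residues A j k i0 -` (O1 \<inter> s -` G)"
    have oO: "open ?O"
      using smooth_on_continuous[OF smooth_on_chart_residues] open_chart_range oP[OF oG] by (rule continuous_open_preimage)
    have "smooth_on ?O (chart_residues A j k i0)"
      using smooth_on_subset[OF smooth_on_chart_residues oO] by blast
    moreover have "smooth_on (O1 \<inter> s -` G) s" using smooth_on_subset[OF s oP[OF oG]] by blast
    ultimately have "smooth_on ?O (\<lambda>y. s (chart_residues A j k i0 y))" by (rule smooth_on_compose) auto
    then have gs: "smooth_on ?O (\<lambda>y. g (s (chart_residues A j k i0 y)))" using g by (rule smooth_on_compose) auto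
    have "((g \<circ> \<sigma>) \<circ> inv_into U \<kappa>) y = g (s (chart_residues A j k i0 y))" if y: "y \<in> chart_space j k i0 \<inter> ?O" for y
    proof -
      have yW: "y \<in> chart_space j k i0 \<inter> chart_range A j k i0" using y by blast
      have "inv_into U \<kappa> y = higgs_class x (($) (chart_residues A j k i0 y))"
        unfolding A(5,6) using chart_facts(2)[OF A(1-4) yW] .
      then show ?thesis using \<sigma>[OF chart_facts(3)[OF A(1-4) yW]] y by simp
    qed
    note eq = this
    have pre: "chart_preimage U \<kappa> (?W G) = chart_space j k i0 \<inter> ?O"
      unfolding A(5,6) by (rule openin_higgs_space(2)[OF oP[OF oG] iP A(1-4)])
    have "smooth (sub_space euclidean_smooth W) (chart_preimage U \<kappa> (?W G)) ((g \<circ> \<sigma>) \<circ> inv_into U \<kappa>)"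
      unfolding pre smooth_sub_euclidean_iff
    proof (intro conjI ballI)
      show "openin (top_of_set W) (chart_space j k i0 \<inter> ?O)" unfolding A(7) using oO by blast
      fix y assume y: "y \<in> chart_space j k i0 \<inter> ?O"
      show "\<exists>V h. y \<in> V \<and> smooth_on V h \<and>
          (\<forall>z\<in>chart_space j k i0 \<inter> ?O \<inter> V. ((g \<circ> \<sigma>) \<circ> inv_into U \<kappa>) z = h z)"
        by (intro exI[of _ ?O] exI[of _ "\<lambda>y. g (s (chart_residues A j k i0 y))"] conjI ballI gs eq)
          (use y in blast)+
    qed
    then show "case c of (U, \<kappa>, W) \<Rightarrow>
        smooth (sub_space euclidean_smooth W) (chart_preimage U \<kappa> (?W G)) ((g \<circ> \<sigma>) \<circ> inv_into U \<kappa>)"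
      unfolding c(1) prod.case .
  qed
  show ?thesis
    unfolding smooth_map_def topo_sub_space[of ?X] pt topo_euclidean_smooth
  proof (intro conjI allI impI, goal_cases)
    case 1
    then show ?case unfolding continuous_map_def pt using opZ by auto
  next
    case (2 V g)
    then have g: "smooth_on V g" "open V" by (auto simp: smooth_euclidean_iff)
    show ?case
      unfolding smooth_sub_space_iff
    proof (intro conjI ballI opZ[OF g(2)])
      fix c assume "c \<in> {c \<in> Z. \<sigma> c \<in> V}"
      then have "c \<in> ?W V" unfolding ZW by blast
      then show "\<exists>V' h. openin (topo ?X) V' \<and> c \<in> V' \<and> smooth ?X V' h \<and> (\<forall>y\<in>{c \<in> Z. \<sigma> c \<in> V} \<inter> V'. (g \<circ> \<sigma>) y = h y)"
        using opW[OF g(2)] sm[OF g(1)] by (intro exI[of _ "?W V"] exI[of _ "g \<circ> \<sigma>"]) blast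
    qed
  qed
qed

end

section \<open>The component of Higgs bundles\<close>

definition model_residues :: "'n::finite set \<Rightarrow> complex^'n \<Rightarrow> 'n \<Rightarrow> complex^2^2" where
  "model_residues S l i = (if i \<in> S then vector [vector [0, l $ i], vector [0, 0]]
     else vector [vector [0, 0], vector [l $ i, 0]])"

lemma model_residues_nth:
  "model_residues S l i $ 1 $ 1 = 0" "model_residues S l i $ 2 $ 2 = 0"
  "model_residues S l i $ 1 $ 2 = (if i \<in> S then l $ i else 0)"
  "model_residues S l i $ 2 $ 1 = (if i \<in> S then 0 else l $ i)"
  by (simp_all add: model_residues_def)

lemma model_residues_trace:
  "pair_trace (model_residues S l) i k = (if (i \<in> S) = (k \<in> S) then 0 else l $ i * l $ k)"
  by (auto simp: pair_trace_expand model_residues_nth)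

lemma model_residues_stable:
  assumes l: "l \<in> config S" and S: "S \<noteq> {}" "- S \<noteq> {}"
  shows "stable_residues (model_residues S l)"
proof -
  have L: "\<And>i. l $ i \<noteq> 0" "(\<Sum>i\<in>S. l $ i) = 0" "(\<Sum>i\<in>-S. l $ i) = 0" using l by (auto simp: config_def)
  have "nilpotent2 (model_residues S l i)" for i
    using L(1)[of i] by (auto simp: nilpotent2_def mat2_eq_iff model_residues_nth)
  moreover have "(\<Sum>i\<in>UNIV. model_residues S l i $ a $ b) = 0" for a b
    using exhaust_2[of a] exhaust_2[of b] L(2,3) by (auto simp: model_residues_nth sum_UNIV_if)
  moreover obtain j k where "j \<in> S" "k \<notin> S" using S by blast
  then have "pair_trace (model_residues S l) j k \<noteq> 0" using L(1) by (simp add: model_residues_trace)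
  ultimately show ?thesis unfolding stable_residues_def by blast
qed

text \<open>The diagonal matrix with entries \<open>c\<close> and \<open>1\<close> scales the two off-diagonal entries by inverse factors.\<close>

lemma model_residues_rel:
  assumes "config_rel S l m"
  shows "conjugate (model_residues S l) (model_residues S m)"
proof -
  obtain c where c: "c \<noteq> 0" "m = config_scale S c l" using assms by (auto simp: config_rel_def)
  let ?g = "vector [vector [c, 0], vector [0, 1]] :: complex^2^2"
  let ?h = "vector [vector [1 / c, 0], vector [0, 1]] :: complex^2^2"
  have "?g ** ?h = mat 1" "?h ** ?g = mat 1" using c(1) by (simp_all add: mat2_eq_iff mult2_nth mat_def)
  then have "invertible ?g" by (auto simp: invertible_def)
  moreover have "?g ** model_residues S l i = model_residues S m i ** ?g" for i
    using c by (simp add: mat2_eq_iff mult2_nth model_residues_nth config_scale_def)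
  ultimately show ?thesis unfolding conjugate_def by blast
qed

text \<open>In a basis of vectors spanning the two kernels, all residues are multiples of elementary
  off-diagonal matrices.\<close>

lemma model_residues_form:
  fixes N :: "'n::finite \<Rightarrow> complex^2^2"
  assumes N: "stable_residues N" and S: "S \<noteq> {}" "- S \<noteq> {}"
    and tr: "\<And>i k. (i \<in> S) = (k \<in> S) \<Longrightarrow> pair_trace N i k = 0"
  shows "\<exists>l\<in>config S. conjugate (model_residues S l) N"
proof -
  have n: "nilpotent2 (N i)" for i using N by (simp add: stable_residues_def)
  have sum0: "(\<Sum>i\<in>UNIV. N i $ a $ b) = 0" for a b using N by (simp add: stable_residues_def)
  obtain p q where pq: "p \<in> S" "q \<notin> S" using S by blast
  obtain v where v: "v \<noteq> 0" "kernel (N p) = vec.span {v}"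
    using nilpotent2_kernel(1)[OF n] by (auto simp: is_line_iff)
  obtain w where w: "w \<noteq> 0" "kernel (N q) = vec.span {w}"
    using nilpotent2_kernel(1)[OF n] by (auto simp: is_line_iff)
  have kS: "kernel (N i) = vec.span {v}" if "i \<in> S" for i
    using tr[of i p] pair_trace_eq_0_iff[of N i p, OF n n] that pq v(2) by simp
  have kC: "kernel (N i) = vec.span {w}" if "i \<notin> S" for i
    using tr[of i q] pair_trace_eq_0_iff[of N i q, OF n n] that pq w(2) by simp
  have vw: "v $ 1 * w $ 2 \<noteq> w $ 1 * v $ 2"
  proof
    assume "v $ 1 * w $ 2 = w $ 1 * v $ 2"
    then have "v \<in> vec.span {w}" using in_span_iff_minor[OF w(1)] by simp
    moreover have "is_line (vec.span {w})" using w(1) by (auto simp: is_line_iff)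
    ultimately have "vec.span {w} = vec.span {v}" using line_eq_span v(1) by blast
    then have "kernel (N i) = kernel (N k)" for i k using kS kC by metis
    then have "pair_trace N i k = 0" for i k using pair_trace_eq_0_iff[of N i k, OF n n] by blast
    then show False using N by (auto simp: stable_residues_def)
  qed
  have "\<exists>c. (i \<in> S \<longrightarrow> N i *v w = c *s v) \<and> (i \<notin> S \<longrightarrow> N i *v v = c *s w)" for i
  proof (cases "i \<in> S")
    case True
    have "N i *v w \<in> vec.span {v}" using nilpotent2_kernel(2)[OF n[of i]] kS[OF True] by simp
    with True show ?thesis by (auto simp: in_span_single)
  next
    case False
    have "N i *v v \<in> vec.span {w}" using nilpotent2_kernel(2)[OF n[of i]] kC[OF False] by simp
    with False show ?thesis by (auto simp: in_span_single)
  qed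
  then obtain c where c: "\<And>i. i \<in> S \<Longrightarrow> N i *v w = c i *s v" "\<And>i. i \<notin> S \<Longrightarrow> N i *v v = c i *s w" by metis
  define l :: "complex^'n" where "l = (\<chi> i. c i)"
  have z: "N i *v v = 0" if "i \<in> S" for i
    using kS[OF that] vec.span_base[of v "{v}"] by (auto simp: kernel_def)
  have z': "N i *v w = 0" if "i \<notin> S" for i
    using kC[OF that] vec.span_base[of w "{w}"] by (auto simp: kernel_def)
  define h :: "complex^2^2" where "h = vector [vector [v $ 1, w $ 1], vector [v $ 2, w $ 2]]"
  let ?d = "v $ 1 * w $ 2 - w $ 1 * v $ 2"
  define h' :: "complex^2^2" where "h' = vector [vector [w $ 2 / ?d, - w $ 1 / ?d], vector [- v $ 2 / ?d, v $ 1 / ?d]]"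
  have d: "?d \<noteq> 0" using vw by simp
  have hh: "h ** h' = mat 1"
    using d by (simp add: h_def h'_def mat2_eq_iff mult2_nth mat_def diff_divide_distrib[symmetric] mult.commute)
  then have inv: "invertible h" using matrix_left_right_inverse[of h h'] by (auto simp: invertible_def)
  have int: "h ** model_residues S l i = N i ** h" for i
  proof (cases "i \<in> S")
    case True
    have "(N i *v v) $ a = 0" "(N i *v w) $ a = c i * v $ a" for a
      using z[OF True] c(1)[OF True] by simp_all
    from this[of 1] this[of 2] True show ?thesis
      by (simp add: mat2_eq_iff mult2_nth model_residues_nth h_def l_def mult.commute)
  next
    case False
    have "(N i *v w) $ a = 0" "(N i *v v) $ a = c i * w $ a" for a
      using z'[OF False] c(2)[OF False] by simp_all
    from this[of 1] this[of 2] False show ?thesis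
      by (simp add: mat2_eq_iff mult2_nth model_residues_nth h_def l_def mult.commute)
  qed
  have conj: "conjugate (model_residues S l) N" unfolding conjugate_def using inv int by blast
  have l0: "l $ i \<noteq> 0" for i
  proof
    assume "l $ i = 0"
    then have "model_residues S l i = 0" by (simp add: mat2_eq_iff model_residues_nth)
    then show False using conjugate_zero_iff[OF conj, of i] n[of i] by (simp add: nilpotent2_def)
  qed
  have s: "(\<Sum>i\<in>UNIV. (N i *v u) $ a) = 0" for u a
    by (simp add: mult2_nth sum.distrib sum_distrib_right[symmetric] sum0)
  have "(\<Sum>i\<in>S. l $ i) = 0"
  proof -
    have "(\<Sum>i\<in>S. l $ i) * v $ a = 0" for a
    proof -
      have "(\<Sum>i\<in>UNIV. (N i *v w) $ a) = (\<Sum>i\<in>UNIV. if i \<in> S then l $ i * v $ a else 0)"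
        by (rule sum.cong[OF refl]) (simp add: c(1) z' l_def)
      then show ?thesis unfolding s sum_UNIV_if by (simp add: sum_distrib_right)
    qed
    from this[of 1] this[of 2] v(1) show ?thesis by (auto simp: vec2_eq_iff)
  qed
  moreover have "(\<Sum>i\<in>-S. l $ i) = 0"
  proof -
    have "(\<Sum>i\<in>-S. l $ i) * w $ a = 0" for a
    proof -
      have "(\<Sum>i\<in>UNIV. (N i *v v) $ a) = (\<Sum>i\<in>UNIV. if i \<in> S then 0 else l $ i * w $ a)"
        by (rule sum.cong[OF refl]) (simp add: c(2) z l_def)
      then show ?thesis unfolding s sum_UNIV_if by (simp add: sum_distrib_right)
    qed
    from this[of 1] this[of 2] w(1) show ?thesis by (auto simp: vec2_eq_iff)
  qed
  ultimately have "l \<in> config S" using l0 by (simp add: config_def)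
  with conj show ?thesis by blast
qed

lemma residue_form_in_span:
  assumes "w \<noteq> 0" "\<And>i. N i *v v \<in> vec.span {w}"
  shows "residue_form x N z *v v \<in> vec.span {w}"
proof -
  have "(residue_form x N z *v v) $ 1 * w $ 2 - w $ 1 * (residue_form x N z *v v) $ 2
     = pole_sum x (\<lambda>i. (N i *v v) $ 1 * w $ 2 - w $ 1 * (N i *v v) $ 2) z"
    by (simp add: mult2_nth residue_form_def pole_sum_linear)
  also have "(\<lambda>i. (N i *v v) $ 1 * w $ 2 - w $ 1 * (N i *v v) $ 2) = (\<lambda>i. 0)"
    using assms(2) in_span_iff_minor[OF assms(1)] by simp
  finally show ?thesis using in_span_iff_minor[OF assms(1)] by (simp add: pole_sum_zero)
qed

lemma smooth_sub_euclidean_cong: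
  "smooth (sub_space euclidean_smooth A) U f \<Longrightarrow> (\<And>x. x \<in> U \<Longrightarrow> f x = g x) \<Longrightarrow>
     smooth (sub_space euclidean_smooth A) U g"
  unfolding smooth_sub_euclidean_iff by (metis IntD1)

lemma smooth_on_pair_trace: "smooth_on UNIV (\<lambda>N :: complex^2^2^'n. pair_trace (($) N) i k)"
  unfolding pair_trace_expand by (intro smooth_intros) auto

lemma open_pair_trace: "open {N :: complex^2^2^'n. pair_trace (($) N) i k \<noteq> 0}"
  using smooth_on_continuous[OF smooth_on_pair_trace]
  by (intro open_Collect_neq continuous_on_const) auto

lemma vec_nth_lambda: "(($) (\<chi> i. N i)) = N"
  by (simp add: fun_eq_iff)

context
  fixes x :: "'n::finite \<Rightarrow> cp1" and S :: "'n set"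
  assumes inj: "inj x" and S: "2 \<le> card S" "card S + 2 \<le> CARD('n)"
begin

text \<open>The summands \<open>L\<^sub>0\<close> and \<open>L\<^sub>1\<close> are constant and equal to the flags, hence to the kernels of the residues.  Conversely the two
  kernels are different by stability, and each \<open>N\<^sub>i\<close> kills one of them and maps the other one into it.\<close>

lemma higgs_component_iff:
  assumes N: "stable_residues N"
  shows "higgs_class x N \<in> higgs_component x S \<longleftrightarrow>
    (\<forall>i k. (i \<in> S \<longleftrightarrow> k \<in> S) \<longrightarrow> pair_trace N i k = 0)"
proof
  assume "higgs_class x N \<in> higgs_component x S"
  then obtain X \<phi> L0 L1 where X: "(X, \<phi>) \<in> higgs_class x N"
      and L: "trivial_line_subbundle L0" "trivial_line_subbundle L1"
        "\<forall>i\<in>S. X i = L0 (x i)" "\<forall>i\<in>- S. X i = L1 (x i)"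
    unfolding higgs_component_def by blast
  obtain v where v: "\<And>y. L0 y = vec.span {v}" using trivial_line_subbundle_constant[OF L(1)] by metis
  obtain w where w: "\<And>y. L1 y = vec.span {w}" using trivial_line_subbundle_constant[OF L(2)] by metis
  have b: "(X, \<phi>) \<in> higgs_bundles x" and c: "conjugate N (residues_of x \<phi>)"
    using X higgs_class_iff[OF inj N] by blast+
  have nz: "Res \<phi> (x i) \<noteq> 0" for i
    using conjugate_zero_iff[OF c, of i] N by (simp add: stable_residues_def nilpotent2_def)
  note k = higgs_bundle_residues[OF inj b nz]
  have "kernel (Res \<phi> (x i)) = kernel (Res \<phi> (x k))" if "(i \<in> S) = (k \<in> S)" for i k
    using that k(2)[of i] k(2)[of k] L(3,4) v w by (cases "i \<in> S") auto
  then show "\<forall>i k. (i \<in> S \<longleftrightarrow> k \<in> S) \<longrightarrow> pair_trace N i k = 0"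
    unfolding conjugate_pair_trace[OF c] using pair_trace_eq_0_iff[of "residues_of x \<phi>"] k(1) by blast
next
  assume tr: "\<forall>i k. (i \<in> S \<longleftrightarrow> k \<in> S) \<longrightarrow> pair_trace N i k = 0"
  have n: "nilpotent2 (N i)" for i using N by (simp add: stable_residues_def)
  obtain p q where pq: "p \<in> S" "q \<notin> S" using parts_nonempty[OF S] by blast
  obtain v where v: "v \<noteq> 0" "kernel (N p) = vec.span {v}"
    using nilpotent2_kernel(1)[OF n] by (auto simp: is_line_iff)
  obtain w where w: "w \<noteq> 0" "kernel (N q) = vec.span {w}"
    using nilpotent2_kernel(1)[OF n] by (auto simp: is_line_iff)
  have kS: "kernel (N i) = vec.span {v}" if "i \<in> S" for i
    using tr pair_trace_eq_0_iff[of N i p, OF n n] that pq v(2) by simp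
  have kC: "kernel (N i) = vec.span {w}" if "i \<notin> S" for i
    using tr pair_trace_eq_0_iff[of N i q, OF n n] that pq w(2) by simp
  have disj: "vec.span {v} \<inter> vec.span {w} = {0}"
  proof -
    have "u = 0" if u: "u \<in> vec.span {v}" "u \<in> vec.span {w}" for u
    proof (rule ccontr)
      assume "u \<noteq> 0"
      moreover have "is_line (vec.span {v})" "is_line (vec.span {w})" using v(1) w(1) by (auto simp: is_line_iff)
      ultimately have "vec.span {v} = vec.span {w}" using line_eq_span u by metis
      then have "kernel (N i) = kernel (N k)" for i k using kS kC by metis
      then have "pair_trace N i k = 0" for i k using pair_trace_eq_0_iff[of N i k, OF n n] by blast
      then show False using N by (auto simp: stable_residues_def)
    qed
    then show ?thesis by (auto simp: vec.span_zero)
  qed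
  note b = stable_residues_bundle[OF inj N]
  have ri: "Res (residue_form x N) (x i) = N i" for i using fun_cong[OF b(3), of i] by simp
  have cls: "(\<lambda>i. kernel (N i), residue_form x N) \<in> higgs_class x N"
    unfolding higgs_class_iff[OF inj N] b(3) using b(1) conjugate_refl by blast
  have 0: "(0 :: complex^2) \<in> vec.span {u}" for u by (rule vec.span_zero)
  have res: "N i *v u = 0" if "i \<in> S" "u \<in> vec.span {v}" for i u using kS[OF that(1)] that(2) by (auto simp: kernel_def)
  have res': "N i *v u = 0" if "i \<notin> S" "u \<in> vec.span {w}" for i u using kC[OF that(1)] that(2) by (auto simp: kernel_def)
  have pres: "residue_form x N z *v u \<in> vec.span {w}" if "u \<in> vec.span {v}" for z u
  proof (rule residue_form_in_span[OF w(1)])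
    show "N i *v u \<in> vec.span {w}" for i
      using nilpotent2_kernel(2)[OF n[of i], of u] kC[of i] res[OF _ that, of i] 0[of w]
      by (cases "i \<in> S") auto
  qed
  have pres': "residue_form x N z *v u \<in> vec.span {v}" if "u \<in> vec.span {w}" for z u
  proof (rule residue_form_in_span[OF v(1)])
    show "N i *v u \<in> vec.span {v}" for i
      using nilpotent2_kernel(2)[OF n[of i], of u] kS[of i] res'[OF _ that, of i] 0[of v]
      by (cases "i \<in> S") auto
  qed
  have mod: "higgs_class x N \<in> higgs_moduli x" unfolding higgs_moduli_eq[OF inj] using N by blast
  let ?L0 = "\<lambda>y :: cp1. vec.span {v}" and ?L1 = "\<lambda>y :: cp1. vec.span {w}"
  have t: "trivial_line_subbundle ?L0" "trivial_line_subbundle ?L1"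
    using constant_line_subbundle(3) v(1) w(1) by blast+
  have fl: "\<forall>i\<in>S. kernel (N i) = ?L0 (x i)" "\<forall>i\<in>- S. kernel (N i) = ?L1 (x i)"
    using kS kC by simp_all
  have rr: "\<forall>i\<in>S. \<forall>u\<in>?L0 (x i). Res (residue_form x N) (x i) *v u = 0"
      "\<forall>i\<in>- S. \<forall>u\<in>?L1 (x i). Res (residue_form x N) (x i) *v u = 0"
    using res res' by (simp_all add: ri)
  show "higgs_class x N \<in> higgs_component x S"
    unfolding higgs_component_def mem_Collect_eq
    by (rule conjI[OF mod], rule bexI[OF _ cls], unfold prod.case,
        rule exI[of _ ?L0], rule exI[of _ ?L1]) (use disj t fl rr pres pres' in blast)
qed

text \<open>Traces are invariant under conjugation, so any representative may be chosen.\<close>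

definition higgs_trace :: "'n higgs set \<Rightarrow> 'n \<Rightarrow> 'n \<Rightarrow> complex" where
  "higgs_trace c = pair_trace (SOME N. stable_residues N \<and> higgs_class x N = c)"

lemma higgs_trace_class:
  assumes "stable_residues N"
  shows "higgs_trace (higgs_class x N) = pair_trace N"
proof -
  let ?M = "SOME M. stable_residues M \<and> higgs_class x M = higgs_class x N"
  have "stable_residues ?M \<and> higgs_class x ?M = higgs_class x N"
    using someI[of "\<lambda>M. stable_residues M \<and> higgs_class x M = higgs_class x N" N] assms by blast
  then have "conjugate ?M N" using higgs_class_eq_iff[OF inj _ assms] by blast
  then show ?thesis unfolding higgs_trace_def by (rule conjugate_pair_trace)
qed

lemma openin_higgs_trace:
  "openin (topo (higgs_space x)) {c \<in> topspace (topo (higgs_space x)). higgs_trace c i k \<noteq> 0}"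
proof -
  have "{c \<in> topspace (topo (higgs_space x)). higgs_trace c i k \<noteq> 0}
      = {higgs_class x (($) N) | N. stable_residues (($) N) \<and> N \<in> {N. pair_trace (($) N) i k \<noteq> 0}}"
    unfolding topspace_higgs_space[OF inj] higgs_moduli_eq[OF inj]
  proof (intro equalityI subsetI)
    fix c assume "c \<in> {c \<in> higgs_class x ` {N. stable_residues N}. higgs_trace c i k \<noteq> 0}"
    then obtain N where "stable_residues N" "c = higgs_class x N" "pair_trace N i k \<noteq> 0"
      using higgs_trace_class by auto
    then show "c \<in> {higgs_class x (($) N) | N. stable_residues (($) N) \<and> N \<in> {N. pair_trace (($) N) i k \<noteq> 0}}"
      by (intro CollectI exI[of _ "\<chi> i. N i"]) (simp add: vec_nth_lambda)
  qed (auto simp: higgs_trace_class)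
  moreover have "openin (topo (higgs_space x))
      {higgs_class x (($) N) | N. stable_residues (($) N) \<and> N \<in> {N. pair_trace (($) N) i k \<noteq> 0}}"
    by (rule openin_higgs_space(1)[OF inj open_pair_trace]) (auto dest: conjugate_pair_trace)
  ultimately show ?thesis by simp
qed

definition model_class :: "complex^'n \<Rightarrow> 'n higgs set" where
  "model_class l = higgs_class x (model_residues S l)"

lemma model_stable: "l \<in> config S \<Longrightarrow> stable_residues (model_residues S l)"
  by (rule model_residues_stable[OF _ parts_nonempty[OF S]])

lemma model_class_rel:
  assumes "l \<in> config S" "config_rel S l m"
  shows "model_class l = model_class m"
  unfolding model_class_def
  using higgs_class_eq_iff[OF inj model_stable[OF assms(1)] model_stable[OF config_rel_in[OF assms]]]
    model_residues_rel[OF assms(2)] by blast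

lemma model_class_in: "l \<in> config S \<Longrightarrow> model_class l \<in> higgs_component x S"
  unfolding model_class_def higgs_component_iff[OF model_stable] by (simp add: model_residues_trace)

lemma higgs_component_form:
  assumes "c \<in> higgs_component x S"
  obtains l where "l \<in> config S" "c = model_class l"
proof -
  have "c \<in> higgs_moduli x" using assms by (simp add: higgs_component_def)
  then obtain N where N: "stable_residues N" "c = higgs_class x N" unfolding higgs_moduli_eq[OF inj] by blast
  then obtain l where l: "l \<in> config S" "conjugate (model_residues S l) N"
    using model_residues_form[OF N(1) parts_nonempty[OF S]] higgs_component_iff[OF N(1)] assms by blast
  show thesis
    by (rule that[OF l(1)]) (use l N higgs_class_eq_iff[OF inj model_stable[OF l(1)] N(1)] in \<open>simp add: model_class_def\<close>)
qed

text \<open>The component lies in the domain of each chart with \<open>A = S\<close> and \<open>i0 \<in> S\<close>; there all \<open>t\<^sub>i\<close> vanish, and the \<open>\<lambda>\<^sub>i\<close> are the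
  configuration scaled by \<open>1 / l\<^sub>j\<close>, up to sign.\<close>

lemma smooth_map_model_class: "smooth_map (sub_space euclidean_smooth (config S)) (higgs_space x) model_class"
proof -
  obtain j where j: "j \<in> S" using parts_nonempty[OF S] by blast
  have "card (S - {j}) \<noteq> 0" using S(1) j by (simp add: card_Diff_singleton)
  then obtain i0 where i0: "i0 \<in> S" "i0 \<noteq> j" by (metis card.empty ex_in_conv DiffD1 DiffD2 singletonI)
  obtain k where k: "k \<notin> S" using parts_nonempty[OF S] by blast
  have ik: "i0 \<noteq> k" using i0 k by blast
  note d = j k i0(2) ik
  \<comment> \<open>the normal form of the model residues\<close>
  define m :: "complex^'n \<Rightarrow> (complex^'n) \<times> (complex^'n)" where
    "m = (\<lambda>l. (0, \<chi> i. if i \<in> S then l $ i / l $ j else - (l $ i * l $ j)))"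
  define \<mu> :: "complex^'n \<Rightarrow> (complex^'n) \<times> (complex^'n)" where
    "\<mu> = (\<lambda>l. drop_params j k i0 (m l))"
  let ?U = "higgs_chart_domain x S j k i0" and ?\<kappa> = "higgs_chart x S j k i0" and ?W = "chart_space j k i0 :: ((complex^'n) \<times> (complex^'n)) set"
  have at: "(?U, ?\<kappa>, ?W) \<in> higgs_atlas x" unfolding higgs_atlas_def using d by blast
  have mn: "m l \<in> normal_parameters S j k" if l: "l \<in> config S" for l
  proof -
    have L: "\<And>i. l $ i \<noteq> 0" "(\<Sum>i\<in>S. l $ i) = 0" "(\<Sum>i\<in>-S. l $ i) = 0" using l by (auto simp: config_def)
    have 1: "(\<Sum>i\<in>UNIV. if i \<in> S then snd (m l) $ i else snd (m l) $ i * (fst (m l) $ i)\<^sup>2)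
        = (\<Sum>i\<in>UNIV. if i \<in> S then l $ i / l $ j else 0)"
      by (rule sum.cong[OF refl]) (simp add: m_def)
    have 2: "(\<Sum>i\<in>UNIV. if i \<in> S then snd (m l) $ i * (fst (m l) $ i)\<^sup>2 else snd (m l) $ i)
        = (\<Sum>i\<in>UNIV. if i \<in> S then 0 else - (l $ i * l $ j))"
      by (rule sum.cong[OF refl]) (simp add: m_def)
    show ?thesis
      unfolding normal_parameters_iff 1 2 sum_UNIV_if
      using L j by (simp add: m_def sum_negf flip: sum_divide_distrib sum_distrib_right)
  qed
  have mW: "\<mu> l \<in> ?W" for l unfolding \<mu>_def by (rule drop_params_in)
  have inv: "inv_into ?U ?\<kappa> (\<mu> l) = model_class l" "\<mu> l \<in> chart_range S j k i0" if l: "l \<in> config S" for l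
  proof -
    have L: "\<And>i. l $ i \<noteq> 0" using l by (auto simp: config_def)
    note p = drop_params_chart[OF mn[OF l] disjI1[OF i0(1)] d]
    show r: "\<mu> l \<in> chart_range S j k i0" unfolding \<mu>_def by (rule p(1))
    have "inv_into ?U ?\<kappa> (\<mu> l) = higgs_class x (($) (chart_residues S j k i0 (\<mu> l)))"
      by (rule chart_facts(2)[OF inj d IntI[OF mW r]])
    also have "(($) (chart_residues S j k i0 (\<mu> l))) = normal_residue S (m l)"
      unfolding chart_residues_def \<mu>_def p(2) vec_nth_lambda ..
    also have "normal_residue S (m l) = model_residues S (config_scale S (1 / l $ j) l)"
      by (auto simp: fun_eq_iff mat2_eq_iff normal_residue_nth model_residues_nth m_def config_scale_def)
    also have "higgs_class x \<dots> = model_class (config_scale S (1 / l $ j) l)" by (simp add: model_class_def)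
    also have "\<dots> = model_class l"
    proof (rule model_class_rel[symmetric, OF l])
      show "config_rel S l (config_scale S (1 / l $ j) l)"
        unfolding config_rel_def using L[of j] by (intro exI[of _ "1 / l $ j"]) simp
    qed
    finally show "inv_into ?U ?\<kappa> (\<mu> l) = model_class l" .
  qed
  have \<mu>: "smooth_map (sub_space euclidean_smooth (config S)) (sub_space euclidean_smooth ?W) \<mu>"
  proof (rule smooth_map_sub_euclidean[OF _ config_subset])
    have e: "\<mu> l = (\<chi> i. 0, \<chi> i. if i \<in> {j, k, i0} then 0 else if i \<in> S then l $ i / l $ j else - (l $ i * l $ j))" for l
      by (simp add: \<mu>_def drop_params_def m_def vec_eq_iff)
    show "smooth_on nonzero_vecs \<mu>"
      unfolding e[abs_def]
      by (intro smooth_intros open_nonzero_vecs) (auto simp: nonzero_vecs_def)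
    show "\<mu> ` config S \<subseteq> ?W" by (rule image_subsetI) (rule mW)
  qed
  have pre: "{l \<in> config S. model_class l \<in> V} = {l \<in> config S. \<mu> l \<in> chart_preimage ?U ?\<kappa> V}" for V
  proof -
    have r: "\<mu> l \<in> ?\<kappa> ` ?U" if "l \<in> config S" for l
      unfolding chart_facts(1)[OF inj d] by (rule IntI[OF mW inv(2)[OF that]])
    show ?thesis
      by (rule Collect_cong) (simp add: chart_preimage_def inv(1) r cong: conj_cong)
  qed
  have op: "openin (top_of_set (config S)) {l \<in> config S. model_class l \<in> V}" if V: "openin (topo (higgs_space x)) V" for V
  proof -
    have "openin (top_of_set ?W) (chart_preimage ?U ?\<kappa> V)"
      using V at unfolding higgs_space_def openin_atlas_space by blast
    then show ?thesis unfolding pre using smooth_mapD(2)[OF \<mu>, of "chart_preimage ?U ?\<kappa> V"] by simp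
  qed
  have sm: "smooth (sub_space euclidean_smooth (config S)) {l \<in> config S. model_class l \<in> V} (g \<circ> model_class)"
    if V: "openin (topo (higgs_space x)) V" "smooth (higgs_space x) V g" for V g
  proof -
    have o: "openin (topo (sub_space euclidean_smooth ?W)) (chart_preimage ?U ?\<kappa> V)"
      using V(1) at unfolding higgs_space_def openin_atlas_space by auto
    have "smooth (sub_space euclidean_smooth ?W) (chart_preimage ?U ?\<kappa> V) (g \<circ> inv_into ?U ?\<kappa>)"
      using bspec[OF V(2)[unfolded smooth_higgs_iff[OF inj]] at] by (simp only: prod.case)
    from smooth_mapD(1)[OF \<mu> o this]
    have "smooth (sub_space euclidean_smooth (config S)) {l \<in> config S. \<mu> l \<in> chart_preimage ?U ?\<kappa> V}
        ((g \<circ> inv_into ?U ?\<kappa>) \<circ> \<mu>)"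
      by (simp only: topspace_sub_euclidean)
    then show ?thesis unfolding pre by (rule smooth_sub_euclidean_cong) (simp add: inv(1))
  qed
  have mod: "model_class l \<in> topspace (topo (higgs_space x))" if "l \<in> config S" for l
    using model_class_in[OF that] unfolding topspace_higgs_space[OF inj] higgs_component_def by blast
  show ?thesis
    unfolding smooth_map_def continuous_map_def topspace_sub_euclidean topo_sub_space topo_euclidean_smooth
    using op sm mod by auto
qed

lemma higgs_component_image: "higgs_component x S = model_class ` config S"
  using model_class_in by (auto elim!: higgs_component_form)

theorem higgs_component_is_component:
  "higgs_component x S \<in> connected_components_of
     (subtopology (topo (higgs_space x)) {c \<in> higgs_moduli x. higgs_involution x c = c})"
proof (rule trace_component[where t = higgs_trace and S = S])
  let ?F = "{c \<in> higgs_moduli x. higgs_involution x c = c}" and ?Z = "higgs_component x S"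
  show "openin (topo (higgs_space x)) {c \<in> topspace (topo (higgs_space x)). higgs_trace c i k \<noteq> 0}" for i k
    by (rule openin_higgs_trace)
  show "?F \<subseteq> topspace (topo (higgs_space x))" unfolding topspace_higgs_space[OF inj] by blast
  show "?Z \<subseteq> ?F"
  proof
    fix c assume c: "c \<in> ?Z"
    then obtain l where l: "l \<in> config S" "c = model_class l" by (rule higgs_component_form)
    have "conjugate (model_residues S l) (\<lambda>i. transpose (model_residues S l i))"
    proof -
      \<comment> \<open>exchanging the two axes transposes off-diagonal matrices\<close>
      let ?g = "vector [vector [0, 1], vector [1, 0]] :: complex^2^2"
      have "?g ** ?g = mat 1" by (simp add: mat2_eq_iff mult2_nth mat_def)
      then have "invertible ?g" by (auto simp: invertible_def)
      moreover have "?g ** model_residues S l i = transpose (model_residues S l i) ** ?g" for i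
        by (simp add: mat2_eq_iff mult2_nth transpose_def model_residues_nth)
      ultimately show ?thesis unfolding conjugate_def by blast
    qed
    then have "higgs_involution x c = c"
      unfolding l(2) model_class_def higgs_involution_class[OF inj model_stable[OF l(1)]]
      using higgs_class_eq_iff[OF inj model_stable[OF l(1)] stable_residues_transpose[OF inj model_stable[OF l(1)]]] by simp
    then show "c \<in> ?F" using c by (simp add: higgs_component_def)
  qed
  show "connectedin (topo (higgs_space x)) ?Z"
    unfolding higgs_component_image
  proof (rule connectedin_continuous_map_image)
    show "continuous_map (top_of_set (config S)) (topo (higgs_space x)) model_class"
      using smooth_mapD(3)[OF smooth_map_model_class] by simp
    show "connectedin (top_of_set (config S)) (config S)"
      using connected_config by (simp add: connectedin_subtopology connectedin_iff_connected)
  qed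
  show "?Z \<noteq> {}" unfolding higgs_component_image using config_nonempty[OF S] by simp
  fix c assume c: "c \<in> ?F"
  then obtain N where N: "stable_residues N" "c = higgs_class x N" unfolding higgs_moduli_eq[OF inj] by blast
  show "c \<in> ?Z \<longleftrightarrow> (\<forall>i k. (i \<in> S \<longleftrightarrow> k \<in> S) \<longrightarrow> higgs_trace c i k = 0)"
    unfolding N(2) higgs_trace_class[OF N(1)] higgs_component_iff[OF N(1)] ..
  show "c \<in> ?Z \<longleftrightarrow> (\<forall>i k. i \<in> S \<and> k \<notin> S \<longrightarrow> higgs_trace c i k \<noteq> 0)"
  proof
    assume "c \<in> ?Z"
    then obtain l where l: "l \<in> config S" "c = model_class l" by (rule higgs_component_form)
    show "\<forall>i k. i \<in> S \<and> k \<notin> S \<longrightarrow> higgs_trace c i k \<noteq> 0"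
      unfolding l(2) model_class_def higgs_trace_class[OF model_stable[OF l(1)]] model_residues_trace
      using l(1) by (auto simp: config_def)
  next
    assume R: "\<forall>i k. i \<in> S \<and> k \<notin> S \<longrightarrow> higgs_trace c i k \<noteq> 0"
    have "higgs_class x (\<lambda>i. transpose (N i)) = higgs_class x N"
      using c higgs_involution_class[OF inj N(1)] N(2) by simp
    then have conj: "conjugate N (\<lambda>i. transpose (N i))"
      using higgs_class_eq_iff[OF inj N(1) stable_residues_transpose[OF inj N(1)]] by simp
    note R' = R[unfolded N(2) higgs_trace_class[OF N(1)], rule_format]
    obtain a b where ab: "a \<in> S" "b \<notin> S" using parts_nonempty[OF S] by blast
    have "pair_trace N i i' = 0" if "(i \<in> S) = (i' \<in> S)" for i i'
    proof (cases "i \<in> S")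
      case True
      with that have "i' \<in> S" by simp
      show ?thesis
        by (rule higgs_fixed_traces[OF inj N(1) conj, of i b i']) (use R' True \<open>i' \<in> S\<close> ab in auto)
    next
      case False
      with that have "i' \<notin> S" by simp
      show ?thesis
        by (rule higgs_fixed_traces[OF inj N(1) conj, of i a i'])
          (use R'[of a i] R'[of a i'] False \<open>i' \<notin> S\<close> ab pair_trace_sym[of N a] in auto)
    qed
    then show "c \<in> ?Z" unfolding N(2) higgs_component_iff[OF N(1)] by blast
  qed
qed

end

theorem higgs_component_diffeomorphic:
  fixes x :: "'n::{finite,linorder} \<Rightarrow> cp1" and S :: "'n set"
  assumes inj: "inj x" and S: "2 \<le> card S" "card S + 2 \<le> CARD('n)"
  shows "diffeomorphic (sub_space (higgs_space x) (higgs_component x S))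
     (null_polygon_space (card S) :: (real^3, 'n) vec set smooth_space)"
proof -
  let ?Z = "higgs_component x S"
  note ne = parts_nonempty[OF S] and isS = inj S
  obtain j k where jk: "j \<in> S" "k \<notin> S" using ne by blast
  define s where "s = (\<lambda>c. trace_config S j k (higgs_trace x c))"
  have s\<Theta>: "config_rel S l (s (model_class x S l))" if l: "l \<in> config S" for l
    unfolding s_def model_class_def[OF isS] higgs_trace_class[OF isS model_stable[OF isS l]]
    by (rule trace_config_model[OF l jk]) (simp_all add: model_residues_trace)
  show ?thesis
  proof (rule diffeomorphic_null_polygon_spaceI[where s = s and \<Theta> = "model_class x S", OF _ _ ne])
    show "smooth_restricts (higgs_space x)" by (rule smooth_restricts_higgs_space[OF inj])
    show "?Z \<subseteq> topspace (topo (higgs_space x))"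
      unfolding topspace_higgs_space[OF inj] by (auto simp: higgs_component_def)
    let ?O = "{N :: (complex^2^2, 'n) vec. pair_trace (($) N) j k \<noteq> 0}"
    have oO: "open ?O" by (rule open_pair_trace)
    show "smooth_map (sub_space (higgs_space x) ?Z) euclidean_smooth s"
    proof (rule smooth_map_higgs_invariant[OF inj, where ?O1.0 = ?O and s = "\<lambda>N. trace_config S j k (pair_trace (($) N))"])
      show "smooth_on ?O (\<lambda>N. trace_config S j k (pair_trace (($) N)))"
        unfolding trace_config_def
        by (intro smooth_on_vec_lambda smooth_on_if smooth_on_divide
            smooth_on_subset[OF smooth_on_pair_trace oO subset_UNIV] oO) auto
      show "M \<in> ?O \<and> trace_config S j k (pair_trace (($) M)) = trace_config S j k (pair_trace (($) N))"
        if "conjugate (($) N) (($) M)" "N \<in> ?O" for N M :: "(complex^2^2, 'n) vec"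
        using conjugate_pair_trace[OF that(1)] that(2) by simp
      show "?Z \<subseteq> {higgs_class x (($) N) | N. stable_residues (($) N) \<and> N \<in> ?O}"
      proof
        fix c assume "c \<in> ?Z"
        then obtain l where l: "l \<in> config S" "c = model_class x S l" by (rule higgs_component_form[OF isS])
        have "pair_trace (model_residues S l) j k \<noteq> 0" using l(1) jk by (simp add: model_residues_trace config_def)
        then show "c \<in> {higgs_class x (($) N) | N. stable_residues (($) N) \<and> N \<in> ?O}"
          using model_stable[OF isS l(1)] l(2)
          by (intro CollectI exI[of _ "\<chi> i. model_residues S l i"]) (simp add: vec_nth_lambda model_class_def[OF isS])
      qed
      show "s (higgs_class x (($) N)) = trace_config S j k (pair_trace (($) N))" if "stable_residues (($) N)" for N
        using that by (simp add: s_def higgs_trace_class[OF isS])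
    qed
    show "smooth_map (sub_space euclidean_smooth (config S)) (higgs_space x) (model_class x S)"
      by (rule smooth_map_model_class[OF isS])
    show "model_class x S l \<in> ?Z" if "l \<in> config S" for l by (rule model_class_in[OF isS that])
    show "config_rel S l (s (model_class x S l))" if "l \<in> config S" for l by (rule s\<Theta>[OF that])
    show "model_class x S l = model_class x S m" if "l \<in> config S" "config_rel S l m" for l m
      by (rule model_class_rel[OF isS that])
    fix c assume "c \<in> ?Z"
    then obtain l where l: "l \<in> config S" "c = model_class x S l" by (rule higgs_component_form[OF isS])
    have r: "config_rel S l (s c)" unfolding l(2) by (rule s\<Theta>[OF l(1)])
    show "s c \<in> config S" by (rule config_rel_in[OF l(1) r])
    show "model_class x S (s c) = c" using model_class_rel[OF isS l(1) r] l(2) by simp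
  qed
qed

theorem theorem6p1:
  fixes x :: "'n::{finite,linorder} \<Rightarrow> cp1" and S :: "'n set"
  assumes "inj x"
    and "Min UNIV \<in> S"
    and "2 \<le> card S"
    and "card S + 2 \<le> CARD('n)"
  shows "higgs_component x S \<in> connected_components_of
           (subtopology (topo (higgs_space x)) {c \<in> higgs_moduli x. higgs_involution x c = c}) \<and>
         (hyperpolygon_component S :: 'n hyperpolygon set set) \<in> connected_components_of
           (subtopology (topo null_hyperpolygon_space)
              {c \<in> null_hyperpolygons. hyperpolygon_involution c = c}) \<and>
         diffeomorphic (sub_space (higgs_space x) (higgs_component x S))
           (null_polygon_space (card S) :: ((real^3, 'n) vec) set smooth_space) \<and>
         diffeomorphic (sub_space null_hyperpolygon_space (hyperpolygon_component S))
           (null_polygon_space (card S) :: ((real^3, 'n) vec) set smooth_space)"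
  using higgs_component_is_component[OF assms(1,3,4)] hyperpolygon_component_is_component[OF assms(3,4)]
    higgs_component_diffeomorphic[OF assms(1,3,4)] hyperpolygon_component_diffeomorphic[OF assms(3,4)]
  by blast

end
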